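(* Let $p\in(1,\infty)$ and let $u$ be a weak subsolution of $A_{\mu,p}u=0$ in $\Omega$. Then there exists a constant $C=C(N,p,\Sigma,\mu)>0$ such that $$\operatorname*{ess\,sup}_{B_{r/2}(x_0)}u\le\delta\,\operatorname{Tail}\left(u_+;x_0,\frac r2\right)+C\,\delta^{-\frac{(p-1)\eta}{(\eta-1)p}}\left(\frac1{|B_r(x_0)|}\int_{B_r(x_0)}u_+^p\,dx\right)^{\frac1p},$$ whenever $B_r(x_0)\subset\Omega$ with $r\in(0,1]$ and $\delta\in(0,1]$, where $\eta=\frac{N}{N-p}$ if $p\in(1,N)$ and $\eta=2$ if $p\in[N,\infty)$.
   Context: Setting: $p\in(1,\infty)$, $\Omega\subset\mathbb{R}^N$ is a bounded domain, and $\mu$ is a nonnegative finite Borel measure on $[0,1]$, nontrivial on $(0,1)$, with $\mu(\{0\})=0$ and $\alpha:=\mu(\{1\})>0$; $\Sigma:=\operatorname{supp}\mu$. The operator is $A_{\mu,p}u=\int_{(0,1)}(-\Delta)_p^su\,d\mu(s)-\alpha\Delta_pu$. The normalizing constant (written $C_{N,s,p}$ or $C_{N,p,s}$) is $$C_{N,s,p}=\frac{\frac{sp}{2}(1-s)2^{2s-1}}{\pi^{\frac{N-1}{2}}}\,\frac{\Gamma(\frac{N+ps}{2})}{\Gamma(\frac{p+1}{2})\Gamma(2-s)}.$$ $B_r(x_0)$ is the open ball of center $x_0$ and radius $r>0$; $u_+=\max\{u,0\}$. Tail: for $u\in L^{p-1}_{loc}(\mathbb{R}^N)$, $$\operatorname{Tail}(u;x_0,r)=\left[\int_{(0,1)}C_{N,s,p}\,r^{sp}\left(\int_{\mathbb{R}^N\setminus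 B_r(x_0)}\frac{|u(y)|^{p-1}}{|y-x_0|^{N+sp}}\,dy\right)d\mu(s)\right]^{\frac1{p-1}},$$ and $L^{p-1}_{sp,\mu}(\mathbb{R}^N)$ is the set of $u\in L^{p-1}_{loc}(\mathbb{R}^N)$ with $\operatorname{Tail}(u;x,r)<\infty$ for all $x\in\mathbb{R}^N$, $r\in(0,\infty)$. Weak solutions: $W_0^{1,p}(\Omega')$ is the standard Sobolev space, its elements being taken equal to $0$ in $\mathbb{R}^N\setminus\Omega'$. A function $u\in W^{1,p}_{loc}(\Omega)\cap L^{p-1}_{sp,\mu}(\mathbb{R}^N)$ is a weak subsolution of $A_{\mu,p}u=0$ in $\Omega$ if for every $\Omega'\Subset\Omega$ and every nonnegative $v\in W_0^{1,p}(\Omega')$, $$\int_{(0,1)}C_{N,s,p}\left(\iint_{\mathbb{R}^{2N}}\frac{|u(x)-u(y)|^{p-2}(u(x)-u(y))(v(x)-v(y))}{|x-y|^{N+sp}}\,dx\,dy\right)d\mu(s)+\alpha\int_\Omega|\nabla u|^{p-2}\nabla u\cdot\nabla v\,dx\le0.$$ *)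

theory Defs
  imports "HOL-Probability.Probability"
begin

text \<open>The ambient space \<open>\<real>\<^sup>N\<close> is a Euclidean space \<open>'a\<close> with \<open>N = DIM('a)\<close>.\<close>

section \<open>Sobolev spaces\<close>

primrec C_k :: "nat \<Rightarrow> ('a::euclidean_space \<Rightarrow> real) \<Rightarrow> bool" where
  "C_k 0 f \<longleftrightarrow> continuous_on UNIV f"
| "C_k (Suc k) f \<longleftrightarrow> f differentiable_on UNIV \<and>
     (\<forall>i\<in>Basis. C_k k (\<lambda>x. frechet_derivative f (at x) i))"

definition test_function :: "'a::euclidean_space set \<Rightarrow> ('a \<Rightarrow> real) \<Rightarrow> bool" where
  "test_function S \<phi> \<longleftrightarrow> (\<forall>k. C_k k \<phi>) \<and>
     compact (closure {x. \<phi> x \<noteq> 0}) \<and> closure {x. \<phi> x \<noteq> 0} \<subseteq> S"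

definition L_pow :: "real \<Rightarrow> 'a::euclidean_space set \<Rightarrow> ('a \<Rightarrow> 'b::euclidean_space) \<Rightarrow> bool" where
  "L_pow q S f \<longleftrightarrow> set_borel_measurable lebesgue S f \<and>
     set_integrable lebesgue S (\<lambda>x. norm (f x) powr q)"

definition L_pow_loc :: "real \<Rightarrow> 'a::euclidean_space set \<Rightarrow> ('a \<Rightarrow> 'b::euclidean_space) \<Rightarrow> bool" where
  "L_pow_loc q S f \<longleftrightarrow> set_borel_measurable lebesgue S f \<and>
     (\<forall>K. compact K \<and> K \<subseteq> S \<longrightarrow> L_pow q K f)"

definition is_weak_gradient ::
    "'a::euclidean_space set \<Rightarrow> ('a \<Rightarrow> real) \<Rightarrow> ('a \<Rightarrow> 'a) \<Rightarrow> bool" where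
  "is_weak_gradient S u g \<longleftrightarrow> L_pow_loc 1 S u \<and> L_pow_loc 1 S g \<and>
     (\<forall>\<phi> i. test_function S \<phi> \<and> i \<in> Basis \<longrightarrow>
        (LINT x:S|lebesgue. u x * frechet_derivative \<phi> (at x) i) =
        - (LINT x:S|lebesgue. (g x \<bullet> i) * \<phi> x))"

text \<open>A representative of the weak gradient, meaningful only a.e. on \<open>S\<close> and only if a weak
  gradient exists.\<close>

definition weak_gradient :: "'a::euclidean_space set \<Rightarrow> ('a \<Rightarrow> real) \<Rightarrow> 'a \<Rightarrow> 'a" where
  "weak_gradient S u = (SOME g. is_weak_gradient S u g)"

definition W1p :: "real \<Rightarrow> 'a::euclidean_space set \<Rightarrow> ('a \<Rightarrow> real) \<Rightarrow> bool" where
  "W1p p S u \<longleftrightarrow> (\<exists>g. is_weak_gradient S u g) \<and> L_pow p S u \<and> L_pow p S (weak_gradient S u)"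

definition W1p_loc :: "real \<Rightarrow> 'a::euclidean_space set \<Rightarrow> ('a \<Rightarrow> real) \<Rightarrow> bool" where
  "W1p_loc p S u \<longleftrightarrow>
     (\<exists>g. is_weak_gradient S u g) \<and> L_pow_loc p S u \<and> L_pow_loc p S (weak_gradient S u)"

definition W1p_norm :: "real \<Rightarrow> 'a::euclidean_space set \<Rightarrow> ('a \<Rightarrow> real) \<Rightarrow> real" where
  "W1p_norm p S u = ((LINT x:S|lebesgue. \<bar>u x\<bar> powr p) +
     (LINT x:S|lebesgue. norm (weak_gradient S u x) powr p)) powr (1 / p)"

text \<open>The closure of the test functions in \<open>W\<^sup>1\<^sup>,\<^sup>p\<close>, its elements being extended by \<open>0\<close>.\<close>

definition W1p_0 :: "real \<Rightarrow> 'a::euclidean_space set \<Rightarrow> ('a \<Rightarrow> real) \<Rightarrow> bool" where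
  "W1p_0 p S v \<longleftrightarrow> W1p p S v \<and> (\<forall>x. x \<notin> S \<longrightarrow> v x = 0) \<and>
     (\<exists>\<phi>. (\<forall>n::nat. test_function S (\<phi> n)) \<and>
        (\<lambda>n. W1p_norm p S (\<lambda>x. \<phi> n x - v x)) \<longlonglongrightarrow> 0)"

section \<open>The tail\<close>

definition C_norm :: "nat \<Rightarrow> real \<Rightarrow> real \<Rightarrow> real" where
  "C_norm N s p =
     (s * p / 2 * (1 - s) * 2 powr (2 * s - 1)) / pi powr ((real N - 1) / 2) *
     (Gamma ((real N + p * s) / 2) / (Gamma ((p + 1) / 2) * Gamma (2 - s)))"

text \<open>Powers of extended nonnegative reals, for positive exponents only.\<close>

definition ennreal_powr :: "ennreal \<Rightarrow> real \<Rightarrow> ennreal" where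
  "ennreal_powr x a = (if x = \<infinity> then \<infinity> else ennreal (enn2real x powr a))"

definition Tail :: "real \<Rightarrow> real measure \<Rightarrow> ('a::euclidean_space \<Rightarrow> real) \<Rightarrow> 'a \<Rightarrow> real \<Rightarrow> ennreal" where
  "Tail p \<mu> u x0 r = ennreal_powr
     (\<integral>\<^sup>+s\<in>{0<..<1}. ennreal (C_norm DIM('a) s p * r powr (s * p)) *
        (\<integral>\<^sup>+y\<in>- ball x0 r. ennreal (\<bar>u y\<bar> powr (p - 1) / norm (y - x0) powr (real DIM('a) + s * p))
           \<partial>lebesgue) \<partial>\<mu>)
     (1 / (p - 1))"

definition tail_space :: "real \<Rightarrow> real measure \<Rightarrow> ('a::euclidean_space \<Rightarrow> real) \<Rightarrow> bool" where
  "tail_space p \<mu> u \<longleftrightarrow> L_pow_loc (p - 1) UNIV u \<and> (\<forall>x r. 0 < r \<longrightarrow> Tail p \<mu> u x r < \<infinity>)"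

section \<open>Weak subsolutions\<close>

text \<open>For \<open>u\<close> and \<open>v\<close> as in the definition of a weak subsolution, all integrals below converge
  absolutely (the inner one for \<open>\<mu>\<close>-almost every \<open>s\<close>), so that the value \<open>0\<close> of the Bochner
  integral of a non-integrable function plays no role.\<close>

definition nonlocal_form ::
    "real \<Rightarrow> real \<Rightarrow> ('a::euclidean_space \<Rightarrow> real) \<Rightarrow> ('a \<Rightarrow> real) \<Rightarrow> real" where
  "nonlocal_form p s u v =
     (LINT z|(lebesgue :: ('a \<times> 'a) measure). (case z of (x, y) \<Rightarrow>
        \<bar>u x - u y\<bar> powr (p - 2) * (u x - u y) * (v x - v y) / norm (x - y) powr (real DIM('a) + s * p)))"

definition weak_subsolution ::
    "real \<Rightarrow> real measure \<Rightarrow> 'a::euclidean_space set \<Rightarrow> ('a \<Rightarrow> real) \<Rightarrow> bool" where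
  "weak_subsolution p \<mu> \<Omega> u \<longleftrightarrow> W1p_loc p \<Omega> u \<and> tail_space p \<mu> u \<and>
     (\<forall>\<Omega>' v. open \<Omega>' \<and> compact (closure \<Omega>') \<and> closure \<Omega>' \<subseteq> \<Omega> \<and> W1p_0 p \<Omega>' v \<and> (\<forall>x. 0 \<le> v x) \<longrightarrow>
        (LINT s:{0<..<1}|\<mu>. C_norm DIM('a) s p * nonlocal_form p s u v) +
        measure \<mu> {1} *
          (LINT x:\<Omega>|lebesgue. norm (weak_gradient \<Omega> u x) powr (p - 2) *
             (weak_gradient \<Omega> u x \<bullet> weak_gradient \<Omega> v x)) \<le> 0)"

definition eta :: "nat \<Rightarrow> real \<Rightarrow> real" where
  "eta N p = (if p < real N then real N / (real N - p) else 2)"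

end

theory Submission
  imports Defs
begin

text \<open>The proof is De Giorgi's method on small balls, and it takes coercivity from the local term only.

  Test the inequality of a subsolution with \<open>v = (u - k)\<^sub>+ \<phi>\<^sup>m\<close>.  The local term controls the gradient of \<open>v\<close> in \<open>L\<^sup>p\<close>.
  The integrand of the nonlocal term is bounded below, point by point, by minus
  \<open>((u(x) - k)\<^sub>+\<^sup>p + (u(y) - k)\<^sub>+\<^sup>p) |\<phi>(x) - \<phi>(y)|\<^sup>p\<close> up to a constant if both points are close to the support of \<open>\<phi>\<close>,
  and by minus \<open>(u(y) - k)\<^sub>+\<^sup>p\<^sup>-\<^sup>1 (u(x) - k)\<^sub>+\<close> if \<open>y\<close> is far away (\<open>nonlocal_kernel_lower\<close>, \<open>nonlocal_kernel_far\<close>).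
  The result is \<open>energy_estimate\<close>; its constants are uniform in the order \<open>s\<close>, because the
  normalizing constant vanishes like \<open>1 - s\<close>.

  A bound for the gradient of \<open>v\<close> bounds \<open>v\<close> itself in \<open>L\<^sup>p\<close>, with a small factor if \<open>v\<close> lives on a small set.  This is
  \<open>Faber_Krahn\<close>, which follows from the estimate of translations by the gradient: most small shifts leave a
  small set.  Iterating over shrinking balls and rising levels gives \<open>De_Giorgi_bound\<close>: \<open>u \<le> K\<close> almost everywhere
  in the ball of radius \<open>R/2\<close> around \<open>z\<close>, provided that the integral of \<open>u\<^sub>+\<^sup>p\<close> over the ball of radius \<open>R\<close> is at
  most \<open>c R\<^sup>N K\<^sup>p\<close> and the tail around \<open>z\<close>, taken without the factor \<open>R\<^sup>s\<^sup>p\<close>, is at most \<open>K\<^sup>p\<^sup>-\<^sup>1/R\<^sup>p\<close>.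

  The parameter \<open>\<delta>\<close> enters by applying this bound to all balls of radius \<open>R\<close> proportional to \<open>r \<delta>\<^sup>(\<^sup>p\<^sup>-\<^sup>1\<^sup>)\<^sup>/\<^sup>p\<close> that are
  centred in the ball of radius \<open>r/2\<close> around \<open>x0\<close> (\<open>bound_by_level\<close>).  The part of the tail that comes from
  outside the ball of radius \<open>r\<close> gets the factor \<open>(R/r)\<^sup>p\<close>, of size \<open>\<delta>\<^sup>p\<^sup>-\<^sup>1\<close>, whatever the order \<open>s\<close>: this is the
  gain from the local term.  The part from inside is controlled by the \<open>L\<^sup>p\<close>-norm of \<open>u\<^sub>+\<close>.  Passing from averages over
  the small balls to the average over the large one costs \<open>(r/R)\<^sup>N\<^sup>/\<^sup>p\<close>, that is, \<open>\<delta>\<close> to the power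
  \<open>- (p - 1) N / p\<^sup>2\<close>.  For \<open>p < N\<close> this is the exponent of the theorem, and for \<open>p \<ge> N\<close> it is a better one.

  That \<open>v\<close> is admissible is shown by approximation.  With a smooth convex function in place of the positive
  part (\<open>soft\<close>), the truncations of mollifications of \<open>u\<close> are test functions, and they converge to \<open>v\<close> together with
  their gradients (\<open>H10_soft\<close>).\<close>

section \<open>Smooth functions\<close>

lemma C_k_differentiable: "C_k (Suc k) f \<Longrightarrow> f differentiable (at x)"
  by (auto simp: differentiable_on_def)

lemma C_k_continuous: "C_k k f \<Longrightarrow> continuous_on UNIV f"
  by (cases k) (auto intro: differentiable_imp_continuous_on)

text \<open>The recursion defining \<open>C_k\<close> does not contain \<open>C_k k f\<close> as a conjunct of \<open>C_k (Suc k) f\<close>; this is recovered by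
  descending through the partial derivatives.\<close>

lemma C_k_Suc_imp: "C_k (Suc k) f \<Longrightarrow> C_k k f"
proof (induction k arbitrary: f)
  case 0
  then show ?case using C_k_continuous[of "Suc 0" f] by simp
next
  case (Suc k)
  then show ?case by (metis C_k.simps(2))
qed

lemma C_k_cong: "C_k k f \<Longrightarrow> (\<And>x. f x = g x) \<Longrightarrow> C_k k g"
  by (metis ext)

text \<open>With any derivative at hand, the choice made by \<open>frechet_derivative\<close> can be forgotten.\<close>

lemma C_k_Suc_I:
  assumes "\<And>x. (f has_derivative f' x) (at x)" "\<And>i. i \<in> Basis \<Longrightarrow> C_k k (\<lambda>x. f' x i)"
  shows "C_k (Suc k) f"
proof -
  have "frechet_derivative f (at x) = f' x" for x
    using assms(1)[of x] by (metis frechet_derivative_at)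
  then show ?thesis using assms by (auto simp: differentiable_on_def differentiable_def intro!: exI)
qed

lemma C_k_deriv:
  assumes "C_k (Suc k) f"
  shows "(f has_derivative frechet_derivative f (at x)) (at x)"
  using C_k_differentiable[OF assms] frechet_derivative_works by blast

lemma C_k_const: "C_k k (\<lambda>_. c)"
proof (induction k arbitrary: c)
  case 0 then show ?case by simp
next
  case (Suc k)
  show ?case by (rule C_k_Suc_I[where f'="\<lambda>x h. 0"]) (auto intro: Suc.IH)
qed

lemma C_k_add: "C_k k f \<Longrightarrow> C_k k g \<Longrightarrow> C_k k (\<lambda>x. f x + g x)"
proof (induction k arbitrary: f g)
  case 0 then show ?case by (auto intro: continuous_intros)
next
  case (Suc k)
  show ?case
    by (rule C_k_Suc_I[OF has_derivative_add[OF C_k_deriv[OF Suc.prems(1)] C_k_deriv[OF Suc.prems(2)]]])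
       (use Suc in auto)
qed

lemma C_k_mult: "C_k k f \<Longrightarrow> C_k k g \<Longrightarrow> C_k k (\<lambda>x. f x * g x)"
proof (induction k arbitrary: f g)
  case 0 then show ?case by (auto intro: continuous_intros)
next
  case (Suc k)
  show ?case
    by (rule C_k_Suc_I[OF has_derivative_mult[OF C_k_deriv[OF Suc.prems(1)] C_k_deriv[OF Suc.prems(2)]]])
       (rule C_k_add; rule Suc.IH; use Suc.prems C_k_Suc_imp in auto)
qed

lemma C_k_power: "C_k k f \<Longrightarrow> C_k k (\<lambda>x. f x ^ n)"
  by (induction n) (auto intro: C_k_const C_k_mult)

lemma C_k_sum: "(\<And>i. i \<in> I \<Longrightarrow> C_k k (f i)) \<Longrightarrow> C_k k (\<lambda>x. \<Sum>i\<in>I. f i x)"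
  by (induction I rule: infinite_finite_induct) (auto intro: C_k_const C_k_add)

lemma C_k_linear: "bounded_linear f \<Longrightarrow> C_k k f"
proof (cases k)
  case 0
  then show "bounded_linear f \<Longrightarrow> C_k k f" by (simp add: linear_continuous_on)
next
  case (Suc j)
  assume f: "bounded_linear f"
  then show ?thesis unfolding Suc
    by (intro C_k_Suc_I[OF bounded_linear_imp_has_derivative[OF f]] C_k_const)
qed

lemma C_k_affine: "C_k k f \<Longrightarrow> C_k k (\<lambda>x. f (a + c *\<^sub>R x))"
proof (induction k arbitrary: f)
  case 0
  then have "continuous_on UNIV f" by simp
  then have "continuous_on UNIV (\<lambda>x. f (a + c *\<^sub>R x))"
    by (rule continuous_on_compose2) (auto intro!: continuous_intros)
  then show ?case by simp
next
  case (Suc k)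
  have "((\<lambda>x. f (a + c *\<^sub>R x)) has_derivative (\<lambda>h. frechet_derivative f (at (a + c *\<^sub>R x)) (c *\<^sub>R h))) (at x)" for x
    by (rule has_derivative_compose[OF _ C_k_deriv[OF Suc.prems]]) (auto intro!: derivative_eq_intros)
  moreover have "frechet_derivative f (at y) (c *\<^sub>R h) = c * frechet_derivative f (at y) h" for y h
    using C_k_deriv[OF Suc.prems, of y] by (metis has_derivative_linear linear_cmul real_scaleR_def)
  ultimately have d: "((\<lambda>x. f (a + c *\<^sub>R x)) has_derivative (\<lambda>h. c * frechet_derivative f (at (a + c *\<^sub>R x)) h)) (at x)" for x
    by simp
  show ?case
    by (rule C_k_Suc_I[OF d]) (use Suc in \<open>auto intro!: C_k_mult C_k_const\<close>)
qed

lemma C_k_compose: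
  fixes G :: "real \<Rightarrow> real"
  shows "C_k k G \<Longrightarrow> C_k k f \<Longrightarrow> C_k k (\<lambda>x. G (f x))"
proof (induction k arbitrary: G f)
  case 0
  then show ?case using continuous_on_compose2[of UNIV G UNIV f] by simp
next
  case (Suc k)
  have lin: "frechet_derivative G (at y) h = frechet_derivative G (at y) 1 * h" for y h
    using C_k_deriv[OF Suc.prems(1), of y]
    by (metis has_derivative_linear linear_cmul mult.commute mult.right_neutral real_scaleR_def)
  have "((\<lambda>x. G (f x)) has_derivative (\<lambda>h. frechet_derivative G (at (f x)) (frechet_derivative f (at x) h))) (at x)" for x
    by (rule has_derivative_compose[OF C_k_deriv[OF Suc.prems(2)] C_k_deriv[OF Suc.prems(1)]])
  then have d: "((\<lambda>x. G (f x)) has_derivative (\<lambda>h. frechet_derivative G (at (f x)) 1 * frechet_derivative f (at x) h)) (at x)" for x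
    by (subst (asm) lin)
  show ?case
    by (rule C_k_Suc_I[OF d], rule C_k_mult, rule Suc.IH)
       (use Suc.prems C_k_Suc_imp[OF Suc.prems(2)] in auto)
qed

lemma C_k_norm_sq: "C_k k (\<lambda>x::'a::euclidean_space. (norm (x - z))\<^sup>2)"
proof -
  have "C_k k (\<lambda>x::'a. \<Sum>b\<in>Basis. (x \<bullet> b + - (z \<bullet> b)) ^ 2)"
    by (intro C_k_sum C_k_power C_k_add C_k_const C_k_linear bounded_linear_inner_left)
  then show ?thesis
    by (rule C_k_cong)
       (subst power2_norm_eq_inner, subst euclidean_inner, simp add: power2_eq_square inner_diff_left)
qed

subsection \<open>The flat function and smooth truncations\<close>

text \<open>The functions \<open>q(1/t) exp(-1/t)\<close>, extended by \<open>0\<close> to \<open>t \<le> 0\<close>.  Letting \<open>q\<close> range over all polynomials makes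
  the family closed under differentiation, so that one derivative settles all of them.\<close>

definition flat :: "real poly \<Rightarrow> real \<Rightarrow> real" where
  "flat q t = (if 0 < t then poly q (1 / t) * exp (- (1 / t)) else 0)"

lemma poly_exp_tendsto_0:
  fixes q :: "real poly"
  shows "((\<lambda>x. poly q x * exp (- x)) \<longlongrightarrow> 0) at_top"
proof -
  have "((\<lambda>x. \<Sum>i\<le>degree q. coeff q i * (x ^ i / exp x)) \<longlongrightarrow> (\<Sum>i\<le>degree q. coeff q i * 0)) at_top"
    by (intro tendsto_sum tendsto_mult tendsto_const tendsto_power_div_exp_0)
  then show ?thesis
    by (simp add: poly_altdef exp_minus sum_distrib_right divide_inverse mult.assoc)
qed

lemma flat_deriv:
  "(flat q has_real_derivative flat (monom 1 2 * (q - pderiv q)) t) (at t)"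
proof -
  consider "t > 0" | "t < 0" | "t = 0" by linarith
  then show ?thesis
  proof cases
    case 1
    have "((\<lambda>t. poly q (1 / t) * exp (- (1 / t))) has_real_derivative flat (monom 1 2 * (q - pderiv q)) t) (at t)"
      using 1 by (auto intro!: derivative_eq_intros DERIV_chain2[OF poly_DERIV]
          simp: flat_def poly_monom field_simps power2_eq_square)
    then show ?thesis
      by (rule has_field_derivative_transform_within_open[where S="{0<..}"]) (use 1 in \<open>auto simp: flat_def\<close>)
  next
    case 2
    have "((\<lambda>t. 0) has_real_derivative flat (monom 1 2 * (q - pderiv q)) t) (at t)"
      using 2 by (simp add: flat_def)
    then show ?thesis
      by (rule has_field_derivative_transform_within_open[where S="{..<0}"]) (use 2 in \<open>auto simp: flat_def\<close>)
  next
    case 3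
    have "((\<lambda>t. flat q t / t) \<longlongrightarrow> 0) (at_right 0)"
    proof -
      \<comment> \<open>substitute \<open>x = 1/t\<close>\<close>
      have "((\<lambda>x. poly (pCons 0 q) x * exp (- x)) \<longlongrightarrow> 0) at_top"
        by (rule poly_exp_tendsto_0)
      moreover have "filterlim (\<lambda>t::real. inverse t) at_top (at_right 0)"
        by (rule filterlim_inverse_at_top_right)
      ultimately have "((\<lambda>t. poly (pCons 0 q) (inverse t) * exp (- inverse t)) \<longlongrightarrow> 0) (at_right 0)"
        by (rule filterlim_compose)
      then show ?thesis
        by (rule Lim_transform_eventually)
           (auto simp: eventually_at_filter flat_def field_simps)
    qed
    moreover have "((\<lambda>t. flat q t / t) \<longlongrightarrow> 0) (at_left 0)"
      by (rule tendsto_eventually) (auto simp: eventually_at_filter flat_def)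
    ultimately have "((\<lambda>t. flat q t / t) \<longlongrightarrow> 0) (at 0)"
      using filterlim_split_at by blast
    then show ?thesis
      using 3 by (simp add: has_field_derivative_iff flat_def[of _ 0])
  qed
qed

lemma C_k_flat: "C_k k (flat q)"
proof (induction k arbitrary: q)
  case 0
  show ?case using DERIV_continuous_on[of UNIV "flat q"] flat_deriv by auto
next
  case (Suc k)
  show ?case
    by (rule C_k_Suc_I[OF has_field_derivative_imp_has_derivative[OF flat_deriv]]) (use Suc in auto)
qed

text \<open>The smooth convex function \<open>t exp(-h/t)\<close> replaces the positive part: it lies between \<open>(t - h)\<^sub>+\<close> and
  \<open>t\<^sub>+\<close> and has slope at most \<open>1\<close>.  Composed with a mollified function and
  multiplied by a cut-off, it gives a test function, so that the classical chain rule applies.\<close>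

definition soft :: "real \<Rightarrow> real \<Rightarrow> real" where
  "soft h t = (if 0 < t then t * exp (- (h / t)) else 0)"

definition soft' :: "real \<Rightarrow> real \<Rightarrow> real" where
  "soft' h t = (if 0 < t then (1 + h / t) * exp (- (h / t)) else 0)"

lemma soft_eq_flat: "h > 0 \<Longrightarrow> soft h t = t * flat 1 (t / h)"
  by (auto simp: soft_def flat_def zero_less_divide_iff)

lemma soft_deriv:
  assumes "h > 0" shows "(soft h has_real_derivative soft' h t) (at t)"
proof -
  have "((\<lambda>t. t * flat 1 (t / h)) has_real_derivative soft' h t) (at t)"
    by (rule DERIV_cong[OF DERIV_mult[OF DERIV_ident DERIV_chain2[OF flat_deriv DERIV_cdivide[OF DERIV_ident]]]])
       (use assms in \<open>auto simp: soft'_def flat_def zero_less_divide_iff field_simps poly_monom power2_eq_square\<close>)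
  moreover have "soft h = (\<lambda>t. t * flat 1 (t / h))" using soft_eq_flat[OF assms] by blast
  ultimately show ?thesis by simp
qed

lemma C_k_soft: "h > 0 \<Longrightarrow> C_k k (soft h)"
proof -
  assume h: "h > 0"
  have "C_k k (\<lambda>t. t * flat 1 (0 + inverse h *\<^sub>R t))"
    by (intro C_k_mult C_k_linear bounded_linear_ident C_k_affine C_k_flat)
  then show ?thesis by (rule C_k_cong) (use h in \<open>simp add: soft_eq_flat field_simps\<close>)
qed

lemma soft'_nonneg: "h > 0 \<Longrightarrow> 0 \<le> soft' h t" and soft'_le_1: "h > 0 \<Longrightarrow> soft' h t \<le> 1"
proof -
  assume h: "h > 0"
  show "0 \<le> soft' h t" using h by (simp add: soft'_def)
  have "(1 + h / t) * exp (- (h / t)) \<le> exp (h / t) * exp (- (h / t))"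
    by (intro mult_right_mono exp_ge_add_one_self) auto
  then show "soft' h t \<le> 1" by (simp add: soft'_def exp_minus)
qed

lemma soft_nonneg: "0 \<le> soft h t" by (simp add: soft_def)

lemma soft_le: "h > 0 \<Longrightarrow> soft h t \<le> max t 0"
  by (auto simp: soft_def mult_left_le)

text \<open>Convexity in the form \<open>G(t) \<le> t G'(t)\<close>: it is what lets the gradient term with the weight
  \<open>G'\<close> absorb the one with the weight \<open>G\<close>.\<close>

lemma soft_le_deriv: "h > 0 \<Longrightarrow> soft h t \<le> max t 0 * soft' h t"
  by (auto simp: soft_def soft'_def field_simps)

lemma soft_ge: "h > 0 \<Longrightarrow> t - h \<le> soft h t"
proof -
  assume h: "h > 0"
  show ?thesis
  proof (cases "t > 0")
    case True
    have "t * (1 + - (h / t)) \<le> t * exp (- (h / t))"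
      by (rule mult_left_mono[OF exp_ge_add_one_self]) (use True in simp)
    moreover have "t * (1 + - (h / t)) = t - h" using True by (simp add: field_simps)
    ultimately have "t - h \<le> t * exp (- (h / t))" by linarith
    then show ?thesis using True by (simp add: soft_def)
  qed (use h in \<open>auto simp: soft_def\<close>)
qed

lemma soft_mono: "h > 0 \<Longrightarrow> a \<le> b \<Longrightarrow> soft h a \<le> soft h b"
  using deriv_nonneg_imp_mono[of a b "soft h" "soft' h"] soft_deriv soft'_nonneg by blast

lemma soft_lipschitz: "h > 0 \<Longrightarrow> \<bar>soft h a - soft h b\<bar> \<le> \<bar>a - b\<bar>"
  using field_differentiable_bound[of UNIV "soft h" "soft' h" 1 b a] soft_deriv[of h] soft'_nonneg[of h] soft'_le_1[of h]
  by auto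

text \<open>The other form of convexity that the proof uses: slopes of chords through the origin increase.\<close>

lemma soft_chord: "h > 0 \<Longrightarrow> 0 < b \<Longrightarrow> b \<le> a \<Longrightarrow> soft h b \<le> soft h a * (b / a)"
  by (auto simp: soft_def frac_le)

lemma continuous_soft': "h > 0 \<Longrightarrow> continuous_on UNIV (soft' h)"
proof -
  assume h: "h > 0"
  have "C_k 1 (soft h)" using C_k_soft[OF h] .
  then have "continuous_on UNIV (\<lambda>x. frechet_derivative (soft h) (at x) 1)" by simp
  moreover have "frechet_derivative (soft h) (at x) 1 = soft' h x" for x
    using soft_deriv[OF h, of x] by (metis frechet_derivative_at has_field_derivative_def mult.right_neutral)
  ultimately show ?thesis by simp
qed

section \<open>Convolution with smooth functions\<close>

definition grad :: "('a::euclidean_space \<Rightarrow> real) \<Rightarrow> 'a \<Rightarrow> 'a" where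
  "grad f x = (\<Sum>i\<in>Basis. frechet_derivative f (at x) i *\<^sub>R i)"

text \<open>Unlike \<open>test_function\<close>, this keeps track of a compact set that carries the function, which need not be
  the closure of \<open>{x. f x \<noteq> 0}\<close>.\<close>

definition smooth_cs :: "('a::euclidean_space \<Rightarrow> real) \<Rightarrow> 'a set \<Rightarrow> bool" where
  "smooth_cs f K \<longleftrightarrow> (\<forall>k. C_k k f) \<and> compact K \<and> (\<forall>x. x \<notin> K \<longrightarrow> f x = 0)"

lemma test_function_iff: "test_function S f \<longleftrightarrow> (\<exists>K\<subseteq>S. smooth_cs f K)"
proof
  assume "test_function S f"
  then show "\<exists>K\<subseteq>S. smooth_cs f K"
    by (intro exI[of _ "closure {x. f x \<noteq> 0}"])
       (use closure_subset[of "{x. f x \<noteq> 0}"] in \<open>auto simp: test_function_def smooth_cs_def\<close>)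
next
  assume "\<exists>K\<subseteq>S. smooth_cs f K"
  then obtain K where K: "K \<subseteq> S" "smooth_cs f K" by blast
  then have "closure {x. f x \<noteq> 0} \<subseteq> K"
    by (intro closure_minimal) (auto simp: smooth_cs_def compact_imp_closed)
  with K show "test_function S f"
    using compact_Int_closed[of K "closure {x. f x \<noteq> 0}"]
    by (auto simp: test_function_def smooth_cs_def Int_absorb1)
qed

lemma smooth_cs_C_k: "smooth_cs f K \<Longrightarrow> C_k k f" by (simp add: smooth_cs_def)
lemma smooth_cs_compact: "smooth_cs f K \<Longrightarrow> compact K" by (simp add: smooth_cs_def)
lemma smooth_cs_0: "smooth_cs f K \<Longrightarrow> x \<notin> K \<Longrightarrow> f x = 0" by (simp add: smooth_cs_def)

lemma smooth_cs_mult: "smooth_cs f K \<Longrightarrow> (\<And>k. C_k k g) \<Longrightarrow> smooth_cs (\<lambda>x. g x * f x) K"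
  by (simp add: smooth_cs_def C_k_mult)

lemma frechet_eq_grad:
  assumes "C_k (Suc 0) f" shows "frechet_derivative f (at x) h = grad f x \<bullet> h"
proof -
  interpret linear "frechet_derivative f (at x)"
    by (rule has_derivative_linear[OF C_k_deriv[OF assms]])
  have "frechet_derivative f (at x) h = frechet_derivative f (at x) (\<Sum>i\<in>Basis. (h \<bullet> i) *\<^sub>R i)"
    by (simp add: euclidean_representation)
  also have "\<dots> = (\<Sum>i\<in>Basis. (h \<bullet> i) * frechet_derivative f (at x) i)"
    by (simp add: sum scale)
  also have "\<dots> = grad f x \<bullet> h"
    unfolding grad_def inner_sum_left by (intro sum.cong refl) (simp add: inner_commute)
  finally show ?thesis .
qed

lemma grad_has_derivative: "C_k (Suc 0) f \<Longrightarrow> (f has_derivative (\<lambda>h. grad f x \<bullet> h)) (at x)"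
proof -
  assume f: "C_k (Suc 0) f"
  have "frechet_derivative f (at x) = (\<lambda>h. grad f x \<bullet> h)"
    using frechet_eq_grad[OF f] by blast
  then show ?thesis using C_k_deriv[OF f, of x] by simp
qed

lemma grad_unique:
  assumes "(f has_derivative (\<lambda>h. D \<bullet> h)) (at x)" shows "grad f x = D"
proof -
  have "frechet_derivative f (at x) = (\<lambda>h. D \<bullet> h)" using frechet_derivative_at[OF assms] by simp
  then show ?thesis by (simp add: grad_def euclidean_representation)
qed

lemma continuous_grad: "C_k (Suc 0) f \<Longrightarrow> continuous_on UNIV (grad f)"
  unfolding grad_def[abs_def] by (auto intro!: continuous_intros)

lemma grad_outside:
  assumes f: "smooth_cs f K" and x: "x \<notin> K" shows "grad f x = 0"
proof (rule grad_unique)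
  have "open (- K)" using smooth_cs_compact[OF f] by (simp add: compact_imp_closed open_Compl)
  moreover have "((\<lambda>x. 0::real) has_derivative (\<lambda>h. 0 \<bullet> h)) (at x)" by simp
  ultimately show "(f has_derivative (\<lambda>h. 0 \<bullet> h)) (at x)"
    using f x has_derivative_transform_within_open[of "\<lambda>x. 0" _ x UNIV "- K" f]
    by (auto simp: smooth_cs_def)
qed

lemma smooth_cs_deriv:
  assumes f: "smooth_cs f K" and i: "i \<in> Basis"
  shows "smooth_cs (\<lambda>x. frechet_derivative f (at x) i) K"
proof -
  have "C_k (Suc k) f" for k using f by (rule smooth_cs_C_k)
  then have "C_k k (\<lambda>x. frechet_derivative f (at x) i)" for k using i by (simp only: C_k.simps) 
  moreover have "frechet_derivative f (at x) i = 0" if "x \<notin> K" for x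
    using frechet_eq_grad[of f x i] grad_outside[OF f that] f by (simp add: smooth_cs_def del: C_k.simps)
  ultimately show ?thesis using f by (simp add: smooth_cs_def)
qed

lemma smooth_cs_bounded_deriv:
  assumes f: "smooth_cs f K" shows "\<exists>B>0. \<forall>x. norm (f x) \<le> B \<and> norm (grad f x) \<le> B"
proof -
  have "continuous_on K f" "continuous_on K (grad f)"
    using C_k_continuous[OF smooth_cs_C_k[OF f]] continuous_grad[OF smooth_cs_C_k[OF f]]
    by (auto intro: continuous_on_subset)
  then have "bounded (f ` K)" "bounded (grad f ` K)"
    using smooth_cs_compact[OF f] by (auto intro: compact_imp_bounded compact_continuous_image)
  then obtain B1 B2 where B: "\<And>x. x \<in> K \<Longrightarrow> norm (f x) \<le> B1" "\<And>x. x \<in> K \<Longrightarrow> norm (grad f x) \<le> B2"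
    unfolding bounded_iff by blast
  have "norm (f x) \<le> max 1 (max B1 B2) \<and> norm (grad f x) \<le> max 1 (max B1 B2)" for x
    using B[of x] smooth_cs_0[OF f, of x] grad_outside[OF f, of x] by (cases "x \<in> K") auto
  then show ?thesis by (intro exI[of _ "max 1 (max B1 B2)"]) auto
qed

lemma compact_support_uniformly_continuous:
  fixes g :: "'a::euclidean_space \<Rightarrow> 'b::euclidean_space"
  assumes g: "continuous_on UNIV g" and K: "compact K" "\<And>x. x \<notin> K \<Longrightarrow> g x = 0" and e: "e > 0"
  shows "\<exists>d>0. \<forall>x y. norm (x - y) < d \<longrightarrow> norm (g x - g y) < e"
proof -
  obtain B where B: "K \<subseteq> cball 0 B"
    using compact_imp_bounded[OF K(1)] by (auto simp: bounded_iff subset_eq)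
  have "uniformly_continuous_on (cball 0 (B + 1)) g"
    using g by (intro compact_uniformly_continuous) (auto intro: continuous_on_subset)
  then obtain d where d: "d > 0" "\<And>x y. x \<in> cball 0 (B + 1) \<Longrightarrow> y \<in> cball 0 (B + 1) \<Longrightarrow> dist y x < d \<Longrightarrow> dist (g y) (g x) < e"
    unfolding uniformly_continuous_on_def using e by metis
  have "norm (g x - g y) < e" if "norm (x - y) < min d 1" for x y
  proof (cases "x \<in> cball 0 (B + 1) \<and> y \<in> cball 0 (B + 1)")
    case True
    then show ?thesis using d(2)[of x y] that by (auto simp: dist_norm norm_minus_commute)
  next
    case False
    have "norm x \<le> norm y + norm (x - y)" "norm y \<le> norm x + norm (x - y)"
      using norm_triangle_sub[of x y] norm_triangle_sub[of y x] by (simp_all add: norm_minus_commute)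
    then have "x \<notin> cball 0 B" "y \<notin> cball 0 B" using False that by auto
    then have "x \<notin> K" "y \<notin> K" using B by auto
    then show ?thesis using K(2) e by simp
  qed
  then show ?thesis using d(1) by (intro exI[of _ "min d 1"]) auto
qed

text \<open>By the mean value theorem the error is the variation of the gradient along a segment of length
  \<open>|h|\<close>, and a continuous gradient with compact support is uniformly continuous.  The uniformity in \<open>x\<close>
  lets derivatives pass under the integral sign without a domination argument.\<close>

lemma uniform_differentiability:
  assumes f: "smooth_cs f K" and e: "e > 0"
  shows "\<exists>d>0. \<forall>x h. norm h < d \<longrightarrow> \<bar>f (x + h) - f x - grad f x \<bullet> h\<bar> \<le> e * norm h"
proof -
  have f1: "C_k (Suc 0) f" using f by (rule smooth_cs_C_k)
  obtain d where d: "d > 0" "\<And>x y. norm (x - y) < d \<Longrightarrow> norm (grad f x - grad f y) < e"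
    using compact_support_uniformly_continuous[OF continuous_grad[OF f1] smooth_cs_compact[OF f] grad_outside[OF f] e]
    by blast
  have "\<bar>f (x + h) - f x - grad f x \<bullet> h\<bar> \<le> e * norm h" if h: "norm h < d" for x h
  proof -
    have "((\<lambda>t. f (x + t *\<^sub>R h)) has_derivative (\<lambda>s. grad f (x + t *\<^sub>R h) \<bullet> (s *\<^sub>R h))) (at t)" for t
      by (rule has_derivative_compose[OF _ grad_has_derivative[OF f1]]) (auto intro!: derivative_eq_intros)
    then have "((\<lambda>t. f (x + t *\<^sub>R h)) has_real_derivative grad f (x + t *\<^sub>R h) \<bullet> h) (at t)" for t
      by (simp add: has_field_derivative_def mult.commute[of _ "_ \<bullet> _"])
    then obtain z where z: "0 < z" "z < 1"
      "f (x + 1 *\<^sub>R h) - f (x + 0 *\<^sub>R h) = (1 - 0) * (grad f (x + z *\<^sub>R h) \<bullet> h)"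
      using MVT2[of 0 1 "\<lambda>t. f (x + t *\<^sub>R h)" "\<lambda>t. grad f (x + t *\<^sub>R h) \<bullet> h"] by auto
    have "\<bar>f (x + h) - f x - grad f x \<bullet> h\<bar> = \<bar>(grad f (x + z *\<^sub>R h) - grad f x) \<bullet> h\<bar>"
      using z(3) by (simp add: inner_diff_left)
    also have "\<dots> \<le> norm (grad f (x + z *\<^sub>R h) - grad f x) * norm h" by (rule Cauchy_Schwarz_ineq2)
    also have "\<dots> \<le> e * norm h"
    proof (rule mult_right_mono)
      have "norm (x + z *\<^sub>R h - x) < d" using z(1,2) h mult_left_le_one_le[of "norm h" z] by simp
      then show "norm (grad f (x + z *\<^sub>R h) - grad f x) \<le> e" using d(2) less_imp_le by blast
    qed simp
    finally show ?thesis .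
  qed
  then show ?thesis using d(1) by blast
qed

lemma measurable_C_k: "C_k k f \<Longrightarrow> f \<in> borel_measurable borel"
  using C_k_continuous borel_measurable_continuous_onI by blast

lemma smooth_cs_measurable: "smooth_cs f K \<Longrightarrow> f \<in> borel_measurable borel"
  using measurable_C_k smooth_cs_C_k by blast

lemma grad_measurable: "C_k (Suc 0) f \<Longrightarrow> grad f \<in> borel_measurable borel"
  using continuous_grad borel_measurable_continuous_onI by blast

lemma integrable_bounded_mult:
  fixes f :: "'a::euclidean_space \<Rightarrow> 'b::euclidean_space"
  assumes f: "integrable lborel f" and g: "g \<in> borel_measurable borel" "\<And>x. \<bar>g x\<bar> \<le> B"
  shows "integrable lborel (\<lambda>x. g x *\<^sub>R f x)"
proof (rule Bochner_Integration.integrable_bound[of _ "\<lambda>x. B *\<^sub>R f x"])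
  show "AE x in lborel. norm (g x *\<^sub>R f x) \<le> norm (B *\<^sub>R f x)"
    using g(2) by (auto intro!: AE_I2 mult_right_mono intro: order_trans[OF _ abs_ge_self])
  have [measurable]: "f \<in> borel_measurable borel" using f by auto
  show "(\<lambda>x. g x *\<^sub>R f x) \<in> borel_measurable lborel" using g(1) by measurable
qed (use f in simp)

lemma integrable_conv:
  assumes u: "integrable lborel u" and f: "smooth_cs f K"
  shows "integrable lborel (\<lambda>y. f (x - y) * u y)"
proof -
  obtain B where "\<And>x. \<bar>f x\<bar> \<le> B" using smooth_cs_bounded_deriv[OF f] by auto
  then show ?thesis using smooth_cs_measurable[OF f]
    by (intro integrable_bounded_mult[OF u, where g="\<lambda>y. f (x - y)" and B=B, simplified]) auto
qed

lemma conv_has_derivative: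
  fixes u :: "'a::euclidean_space \<Rightarrow> real"
  assumes u: "integrable lborel u" and f: "smooth_cs f K"
  shows "((\<lambda>x. LINT y|lborel. f (x - y) * u y) has_derivative
      (\<lambda>h. (LINT y|lborel. u y *\<^sub>R grad f (x - y)) \<bullet> h)) (at x)"
  unfolding has_derivative_at_alt
proof (intro conjI allI impI)
  show "bounded_linear ((\<bullet>) (LINT y|lborel. u y *\<^sub>R grad f (x - y)))"
    by (rule bounded_linear_inner_right)
  obtain B where B: "B > 0" "\<And>x. \<bar>f x\<bar> \<le> B" "\<And>x. norm (grad f x) \<le> B"
    using smooth_cs_bounded_deriv[OF f] by auto
  have f1: "C_k (Suc 0) f" using f by (rule smooth_cs_C_k)
  have [measurable]: "u \<in> borel_measurable borel" "grad f \<in> borel_measurable borel"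
    using u grad_measurable[OF f1] by auto
  have ig: "integrable lborel (\<lambda>y. u y *\<^sub>R grad f (x - y))"
    by (rule Bochner_Integration.integrable_bound[of _ "\<lambda>x. B *\<^sub>R u x"])
       (use u B in \<open>auto intro!: AE_I2 mult_left_mono simp: mult.commute[of B] abs_mult\<close>)
  define I where "I = (LINT y|lborel. \<bar>u y\<bar>)"
  have I: "I \<ge> 0" by (simp add: I_def)
  fix e :: real assume e: "0 < e"
  then have "e / (I + 1) > 0" using I by (simp add: divide_pos_pos)
  then obtain d where d: "d > 0" "\<And>x h. norm h < d \<Longrightarrow> \<bar>f (x + h) - f x - grad f x \<bullet> h\<bar> \<le> e / (I + 1) * norm h"
    using uniform_differentiability[OF f] by blast
  show "\<exists>d>0. \<forall>y. norm (y - x) < d \<longrightarrow>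
      norm ((LINT z|lborel. f (y - z) * u z) - (LINT z|lborel. f (x - z) * u z) -
      (LINT z|lborel. u z *\<^sub>R grad f (x - z)) \<bullet> (y - x)) \<le> e * norm (y - x)"
  proof (intro exI conjI allI impI)
    show "d > 0" by (rule d)
    fix y assume y: "norm (y - x) < d"
    have "(LINT z|lborel. f (y - z) * u z) - (LINT z|lborel. f (x - z) * u z) -
      (LINT z|lborel. u z *\<^sub>R grad f (x - z)) \<bullet> (y - x) =
      (LINT z|lborel. f (y - z) * u z - f (x - z) * u z - (u z *\<^sub>R grad f (x - z)) \<bullet> (y - x))"
      using integrable_conv[OF u f] ig
      by (simp only: Bochner_Integration.integral_diff Bochner_Integration.integrable_diff
          Bochner_Integration.integral_inner_left Bochner_Integration.integrable_inner_left)
    also have "norm \<dots> \<le> (LINT z|lborel. e / (I + 1) * norm (y - x) * \<bar>u z\<bar>)"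
    proof (rule Bochner_Integration.integral_norm_bound_integral)
      fix z
      have "norm (f (y - z) * u z - f (x - z) * u z - (u z *\<^sub>R grad f (x - z)) \<bullet> (y - x)) =
        \<bar>f ((x - z) + (y - x)) - f (x - z) - grad f (x - z) \<bullet> (y - x)\<bar> * \<bar>u z\<bar>"
        by (simp add: abs_mult[symmetric] algebra_simps)
      also have "\<dots> \<le> e / (I + 1) * norm (y - x) * \<bar>u z\<bar>"
        by (intro mult_right_mono d(2) y) auto
      finally show "norm (f (y - z) * u z - f (x - z) * u z - (u z *\<^sub>R grad f (x - z)) \<bullet> (y - x))
        \<le> e / (I + 1) * norm (y - x) * \<bar>u z\<bar>" .
    next
      show "integrable lborel (\<lambda>z. f (y - z) * u z - f (x - z) * u z - (u z *\<^sub>R grad f (x - z)) \<bullet> (y - x))"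
        by (intro Bochner_Integration.integrable_diff Bochner_Integration.integrable_inner_left
            integrable_conv[OF u f] ig)
    qed (use u in auto)
    also have "\<dots> = e * norm (y - x) * (I / (I + 1))" by (simp add: I_def)
    also have "\<dots> \<le> e * norm (y - x) * 1"
      using I e by (intro mult_left_mono) auto
    finally show "norm ((LINT z|lborel. f (y - z) * u z) - (LINT z|lborel. f (x - z) * u z) -
      (LINT z|lborel. u z *\<^sub>R grad f (x - z)) \<bullet> (y - x)) \<le> e * norm (y - x)" by simp
  qed
qed

lemma conv_deriv_eq:
  fixes u :: "'a::euclidean_space \<Rightarrow> real"
  assumes u: "integrable lborel u" and f: "smooth_cs f K"
  shows "(LINT y|lborel. u y *\<^sub>R grad f (x - y)) \<bullet> h = (LINT y|lborel. frechet_derivative f (at (x - y)) h * u y)"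
proof -
  have f1: "C_k (Suc 0) f" using f by (rule smooth_cs_C_k)
  obtain B where B: "B > 0" "\<And>x. norm (grad f x) \<le> B"
    using smooth_cs_bounded_deriv[OF f] by auto
  have [measurable]: "u \<in> borel_measurable borel" "grad f \<in> borel_measurable borel"
    using u grad_measurable[OF f1] by auto
  have ig: "integrable lborel (\<lambda>y. u y *\<^sub>R grad f (x - y))"
    by (rule Bochner_Integration.integrable_bound[of _ "\<lambda>x. B *\<^sub>R u x"])
       (use u B in \<open>auto intro!: AE_I2 mult_left_mono simp: mult.commute[of B] abs_mult\<close>)
  show ?thesis
    by (subst integral_inner_left[symmetric]) (use ig in \<open>auto simp: frechet_eq_grad[OF f1] mult.commute\<close>)
qed

text \<open>Differentiating a convolution only replaces the smooth factor by one of its partial derivatives.\<close>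

lemma C_k_conv:
  fixes u :: "'a::euclidean_space \<Rightarrow> real"
  assumes u: "integrable lborel u"
  shows "smooth_cs f K \<Longrightarrow> C_k k (\<lambda>x. LINT y|lborel. f (x - y) * u y)"
proof (induction k arbitrary: f)
  case 0
  have "continuous_on UNIV (\<lambda>x. LINT y|lborel. f (x - y) * u y)"
    by (rule has_derivative_continuous_on) (use conv_has_derivative[OF u 0] in simp)
  then show ?case by simp
next
  case (Suc k)
  show ?case
    by (rule C_k_Suc_I[OF conv_has_derivative[OF u Suc.prems]])
       (unfold conv_deriv_eq[OF u Suc.prems], intro Suc.IH smooth_cs_deriv[OF Suc.prems])
qed

lemma lborel_distr_reflect: "distr lborel borel ((-) x) = (lborel :: 'a::euclidean_space measure)"
proof -
  have "(\<lambda>xa. x + - 1 *\<^sub>R xa) = (-) x" by auto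
  then show ?thesis by (subst (2) lborel_affine[of "-1" x]) (auto simp: density_1)
qed

lemma nn_integral_lborel_reflect:
  assumes [measurable]: "f \<in> borel_measurable borel"
  shows "(\<integral>\<^sup>+y. f (x - y) \<partial>lborel) = (\<integral>\<^sup>+y. f (y::'a::euclidean_space) \<partial>lborel)"
  by (subst (2) lborel_distr_reflect[of x, symmetric]) (simp add: nn_integral_distr)

lemma nn_integral_lborel_shift:
  assumes [measurable]: "f \<in> borel_measurable borel"
  shows "(\<integral>\<^sup>+y. f (y + x) \<partial>lborel) = (\<integral>\<^sup>+y. f (y::'a::euclidean_space) \<partial>lborel)"
  by (subst (2) lborel_distr_plus[of x, symmetric]) (simp add: nn_integral_distr add.commute)

lemma integral_lborel_reflect:
  fixes f :: "'a::euclidean_space \<Rightarrow> 'b::euclidean_space"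
  assumes [measurable]: "f \<in> borel_measurable borel"
  shows "(LINT y|lborel. f (x - y)) = (LINT y|lborel. f y)"
  by (subst (2) lborel_distr_reflect[of x, symmetric]) (simp add: integral_distr)

lemma integrable_lborel_reflect:
  fixes f :: "'a::euclidean_space \<Rightarrow> 'b::euclidean_space"
  assumes "integrable lborel f"
  shows "integrable lborel (\<lambda>y. f (x - y))"
  using assms by (subst (asm) lborel_distr_reflect[of x, symmetric], subst (asm) integrable_distr_eq) auto

lemma integrable_lborel_shift:
  fixes f :: "'a::euclidean_space \<Rightarrow> 'b::euclidean_space"
  assumes "integrable lborel f"
  shows "integrable lborel (\<lambda>y. f (y + x))"
  using assms
  by (subst (asm) lborel_distr_plus[of x, symmetric], subst (asm) integrable_distr_eq) (auto simp: add.commute)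

lemma smooth_cs_integrable: assumes "smooth_cs f K" shows "integrable lborel f"
proof -
  have "integrable lborel (\<lambda>x. indicator K x *\<^sub>R f x)"
    using borel_integrable_compact[of K f] assms C_k_continuous[of 0 f]
    by (auto simp: smooth_cs_def intro: continuous_on_subset)
  moreover have "(\<lambda>x. indicator K x *\<^sub>R f x) = f"
    using smooth_cs_0[OF assms] by (intro ext) (auto simp: indicator_def)
  ultimately show ?thesis by simp
qed

text \<open>Convolving \<open>f\<close> with the indicator function of a huge ball gives a function that is constant near the
  origin, and the derivative of that constant is the integral in question.\<close>

lemma integral_deriv_0:
  fixes f :: "'a::euclidean_space \<Rightarrow> real"
  assumes f: "smooth_cs f K"
  shows "(LINT x|lborel. frechet_derivative f (at x) h) = 0"
proof -
  have f1: "C_k (Suc 0) f" using f by (rule smooth_cs_C_k)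
  obtain B where B: "K \<subseteq> cball 0 B"
    using compact_imp_bounded[OF smooth_cs_compact[OF f]] by (auto simp: bounded_iff subset_eq)
  define b :: "'a \<Rightarrow> real" where "b = indicator (cball 0 (B + 1))"
  have b: "integrable lborel b" unfolding b_def by (rule integrable_real_indicator) (use emeasure_bounded_finite[OF bounded_cball] in auto)
  have eq: "frechet_derivative f (at (x - y)) h * b y = frechet_derivative f (at (x - y)) h"
    "f (x - y) * b y = f (x - y)" if "norm x < 1" for x y
  proof -
    have "f (x - y) = 0 \<and> grad f (x - y) = 0" if "y \<notin> cball 0 (B + 1)"
    proof -
      have "norm y \<le> norm x + norm (x - y)"
        using norm_triangle_sub[of y x] by (simp add: norm_minus_commute)
      then have "x - y \<notin> K" using that \<open>norm x < 1\<close> B by auto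
      then show ?thesis using smooth_cs_0[OF f] grad_outside[OF f] by auto
    qed
    then show "frechet_derivative f (at (x - y)) h * b y = frechet_derivative f (at (x - y)) h"
      "f (x - y) * b y = f (x - y)"
      by (auto simp: b_def frechet_eq_grad[OF f1] indicator_def)
  qed
  have const: "(LINT y|lborel. f (x - y) * b y) = (LINT y|lborel. f y)" if "norm x < 1" for x
    using smooth_cs_measurable[OF f] by (simp add: eq(2)[OF that] integral_lborel_reflect)
  have "((\<lambda>x. LINT y|lborel. f (x - y) * b y) has_derivative (\<lambda>h. 0)) (at 0)"
    by (rule has_derivative_transform_within_open[where f="\<lambda>_. LINT y|lborel. f y" and s="ball 0 1"])
       (auto simp: const)
  with conv_has_derivative[OF b f, of 0]
  have "(\<lambda>h. (LINT y|lborel. b y *\<^sub>R grad f (0 - y)) \<bullet> h) = (\<lambda>h. 0)"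
    using has_derivative_unique by blast
  then have "(LINT y|lborel. frechet_derivative f (at (0 - y)) h * b y) = 0"
    using conv_deriv_eq[OF b f, of 0 h] by (simp only: fun_eq_iff)
  then have "(LINT y|lborel. frechet_derivative f (at (0 - y)) h) = 0"
    by (subst (asm) eq(1)) auto
  moreover have "(\<lambda>x. frechet_derivative f (at x) h) \<in> borel_measurable borel"
    using grad_measurable[OF f1] by (simp add: frechet_eq_grad[OF f1])
  ultimately show ?thesis by (subst (asm) integral_lborel_reflect) auto
qed

lemma integration_by_parts:
  fixes f g :: "'a::euclidean_space \<Rightarrow> real"
  assumes f: "\<And>k. C_k k f" and g: "smooth_cs g K" and i: "i \<in> Basis"
  shows "(LINT x|lborel. f x * frechet_derivative g (at x) i) = - (LINT x|lborel. (grad f x \<bullet> i) * g x)"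
proof -
  have fg: "smooth_cs (\<lambda>x. f x * g x) K" using smooth_cs_mult[OF g f] .
  have f1: "C_k (Suc 0) f" using f .
  have g1: "C_k (Suc 0) g" using g smooth_cs_C_k by blast
  have "((\<lambda>x. f x * g x) has_derivative (\<lambda>h. f x * (grad g x \<bullet> h) + (grad f x \<bullet> h) * g x)) (at x)" for x
    by (intro has_derivative_mult grad_has_derivative f1 g1)
  then have "frechet_derivative (\<lambda>x. f x * g x) (at x) = (\<lambda>h. f x * (grad g x \<bullet> h) + (grad f x \<bullet> h) * g x)" for x
    by (rule frechet_derivative_at[symmetric])
  then have eq: "frechet_derivative (\<lambda>x. f x * g x) (at x) i = f x * frechet_derivative g (at x) i + (grad f x \<bullet> i) * g x" for x
    by (simp add: frechet_eq_grad[OF g1])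
  have "\<And>k. C_k k (\<lambda>x. frechet_derivative f (at x) i)"
    using f[of "Suc _"] i by (simp only: C_k.simps)
  then have "\<And>k. C_k k (\<lambda>x. grad f x \<bullet> i)" by (simp only: frechet_eq_grad[OF f1])
  then have "integrable lborel (\<lambda>x. (grad f x \<bullet> i) * g x)"
    "integrable lborel (\<lambda>x. f x * frechet_derivative g (at x) i)"
    by (auto intro!: smooth_cs_integrable smooth_cs_mult g f smooth_cs_deriv i)
  then show ?thesis
    using integral_deriv_0[OF fg, of i] by (simp add: eq)
qed

section \<open>Mollification in Lebesgue spaces\<close>

text \<open>The integral of the \<open>p\<close>-th power of the norm.  Without the root, integrals add up over
  disjoint sets and can be exchanged directly; the triangle inequality holds up to a constant.\<close>

definition pint :: "real \<Rightarrow> ('a::euclidean_space \<Rightarrow> 'b::euclidean_space) \<Rightarrow> ennreal" where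
  "pint p f = (\<integral>\<^sup>+x. ennreal (norm (f x) powr p) \<partial>lborel)"

lemma powr_add_le:
  fixes a b p :: real
  assumes "0 \<le> a" "0 \<le> b" "0 \<le> p" shows "(a + b) powr p \<le> 2 powr p * (a powr p + b powr p)"
proof -
  have "(a + b) powr p \<le> (2 * max a b) powr p" using assms by (intro powr_mono2) auto
  also have "\<dots> = 2 powr p * (max a b) powr p" using assms by (simp add: powr_mult)
  also have "\<dots> \<le> 2 powr p * (a powr p + b powr p)" by (intro mult_left_mono) (auto simp: max_def)
  finally show ?thesis .
qed

lemma powr_add3_le:
  fixes a b c p :: real
  assumes "0 \<le> a" "0 \<le> b" "0 \<le> c" "0 \<le> p"
  shows "(a + b + c) powr p \<le> 3 powr p * (a powr p + b powr p + c powr p)"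
proof -
  have "(a + b + c) powr p \<le> (3 * max a (max b c)) powr p" using assms by (intro powr_mono2) auto
  also have "\<dots> = 3 powr p * (max a (max b c)) powr p" using assms by (simp add: powr_mult)
  also have "\<dots> \<le> 3 powr p * (a powr p + b powr p + c powr p)" by (intro mult_left_mono) (auto simp: max_def)
  finally show ?thesis .
qed

lemma pint_mono: 
  assumes "\<And>x. norm (f x) \<le> norm (g x)" "0 \<le> p" shows "pint p f \<le> pint p g"
  unfolding pint_def by (intro nn_integral_mono ennreal_leI powr_mono2 assms) auto

lemma pint_cong_AE: "AE x in lborel. f x = g x \<Longrightarrow> pint p f = pint p g"
  unfolding pint_def by (intro nn_integral_cong_AE) auto

lemma pint_add:
  assumes [measurable]: "f \<in> borel_measurable borel" "g \<in> borel_measurable borel" and p: "0 \<le> p"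
  shows "pint p (\<lambda>x. f x + g x) \<le> ennreal (2 powr p) * (pint p f + pint p g)"
proof -
  have "pint p (\<lambda>x. f x + g x) \<le> (\<integral>\<^sup>+x. ennreal (2 powr p) * (ennreal (norm (f x) powr p) + ennreal (norm (g x) powr p)) \<partial>lborel)"
    unfolding pint_def
  proof (intro nn_integral_mono)
    fix x
    have "norm (f x + g x) powr p \<le> (norm (f x) + norm (g x)) powr p"
      using p by (intro powr_mono2) (auto simp: norm_triangle_ineq)
    also have "\<dots> \<le> 2 powr p * (norm (f x) powr p + norm (g x) powr p)"
      using p by (intro powr_add_le) auto
    finally show "ennreal (norm (f x + g x) powr p) \<le> ennreal (2 powr p) * (ennreal (norm (f x) powr p) + ennreal (norm (g x) powr p))"
      by (simp add: ennreal_mult[symmetric] ennreal_plus[symmetric] ennreal_leI del: ennreal_plus)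
  qed
  also have "\<dots> = ennreal (2 powr p) * (pint p f + pint p g)"
    unfolding pint_def by (subst nn_integral_cmult, measurable, subst nn_integral_add) auto
  finally show ?thesis .
qed

lemma pint_add3:
  assumes [measurable]: "f \<in> borel_measurable borel" "g \<in> borel_measurable borel" "h \<in> borel_measurable borel" and p: "0 \<le> p"
  shows "pint p (\<lambda>x. f x + g x + h x) \<le> ennreal (3 powr p) * (pint p f + pint p g + pint p h)"
proof -
  have "pint p (\<lambda>x. f x + g x + h x) \<le> (\<integral>\<^sup>+x. ennreal (3 powr p) * (ennreal (norm (f x) powr p) + ennreal (norm (g x) powr p) + ennreal (norm (h x) powr p)) \<partial>lborel)"
    unfolding pint_def
  proof (intro nn_integral_mono)
    fix x
    have "norm (f x + g x + h x) powr p \<le> (norm (f x) + norm (g x) + norm (h x)) powr p"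
      using p norm_triangle_ineq[of "f x + g x" "h x"] norm_triangle_ineq[of "f x" "g x"] by (intro powr_mono2) auto
    also have "\<dots> \<le> 3 powr p * (norm (f x) powr p + norm (g x) powr p + norm (h x) powr p)"
      using p by (intro powr_add3_le) auto
    finally show "ennreal (norm (f x + g x + h x) powr p) \<le> ennreal (3 powr p) * (ennreal (norm (f x) powr p) + ennreal (norm (g x) powr p) + ennreal (norm (h x) powr p))"
      by (simp add: ennreal_mult[symmetric] ennreal_plus[symmetric] ennreal_leI del: ennreal_plus)
  qed
  also have "\<dots> = ennreal (3 powr p) * (pint p f + pint p g + pint p h)"
    unfolding pint_def by (subst nn_integral_cmult, measurable, subst nn_integral_add, measurable, subst nn_integral_add) auto
  finally show ?thesis .
qed

lemma pint_shift:
  assumes [measurable]: "f \<in> borel_measurable borel"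
  shows "pint p (\<lambda>x. f (x + h)) = pint p f"
  unfolding pint_def by (rule nn_integral_lborel_shift) measurable

lemma pint_minus: "pint p (\<lambda>x. f x - g x) = pint p (\<lambda>x. g x - f x)"
  unfolding pint_def by (simp add: norm_minus_commute)

lemma pint_uminus: "pint p (\<lambda>x. - f x) = pint p f"
  unfolding pint_def by simp

subsection \<open>Continuity of translations\<close>

definition trans_cont :: "('a::euclidean_space \<Rightarrow> 'b::euclidean_space) \<Rightarrow> bool" where
  "trans_cont f \<longleftrightarrow> (\<forall>X. X \<longlonglongrightarrow> 0 \<longrightarrow> (\<lambda>n. LINT x|lborel. norm (f (x + X n) - f x)) \<longlonglongrightarrow> 0)"

text \<open>Functions with this continuity form a closed subset of \<open>L\<^sup>1\<close>, since Lebesgue measure is invariant under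
  translations.\<close>

lemma trans_cont_approx:
  fixes f :: "'a::euclidean_space \<Rightarrow> 'b::euclidean_space"
  assumes f: "integrable lborel f"
    and g: "\<And>e. e > 0 \<Longrightarrow> \<exists>g. integrable lborel g \<and> trans_cont g \<and> (LINT x|lborel. norm (f x - g x)) \<le> e"
  shows "trans_cont f"
  unfolding trans_cont_def
proof (intro allI impI LIMSEQ_I)
  fix X :: "nat \<Rightarrow> 'a" and e :: real assume X: "X \<longlonglongrightarrow> 0" and e: "0 < e"
  obtain g where gi: "integrable lborel g" and tg: "trans_cont g" and le: "(LINT x|lborel. norm (f x - g x)) \<le> e / 4"
    using g[of "e / 4"] e by auto
  obtain no where no: "\<And>n. n \<ge> no \<Longrightarrow> norm ((LINT x|lborel. norm (g (x + X n) - g x)) - 0) < e / 4"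
    using LIMSEQ_D[OF tg[unfolded trans_cont_def, rule_format, OF X], of "e / 4"] e by auto
  show "\<exists>no. \<forall>n\<ge>no. norm ((LINT x|lborel. norm (f (x + X n) - f x)) - 0) < e"
  proof (intro exI[of _ no] allI impI)
    fix n assume n: "no \<le> n"
    define h where "h = X n"
    have i1: "integrable lborel (\<lambda>x. norm (f x - g x))" using f gi by (intro integrable_norm Bochner_Integration.integrable_diff)
    have i2: "integrable lborel (\<lambda>x. norm (f (x + h) - g (x + h)))"
      using integrable_lborel_shift[OF i1] .
    have i3: "integrable lborel (\<lambda>x. norm (g (x + h) - g x))"
      by (intro integrable_norm Bochner_Integration.integrable_diff integrable_lborel_shift gi)
    have i4: "integrable lborel (\<lambda>x. norm (f (x + h) - f x))"
      by (intro integrable_norm Bochner_Integration.integrable_diff integrable_lborel_shift f)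
    have [measurable]: "f \<in> borel_measurable borel" "g \<in> borel_measurable borel" using f gi by auto
    have sh: "(LINT x|lborel. norm (f (x + h) - g (x + h))) = (LINT x|lborel. norm (f x - g x))"
      by (subst (2) lborel_distr_plus[of h, symmetric]) (simp add: integral_distr add.commute)
    have "(LINT x|lborel. norm (f (x + h) - f x)) \<le>
      (LINT x|lborel. norm (f (x + h) - g (x + h)) + norm (g (x + h) - g x) + norm (f x - g x))"
    proof (rule integral_mono)
      fix x show "norm (f (x + h) - f x) \<le> norm (f (x + h) - g (x + h)) + norm (g (x + h) - g x) + norm (f x - g x)"
        using norm_triangle_ineq[of "f (x + h) - g (x + h)" "g (x + h) - g x"]
          norm_triangle_ineq4[of "f (x + h) - g x" "f x - g x"] by simp
    qed (intro Bochner_Integration.integrable_add i1 i2 i3 i4)+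
    also have "\<dots> = (LINT x|lborel. norm (f (x + h) - g (x + h))) + (LINT x|lborel. norm (g (x + h) - g x)) + (LINT x|lborel. norm (f x - g x))"
      using i1 i2 i3 by (simp add: Bochner_Integration.integral_add)
    also have "\<dots> < e" unfolding sh using le no[OF n] e by (simp add: h_def)
    finally show "norm ((LINT x|lborel. norm (f (x + X n) - f x)) - 0) < e" by (simp add: h_def)
  qed
qed

text \<open>Since \<open>u\<close> and its translates have equal integrals, the integral of \<open>|u(x + h) - u(x)|\<close> is twice that of
  \<open>(u(x) - u(x + h))\<^sub>+\<close>, for the indicator function \<open>u\<close> of the open set.  This positive part is dominated by
  \<open>u\<close> and tends to \<open>0\<close> at every point, because a point of an open set stays in it under small shifts.\<close>

lemma trans_cont_open:
  fixes U :: "'a::euclidean_space set" and c :: "'b::euclidean_space"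
  assumes U: "open U" and fin: "emeasure lborel U < \<infinity>"
  shows "trans_cont (\<lambda>x. indicator U x *\<^sub>R c)"
  unfolding trans_cont_def
proof (intro allI impI)
  fix X :: "nat \<Rightarrow> 'a" assume X: "X \<longlonglongrightarrow> 0"
  define u :: "'a \<Rightarrow> real" where "u = indicator U"
  have [measurable]: "U \<in> sets borel" using U by auto
  have ui: "integrable lborel u" unfolding u_def using fin by (intro integrable_real_indicator) auto
  have [measurable]: "u \<in> borel_measurable borel" unfolding u_def by measurable
  have uX: "integrable lborel (\<lambda>x. u (x + h))" for h by (rule integrable_lborel_shift[OF ui])
  have shift: "(LINT x|lborel. u (x + h)) = (LINT x|lborel. u x)" for h
    by (subst (2) lborel_distr_plus[of h, symmetric]) (simp add: integral_distr add.commute)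
  have "(\<lambda>n. LINT x|lborel. max (u x - u (x + X n)) 0) \<longlonglongrightarrow> (LINT x|(lborel::'a measure). 0)"
  proof (rule integral_dominated_convergence[where w=u])
    show "AE x in lborel. (\<lambda>n. max (u x - u (x + X n)) 0) \<longlonglongrightarrow> 0"
    proof (intro AE_I2)
      fix x show "(\<lambda>n. max (u x - u (x + X n)) 0) \<longlonglongrightarrow> 0"
      proof (cases "x \<in> U")
        case True
        have "(\<lambda>n. x + X n) \<longlonglongrightarrow> x + 0" by (intro tendsto_intros X)
        then have "eventually (\<lambda>n. x + X n \<in> U) sequentially"
          using topological_tendstoD[of _ x _ U] U True by simp
        then have "eventually (\<lambda>n. max (u x - u (x + X n)) 0 = 0) sequentially"
          by eventually_elim (use True in \<open>simp add: u_def\<close>)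
        then show ?thesis by (rule tendsto_eventually)
      next
        case False
        then have "max (u x - u (x + X n)) 0 = 0" for n by (simp add: u_def indicator_def)
        then show ?thesis by simp
      qed
    qed
    show "AE x in lborel. norm (max (u x - u (x + X n)) 0) \<le> u x" for n
      by (intro AE_I2) (auto simp: u_def indicator_def)
  qed (use ui in auto)
  moreover have "(LINT x|lborel. norm (indicator U (x + X n) *\<^sub>R c - indicator U x *\<^sub>R c)) =
      norm c * 2 * (LINT x|lborel. max (u x - u (x + X n)) 0)" for n
  proof -
    have "norm (indicator U (x + X n) *\<^sub>R c - indicator U x *\<^sub>R c) =
        norm c * (2 * max (u x - u (x + X n)) 0 - (u x - u (x + X n)))" for x
      by (auto simp: u_def indicator_def)
    then have "(LINT x|lborel. norm (indicator U (x + X n) *\<^sub>R c - indicator U x *\<^sub>R c)) =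
      norm c * (LINT x|lborel. 2 * max (u x - u (x + X n)) 0 - (u x - u (x + X n)))" by simp
    also have "(LINT x|lborel. 2 * max (u x - u (x + X n)) 0 - (u x - u (x + X n))) =
      2 * (LINT x|lborel. max (u x - u (x + X n)) 0) - ((LINT x|lborel. u x) - (LINT x|lborel. u (x + X n)))"
      using ui uX[of "X n"] integrable_max[of lborel "\<lambda>x. u x - u (x + X n)" "\<lambda>_. 0"] by simp
    finally show ?thesis by (simp add: shift)
  qed
  ultimately show "(\<lambda>n. LINT x|lborel. norm (indicator U (x + X n) *\<^sub>R c - indicator U x *\<^sub>R c)) \<longlonglongrightarrow> 0"
    using tendsto_mult[OF tendsto_const[of "norm c * 2"], of "\<lambda>n. LINT x|lborel. max (u x - u (x + X n)) 0" 0 sequentially]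
    by simp
qed

lemma trans_cont_L1:
  fixes f :: "'a::euclidean_space \<Rightarrow> 'b::euclidean_space"
  assumes "integrable lborel f"
  shows "trans_cont f"
  using assms
proof (induction rule: integrable_induct)
  case (base A c)
  then have A: "A \<in> sets borel" by simp
  have iA: "integrable lborel (indicator A :: 'a \<Rightarrow> real)" using base by (intro integrable_real_indicator) auto
  show ?case
  proof (rule trans_cont_approx)
    show "integrable lborel (\<lambda>x. indicator A x *\<^sub>R c)" using iA by simp
    fix e :: real assume e: "e > 0"
    obtain U where U: "open U" "A \<subseteq> U" "emeasure lborel (U - A) < ennreal (e / (norm c + 1))"
      using outer_regular_lborel[OF A, of "e / (norm c + 1)"] e by (auto simp: divide_pos_pos add_nonneg_pos)
    have fin: "emeasure lborel (U - A) < \<infinity>" using less_trans[OF U(3) ennreal_less_top] by simp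
    have "emeasure lborel U \<le> emeasure lborel (A \<union> (U - A))" using U A by (intro emeasure_mono) auto
    also have "\<dots> \<le> emeasure lborel A + emeasure lborel (U - A)" using U A by (intro emeasure_subadditive) auto
    also have "\<dots> < \<infinity>" using base fin by (simp add: ennreal_add_eq_top less_top)
    finally have finU: "emeasure lborel U < \<infinity>" .
    have iU: "integrable lborel (indicator U :: 'a \<Rightarrow> real)" using finU U by (intro integrable_real_indicator) auto
    have "(LINT x|lborel. norm (indicator A x *\<^sub>R c - indicator U x *\<^sub>R c)) = (LINT x|lborel. norm c * indicator (U - A) x)"
      using U(2) by (intro Bochner_Integration.integral_cong) (auto simp: indicator_def)
    also have "\<dots> = norm c * measure lborel (U - A)" using U A fin by simp
    also have "\<dots> \<le> norm c * (e / (norm c + 1))"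
      using U(3) e fin by (intro mult_left_mono)
        (auto simp: measure_def enn2real_le add_nonneg_pos less_imp_le)
    also have "\<dots> = e * (norm c / (norm c + 1))" by simp
    also have "\<dots> \<le> e * 1" using e by (intro mult_left_mono) (auto simp: add_nonneg_pos)
    finally show "\<exists>g. integrable lborel g \<and> trans_cont g \<and> (LINT x|lborel. norm (indicator A x *\<^sub>R c - g x)) \<le> e"
      using trans_cont_open[OF U(1) finU, of c] iU by (intro exI[of _ "\<lambda>x. indicator U x *\<^sub>R c"]) auto
  qed
next
  case (add f g)
  show ?case unfolding trans_cont_def
  proof (intro allI impI)
    fix X :: "nat \<Rightarrow> 'a" assume X: "X \<longlonglongrightarrow> 0"
    have lim: "(\<lambda>n. (LINT x|lborel. norm (f (x + X n) - f x)) + (LINT x|lborel. norm (g (x + X n) - g x))) \<longlonglongrightarrow> 0"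
    proof -
      have t: "trans_cont f" "trans_cont g" using add by blast+
      show ?thesis
        by (rule tendsto_add_zero[OF t(1)[unfolded trans_cont_def, rule_format, OF X]
              t(2)[unfolded trans_cont_def, rule_format, OF X]])
    qed
    have "(LINT x|lborel. norm (f (x + h) + g (x + h) - (f x + g x))) \<le>
      (LINT x|lborel. norm (f (x + h) - f x)) + (LINT x|lborel. norm (g (x + h) - g x))" for h
    proof -
      have i: "integrable lborel (\<lambda>x. norm (f (x + h) - f x))" "integrable lborel (\<lambda>x. norm (g (x + h) - g x))"
        "integrable lborel (\<lambda>x. norm (f (x + h) + g (x + h) - (f x + g x)))"
        by (intro integrable_norm Bochner_Integration.integrable_diff Bochner_Integration.integrable_add
            integrable_lborel_shift add)+
      show ?thesis
        by (subst Bochner_Integration.integral_add[symmetric, OF i(1,2)],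
            intro integral_mono i Bochner_Integration.integrable_add)
           (simp add: add_diff_add norm_triangle_ineq)
    qed
    then show "(\<lambda>n. LINT x|lborel. norm (f (x + X n) + g (x + X n) - (f x + g x))) \<longlonglongrightarrow> 0"
      by (intro tendsto_sandwich[OF _ _ tendsto_const lim]) (auto intro!: always_eventually)
  qed
next
  case (lim f s)
  show ?case
  proof (rule trans_cont_approx)
    show "integrable lborel f" by fact
    fix e :: real assume e: "e > 0"
    have cv: "\<And>x. (\<lambda>i. s i x) \<longlonglongrightarrow> f x" and bd: "\<And>x i. norm (s i x) \<le> 2 * norm (f x)"
      and tc: "\<And>i. integrable lborel (s i)" "\<And>i. trans_cont (s i)"
      using lim by auto
    have sm: "s i \<in> borel_measurable lborel" "f \<in> borel_measurable lborel" for i using lim by auto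
    have "(\<lambda>i. LINT x|lborel. norm (f x - s i x)) \<longlonglongrightarrow> (LINT x|(lborel::'a measure). 0)"
    proof (rule integral_dominated_convergence[where w="\<lambda>x. 3 * norm (f x)"])
      show "AE x in lborel. (\<lambda>i. norm (f x - s i x)) \<longlonglongrightarrow> 0"
      proof (intro AE_I2)
        fix x :: 'a
        have "(\<lambda>i. norm (f x - s i x)) \<longlonglongrightarrow> norm (f x - f x)"
          using cv by (intro tendsto_intros)
        then show "(\<lambda>i. norm (f x - s i x)) \<longlonglongrightarrow> 0" by simp
      qed
      show "AE x in lborel. norm (norm (f x - s i x)) \<le> 3 * norm (f x)" for i
      proof (intro AE_I2)
        fix x :: 'a
        have "norm (s i x) \<le> 2 * norm (f x)" using bd .
        then show "norm (norm (f x - s i x)) \<le> 3 * norm (f x)" using norm_triangle_ineq4[of "f x" "s i x"] by simp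
      qed
    qed (use lim sm in auto)
    then obtain i where "(LINT x|lborel. norm (f x - s i x)) < e"
      using order_tendstoD(2)[of _ "0::real" sequentially e] e by (auto simp: eventually_sequentially)
    then show "\<exists>g. integrable lborel g \<and> trans_cont g \<and> (LINT x|lborel. norm (f x - g x)) \<le> e"
      using tc less_imp_le by blast
  qed
qed

lemma truncate_pint:
  fixes f :: "'a::euclidean_space \<Rightarrow> 'b::euclidean_space"
  assumes [measurable]: "f \<in> borel_measurable borel" and fin: "pint p f < \<infinity>"
  shows "(\<lambda>M::nat. pint p (\<lambda>x. f x - (if norm (f x) \<le> real M then f x else 0))) \<longlonglongrightarrow> 0"
proof -
  have "(\<lambda>M::nat. \<integral>\<^sup>+x. ennreal (norm (f x - (if norm (f x) \<le> real M then f x else 0)) powr p) \<partial>lborel)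
     \<longlonglongrightarrow> (\<integral>\<^sup>+(x::'a). 0 \<partial>lborel)"
  proof (rule nn_integral_dominated_convergence[where w="\<lambda>x. ennreal (norm (f x) powr p)"])
    show "AE x in lborel. (\<lambda>M. ennreal (norm (f x - (if norm (f x) \<le> real M then f x else 0)) powr p)) \<longlonglongrightarrow> 0"
    proof (intro AE_I2 tendsto_eventually)
      fix x :: 'a
      obtain M0 :: nat where "norm (f x) \<le> real M0" using real_arch_simple by blast
      then show "\<forall>\<^sub>F M in sequentially. ennreal (norm (f x - (if norm (f x) \<le> real M then f x else 0)) powr p) = 0"
        unfolding eventually_sequentially by (intro exI[of _ M0]) auto
    qed
  qed (use fin in \<open>auto simp: pint_def intro!: AE_I2 ennreal_leI\<close>)
  then show ?thesis by (simp add: pint_def)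
qed

text \<open>The truncation of \<open>f\<close> at height \<open>M\<close> is bounded, so the \<open>p\<close>-th power of its increment is at most
  \<open>(2M)\<^sup>p\<^sup>-\<^sup>1\<close> times the increment, and continuity in \<open>L\<^sup>1\<close> applies.\<close>

lemma trans_cont_Lp:
  fixes f :: "'a::euclidean_space \<Rightarrow> 'b::euclidean_space"
  assumes f: "integrable lborel f" and fin: "pint p f < \<infinity>" and p: "1 \<le> p" and e: "0 < e"
  shows "\<exists>d>0. \<forall>h. norm h < d \<longrightarrow> pint p (\<lambda>x. f (x + h) - f x) \<le> ennreal e"
proof -
  have [measurable]: "f \<in> borel_measurable borel" using f by auto
  define e' where "e' = e / (3 * 3 powr p)"
  have e': "e' > 0" using e by (simp add: e'_def)
  have "eventually (\<lambda>M::nat. pint p (\<lambda>x. f x - (if norm (f x) \<le> real M then f x else 0)) < ennreal e') sequentially"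
    using order_tendstoD(2)[OF truncate_pint[OF _ fin], of "ennreal e'"] e' by simp
  then obtain M :: nat where M: "pint p (\<lambda>x. f x - (if norm (f x) \<le> real M then f x else 0)) < ennreal e'"
    by (auto simp: eventually_sequentially)
  define g where "g x = (if norm (f x) \<le> real M then f x else 0)" for x
  have [measurable]: "g \<in> borel_measurable borel" unfolding g_def by measurable
  have gi: "integrable lborel g"
    by (rule Bochner_Integration.integrable_bound[OF f]) (auto simp: g_def)
  have gM: "norm (g x) \<le> real M" for x by (simp add: g_def)
  define c where "c = (2 * real M) powr (p - 1) + 1"
  have c: "c > 0" by (simp add: c_def add_nonneg_pos)
  have "\<exists>d>0. \<forall>h. norm h < d \<longrightarrow> (LINT x|lborel. norm (g (x + h) - g x)) < e' / c"
  proof (rule ccontr)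
    assume "\<not> ?thesis"
    then have "\<forall>n::nat. \<exists>h. norm h < 1 / Suc n \<and> \<not> (LINT x|lborel. norm (g (x + h) - g x)) < e' / c"
      by (force simp: not_less)
    then obtain X where X: "\<And>n::nat. norm (X n) < 1 / Suc n" "\<And>n. \<not> (LINT x|lborel. norm (g (x + X n) - g x)) < e' / c"
      using choice[of "\<lambda>(n::nat) h. norm h < 1 / Suc n \<and> \<not> (LINT x|lborel. norm (g (x + h) - g x)) < e' / c"] by blast
    have "X \<longlonglongrightarrow> 0"
      by (rule Lim_null_comparison[OF _ LIMSEQ_inverse_real_of_nat])
         (use X(1) in \<open>auto intro!: always_eventually less_imp_le simp: inverse_eq_divide\<close>)
    then have "(\<lambda>n. LINT x|lborel. norm (g (x + X n) - g x)) \<longlonglongrightarrow> 0"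
      using trans_cont_L1[OF gi] unfolding trans_cont_def by blast
    then have "eventually (\<lambda>n. (LINT x|lborel. norm (g (x + X n) - g x)) < e' / c) sequentially"
      by (rule order_tendstoD) (use e' c in simp)
    then show False using X(2) by (auto simp: eventually_sequentially)
  qed
  then obtain d where d: "d > 0" "\<And>h. norm h < d \<Longrightarrow> (LINT x|lborel. norm (g (x + h) - g x)) < e' / c"
    by blast
  have "pint p (\<lambda>x. f (x + h) - f x) \<le> ennreal e" if h: "norm h < d" for h
  proof -
    have ig: "integrable lborel (\<lambda>x. norm (g (x + h) - g x))"
      by (intro integrable_norm Bochner_Integration.integrable_diff integrable_lborel_shift gi)
    have "pint p (\<lambda>x. g (x + h) - g x) \<le> (\<integral>\<^sup>+x. ennreal (c * norm (g (x + h) - g x)) \<partial>lborel)"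
      unfolding pint_def
    proof (intro nn_integral_mono ennreal_leI)
      fix x
      define t where "t = norm (g (x + h) - g x)"
      have t: "0 \<le> t" "t \<le> 2 * real M"
        using gM[of x] gM[of "x + h"] norm_triangle_ineq4[of "g (x + h)" "g x"] by (auto simp: t_def)
      have "t powr p = t powr (p - 1) * t"
        using t powr_mult_base[of t "p - 1"] by (simp add: mult.commute)
      also have "\<dots> \<le> c * t"
        using t p powr_mono2[of "p - 1" t "2 * real M"] by (intro mult_right_mono) (auto simp: c_def)
      finally show "norm (g (x + h) - g x) powr p \<le> c * norm (g (x + h) - g x)" by (simp add: t_def)
    qed
    also have "\<dots> = ennreal (c * (LINT x|lborel. norm (g (x + h) - g x)))"
      by (subst nn_integral_eq_integral) (use ig c in auto)
    also have "\<dots> \<le> ennreal e'"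
      using d(2)[OF h] c by (intro ennreal_leI) (auto simp: field_simps)
    finally have 2: "pint p (\<lambda>x. g (x + h) - g x) \<le> ennreal e'" .
    have 1: "pint p (\<lambda>x. f (x + h) - g (x + h)) \<le> ennreal e'"
      using pint_shift[of "\<lambda>x. f x - g x" p h] M by (simp add: g_def[symmetric])
    have 3: "pint p (\<lambda>x. g x - f x) \<le> ennreal e'"
      using M by (subst pint_minus) (simp add: g_def[symmetric])
    have "pint p (\<lambda>x. f (x + h) - f x) = pint p (\<lambda>x. (f (x + h) - g (x + h)) + (g (x + h) - g x) + (g x - f x))"
      by simp
    also have "\<dots> \<le> ennreal (3 powr p) * (pint p (\<lambda>x. f (x + h) - g (x + h)) + pint p (\<lambda>x. g (x + h) - g x) + pint p (\<lambda>x. g x - f x))"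
      by (rule pint_add3) (use p in auto)
    also have "\<dots> \<le> ennreal (3 powr p) * (ennreal e' + ennreal e' + ennreal e')"
      by (intro mult_left_mono add_mono 1 2 3) auto
    also have "\<dots> = ennreal e" using e' by (simp add: e'_def ennreal_mult[symmetric] ennreal_plus[symmetric] del: ennreal_plus)
    finally show ?thesis .
  qed
  then show ?thesis using d(1) by blast
qed

subsection \<open>Mollifiers\<close>

definition mollifier :: "real \<Rightarrow> ('a::euclidean_space \<Rightarrow> real) \<Rightarrow> bool" where
  "mollifier t \<eta> \<longleftrightarrow> smooth_cs \<eta> (cball 0 t) \<and> (\<forall>x. 0 \<le> \<eta> x) \<and> (LINT x|lborel. \<eta> x) = 1"

definition conv :: "('a::euclidean_space \<Rightarrow> real) \<Rightarrow> ('a \<Rightarrow> 'b::euclidean_space) \<Rightarrow> 'a \<Rightarrow> 'b" where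
  "conv \<eta> f x = (LINT y|lborel. \<eta> (x - y) *\<^sub>R f y)"

lemma C_k_flat_ball: "C_k k (\<lambda>x::'a::euclidean_space. flat 1 (a + b * (norm (x - z))\<^sup>2))"
  by (rule C_k_compose[OF C_k_flat]) (intro C_k_add C_k_mult C_k_const C_k_norm_sq)

lemma mollifier_exists:
  assumes t: "t > 0" shows "\<exists>\<eta>::'a::euclidean_space \<Rightarrow> real. mollifier t \<eta>"
proof -
  define f :: "'a \<Rightarrow> real" where "f x = flat 1 (t\<^sup>2 + (-1) * (norm (x - 0))\<^sup>2)" for x
  have out: "f x = 0" if "x \<notin> cball 0 t" for x
    using that t power_strict_mono[of t "norm x" 2] by (auto simp: f_def flat_def not_le)
  have sm: "smooth_cs f (cball 0 t)"
    using out C_k_flat_ball[of _ "t\<^sup>2" "-1" 0] by (auto simp: smooth_cs_def f_def[abs_def])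
  have nn: "0 \<le> f x" for x by (simp add: f_def flat_def)
  have pos: "0 < f x" if "x \<in> ball 0 t" for x
    using that t power_strict_mono[of "norm x" t 2] by (auto simp: f_def flat_def not_le)
  have int: "integrable lborel f" by (rule smooth_cs_integrable[OF sm])
  have "(LINT x|lborel. f x) \<noteq> 0"
  proof
    assume "(LINT x|lborel. f x) = 0"
    then have "AE x in lborel. f x = 0"
      using integral_nonneg_eq_0_iff_AE[OF int] nn by auto
    then have "AE x in lborel. x \<notin> ball (0::'a) t"
      by (rule eventually_mono) (use pos in force)
    then have "ball (0::'a) t \<in> null_sets lborel" by (subst AE_iff_null_sets) auto
    then show False using content_ball_pos[OF t, of "0::'a"] by (auto simp: null_sets_def measure_def)
  qed
  moreover have "0 \<le> (LINT x|lborel. f x)" using nn by simp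
  ultimately have I: "0 < (LINT x|lborel. f x)" by simp
  have "mollifier t (\<lambda>x. (1 / (LINT x|lborel. f x)) * f x)"
    unfolding mollifier_def using I nn by (intro conjI smooth_cs_mult[OF sm] C_k_const) auto
  then show ?thesis by blast
qed

lemma mollifier_integrable: "mollifier t \<eta> \<Longrightarrow> integrable lborel \<eta>"
  unfolding mollifier_def using smooth_cs_integrable by blast

text \<open>The graph of a convex power lies above its tangent at \<open>m\<close>.\<close>

lemma powr_tangent:
  fixes p t m :: real
  assumes p: "1 \<le> p" and t: "0 \<le> t" and m: "0 < m"
  shows "m powr p + p * m powr (p - 1) * (t - m) \<le> t powr p"
proof (cases "t = 0")
  case True
  have "m powr (p - 1) * m = m powr p" using m by (simp add: powr_mult_base[of m "p - 1"] mult.commute)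
  then have "p * m powr (p - 1) * m = p * m powr p" by simp
  moreover have "m powr p \<le> p * m powr p" using p mult_right_mono[of 1 p "m powr p"] by simp
  ultimately show ?thesis using True p by (simp add: algebra_simps)
next
  case False
  then have t: "t > 0" using t by simp
  have d: "((\<lambda>x. x powr p) has_real_derivative p * x powr (p - 1)) (at x)" if "x > 0" for x
    using that has_real_derivative_powr by blast
  consider "t = m" | "m < t" | "t < m" by linarith
  then show ?thesis
  proof cases
    case 2
    obtain z where z: "m < z" "z < t" "t powr p - m powr p = (t - m) * (p * z powr (p - 1))"
      using MVT2[OF 2, of "\<lambda>x. x powr p" "\<lambda>x. p * x powr (p - 1)", OF d] m by auto
    have "m powr (p - 1) \<le> z powr (p - 1)" using z m p by (intro powr_mono2) auto
    then have "(t - m) * (p * m powr (p - 1)) \<le> (t - m) * (p * z powr (p - 1))"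
      using 2 p by (intro mult_left_mono) auto
    then show ?thesis using z(3) by (simp add: algebra_simps)
  next
    case 3
    obtain z where z: "t < z" "z < m" "m powr p - t powr p = (m - t) * (p * z powr (p - 1))"
      using MVT2[OF 3, of "\<lambda>x. x powr p" "\<lambda>x. p * x powr (p - 1)", OF d] t by auto
    have "z powr (p - 1) \<le> m powr (p - 1)" using z t p by (intro powr_mono2) auto
    then have "(m - t) * (p * z powr (p - 1)) \<le> (m - t) * (p * m powr (p - 1))"
      using 3 p by (intro mult_left_mono) auto
    then show ?thesis using z(3) by (simp add: algebra_simps)
  qed simp
qed

text \<open>It holds for all functions, because the Bochner integral of a function that is not integrable is \<open>0\<close>.
  So lower bounds of the integrand give lower bounds of the energy form of a subsolution, convergent
  or not.\<close>

lemma integral_le_nn_integral: "ennreal (LINT x|M. f x) \<le> (\<integral>\<^sup>+x. ennreal (f x) \<partial>M)"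
proof (cases "integrable M f")
  case True
  then have "(LINT x|M. f x) = enn2real (\<integral>\<^sup>+x. ennreal (f x) \<partial>M) - enn2real (\<integral>\<^sup>+x. ennreal (- f x) \<partial>M)"
    by (rule real_lebesgue_integral_def)
  also have "\<dots> \<le> enn2real (\<integral>\<^sup>+x. ennreal (f x) \<partial>M)" by simp
  finally have "ennreal (LINT x|M. f x) \<le> ennreal (enn2real (\<integral>\<^sup>+x. ennreal (f x) \<partial>M))"
    by (rule ennreal_leI)
  also have "\<dots> \<le> (\<integral>\<^sup>+x. ennreal (f x) \<partial>M)" by (simp add: ennreal_enn2real_if)
  finally show ?thesis .
next
  case False
  then show ?thesis by (simp add: not_integrable_integral_eq)
qed

text \<open>Integrate the tangent inequality at the mean value.\<close>

lemma Jensen_powr: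
  fixes \<eta> g :: "'a \<Rightarrow> real"
  assumes \<eta>: "integrable M \<eta>" "\<And>x. 0 \<le> \<eta> x" "(LINT x|M. \<eta> x) = 1"
    and g: "\<And>x. 0 \<le> g x" "integrable M (\<lambda>x. \<eta> x * g x)" and p: "1 \<le> p"
  shows "ennreal ((LINT x|M. \<eta> x * g x) powr p) \<le> (\<integral>\<^sup>+x. ennreal (\<eta> x * g x powr p) \<partial>M)"
proof (cases "(LINT x|M. \<eta> x * g x) = 0")
  case True then show ?thesis using p by simp
next
  case False
  define m where "m = (LINT x|M. \<eta> x * g x)"
  have "m \<ge> 0" unfolding m_def using \<eta> g by simp
  then have m: "m > 0" using False by (simp add: m_def)
  have eq: "m powr p = (LINT x|M. (m powr p - p * m powr (p - 1) * m) * \<eta> x + p * m powr (p - 1) * (\<eta> x * g x))"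
    using \<eta> g by (simp add: m_def[symmetric])
  have "ennreal (m powr p) \<le> (\<integral>\<^sup>+x. ennreal ((m powr p - p * m powr (p - 1) * m) * \<eta> x + p * m powr (p - 1) * (\<eta> x * g x)) \<partial>M)"
    by (subst eq) (rule integral_le_nn_integral)
  also have "\<dots> \<le> (\<integral>\<^sup>+x. ennreal (\<eta> x * g x powr p) \<partial>M)"
  proof (intro nn_integral_mono ennreal_leI)
    fix x
    have "\<eta> x * (m powr p + p * m powr (p - 1) * (g x - m)) \<le> \<eta> x * g x powr p"
      by (intro mult_left_mono powr_tangent p g m \<eta>)
    then show "(m powr p - p * m powr (p - 1) * m) * \<eta> x + p * m powr (p - 1) * (\<eta> x * g x) \<le> \<eta> x * g x powr p"
      by (simp add: algebra_simps)
  qed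
  finally show ?thesis by (simp add: m_def)
qed

lemma conv_error_pointwise:
  fixes f :: "'a::euclidean_space \<Rightarrow> 'b::euclidean_space"
  assumes \<eta>: "mollifier t \<eta>" and f: "integrable lborel f" and p: "1 \<le> p"
  shows "ennreal (norm (conv \<eta> f x - f x) powr p) \<le> (\<integral>\<^sup>+h. ennreal (\<eta> h * norm (f (x - h) - f x) powr p) \<partial>lborel)"
proof -
  have sm: "smooth_cs \<eta> (cball 0 t)" and nn: "\<And>x. 0 \<le> \<eta> x" and I: "(LINT x|lborel. \<eta> x) = 1"
    using \<eta> by (auto simp: mollifier_def)
  have [measurable]: "f \<in> borel_measurable borel" "\<eta> \<in> borel_measurable borel"
    using f smooth_cs_measurable[OF sm] by auto
  obtain B where B: "\<And>x. \<bar>\<eta> x\<bar> \<le> B" using smooth_cs_bounded_deriv[OF sm] by auto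
  have i1: "integrable lborel (\<lambda>h. \<eta> h *\<^sub>R f (x - h))"
    by (rule integrable_bounded_mult[OF integrable_lborel_reflect[OF f] _ B]) measurable
  have i2: "integrable lborel (\<lambda>h. \<eta> h *\<^sub>R f x)" using mollifier_integrable[OF \<eta>] by simp
  have i3: "integrable lborel (\<lambda>h. \<eta> h *\<^sub>R (f (x - h) - f x))"
    unfolding scaleR_diff_right by (intro Bochner_Integration.integrable_diff i1 i2)
  have "conv \<eta> f x = (LINT h|lborel. \<eta> h *\<^sub>R f (x - h))"
    unfolding conv_def using integral_lborel_reflect[of "\<lambda>y. \<eta> (x - y) *\<^sub>R f y" x] by simp
  moreover have "f x = (LINT h|lborel. \<eta> h *\<^sub>R f x)" using I mollifier_integrable[OF \<eta>] by simp
  ultimately have "conv \<eta> f x - f x = (LINT h|lborel. \<eta> h *\<^sub>R f (x - h) - \<eta> h *\<^sub>R f x)"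
    using i1 i2 by simp
  then have eq: "conv \<eta> f x - f x = (LINT h|lborel. \<eta> h *\<^sub>R (f (x - h) - f x))"
    by (simp add: scaleR_diff_right)
  have "norm (conv \<eta> f x - f x) \<le> (LINT h|lborel. norm (\<eta> h *\<^sub>R (f (x - h) - f x)))"
    unfolding eq by (rule integral_norm_bound)
  also have "\<dots> = (LINT h|lborel. \<eta> h * norm (f (x - h) - f x))" using nn by simp
  finally have "norm (conv \<eta> f x - f x) powr p \<le> (LINT h|lborel. \<eta> h * norm (f (x - h) - f x)) powr p"
    using p by (intro powr_mono2) auto
  then have "ennreal (norm (conv \<eta> f x - f x) powr p) \<le> ennreal ((LINT h|lborel. \<eta> h * norm (f (x - h) - f x)) powr p)"
    by (rule ennreal_leI)
  also have "\<dots> \<le> (\<integral>\<^sup>+h. ennreal (\<eta> h * norm (f (x - h) - f x) powr p) \<partial>lborel)"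
    using integrable_norm[OF i3] nn by (intro Jensen_powr mollifier_integrable[OF \<eta>] nn I p) auto
  finally show ?thesis .
qed

lemma conv_measurable:
  fixes f :: "'a::euclidean_space \<Rightarrow> 'b::euclidean_space"
  assumes "mollifier t \<eta>" and [measurable]: "f \<in> borel_measurable borel"
  shows "conv \<eta> f \<in> borel_measurable borel"
proof -
  have [measurable]: "\<eta> \<in> borel_measurable borel" using assms smooth_cs_measurable by (auto simp: mollifier_def)
  have "(\<lambda>x. LINT y|lborel. \<eta> (x - y) *\<^sub>R f y) \<in> borel_measurable borel"
    by (rule lborel.borel_measurable_lebesgue_integral) measurable
  then show ?thesis by (simp add: conv_def[abs_def])
qed

text \<open>The error at \<open>x\<close> is an average of increments \<open>f(x - h) - f(x)\<close>, so Jensen's inequality and Tonelli's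
  theorem bound it by the worst translation with \<open>|h| \<le> t\<close>.\<close>

lemma conv_error_pint:
  fixes f :: "'a::euclidean_space \<Rightarrow> 'b::euclidean_space"
  assumes \<eta>: "mollifier t \<eta>" and f: "integrable lborel f" and p: "1 \<le> p"
    and e: "\<And>h. norm h \<le> t \<Longrightarrow> pint p (\<lambda>x. f (x + h) - f x) \<le> e"
  shows "pint p (\<lambda>x. conv \<eta> f x - f x) \<le> e"
proof -
  have sm: "smooth_cs \<eta> (cball 0 t)" and nn: "\<And>x. 0 \<le> \<eta> x" and I: "(LINT x|lborel. \<eta> x) = 1"
    using \<eta> by (auto simp: mollifier_def)
  have [measurable]: "f \<in> borel_measurable borel" "\<eta> \<in> borel_measurable borel"
    using f smooth_cs_measurable[OF sm] by auto
  have "pint p (\<lambda>x. conv \<eta> f x - f x) \<le> (\<integral>\<^sup>+x. \<integral>\<^sup>+h. ennreal (\<eta> h * norm (f (x - h) - f x) powr p) \<partial>lborel \<partial>lborel)"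
    unfolding pint_def by (intro nn_integral_mono conv_error_pointwise[OF \<eta> f p])
  also have "\<dots> = (\<integral>\<^sup>+h. \<integral>\<^sup>+x. ennreal (\<eta> h * norm (f (x - h) - f x) powr p) \<partial>lborel \<partial>lborel)"
    by (rule lborel_pair.Fubini'[symmetric]) measurable
  also have "\<dots> \<le> (\<integral>\<^sup>+h. ennreal (\<eta> h) * e \<partial>lborel)"
  proof (intro nn_integral_mono)
    fix h :: 'a
    have "(\<integral>\<^sup>+x. ennreal (\<eta> h * norm (f (x - h) - f x) powr p) \<partial>lborel) = ennreal (\<eta> h) * pint p (\<lambda>x. f (x + - h) - f x)"
      unfolding pint_def using nn by (simp add: ennreal_mult nn_integral_cmult)
    also have "\<dots> \<le> ennreal (\<eta> h) * e"
    proof (cases "norm h \<le> t")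
      case True then show ?thesis by (intro mult_left_mono e) auto
    next
      case False then have "\<eta> h = 0" using smooth_cs_0[OF sm, of h] by auto
      then show ?thesis by simp
    qed
    finally show "(\<integral>\<^sup>+x. ennreal (\<eta> h * norm (f (x - h) - f x) powr p) \<partial>lborel) \<le> ennreal (\<eta> h) * e" .
  qed
  also have "\<dots> = (\<integral>\<^sup>+h. ennreal (\<eta> h) \<partial>lborel) * e" by (rule nn_integral_multc) measurable
  also have "(\<integral>\<^sup>+h. ennreal (\<eta> h) \<partial>lborel) = 1"
    using nn I by (subst nn_integral_eq_integral[OF mollifier_integrable[OF \<eta>]]) auto
  finally show ?thesis by simp
qed

lemma conv_tendsto:
  fixes f :: "'a::euclidean_space \<Rightarrow> 'b::euclidean_space"
  assumes \<eta>: "\<And>n. mollifier (t n) (\<eta> n)" and t: "t \<longlonglongrightarrow> 0"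
    and f: "integrable lborel f" and fin: "pint p f < \<infinity>" and p: "1 \<le> p"
  shows "(\<lambda>n. pint p (\<lambda>x. conv (\<eta> n) f x - f x)) \<longlonglongrightarrow> 0"
proof (rule order_tendstoI)
  fix a :: ennreal assume "0 < a"
  then obtain c where c: "0 < c" "c < a" using dense by blast
  then obtain e where e: "0 < ennreal e" "ennreal e < a" by (cases c) auto
  then have e0: "e > 0" by simp
  obtain d where d: "d > 0" "\<And>h. norm h < d \<Longrightarrow> pint p (\<lambda>x. f (x + h) - f x) \<le> ennreal e"
    using trans_cont_Lp[OF f fin p e0] by blast
  have "eventually (\<lambda>n. t n < d) sequentially" by (rule order_tendstoD(2)[OF t d(1)])
  then show "eventually (\<lambda>n. pint p (\<lambda>x. conv (\<eta> n) f x - f x) < a) sequentially"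
  proof eventually_elim
    case (elim n)
    have "pint p (\<lambda>x. conv (\<eta> n) f x - f x) \<le> ennreal e"
      by (rule conv_error_pint[OF \<eta> f p]) (use elim d(2) in auto)
    then show ?case using e(2) by simp
  qed
qed simp

lemma AE_open_local:
  fixes S :: "'a::euclidean_space set"
  assumes "\<And>z. z \<in> S \<Longrightarrow> \<exists>r>0. AE x in lborel. x \<in> ball z r \<longrightarrow> P x"
  shows "AE x in lborel. x \<in> S \<longrightarrow> P x"
proof -
  obtain r where r: "\<And>z. z \<in> S \<Longrightarrow> r z > 0" "\<And>z. z \<in> S \<Longrightarrow> AE x in lborel. x \<in> ball z (r z) \<longrightarrow> P x"
    using bchoice[of S "\<lambda>z r. r > 0 \<and> (AE x in lborel. x \<in> ball z r \<longrightarrow> P x)"] assms by blast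
  obtain \<F> where F: "\<F> \<subseteq> (\<lambda>z. ball z (r z)) ` S" "countable \<F>" "\<Union>\<F> = (\<Union>z\<in>S. ball z (r z))"
    using Lindelof[of "(\<lambda>z. ball z (r z)) ` S"] by blast
  have "AE x in lborel. \<forall>A\<in>\<F>. x \<in> A \<longrightarrow> P x"
    using F(1) r(2) by (subst AE_ball_countable[OF F(2)]) auto
  then show ?thesis
  proof eventually_elim
    case (elim x)
    show ?case
    proof
      assume x: "x \<in> S"
      then have "x \<in> \<Union>\<F>" unfolding F(3) using r(1)[OF x] by (intro UN_I[OF x]) simp
      then show "P x" using elim by auto
    qed
  qed
qed

section \<open>Weak gradients\<close>

text \<open>The completed measure makes this possible.  It is used to move freely between a Lebesgue measurable
  function and a Borel measurable representative, for which product measures are available.\<close>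

lemma lebesgue_measurable_cong_AE:
  assumes f: "f \<in> borel_measurable lebesgue" and ae: "AE x in lborel. f x = g x"
  shows "g \<in> borel_measurable lebesgue"
proof (rule measurableI)
  fix A :: "'b set" assume A: "A \<in> sets borel"
  show "g -` A \<inter> space lebesgue \<in> sets lebesgue"
  proof (rule completion.in_sets_AE)
    show "f -` A \<inter> space lebesgue \<in> sets lebesgue" using f A by (rule measurable_sets)
    show "AE x in lebesgue. (x \<in> f -` A \<inter> space lebesgue) = (x \<in> g -` A \<inter> space lebesgue)"
      using ae by (intro AE_completion) (auto elim!: eventually_mono)
  qed simp
qed simp

lemma borel_imp_lebesgue: "f \<in> borel_measurable borel \<Longrightarrow> f \<in> borel_measurable lebesgue"
  by (rule measurable_completion) simp

lemma borel_representative: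
  fixes f :: "'a::euclidean_space \<Rightarrow> 'b::euclidean_space"
  assumes f: "f \<in> borel_measurable lebesgue"
  shows "\<exists>f'\<in>borel_measurable borel. AE x in lborel. f x = f' x"
proof -
  have "\<forall>b\<in>Basis. \<exists>F. F \<in> borel_measurable lborel \<and> (AE x in lborel. f x \<bullet> b = F x)"
  proof
    fix b :: 'b
    have "(\<lambda>x. f x \<bullet> b) \<in> borel_measurable lebesgue" using f by measurable
    then show "\<exists>F. F \<in> borel_measurable lborel \<and> (AE x in lborel. f x \<bullet> b = F x)"
      using completion_ex_borel_measurable_real[of "\<lambda>x. f x \<bullet> b" lborel] by blast
  qed
  then obtain F where F: "\<And>b. b \<in> Basis \<Longrightarrow> F b \<in> borel_measurable lborel"
    "\<And>b. b \<in> Basis \<Longrightarrow> AE x in lborel. f x \<bullet> b = F b x"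
    using bchoice[of Basis "\<lambda>b F. F \<in> borel_measurable lborel \<and> (AE x in lborel. f x \<bullet> b = F x)"] by blast
  show ?thesis
  proof (intro bexI[of _ "\<lambda>x. \<Sum>b\<in>Basis. F b x *\<^sub>R b"])
    have "AE x in lborel. \<forall>b\<in>Basis. f x \<bullet> b = F b x"
      using F(2) by (subst AE_finite_all) auto
    then show "AE x in lborel. f x = (\<Sum>b\<in>Basis. F b x *\<^sub>R b)"
    proof eventually_elim
      case (elim x)
      have "f x = (\<Sum>b\<in>Basis. (f x \<bullet> b) *\<^sub>R b)" by (simp add: euclidean_representation)
      also have "\<dots> = (\<Sum>b\<in>Basis. F b x *\<^sub>R b)" using elim by (intro sum.cong) auto
      finally show ?case .
    qed
    show "(\<lambda>x. \<Sum>b\<in>Basis. F b x *\<^sub>R b) \<in> borel_measurable borel" using F(1) by measurable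
  qed
qed

lemma lebesgue_set_integral_cong_AE:
  fixes F G :: "'a::euclidean_space \<Rightarrow> real"
  assumes m: "(\<lambda>x. indicator S x *\<^sub>R F x) \<in> borel_measurable lebesgue"
    and ae: "AE x in lborel. x \<in> S \<longrightarrow> F x = G x"
  shows "(LINT x:S|lebesgue. F x) = (LINT x:S|lebesgue. G x)"
proof -
  have ae': "AE x in lborel. indicator S x *\<^sub>R F x = indicator S x *\<^sub>R G x"
    using ae by eventually_elim (auto simp: indicator_def)
  show ?thesis
    unfolding set_lebesgue_integral_def
    by (intro integral_cong_AE m lebesgue_measurable_cong_AE[OF m ae'] AE_completion ae')
qed

lemma set_borel_measurable_cong_AE:
  fixes f g :: "'a::euclidean_space \<Rightarrow> 'b::euclidean_space"
  assumes f: "set_borel_measurable lebesgue S f" and ae: "AE x in lborel. x \<in> S \<longrightarrow> f x = g x"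
  shows "set_borel_measurable lebesgue S g"
  unfolding set_borel_measurable_def
  by (rule lebesgue_measurable_cong_AE[OF f[unfolded set_borel_measurable_def]])
     (use ae in \<open>auto elim!: eventually_mono simp: indicator_def\<close>)

lemma L_pow_iff:
  "L_pow q S f \<longleftrightarrow> set_borel_measurable lebesgue S f \<and> pint q (\<lambda>x. indicator S x *\<^sub>R f x) < \<infinity>"
proof -
  have eq: "indicator S x *\<^sub>R norm (f x) powr q = norm (indicator S x *\<^sub>R f x) powr q" for x
    by (auto simp: indicator_def)
  have "integrable lebesgue (\<lambda>x. norm (indicator S x *\<^sub>R f x) powr q) \<longleftrightarrow> pint q (\<lambda>x. indicator S x *\<^sub>R f x) < \<infinity>"
    if "(\<lambda>x. indicator S x *\<^sub>R f x) \<in> borel_measurable lebesgue"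
  proof -
    have "(\<lambda>x. norm (indicator S x *\<^sub>R f x) powr q) \<in> borel_measurable lebesgue" using that by measurable
    then show ?thesis
      by (simp add: integrable_iff_bounded pint_def nn_integral_completion)
  qed
  then show ?thesis
    unfolding L_pow_def set_integrable_def eq by (auto simp: set_borel_measurable_def)
qed

lemma L_pow_cong_AE:
  assumes f: "L_pow q S f" and ae: "AE x in lborel. x \<in> S \<longrightarrow> f x = g x"
  shows "L_pow q S g"
proof -
  have "pint q (\<lambda>x. indicator S x *\<^sub>R f x) = pint q (\<lambda>x. indicator S x *\<^sub>R g x)"
    by (rule pint_cong_AE) (use ae in \<open>auto elim!: eventually_mono simp: indicator_def\<close>)
  then show ?thesis using f set_borel_measurable_cong_AE[OF _ ae] by (simp add: L_pow_iff)
qed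

lemma L_pow_loc_cong_AE:
  assumes f: "L_pow_loc q S f" and ae: "AE x in lborel. x \<in> S \<longrightarrow> f x = g x"
  shows "L_pow_loc q S g"
  unfolding L_pow_loc_def
proof (intro conjI allI impI)
  show "set_borel_measurable lebesgue S g"
    using f set_borel_measurable_cong_AE[OF _ ae] by (simp add: L_pow_loc_def)
  fix K assume K: "compact K \<and> K \<subseteq> S"
  then have "L_pow q K f" using f by (simp add: L_pow_loc_def)
  then show "L_pow q K g"
    by (rule L_pow_cong_AE) (use ae K in \<open>auto elim!: eventually_mono\<close>)
qed

lemma integrable_iff_pint_1:
  "f \<in> borel_measurable borel \<Longrightarrow> integrable lborel f \<longleftrightarrow> pint 1 f < \<infinity>"
  unfolding integrable_iff_bounded pint_def by simp

lemma is_weak_gradient_cong_AE: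
  assumes w: "is_weak_gradient S u g"
    and ae: "AE x in lborel. x \<in> S \<longrightarrow> u x = u' x" "AE x in lborel. x \<in> S \<longrightarrow> g x = g' x"
  shows "is_weak_gradient S u' g'"
  unfolding is_weak_gradient_def
proof (intro conjI allI impI)
  show "L_pow_loc 1 S u'" "L_pow_loc 1 S g'"
    using w L_pow_loc_cong_AE ae by (auto simp: is_weak_gradient_def)
  then have m: "set_borel_measurable lebesgue S u'" "set_borel_measurable lebesgue S g'"
    "set_borel_measurable lebesgue S u" "set_borel_measurable lebesgue S g"
    using w by (auto simp: is_weak_gradient_def L_pow_loc_def)
  fix \<phi> and i :: 'a assume \<phi>: "test_function S \<phi> \<and> i \<in> Basis"
  then obtain K where K: "smooth_cs \<phi> K" "K \<subseteq> S" by (auto simp: test_function_iff)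
  have [measurable]: "\<phi> \<in> borel_measurable lebesgue" "(\<lambda>x. frechet_derivative \<phi> (at x) i) \<in> borel_measurable lebesgue"
    using smooth_cs_measurable[OF K(1)] smooth_cs_measurable[OF smooth_cs_deriv[OF K(1)]] \<phi>
    by (auto intro: borel_imp_lebesgue)
  have [measurable]: "(\<lambda>x. indicator S x *\<^sub>R u x) \<in> borel_measurable lebesgue" "(\<lambda>x. indicator S x *\<^sub>R u' x) \<in> borel_measurable lebesgue"
    "(\<lambda>x. indicator S x *\<^sub>R g x) \<in> borel_measurable lebesgue" "(\<lambda>x. indicator S x *\<^sub>R g' x) \<in> borel_measurable lebesgue"
    using m by (auto simp: set_borel_measurable_def)
  have e1: "(LINT x:S|lebesgue. u x * frechet_derivative \<phi> (at x) i) = (LINT x:S|lebesgue. u' x * frechet_derivative \<phi> (at x) i)"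
  proof (rule lebesgue_set_integral_cong_AE)
    have "(\<lambda>x. (indicator S x *\<^sub>R u x) * frechet_derivative \<phi> (at x) i) \<in> borel_measurable lebesgue" by measurable
    then show "(\<lambda>x. indicator S x *\<^sub>R (u x * frechet_derivative \<phi> (at x) i)) \<in> borel_measurable lebesgue"
      by (simp add: mult.assoc)
  qed (use ae(1) in \<open>auto elim!: eventually_mono\<close>)
  have e2: "(LINT x:S|lebesgue. (g x \<bullet> i) * \<phi> x) = (LINT x:S|lebesgue. (g' x \<bullet> i) * \<phi> x)"
  proof (rule lebesgue_set_integral_cong_AE)
    have "(\<lambda>x. ((indicator S x *\<^sub>R g x) \<bullet> i) * \<phi> x) \<in> borel_measurable lebesgue" by measurable
    then show "(\<lambda>x. indicator S x *\<^sub>R ((g x \<bullet> i) * \<phi> x)) \<in> borel_measurable lebesgue"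
      by (simp add: mult.assoc)
  qed (use ae(2) in \<open>auto elim!: eventually_mono\<close>)
  show "(LINT x:S|lebesgue. u' x * frechet_derivative \<phi> (at x) i) = - (LINT x:S|lebesgue. g' x \<bullet> i * \<phi> x)"
    unfolding e1[symmetric] e2[symmetric] using w \<phi> unfolding is_weak_gradient_def by blast
qed

lemma set_borel_measurable_representative:
  assumes "set_borel_measurable lebesgue S (f :: 'a::euclidean_space \<Rightarrow> 'b::euclidean_space)"
  shows "\<exists>f'\<in>borel_measurable borel. AE x in lborel. x \<in> S \<longrightarrow> f x = f' x"
proof -
  obtain f' where "f' \<in> borel_measurable borel" "AE x in lborel. indicator S x *\<^sub>R f x = f' x"
    using borel_representative[of "\<lambda>x. indicator S x *\<^sub>R f x"] assms by (auto simp: set_borel_measurable_def)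
  then show ?thesis
    by (intro bexI[of _ f']) (auto elim!: eventually_mono)
qed

definition zero_off :: "'a set \<Rightarrow> ('a \<Rightarrow> 'b::real_vector) \<Rightarrow> 'a \<Rightarrow> 'b" where
  "zero_off B f x = indicator B x *\<^sub>R f x"

lemma zero_off_measurable:
  fixes f :: "'a::euclidean_space \<Rightarrow> 'b::euclidean_space"
  assumes [measurable]: "B \<in> sets borel" "f \<in> borel_measurable borel"
  shows "zero_off B f \<in> borel_measurable borel"
  unfolding zero_off_def[abs_def] by measurable

lemma L_pow_loc_pint: "L_pow_loc q S f \<Longrightarrow> compact K \<Longrightarrow> K \<subseteq> S \<Longrightarrow> pint q (zero_off K f) < \<infinity>"
  by (auto simp: L_pow_loc_def L_pow_iff zero_off_def[abs_def])

lemma L_pow_loc_integrable: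
  assumes "f \<in> borel_measurable borel" "L_pow_loc 1 S f" "compact K" "K \<subseteq> S"
  shows "integrable lborel (zero_off K f)"
  using assms L_pow_loc_pint[of 1 S f K] by (subst integrable_iff_pint_1) (auto intro: zero_off_measurable borel_compact)

lemma lebesgue_set_integral_eq:
  fixes f :: "'a::euclidean_space \<Rightarrow> real"
  assumes "f \<in> borel_measurable borel" "\<And>x. x \<notin> S \<Longrightarrow> f x = 0"
  shows "(LINT x:S|lebesgue. f x) = (LINT x|lborel. f x)"
proof -
  have "(LINT x:S|lebesgue. f x) = (LINT x|lebesgue. f x)"
    unfolding set_lebesgue_integral_def using assms(2)
    by (intro Bochner_Integration.integral_cong) (auto simp: indicator_def)
  also have "\<dots> = (LINT x|lborel. f x)" by (rule integral_completion) (use assms in simp)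
  finally show ?thesis .
qed

text \<open>Away from the boundary mollification commutes with the weak gradient, because the mollifier centred at
  an interior point is itself a test function.\<close>

lemma grad_conv:
  assumes w: "is_weak_gradient S u g" and [measurable]: "u \<in> borel_measurable borel" "g \<in> borel_measurable borel"
    and B: "compact B" "B \<subseteq> S" and \<eta>: "mollifier t \<eta>" and x: "cball x t \<subseteq> B"
  shows "grad (conv \<eta> (zero_off B u)) x = conv \<eta> (zero_off B g) x"
proof -
  have sm: "smooth_cs \<eta> (cball 0 t)" using \<eta> by (simp add: mollifier_def)
  have [measurable]: "B \<in> sets borel" using B by (simp add: borel_compact)
  have ui: "integrable lborel (zero_off B u)" and gi: "integrable lborel (zero_off B g)"
    using w B by (auto intro!: L_pow_loc_integrable simp: is_weak_gradient_def)
  have [measurable]: "\<eta> \<in> borel_measurable borel" using smooth_cs_measurable[OF sm] .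
  obtain M where M: "\<And>x. \<bar>\<eta> x\<bar> \<le> M" using smooth_cs_bounded_deriv[OF sm] by auto
  have i: "integrable lborel (\<lambda>y. \<eta> (x - y) *\<^sub>R zero_off B g y)"
    by (rule integrable_bounded_mult[OF gi _ M]) measurable
  have \<phi>: "smooth_cs (\<lambda>y. \<eta> (x - y)) (cball x t)"
  proof -
    have "C_k k (\<lambda>y. \<eta> (x + (-1) *\<^sub>R y))" for k by (rule C_k_affine) (rule smooth_cs_C_k[OF sm])
    then show ?thesis using smooth_cs_0[OF sm] by (auto simp: smooth_cs_def dist_norm[of x])
  qed
  have e1: "C_k (Suc 0) \<eta>" using smooth_cs_C_k[OF sm] .
  have gr: "grad (\<lambda>y. \<eta> (x - y)) y = - grad \<eta> (x - y)" for y
  proof (rule grad_unique)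
    have "((\<lambda>y. \<eta> (x - y)) has_derivative (\<lambda>h. grad \<eta> (x - y) \<bullet> (- h))) (at y)"
      by (rule has_derivative_compose[OF _ grad_has_derivative[OF e1]]) (auto intro!: derivative_eq_intros)
    then show "((\<lambda>y. \<eta> (x - y)) has_derivative (\<lambda>h. - grad \<eta> (x - y) \<bullet> h)) (at y)" by simp
  qed
  have fr: "frechet_derivative (\<lambda>y. \<eta> (x - y)) (at y) b = - (frechet_derivative \<eta> (at (x - y)) b)" for y b
    using frechet_eq_grad[OF smooth_cs_C_k[OF \<phi>], of y b] frechet_eq_grad[OF e1] gr by simp
  have "grad (conv \<eta> (zero_off B u)) x = (LINT y|lborel. zero_off B u y *\<^sub>R grad \<eta> (x - y))"
    using conv_has_derivative[OF ui sm, of x] by (intro grad_unique) (simp add: conv_def[abs_def])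
  also have "\<dots> = conv \<eta> (zero_off B g) x"
  proof (rule euclidean_eqI)
    fix b :: 'a assume b: "b \<in> Basis"
    have [measurable]: "(\<lambda>x. frechet_derivative \<eta> (at x) b) \<in> borel_measurable borel"
      using smooth_cs_measurable[OF smooth_cs_deriv[OF sm b]] .
    have z: "y \<notin> B \<Longrightarrow> \<eta> (x - y) = 0 \<and> frechet_derivative \<eta> (at (x - y)) b = 0" for y
    proof -
      assume "y \<notin> B"
      then have "y \<notin> cball x t" using x by auto
      then have "x - y \<notin> cball 0 t" by (auto simp: dist_norm[of x])
      then show ?thesis using smooth_cs_0[OF sm] smooth_cs_0[OF smooth_cs_deriv[OF sm b]] by blast
    qed
    have "(LINT y|lborel. zero_off B u y *\<^sub>R grad \<eta> (x - y)) \<bullet> b = (LINT y|lborel. frechet_derivative \<eta> (at (x - y)) b * zero_off B u y)"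
      by (rule conv_deriv_eq[OF ui sm])
    also have "\<dots> = (LINT y|lborel. - (u y * frechet_derivative (\<lambda>y. \<eta> (x - y)) (at y) b))"
      unfolding fr using z by (intro Bochner_Integration.integral_cong) (auto simp: zero_off_def indicator_def)
    also have "\<dots> = - (LINT y|lborel. u y * frechet_derivative (\<lambda>y. \<eta> (x - y)) (at y) b)" by simp
    also have "(LINT y|lborel. u y * frechet_derivative (\<lambda>y. \<eta> (x - y)) (at y) b) =
      (LINT y:S|lebesgue. u y * frechet_derivative (\<lambda>y. \<eta> (x - y)) (at y) b)"
      unfolding fr using z B by (intro lebesgue_set_integral_eq[symmetric]) auto
    also have "- \<dots> = (LINT y:S|lebesgue. (g y \<bullet> b) * \<eta> (x - y))"
    proof -
      have "test_function S (\<lambda>y. \<eta> (x - y))" using \<phi> x B by (auto simp: test_function_iff)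
      then show ?thesis using w b by (auto simp: is_weak_gradient_def)
    qed
    also have "\<dots> = (LINT y|lborel. (g y \<bullet> b) * \<eta> (x - y))"
      using z B by (intro lebesgue_set_integral_eq) auto
    also have "\<dots> = (LINT y|lborel. (\<eta> (x - y) *\<^sub>R zero_off B g y) \<bullet> b)"
      using z by (intro Bochner_Integration.integral_cong) (auto simp: zero_off_def indicator_def)
    also have "\<dots> = conv \<eta> (zero_off B g) x \<bullet> b"
      unfolding conv_def by (rule Bochner_Integration.integral_inner_left) (rule i)
    finally show "(LINT y|lborel. zero_off B u y *\<^sub>R grad \<eta> (x - y)) \<bullet> b = conv \<eta> (zero_off B g) x \<bullet> b" .
  qed
  finally show ?thesis .
qed

text \<open>Both weak gradients have the same mollifications near a given point, namely the gradients of the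
  mollified function, and they are the \<open>L\<^sup>1\<close>-limits of these.\<close>

lemma weak_gradient_unique_borel:
  assumes w: "is_weak_gradient S u g1" "is_weak_gradient S u g2" and S: "open S"
    and m [measurable]: "u \<in> borel_measurable borel" "g1 \<in> borel_measurable borel" "g2 \<in> borel_measurable borel"
  shows "AE x in lborel. x \<in> S \<longrightarrow> g1 x = g2 x"
proof (rule AE_open_local)
  fix z assume "z \<in> S"
  then obtain R where R: "R > 0" "cball z R \<subseteq> S" using S open_contains_cball by blast
  define B where "B = cball z R"
  have B: "compact B" "B \<subseteq> S" using R by (auto simp: B_def)
  have [measurable]: "B \<in> sets borel" using B by (simp add: borel_compact)
  have i: "integrable lborel (zero_off B g1)" "integrable lborel (zero_off B g2)"
    using w B by (auto intro!: L_pow_loc_integrable simp: is_weak_gradient_def)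
  have om [measurable]: "zero_off B g1 \<in> borel_measurable borel" "zero_off B g2 \<in> borel_measurable borel"
    by (auto intro: zero_off_measurable)
  have fin: "pint 1 (zero_off B g1) < \<infinity>" "pint 1 (zero_off B g2) < \<infinity>"
    using i integrable_iff_pint_1[OF om(1)] integrable_iff_pint_1[OF om(2)] by auto
  define t where "t n = R / 2 * inverse (real (Suc n))" for n
  have t: "0 < t n" "t n \<le> R / 2" for n
    using R(1) by (auto simp: t_def field_simps)
  have "\<forall>n. \<exists>\<eta>::'a\<Rightarrow>real. mollifier (t n) \<eta>" using mollifier_exists t by blast
  then obtain \<eta> :: "nat \<Rightarrow> 'a \<Rightarrow> real" where \<eta>: "\<And>n. mollifier (t n) (\<eta> n)" by metis
  have t0: "t \<longlonglongrightarrow> 0"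
    unfolding t_def using tendsto_mult[OF tendsto_const LIMSEQ_inverse_real_of_nat, of "R / 2"] by simp
  define b where "b = ball z (R / 2)"
  have [measurable]: "b \<in> sets borel" by (simp add: b_def)
  have bound: "pint 1 (zero_off b (\<lambda>x. g1 x - g2 x)) \<le> ennreal (2 powr 1) * (pint 1 (\<lambda>x. conv (\<eta> n) (zero_off B g1) x - zero_off B g1 x)
      + pint 1 (\<lambda>x. conv (\<eta> n) (zero_off B g2) x - zero_off B g2 x))" for n
  proof -
    have [measurable]: "conv (\<eta> n) (zero_off B g1) \<in> borel_measurable borel" "conv (\<eta> n) (zero_off B g2) \<in> borel_measurable borel"
      by (auto intro!: conv_measurable[OF \<eta>])
    have "pint 1 (zero_off b (\<lambda>x. g1 x - g2 x)) \<le>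
       pint 1 (\<lambda>x. - (conv (\<eta> n) (zero_off B g1) x - zero_off B g1 x) + (conv (\<eta> n) (zero_off B g2) x - zero_off B g2 x))"
    proof (rule pint_mono)
      fix x
      show "norm (zero_off b (\<lambda>x. g1 x - g2 x) x) \<le>
        norm (- (conv (\<eta> n) (zero_off B g1) x - zero_off B g1 x) + (conv (\<eta> n) (zero_off B g2) x - zero_off B g2 x))"
      proof (cases "x \<in> b")
        case True
        have "cball x (t n) \<subseteq> B"
        proof
          fix y assume "y \<in> cball x (t n)"
          then have "dist z y \<le> dist z x + t n" using dist_triangle[of z y x] by simp
          then show "y \<in> B" using True t(2)[of n] by (simp add: b_def B_def)
        qed
        then have "conv (\<eta> n) (zero_off B g1) x = conv (\<eta> n) (zero_off B g2) x"
          using grad_conv[OF w(1) m(1,2) B \<eta>] grad_conv[OF w(2) m(1,3) B \<eta>] by metis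
        moreover have "x \<in> B" using True R(1) by (auto simp: b_def B_def)
        ultimately show ?thesis using True by (simp add: zero_off_def)
      qed (simp add: zero_off_def)
    qed simp
    also have "\<dots> \<le> ennreal (2 powr 1) * (pint 1 (\<lambda>x. - (conv (\<eta> n) (zero_off B g1) x - zero_off B g1 x))
      + pint 1 (\<lambda>x. conv (\<eta> n) (zero_off B g2) x - zero_off B g2 x))"
      by (rule pint_add) auto
    finally show ?thesis by (simp only: pint_uminus)
  qed
  have "(\<lambda>n. ennreal (2 powr 1) * (pint 1 (\<lambda>x. conv (\<eta> n) (zero_off B g1) x - zero_off B g1 x)
      + pint 1 (\<lambda>x. conv (\<eta> n) (zero_off B g2) x - zero_off B g2 x))) \<longlonglongrightarrow> ennreal (2 powr 1) * (0 + 0)"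
    by (intro ennreal_tendsto_cmult tendsto_add conv_tendsto[OF \<eta> t0] i fin) auto
  then have "pint 1 (zero_off b (\<lambda>x. g1 x - g2 x)) \<le> ennreal (2 powr 1) * (0 + 0)"
    by (rule LIMSEQ_le_const) (use bound in auto)
  then have "(\<integral>\<^sup>+x. ennreal (norm (zero_off b (\<lambda>x. g1 x - g2 x) x)) \<partial>lborel) = 0"
    by (simp add: pint_def)
  then have "AE x in lborel. ennreal (norm (zero_off b (\<lambda>x. g1 x - g2 x) x)) = 0"
    by (subst (asm) nn_integral_0_iff_AE) (auto intro!: zero_off_measurable measurable_compose[OF _ borel_measurable_norm])
  then have "AE x in lborel. x \<in> b \<longrightarrow> g1 x = g2 x"
    by (auto elim!: eventually_mono simp: zero_off_def)
  then show "\<exists>r>0. AE x in lborel. x \<in> ball z r \<longrightarrow> g1 x = g2 x"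
    using R(1) unfolding b_def by (intro exI[of _ "R / 2"]) simp
qed

lemma weak_gradient_unique:
  assumes w: "is_weak_gradient S u g1" "is_weak_gradient S u g2" and S: "open S"
  shows "AE x in lborel. x \<in> S \<longrightarrow> g1 x = g2 x"
proof -
  obtain u' g1' g2' where r: "u' \<in> borel_measurable borel" "AE x in lborel. x \<in> S \<longrightarrow> u x = u' x"
    "g1' \<in> borel_measurable borel" "AE x in lborel. x \<in> S \<longrightarrow> g1 x = g1' x"
    "g2' \<in> borel_measurable borel" "AE x in lborel. x \<in> S \<longrightarrow> g2 x = g2' x"
    using w set_borel_measurable_representative[of S u] set_borel_measurable_representative[of S g1]
      set_borel_measurable_representative[of S g2] by (auto simp: is_weak_gradient_def L_pow_loc_def)
  have "AE x in lborel. x \<in> S \<longrightarrow> g1' x = g2' x"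
    by (rule weak_gradient_unique_borel[OF is_weak_gradient_cong_AE[OF w(1) r(2,4)]
          is_weak_gradient_cong_AE[OF w(2) r(2,6)] S r(1,3,5)])
  with r(4,6) show ?thesis by eventually_elim auto
qed

section \<open>Limits of test functions\<close>

text \<open>The pair of a function in \<open>W\<^sub>0\<^sup>1\<^sup>,\<^sup>p(S)\<close> and its gradient, given by approximation with test functions only.
  All properties of the test functions that the proof needs pass to the limit from smooth functions.\<close>

definition H10 :: "real \<Rightarrow> 'a::euclidean_space set \<Rightarrow> ('a \<Rightarrow> real) \<Rightarrow> ('a \<Rightarrow> 'a) \<Rightarrow> bool" where
  "H10 p S v D \<longleftrightarrow> v \<in> borel_measurable borel \<and> D \<in> borel_measurable borel \<and>
     (\<forall>x. x \<notin> S \<longrightarrow> v x = 0 \<and> D x = 0) \<and>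
     (\<exists>\<phi>. (\<forall>n::nat. test_function S (\<phi> n)) \<and> (\<lambda>n. pint p (\<lambda>x. \<phi> n x - v x)) \<longlonglongrightarrow> 0 \<and>
        (\<lambda>n. pint p (\<lambda>x. grad (\<phi> n) x - D x)) \<longlonglongrightarrow> 0)"

lemma H10_measurable: "H10 p S v D \<Longrightarrow> v \<in> borel_measurable borel" "H10 p S v D \<Longrightarrow> D \<in> borel_measurable borel"
  and H10_outside: "H10 p S v D \<Longrightarrow> x \<notin> S \<Longrightarrow> v x = 0" "H10 p S v D \<Longrightarrow> x \<notin> S \<Longrightarrow> D x = 0"
  by (auto simp: H10_def)

lemma pint_bounded_finite:
  fixes f :: "'a::euclidean_space \<Rightarrow> 'b::euclidean_space"
  assumes B: "\<And>x. norm (f x) \<le> B" and K: "K \<in> sets borel" "emeasure lborel K < \<infinity>" "\<And>x. x \<notin> K \<Longrightarrow> f x = 0" and p: "0 < p"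
  shows "pint p f < \<infinity>"
proof -
  have "pint p f \<le> (\<integral>\<^sup>+x. ennreal (B powr p) * indicator K x \<partial>lborel)"
    unfolding pint_def
  proof (intro nn_integral_mono)
    fix x show "ennreal (norm (f x) powr p) \<le> ennreal (B powr p) * indicator K x"
      using B[of x] K(3)[of x] p by (cases "x \<in> K") (auto intro!: ennreal_leI powr_mono2)
  qed
  also have "\<dots> < \<infinity>" using K by (simp add: nn_integral_cmult ennreal_mult_less_top)
  finally show ?thesis .
qed

lemma smooth_cs_pint_finite:
  assumes f: "smooth_cs f K" and p: "0 < p"
  shows "pint p f < \<infinity>" "pint p (grad f) < \<infinity>"
proof -
  obtain B where B: "\<And>x. norm (f x) \<le> B" "\<And>x. norm (grad f x) \<le> B"
    using smooth_cs_bounded_deriv[OF f] by blast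
  have K: "K \<in> sets borel" "emeasure lborel K < \<infinity>"
    using smooth_cs_compact[OF f] emeasure_bounded_finite[OF compact_imp_bounded, of K] by (auto intro: borel_compact)
  show "pint p f < \<infinity>" by (rule pint_bounded_finite[OF B(1) K _ p]) (rule smooth_cs_0[OF f])
  show "pint p (grad f) < \<infinity>" by (rule pint_bounded_finite[OF B(2) K _ p]) (rule grad_outside[OF f])
qed

lemma pint_limit_finite:
  fixes f :: "nat \<Rightarrow> 'a::euclidean_space \<Rightarrow> 'b::euclidean_space"
  assumes m: "\<And>n. f n \<in> borel_measurable borel" "v \<in> borel_measurable borel" and fin: "\<And>n. pint p (f n) < \<infinity>"
    and lim: "(\<lambda>n. pint p (\<lambda>x. f n x - v x)) \<longlonglongrightarrow> 0" and p: "0 \<le> p"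
  shows "pint p v < \<infinity>"
proof -
  have "eventually (\<lambda>n. pint p (\<lambda>x. f n x - v x) < 1) sequentially"
    by (rule order_tendstoD(2)[OF lim]) simp
  then obtain n where n: "pint p (\<lambda>x. f n x - v x) < 1" by (auto simp: eventually_sequentially)
  have "pint p v = pint p (\<lambda>x. (v x - f n x) + f n x)" by simp
  also have "\<dots> \<le> ennreal (2 powr p) * (pint p (\<lambda>x. v x - f n x) + pint p (f n))"
    by (rule pint_add) (use m p in auto)
  also have "pint p (\<lambda>x. v x - f n x) = pint p (\<lambda>x. f n x - v x)" by (rule pint_minus)
  also have "ennreal (2 powr p) * (pint p (\<lambda>x. f n x - v x) + pint p (f n)) < \<infinity>"
  proof -
    have "pint p (\<lambda>x. f n x - v x) < \<infinity>" using n by (rule order.strict_trans) simp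
    then show ?thesis using fin[of n] by (simp add: ennreal_mult_less_top)
  qed
  finally show ?thesis .
qed

lemma test_function_grad_measurable: "test_function S f \<Longrightarrow> grad f \<in> borel_measurable borel"
  and test_function_measurable: "test_function S f \<Longrightarrow> f \<in> borel_measurable borel"
  by (auto simp: test_function_iff intro: grad_measurable smooth_cs_C_k smooth_cs_measurable)

lemma H10_pint_finite:
  assumes H: "H10 p S v D" and p: "0 < p"
  shows "pint p v < \<infinity>" "pint p D < \<infinity>"
proof -
  obtain \<phi> where \<phi>: "\<And>n::nat. test_function S (\<phi> n)" "(\<lambda>n. pint p (\<lambda>x. \<phi> n x - v x)) \<longlonglongrightarrow> 0"
    "(\<lambda>n. pint p (\<lambda>x. grad (\<phi> n) x - D x)) \<longlonglongrightarrow> 0"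
    using H by (auto simp: H10_def)
  have fin: "pint p (\<phi> n) < \<infinity>" "pint p (grad (\<phi> n)) < \<infinity>" for n
    using \<phi>(1)[of n] smooth_cs_pint_finite[OF _ p] by (auto simp: test_function_iff)
  show "pint p v < \<infinity>"
    by (rule pint_limit_finite[OF _ H10_measurable(1)[OF H] fin(1) \<phi>(2)])
      (use p test_function_measurable[OF \<phi>(1)] in auto)
  show "pint p D < \<infinity>"
    by (rule pint_limit_finite[OF _ H10_measurable(2)[OF H] fin(2) \<phi>(3)])
      (use p test_function_grad_measurable[OF \<phi>(1)] in auto)
qed

text \<open>Split according to \<open>|w| \<le> e\<close>, and use \<open>|w| \<le> e\<^sup>1\<^sup>-\<^sup>p |w|\<^sup>p\<close> in the other case.\<close>

lemma pint_1_le: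
  fixes w :: "'a::euclidean_space \<Rightarrow> 'b::euclidean_space"
  assumes m [measurable]: "w \<in> borel_measurable borel" "K \<in> sets borel"
    and K: "\<And>x. x \<notin> K \<Longrightarrow> w x = 0" and p: "1 \<le> p" and e: "0 < e"
  shows "pint 1 w \<le> ennreal e * emeasure lborel K + ennreal (e powr (1 - p)) * pint p w"
proof -
  have "pint 1 w \<le> (\<integral>\<^sup>+x. ennreal e * indicator K x + ennreal (e powr (1 - p)) * ennreal (norm (w x) powr p) \<partial>lborel)"
    unfolding pint_def
  proof (intro nn_integral_mono)
    fix x
    show "ennreal (norm (w x) powr 1) \<le> ennreal e * indicator K x + ennreal (e powr (1 - p)) * ennreal (norm (w x) powr p)"
    proof (cases "x \<in> K")
      case True
      define t where "t = norm (w x)"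
      have t: "t \<ge> 0" by (simp add: t_def)
      have "t \<le> e + e powr (1 - p) * t powr p"
      proof (cases "t \<le> e")
        case False
        then have "t = t powr (1 - p) * t powr p" using t e by (simp flip: powr_add)
        also have "\<dots> \<le> e powr (1 - p) * t powr p"
          using False e p by (intro mult_right_mono powr_mono2') auto
        finally show ?thesis using e by simp
      qed (simp add: add_increasing2)
      then have "ennreal t \<le> ennreal (e + e powr (1 - p) * t powr p)" by (rule ennreal_leI)
      also have "\<dots> = ennreal e + ennreal (e powr (1 - p)) * ennreal (t powr p)"
        using e by (simp add: ennreal_plus ennreal_mult)
      finally show ?thesis using True by (simp add: t_def)
    next
      case False then show ?thesis using K by simp
    qed
  qed
  also have "\<dots> = ennreal e * emeasure lborel K + ennreal (e powr (1 - p)) * pint p w"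
    unfolding pint_def by (subst nn_integral_add) (simp_all add: nn_integral_cmult)
  finally show ?thesis .
qed

lemma pint_1_tendsto:
  fixes w :: "nat \<Rightarrow> 'a::euclidean_space \<Rightarrow> 'b::euclidean_space"
  assumes m: "\<And>n. w n \<in> borel_measurable borel" and K: "K \<in> sets borel" "emeasure lborel K < \<infinity>"
    and out: "\<And>n x. x \<notin> K \<Longrightarrow> w n x = 0" and p: "1 \<le> p" and lim: "(\<lambda>n. pint p (w n)) \<longlonglongrightarrow> 0"
  shows "(\<lambda>n. pint 1 (w n)) \<longlonglongrightarrow> 0"
proof (rule order_tendstoI)
  fix a :: ennreal assume "0 < a"
  then obtain c where c: "0 < c" "c < a" using dense by blast
  then obtain e where e: "0 < e" "ennreal e < a" by (cases c) auto
  define d where "d = e / (2 * (measure lborel K + 1))"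
  have M: "measure lborel K \<ge> 0" by simp
  have d: "d > 0" using e M by (simp add: d_def add_nonneg_pos)
  have "eventually (\<lambda>n. pint p (w n) < ennreal (d powr (p - 1) * (e / 2))) sequentially"
    by (rule order_tendstoD(2)[OF lim]) (use d e in simp)
  then show "eventually (\<lambda>n. pint 1 (w n) < a) sequentially"
  proof eventually_elim
    case (elim n)
    have "pint 1 (w n) \<le> ennreal d * emeasure lborel K + ennreal (d powr (1 - p)) * pint p (w n)"
      by (rule pint_1_le[OF m K(1) out p d])
    also have "\<dots> \<le> ennreal d * ennreal (measure lborel K) + ennreal (d powr (1 - p)) * ennreal (d powr (p - 1) * (e / 2))"
      using elim K(2) by (intro add_mono mult_left_mono) (auto simp: emeasure_eq_ennreal_measure less_top)
    also have "\<dots> = ennreal (d * measure lborel K + d powr (1 - p) * (d powr (p - 1) * (e / 2)))"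
      using d e by (subst ennreal_plus) (simp_all only: ennreal_mult measure_nonneg mult_nonneg_nonneg powr_ge_zero less_imp_le divide_nonneg_pos zero_less_numeral)
    also have "d powr (1 - p) * (d powr (p - 1) * (e / 2)) = e / 2"
      using d by (simp flip: powr_add mult.assoc)
    also have "d * measure lborel K \<le> d * (measure lborel K + 1)" using d by simp
    also have "d * (measure lborel K + 1) = e / 2" using M by (simp add: d_def field_simps add_nonneg_eq_0_iff)
    finally have "pint 1 (w n) \<le> ennreal (e / 2 + e / 2)" using e by (simp add: ennreal_leI)
    then show ?case using e(2) by simp
  qed
qed simp

lemma tendsto_enn2real_0: "(f \<longlongrightarrow> 0) F \<Longrightarrow> ((\<lambda>n. enn2real (f n)) \<longlongrightarrow> 0) F"
  using tendsto_enn2real[where l=0] by simp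

lemma integral_mult_tendsto:
  fixes w :: "nat \<Rightarrow> 'a::euclidean_space \<Rightarrow> real"
  assumes w: "\<And>n. integrable lborel (w n)" and v: "integrable lborel v" and b: "b \<in> borel_measurable borel" "\<And>x. \<bar>b x\<bar> \<le> B"
    and lim: "(\<lambda>n. pint 1 (\<lambda>x. w n x - v x)) \<longlonglongrightarrow> 0"
  shows "(\<lambda>n. LINT x|lborel. w n x * b x) \<longlonglongrightarrow> (LINT x|lborel. v x * b x)"
proof (rule LIM_zero_cancel, rule Lim_null_comparison)
  have i: "integrable lborel (\<lambda>x. f x * b x)" if "integrable lborel f" for f :: "'a \<Rightarrow> real"
    using integrable_bounded_mult[OF that b] by (simp add: mult.commute)
  show "\<forall>\<^sub>F n in sequentially. norm ((LINT x|lborel. w n x * b x) - (LINT x|lborel. v x * b x)) \<le>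
     enn2real (pint 1 (\<lambda>x. w n x - v x)) * B"
  proof (intro always_eventually allI)
    fix n
    have d: "integrable lborel (\<lambda>x. w n x - v x)" by (intro Bochner_Integration.integrable_diff w v)
    have "(LINT x|lborel. w n x * b x) - (LINT x|lborel. v x * b x) = (LINT x|lborel. (w n x - v x) * b x)"
      using i[OF w[of n]] i[OF v] by (simp add: left_diff_distrib)
    also have "norm \<dots> \<le> (LINT x|lborel. norm (w n x - v x) * B)"
      using d i[OF d] b(2) by (intro Bochner_Integration.integral_norm_bound_integral) (auto simp: abs_mult intro!: mult_left_mono)
    also have "\<dots> = (LINT x|lborel. norm (w n x - v x)) * B" by simp
    also have "(LINT x|lborel. norm (w n x - v x)) = enn2real (pint 1 (\<lambda>x. w n x - v x))"
      unfolding pint_def using d by (subst integral_eq_nn_integral) auto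
    finally show "norm ((LINT x|lborel. w n x * b x) - (LINT x|lborel. v x * b x)) \<le> enn2real (pint 1 (\<lambda>x. w n x - v x)) * B" .
  qed
  show "(\<lambda>n. enn2real (pint 1 (\<lambda>x. w n x - v x)) * B) \<longlonglongrightarrow> 0"
    using tendsto_mult[OF tendsto_enn2real_0[OF lim] tendsto_const[of B]] by simp
qed

lemma bounded_in_cball: "bounded S \<Longrightarrow> \<exists>B. S \<subseteq> cball (0::'a::euclidean_space) B"
  by (auto simp: bounded_iff subset_eq)

lemma H10_L1:
  assumes H: "H10 p S v D" and p: "1 \<le> p" and S: "bounded S"
  shows "integrable lborel v" "integrable lborel D"
proof -
  obtain B where B: "S \<subseteq> cball 0 B" using bounded_in_cball[OF S] by blast
  define K where "K = cball (0::'a) B"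
  have K: "K \<in> sets borel" "emeasure lborel K < \<infinity>" and SK: "S \<subseteq> K"
    using B emeasure_bounded_finite[OF bounded_cball[of "0::'a" B]] by (auto simp: K_def)
  note m = H10_measurable[OF H]
  have "x \<notin> K \<Longrightarrow> v x = 0" "x \<notin> K \<Longrightarrow> D x = 0" for x using H10_outside[OF H, of x] SK by blast+
  then have "pint 1 v \<le> ennreal 1 * emeasure lborel K + ennreal (1 powr (1 - p)) * pint p v"
    "pint 1 D \<le> ennreal 1 * emeasure lborel K + ennreal (1 powr (1 - p)) * pint p D"
    using pint_1_le[OF m(1) K(1) _ p, of 1] pint_1_le[OF m(2) K(1) _ p, of 1] by auto
  moreover have "ennreal 1 * emeasure lborel K + ennreal (1 powr (1 - p)) * pint p v < \<infinity>"
    "ennreal 1 * emeasure lborel K + ennreal (1 powr (1 - p)) * pint p D < \<infinity>"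
    using K(2) H10_pint_finite[OF H] p by (auto simp: less_top[symmetric])
  ultimately show "integrable lborel v" "integrable lborel D"
    using m by (auto simp: integrable_iff_pint_1 intro: le_less_trans)
qed

lemma L_pow_of_pint:
  assumes f: "f \<in> borel_measurable borel" "\<And>x. x \<notin> T \<Longrightarrow> f x = 0" and K: "K = T \<or> compact K" and fin: "pint q f < \<infinity>" and q: "0 < q"
  shows "L_pow q K f"
proof -
  have "pint q (\<lambda>x. indicator K x *\<^sub>R f x) \<le> pint q f"
    by (rule pint_mono) (use q in \<open>auto simp: indicator_def\<close>)
  moreover have "set_borel_measurable lebesgue K f"
    using K
  proof
    assume "K = T"
    then have "(\<lambda>x. indicator K x *\<^sub>R f x) = f" using f(2) by (intro ext) (auto simp: indicator_def)
    then show ?thesis using f(1) by (simp add: set_borel_measurable_def borel_imp_lebesgue)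
  next
    assume "compact K"
    then have "(\<lambda>x. indicator K x *\<^sub>R f x) \<in> borel_measurable borel"
      using zero_off_measurable[OF borel_compact[of K] f(1)] by (simp add: zero_off_def[abs_def])
    then show ?thesis by (simp add: set_borel_measurable_def borel_imp_lebesgue)
  qed
  ultimately show ?thesis using fin by (auto simp: L_pow_iff intro: le_less_trans)
qed

text \<open>Integration by parts holds for the approximating test functions, and both sides are continuous with
  respect to convergence in \<open>L\<^sup>1\<close>.\<close>

lemma H10_weak_gradient:
  assumes H: "H10 p S v D" and p: "1 \<le> p" and S: "bounded S" and ST: "S \<subseteq> T"
  shows "is_weak_gradient T v D"
  unfolding is_weak_gradient_def
proof (intro conjI allI impI)
  note m [measurable] = H10_measurable[OF H]
  have out: "x \<notin> T \<Longrightarrow> v x = 0" "x \<notin> T \<Longrightarrow> D x = 0" for x using H10_outside[OF H] ST by auto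
  note L1 = H10_L1[OF H p S]
  have L: "pint 1 v < \<infinity>" "pint 1 D < \<infinity>" using L1 integrable_iff_pint_1[OF m(1)] integrable_iff_pint_1[OF m(2)] by auto
  show "L_pow_loc 1 T v" "L_pow_loc 1 T D"
    unfolding L_pow_loc_def
    using L_pow_of_pint[OF m(1) out(1) _ L(1)] L_pow_of_pint[OF m(2) out(2) _ L(2)]
    by (auto simp: L_pow_def)
  obtain B where B: "S \<subseteq> cball 0 B" using bounded_in_cball[OF S] by blast
  define K where "K = cball (0::'a) B"
  have K: "K \<in> sets borel" "emeasure lborel K < \<infinity>" and SK: "S \<subseteq> K"
    using B emeasure_bounded_finite[OF bounded_cball[of "0::'a" B]] by (auto simp: K_def)
  obtain f where f: "\<And>n::nat. test_function S (f n)" "(\<lambda>n. pint p (\<lambda>x. f n x - v x)) \<longlonglongrightarrow> 0"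
    "(\<lambda>n. pint p (\<lambda>x. grad (f n) x - D x)) \<longlonglongrightarrow> 0"
    using H by (auto simp: H10_def)
  have fm [measurable]: "f n \<in> borel_measurable borel" "grad (f n) \<in> borel_measurable borel" for n
    using test_function_measurable[OF f(1)] test_function_grad_measurable[OF f(1)] by auto
  have fout: "x \<notin> K \<Longrightarrow> f n x - v x = 0" "x \<notin> K \<Longrightarrow> grad (f n) x - D x = 0" for n x
  proof -
    assume x: "x \<notin> K"
    then have x: "x \<notin> S" using SK by auto
    obtain L where "L \<subseteq> S" "smooth_cs (f n) L" using f(1)[of n] by (auto simp: test_function_iff)
    then show "f n x - v x = 0" "grad (f n) x - D x = 0"
      using x H10_outside[OF H x] smooth_cs_0[of "f n" L x] grad_outside[of "f n" L x] by auto
  qed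
  have l1: "(\<lambda>n. pint 1 (\<lambda>x. f n x - v x)) \<longlonglongrightarrow> 0"
    by (rule pint_1_tendsto[OF _ K fout(1) p f(2)]) measurable
  have l2: "(\<lambda>n. pint 1 (\<lambda>x. grad (f n) x - D x)) \<longlonglongrightarrow> 0"
    by (rule pint_1_tendsto[OF _ K fout(2) p f(3)]) measurable
  fix \<phi> and i :: 'a assume "test_function T \<phi> \<and> i \<in> Basis"
  then obtain M where M: "M \<subseteq> T" "smooth_cs \<phi> M" and i: "i \<in> Basis" by (auto simp: test_function_iff)
  have [measurable]: "\<phi> \<in> borel_measurable borel" "(\<lambda>x. frechet_derivative \<phi> (at x) i) \<in> borel_measurable borel"
    using smooth_cs_measurable[OF M(2)] smooth_cs_measurable[OF smooth_cs_deriv[OF M(2) i]] .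
  obtain C where C: "\<And>x. \<bar>\<phi> x\<bar> \<le> C" using smooth_cs_bounded_deriv[OF M(2)] by auto
  obtain C' where C': "\<And>x. \<bar>frechet_derivative \<phi> (at x) i\<bar> \<le> C'" 
    using smooth_cs_bounded_deriv[OF smooth_cs_deriv[OF M(2) i]] by auto
  have fi: "integrable lborel (f n)" "integrable lborel (grad (f n))" for n
  proof -
    obtain L where L: "L \<subseteq> S" "smooth_cs (f n) L" using f(1)[of n] by (auto simp: test_function_iff)
    then show "integrable lborel (f n)" "integrable lborel (grad (f n))"
      using smooth_cs_pint_finite[OF L(2), of 1] by (auto simp: integrable_iff_pint_1)
  qed
  have "(\<lambda>n. LINT x|lborel. f n x * frechet_derivative \<phi> (at x) i) \<longlonglongrightarrow> (LINT x|lborel. v x * frechet_derivative \<phi> (at x) i)"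
    by (rule integral_mult_tendsto[OF fi(1) L1(1) _ C' l1]) measurable
  moreover have "(\<lambda>n. LINT x|lborel. (grad (f n) x \<bullet> i) * \<phi> x) \<longlonglongrightarrow> (LINT x|lborel. (D x \<bullet> i) * \<phi> x)"
  proof (rule integral_mult_tendsto[OF _ _ _ C])
    show "(\<lambda>n. pint 1 (\<lambda>x. grad (f n) x \<bullet> i - D x \<bullet> i)) \<longlonglongrightarrow> 0"
    proof (rule tendsto_sandwich[OF _ _ tendsto_const l2])
      show "\<forall>\<^sub>F n in sequentially. pint 1 (\<lambda>x. grad (f n) x \<bullet> i - D x \<bullet> i) \<le> pint 1 (\<lambda>x. grad (f n) x - D x)"
        using i by (intro always_eventually allI pint_mono) (auto simp: inner_diff_left[symmetric] Basis_le_norm)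
    qed simp
  qed (use fi(2) L1(2) in auto)
  moreover have "(LINT x|lborel. f n x * frechet_derivative \<phi> (at x) i) = - (LINT x|lborel. (grad (f n) x \<bullet> i) * \<phi> x)" for n
  proof -
    have "C_k k (f n)" for k using f(1)[of n] by (auto simp: test_function_def)
    then show ?thesis by (rule integration_by_parts[OF _ M(2) i])
  qed
  ultimately have "(LINT x|lborel. v x * frechet_derivative \<phi> (at x) i) = - (LINT x|lborel. (D x \<bullet> i) * \<phi> x)"
    using LIMSEQ_unique[OF _ tendsto_minus] by fastforce
  then show "(LINT x:T|lebesgue. v x * frechet_derivative \<phi> (at x) i) = - (LINT x:T|lebesgue. (D x \<bullet> i) * \<phi> x)"
    using out by (subst (1 2) lebesgue_set_integral_eq) auto
qed

lemma H10_diff_test: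
  assumes H: "H10 p S v D" and f: "test_function S f" and p: "0 < p"
  shows "H10 p S (\<lambda>x. f x - v x) (\<lambda>x. grad f x - D x)"
proof -
  obtain \<phi> where \<phi>: "\<And>n::nat. test_function S (\<phi> n)" "(\<lambda>n. pint p (\<lambda>x. \<phi> n x - v x)) \<longlonglongrightarrow> 0"
    "(\<lambda>n. pint p (\<lambda>x. grad (\<phi> n) x - D x)) \<longlonglongrightarrow> 0"
    using H by (auto simp: H10_def)
  obtain K where K: "K \<subseteq> S" "smooth_cs f K" using f by (auto simp: test_function_iff)
  have t: "test_function S (\<lambda>x. f x + (- 1) * \<phi> n x)" for n
  proof -
    obtain L where L: "L \<subseteq> S" "smooth_cs (\<phi> n) L" using \<phi>(1)[of n] by (auto simp: test_function_iff)
    then have "smooth_cs (\<lambda>x. f x + (- 1) * \<phi> n x) (K \<union> L)"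
      using K unfolding smooth_cs_def by (intro conjI allI impI C_k_add C_k_mult C_k_const) auto
    then show ?thesis unfolding test_function_iff using K(1) L(1) by (intro exI[of _ "K \<union> L"]) simp
  qed
  have g: "grad (\<lambda>x. f x + (- 1) * \<phi> n x) x = grad f x - grad (\<phi> n) x" for n x
  proof (rule grad_unique)
    have "C_k (Suc 0) f" "C_k (Suc 0) (\<phi> n)" using f \<phi>(1)[of n] by (auto simp: test_function_def)
    then show "((\<lambda>x. f x + - 1 * \<phi> n x) has_derivative (\<bullet>) (grad f x - grad (\<phi> n) x)) (at x)"
      by (auto intro!: derivative_eq_intros grad_has_derivative simp: inner_diff_left)
  qed
  have o: "x \<notin> S \<Longrightarrow> f x = 0 \<and> grad f x = 0" for x
    using K smooth_cs_0[of f K x] grad_outside[of f K x] by blast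
  have "pint p (\<lambda>x. (f x + (- 1) * \<phi> n x) - (f x - v x)) = pint p (\<lambda>x. \<phi> n x - v x)"
    "pint p (\<lambda>x. (grad f x - grad (\<phi> n) x) - (grad f x - D x)) = pint p (\<lambda>x. grad (\<phi> n) x - D x)" for n
    using pint_minus[of p "\<phi> n" v] pint_minus[of p "grad (\<phi> n)" D] by simp_all
  then show ?thesis
    unfolding H10_def using H10_measurable[OF H] test_function_measurable[OF f] test_function_grad_measurable[OF f]
      H10_outside[OF H] o \<phi> t by (intro conjI exI[of _ "\<lambda>n x. f x + (- 1) * \<phi> n x"]) (simp_all only: g, auto)
qed

lemma H10_W1p:
  assumes H: "H10 p S v D" and p: "1 \<le> p" and S: "bounded S" "open S"
  shows "AE x in lborel. x \<in> S \<longrightarrow> weak_gradient S v x = D x" "W1p p S v"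
    "W1p_norm p S v = (enn2real (pint p v) + enn2real (pint p D)) powr (1 / p)"
proof -
  note m [measurable] = H10_measurable[OF H] 
  note out = H10_outside[OF H]
  have w: "is_weak_gradient S v D" by (rule H10_weak_gradient[OF H p S(1) order_refl])
  then have w': "is_weak_gradient S v (weak_gradient S v)" unfolding weak_gradient_def by (rule someI[of "is_weak_gradient S v"])
  show ae: "AE x in lborel. x \<in> S \<longrightarrow> weak_gradient S v x = D x"
    by (rule weak_gradient_unique[OF w' w S(2)])
  then have ae': "AE x in lborel. x \<in> S \<longrightarrow> D x = weak_gradient S v x" by eventually_elim auto
  have "0 < p" using p by simp
  note fin = H10_pint_finite[OF H this]
  have LD: "L_pow p S v" "L_pow p S D"
    using L_pow_of_pint[OF m(1) out(1) _ fin(1)] L_pow_of_pint[OF m(2) out(2) _ fin(2)] p by auto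
  then show "W1p p S v" unfolding W1p_def using w L_pow_cong_AE[OF LD(2) ae'] by blast
  have "(LINT x:S|lebesgue. \<bar>v x\<bar> powr p) = (LINT x|lborel. norm (v x) powr p)"
    using out p by (subst lebesgue_set_integral_eq) auto
  also have "\<dots> = enn2real (pint p v)" unfolding pint_def by (rule integral_eq_nn_integral) auto
  finally have e1: "(LINT x:S|lebesgue. \<bar>v x\<bar> powr p) = enn2real (pint p v)" .
  have "(LINT x:S|lebesgue. norm (weak_gradient S v x) powr p) = (LINT x:S|lebesgue. norm (D x) powr p)"
  proof (rule lebesgue_set_integral_cong_AE[symmetric])
    have "(\<lambda>x. indicator S x *\<^sub>R norm (D x) powr p) = (\<lambda>x. norm (D x) powr p)"
      using out p by (intro ext) (auto simp: indicator_def)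
    moreover have "(\<lambda>x. norm (D x) powr p) \<in> borel_measurable borel" by measurable
    ultimately show "(\<lambda>x. indicator S x *\<^sub>R norm (D x) powr p) \<in> borel_measurable lebesgue"
      by (simp add: borel_imp_lebesgue)
    show "AE x in lborel. x \<in> S \<longrightarrow> norm (D x) powr p = norm (weak_gradient S v x) powr p"
      using ae by eventually_elim auto
  qed
  also have "\<dots> = (LINT x|lborel. norm (D x) powr p)"
    using out p by (subst lebesgue_set_integral_eq) auto
  also have "\<dots> = enn2real (pint p D)" unfolding pint_def by (rule integral_eq_nn_integral) auto
  finally show "W1p_norm p S v = (enn2real (pint p v) + enn2real (pint p D)) powr (1 / p)"
    unfolding W1p_norm_def e1 by simp
qed

text \<open>The norm in \<open>W1p_0\<close> is formed with the chosen representative \<open>weak_gradient\<close>; uniqueness of weak gradients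
  identifies it with the gradient that the approximation produces.\<close>

lemma H10_imp_W1p_0:
  assumes H: "H10 p S v D" and p: "1 \<le> p" and S: "bounded S" "open S"
  shows "W1p_0 p S v"
proof -
  obtain \<phi> where \<phi>: "\<And>n::nat. test_function S (\<phi> n)" "(\<lambda>n. pint p (\<lambda>x. \<phi> n x - v x)) \<longlonglongrightarrow> 0"
    "(\<lambda>n. pint p (\<lambda>x. grad (\<phi> n) x - D x)) \<longlonglongrightarrow> 0"
    using H by (auto simp: H10_def)
  have p0: "0 < p" using p by simp
  have "(\<lambda>n. (enn2real (pint p (\<lambda>x. \<phi> n x - v x)) + enn2real (pint p (\<lambda>x. grad (\<phi> n) x - D x))) powr (1 / p))
    \<longlonglongrightarrow> (0 + 0) powr (1 / p)"
    by (rule tendsto_powr'[OF tendsto_add[OF tendsto_enn2real_0[OF \<phi>(2)] tendsto_enn2real_0[OF \<phi>(3)]] tendsto_const])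
      (use p in auto)
  then have "(\<lambda>n. W1p_norm p S (\<lambda>x. \<phi> n x - v x)) \<longlonglongrightarrow> 0"
    using p by (simp add: H10_W1p(3)[OF H10_diff_test[OF H \<phi>(1) p0] p S])
  then show ?thesis
    unfolding W1p_0_def using H10_W1p(2)[OF H p S] H10_outside[OF H] \<phi>(1) by blast
qed

section \<open>A Faber-Krahn inequality\<close>

text \<open>The increment is the integral of the gradient along a segment; apply Jensen's inequality on the segment
  and Tonelli's theorem.\<close>

lemma test_translation:
  fixes f :: "'a::euclidean_space \<Rightarrow> real"
  assumes f: "smooth_cs f K" and p: "1 \<le> p"
  shows "pint p (\<lambda>x. f (x + h) - f x) \<le> ennreal (norm h powr p) * pint p (grad f)"
proof -
  have f1: "C_k (Suc 0) f" using smooth_cs_C_k[OF f] .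
  have [measurable]: "f \<in> borel_measurable borel" "grad f \<in> borel_measurable borel"
    using smooth_cs_measurable[OF f] grad_measurable[OF f1] by auto
  have cg: "continuous_on UNIV (\<lambda>t. grad f (x + t *\<^sub>R h))" for x
    by (rule continuous_on_compose2[OF continuous_grad[OF f1]]) (auto intro!: continuous_intros)
  have pt: "ennreal (norm (f (x + h) - f x) powr p) \<le>
    ennreal (norm h powr p) * (\<integral>\<^sup>+t. ennreal (indicator {0..1::real} t * norm (grad f (x + t *\<^sub>R h)) powr p) \<partial>lborel)" for x
  proof -
    have "((\<lambda>t. f (x + t *\<^sub>R h)) has_derivative (\<lambda>s. grad f (x + t *\<^sub>R h) \<bullet> (s *\<^sub>R h))) (at t)" for t
      by (rule has_derivative_compose[OF _ grad_has_derivative[OF f1]]) (auto intro!: derivative_eq_intros)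
    then have d: "((\<lambda>t. f (x + t *\<^sub>R h)) has_real_derivative grad f (x + t *\<^sub>R h) \<bullet> h) (at t)" for t
      by (simp add: has_field_derivative_def mult.commute[of _ "_ \<bullet> _"])
    have c: "isCont (\<lambda>t. grad f (x + t *\<^sub>R h) \<bullet> h) t" for t
      using cg[of x] by (intro continuous_intros) (simp add: continuous_on_eq_continuous_at)
    have eq: "(LINT t|lborel. (grad f (x + t *\<^sub>R h) \<bullet> h) * indicator {0..1} t) = f (x + h) - f x"
      using integral_FTC_Icc_real[of 0 1 "\<lambda>t. f (x + t *\<^sub>R h)" "\<lambda>t. grad f (x + t *\<^sub>R h) \<bullet> h"] d c by simp
    have ig: "integrable lborel (\<lambda>t. indicator {0..1::real} t * norm (grad f (x + t *\<^sub>R h)))"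
      using borel_integrable_compact[of "{0..1::real}" "\<lambda>t. norm (grad f (x + t *\<^sub>R h))"]
        continuous_on_norm[OF continuous_on_subset[OF cg[of x] subset_UNIV]] by simp
    have "norm (f (x + h) - f x) \<le> (LINT t|lborel. norm ((grad f (x + t *\<^sub>R h) \<bullet> h) * indicator {0..1} t))"
      unfolding eq[symmetric] by (rule integral_norm_bound)
    also have "\<dots> \<le> (LINT t|lborel. norm h * (indicator {0..1} t * norm (grad f (x + t *\<^sub>R h))))"
    proof (rule Bochner_Integration.integral_mono')
      show "integrable lborel (\<lambda>t. norm h * (indicator {0..1::real} t * norm (grad f (x + t *\<^sub>R h))))" using ig by simp
      fix t :: real
      show "norm ((grad f (x + t *\<^sub>R h) \<bullet> h) * indicator {0..1} t) \<le> norm h * (indicator {0..1} t * norm (grad f (x + t *\<^sub>R h)))"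
        using Cauchy_Schwarz_ineq2[of "grad f (x + t *\<^sub>R h)" h] by (auto simp: indicator_def mult.commute)
    qed simp
    also have "\<dots> = norm h * (LINT t|lborel. indicator {0..1} t * norm (grad f (x + t *\<^sub>R h)))" by simp
    finally have "norm (f (x + h) - f x) powr p \<le> (norm h * (LINT t|lborel. indicator {0..1} t * norm (grad f (x + t *\<^sub>R h)))) powr p"
      using p by (intro powr_mono2) auto
    also have "\<dots> = norm h powr p * (LINT t|lborel. indicator {0..1} t * norm (grad f (x + t *\<^sub>R h))) powr p"
      by (simp add: powr_mult)
    finally have "ennreal (norm (f (x + h) - f x) powr p) \<le> ennreal (norm h powr p) *
        ennreal ((LINT t|lborel. indicator {0..1} t * norm (grad f (x + t *\<^sub>R h))) powr p)"
      by (simp add: ennreal_leI flip: ennreal_mult)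
    also have "\<dots> \<le> ennreal (norm h powr p) * (\<integral>\<^sup>+t. ennreal (indicator {0..1::real} t * norm (grad f (x + t *\<^sub>R h)) powr p) \<partial>lborel)"
      by (intro mult_left_mono Jensen_powr ig p) auto
    finally show ?thesis .
  qed
  have "pint p (\<lambda>x. f (x + h) - f x) \<le> (\<integral>\<^sup>+x. ennreal (norm h powr p) * (\<integral>\<^sup>+t. ennreal (indicator {0..1::real} t * norm (grad f (x + t *\<^sub>R h)) powr p) \<partial>lborel) \<partial>lborel)"
    unfolding pint_def by (intro nn_integral_mono pt)
  also have "\<dots> = ennreal (norm h powr p) * (\<integral>\<^sup>+x. \<integral>\<^sup>+t. ennreal (indicator {0..1::real} t * norm (grad f (x + t *\<^sub>R h)) powr p) \<partial>lborel \<partial>lborel)"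
    by (rule nn_integral_cmult) measurable
  also have "(\<integral>\<^sup>+x. \<integral>\<^sup>+t. ennreal (indicator {0..1::real} t * norm (grad f (x + t *\<^sub>R h)) powr p) \<partial>lborel \<partial>lborel) =
     (\<integral>\<^sup>+t. \<integral>\<^sup>+x. ennreal (indicator {0..1::real} t * norm (grad f (x + t *\<^sub>R h)) powr p) \<partial>lborel \<partial>lborel)"
    by (rule lborel_pair.Fubini'[symmetric]) measurable
  also have "\<dots> = (\<integral>\<^sup>+t. pint p (grad f) * indicator {0..1::real} t \<partial>lborel)"
  proof (intro nn_integral_cong)
    fix t :: real
    show "(\<integral>\<^sup>+x. ennreal (indicator {0..1::real} t * norm (grad f (x + t *\<^sub>R h)) powr p) \<partial>lborel) = pint p (grad f) * indicator {0..1} t"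
      using pint_shift[of "grad f" p "t *\<^sub>R h"] by (cases "t \<in> {0..1}") (auto simp: pint_def)
  qed
  also have "\<dots> = pint p (grad f)" by (simp add: nn_integral_cmult_indicator)
  finally show ?thesis .
qed

lemma H10_translation:
  assumes H: "H10 p S v D" and p: "1 \<le> p"
  shows "pint p (\<lambda>x. v (x + h) - v x) \<le> ennreal (6 powr p * norm h powr p) * pint p D"
proof -
  note [measurable] = H10_measurable[OF H]
  obtain \<phi> where \<phi>: "\<And>n::nat. test_function S (\<phi> n)" "(\<lambda>n. pint p (\<lambda>x. \<phi> n x - v x)) \<longlonglongrightarrow> 0"
    "(\<lambda>n. pint p (\<lambda>x. grad (\<phi> n) x - D x)) \<longlonglongrightarrow> 0"
    using H by (auto simp: H10_def)
  have [measurable]: "\<phi> n \<in> borel_measurable borel" "grad (\<phi> n) \<in> borel_measurable borel" for n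
    using test_function_measurable[OF \<phi>(1)] test_function_grad_measurable[OF \<phi>(1)] by auto
  define a b where "a n = pint p (\<lambda>x. \<phi> n x - v x)" and "b n = pint p (\<lambda>x. grad (\<phi> n) x - D x)" for n
  have le: "pint p (\<lambda>x. v (x + h) - v x) \<le>
    ennreal (3 powr p) * (a n + ennreal (norm h powr p) * (ennreal (2 powr p) * (b n + pint p D)) + a n)" for n
  proof -
    have "pint p (\<lambda>x. v (x + h) - v x) = pint p (\<lambda>x. (v (x + h) - \<phi> n (x + h)) + (\<phi> n (x + h) - \<phi> n x) + (\<phi> n x - v x))"
      by simp
    also have "\<dots> \<le> ennreal (3 powr p) * (pint p (\<lambda>x. v (x + h) - \<phi> n (x + h)) + pint p (\<lambda>x. \<phi> n (x + h) - \<phi> n x) + pint p (\<lambda>x. \<phi> n x - v x))"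
      by (rule pint_add3) (use p in auto)
    also have "pint p (\<lambda>x. v (x + h) - \<phi> n (x + h)) = a n"
      using pint_shift[of "\<lambda>x. v x - \<phi> n x" p h] pint_minus[of p v "\<phi> n"] by (simp add: a_def)
    also have "pint p (\<lambda>x. \<phi> n x - v x) = a n" by (simp add: a_def)
    also have "pint p (\<lambda>x. \<phi> n (x + h) - \<phi> n x) \<le> ennreal (norm h powr p) * pint p (grad (\<phi> n))"
      using \<phi>(1)[of n] test_translation[OF _ p] by (auto simp: test_function_iff)
    also have "pint p (grad (\<phi> n)) = pint p (\<lambda>x. (grad (\<phi> n) x - D x) + D x)" by simp
    also have "\<dots> \<le> ennreal (2 powr p) * (b n + pint p D)"
      unfolding b_def by (rule pint_add) (use p in auto)
    finally show ?thesis by (simp add: add_mono mult_left_mono)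
  qed
  have "(\<lambda>n. ennreal (3 powr p) * (a n + ennreal (norm h powr p) * (ennreal (2 powr p) * (b n + pint p D)) + a n))
    \<longlonglongrightarrow> ennreal (3 powr p) * (0 + ennreal (norm h powr p) * (ennreal (2 powr p) * (0 + pint p D)) + 0)"
    using \<phi>(2,3) unfolding a_def[symmetric] b_def[symmetric]
    by (intro ennreal_tendsto_cmult tendsto_add tendsto_const) auto
  then have "pint p (\<lambda>x. v (x + h) - v x) \<le> ennreal (3 powr p) * (0 + ennreal (norm h powr p) * (ennreal (2 powr p) * (0 + pint p D)) + 0)"
    by (rule LIMSEQ_le_const) (use le in auto)
  also have "\<dots> = ennreal (3 powr p * (norm h powr p * 2 powr p)) * pint p D"
    by (simp add: ennreal_mult mult.assoc)
  also have "3 powr p * (norm h powr p * 2 powr p) = 6 powr p * norm h powr p"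
    using powr_mult[of 3 2 p] by simp
  finally show ?thesis .
qed

text \<open>This takes the place of the Sobolev inequality.  If \<open>v\<close> lives on \<open>A\<close> and a ball has at least twice the
  measure of \<open>A\<close>, then from each point at least half of the shifts \<open>h\<close> in the ball leave \<open>A\<close>, where \<open>v\<close>
  vanishes.  Hence \<open>|v(x)|\<^sup>p\<close> is at most twice the mean of \<open>|v(x + h) - v(x)|\<^sup>p\<close> over \<open>h\<close>, and the
  translation estimate bounds the integral of this mean.\<close>

lemma Faber_Krahn:
  fixes v :: "'a::euclidean_space \<Rightarrow> real"
  assumes H: "H10 p S v D" and p: "1 \<le> p" and \<tau>: "0 < \<tau>"
    and A [measurable]: "A \<in> sets borel" and out: "\<And>x. x \<notin> A \<Longrightarrow> v x = 0"
    and small: "emeasure lborel A \<le> ennreal (measure lborel (ball (0::'a) \<tau>) / 2)"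
  shows "pint p v \<le> ennreal (2 * 6 powr p * \<tau> powr p) * pint p D"
proof -
  note [measurable] = H10_measurable[OF H]
  define B where "B = ball (0::'a) \<tau>"
  define M where "M = measure lborel B"
  have M: "M > 0" using \<tau> by (simp add: M_def B_def content_ball_pos)
  have [measurable]: "B \<in> sets borel" by (simp add: B_def)
  have eB: "emeasure lborel B = ennreal M"
    unfolding M_def using emeasure_lborel_ball_finite[of "0::'a" \<tau>] by (simp add: B_def emeasure_eq_ennreal_measure less_top)
  have pt: "ennreal (M / 2) * ennreal (norm (v x) powr p) \<le> (\<integral>\<^sup>+h. indicator B h * ennreal (norm (v (x + h) - v x) powr p) \<partial>lborel)" for x
  proof -
    define E where "E = {h. h \<in> B \<and> x + h \<notin> A}"
    define F where "F = {h. x + h \<in> A}"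
    have [measurable]: "E \<in> sets borel" "F \<in> sets borel" unfolding E_def F_def by measurable
    have "(\<integral>\<^sup>+h. indicator F h \<partial>lborel) = (\<integral>\<^sup>+h. indicator A (h + x) \<partial>lborel)"
      by (intro nn_integral_cong) (auto simp: F_def indicator_def add.commute)
    then have "emeasure lborel F = (\<integral>\<^sup>+h. indicator A (h + x) \<partial>lborel)" by simp
    also have "\<dots> = emeasure lborel A" by (subst nn_integral_lborel_shift) auto
    finally have F: "emeasure lborel F \<le> ennreal (M / 2)" using small by (simp add: M_def B_def)
    have "ennreal M = emeasure lborel B" by (simp add: eB)
    also have "\<dots> \<le> emeasure lborel (E \<union> F)" by (intro emeasure_mono) (auto simp: E_def F_def)
    also have "\<dots> \<le> emeasure lborel E + emeasure lborel F" by (intro emeasure_subadditive) auto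
    also have "\<dots> \<le> emeasure lborel E + ennreal (M / 2)" by (intro add_left_mono F)
    finally have "ennreal (M / 2) + ennreal (M / 2) \<le> ennreal (M / 2) + emeasure lborel E"
      using M by (simp add: add.commute flip: ennreal_plus)
    then have "ennreal (M / 2) \<le> emeasure lborel E"
      by (simp only: ennreal_add_left_cancel_le) simp
    then have "ennreal (M / 2) * ennreal (norm (v x) powr p) \<le> emeasure lborel E * ennreal (norm (v x) powr p)"
      by (rule mult_right_mono) simp
    also have "\<dots> = (\<integral>\<^sup>+h. ennreal (norm (v x) powr p) * indicator E h \<partial>lborel)"
      by (subst nn_integral_cmult_indicator) (auto simp: mult.commute)
    also have "\<dots> \<le> (\<integral>\<^sup>+h. indicator B h * ennreal (norm (v (x + h) - v x) powr p) \<partial>lborel)"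
      using out by (intro nn_integral_mono) (auto simp: E_def indicator_def)
    finally show ?thesis .
  qed
  have "ennreal (M / 2) * pint p v = (\<integral>\<^sup>+x. ennreal (M / 2) * ennreal (norm (v x) powr p) \<partial>lborel)"
    unfolding pint_def by (rule nn_integral_cmult[symmetric]) measurable
  also have "\<dots> \<le> (\<integral>\<^sup>+x. \<integral>\<^sup>+h. indicator B h * ennreal (norm (v (x + h) - v x) powr p) \<partial>lborel \<partial>lborel)"
    by (intro nn_integral_mono pt)
  also have "\<dots> = (\<integral>\<^sup>+h. \<integral>\<^sup>+x. indicator B h * ennreal (norm (v (x + h) - v x) powr p) \<partial>lborel \<partial>lborel)"
    by (rule lborel_pair.Fubini'[symmetric]) measurable
  also have "\<dots> \<le> (\<integral>\<^sup>+h. ennreal (6 powr p * \<tau> powr p) * pint p D * indicator B h \<partial>lborel)"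
  proof (intro nn_integral_mono)
    fix h :: 'a
    have "(\<integral>\<^sup>+x. indicator B h * ennreal (norm (v (x + h) - v x) powr p) \<partial>lborel) = indicator B h * pint p (\<lambda>x. v (x + h) - v x)"
      unfolding pint_def by (rule nn_integral_cmult) measurable
    also have "\<dots> \<le> indicator B h * (ennreal (6 powr p * norm h powr p) * pint p D)"
      by (intro mult_left_mono H10_translation[OF H p]) auto
    also have "\<dots> \<le> indicator B h * (ennreal (6 powr p * \<tau> powr p) * pint p D)"
    proof (cases "h \<in> B")
      case True
      then have "norm h powr p \<le> \<tau> powr p" using p by (intro powr_mono2) (auto simp: B_def)
      then show ?thesis by (intro mult_left_mono mult_right_mono ennreal_leI) auto
    qed simp
    finally show "(\<integral>\<^sup>+x. indicator B h * ennreal (norm (v (x + h) - v x) powr p) \<partial>lborel) \<le> ennreal (6 powr p * \<tau> powr p) * pint p D * indicator B h"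
      by (simp add: mult.commute)
  qed
  also have "\<dots> = ennreal (6 powr p * \<tau> powr p) * pint p D * ennreal M"
    by (subst nn_integral_cmult_indicator) (auto simp: eB)
  also have "\<dots> = ennreal (M / 2) * (ennreal (2 * 6 powr p * \<tau> powr p) * pint p D)"
  proof -
    have "ennreal M * ennreal (6 powr p * \<tau> powr p) = ennreal (M / 2) * ennreal (2 * 6 powr p * \<tau> powr p)"
      using M by (simp flip: ennreal_mult)
    then have "ennreal M * ennreal (6 powr p * \<tau> powr p) * pint p D = ennreal (M / 2) * ennreal (2 * 6 powr p * \<tau> powr p) * pint p D"
      by simp
    then show ?thesis by (simp only: mult.assoc mult.commute mult.left_commute)
  qed
  finally have "ennreal (M / 2) * pint p v \<le> ennreal (M / 2) * (ennreal (2 * 6 powr p * \<tau> powr p) * pint p D)" .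
  then show ?thesis using M by (subst (asm) ennreal_mult_le_mult_iff) auto
qed

section \<open>Truncations of Sobolev functions\<close>

lemma pint_scaled:
  fixes f :: "'a::euclidean_space \<Rightarrow> 'b::euclidean_space" and g :: "'a \<Rightarrow> 'c::euclidean_space"
  assumes [measurable]: "g \<in> borel_measurable borel" and "\<And>x. norm (f x) \<le> C * norm (g x)" "0 \<le> C" "0 \<le> p"
  shows "pint p f \<le> ennreal (C powr p) * pint p g"
proof -
  have "pint p f \<le> (\<integral>\<^sup>+x. ennreal (C powr p) * ennreal (norm (g x) powr p) \<partial>lborel)"
    unfolding pint_def
  proof (intro nn_integral_mono)
    fix x
    have "norm (f x) powr p \<le> (C * norm (g x)) powr p" using assms by (intro powr_mono2) auto
    also have "\<dots> = C powr p * norm (g x) powr p" using assms by (simp add: powr_mult)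
    finally show "ennreal (norm (f x) powr p) \<le> ennreal (C powr p) * ennreal (norm (g x) powr p)"
      by (simp add: ennreal_leI flip: ennreal_mult)
  qed
  also have "\<dots> = ennreal (C powr p) * pint p g" unfolding pint_def by (rule nn_integral_cmult) measurable
  finally show ?thesis .
qed

lemma pint_scaled_tendsto:
  fixes f :: "nat \<Rightarrow> 'a::euclidean_space \<Rightarrow> 'b::euclidean_space" and g :: "nat \<Rightarrow> 'a \<Rightarrow> 'c::euclidean_space"
  assumes "\<And>n. g n \<in> borel_measurable borel" and "\<And>n x. norm (f n x) \<le> C * norm (g n x)" "0 \<le> C" "0 \<le> p"
    and "(\<lambda>n. pint p (g n)) \<longlonglongrightarrow> 0"
  shows "(\<lambda>n. pint p (f n)) \<longlonglongrightarrow> 0"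
proof (rule tendsto_sandwich[OF _ _ tendsto_const])
  show "\<forall>\<^sub>F n in sequentially. pint p (f n) \<le> ennreal (C powr p) * pint p (g n)"
    using assms by (intro always_eventually allI pint_scaled) auto
  show "(\<lambda>n. ennreal (C powr p) * pint p (g n)) \<longlonglongrightarrow> 0"
    using ennreal_tendsto_cmult[OF _ assms(5), of "ennreal (C powr p)"] by simp
qed simp

text \<open>The truncated and cut off mollifications of \<open>u\<close> are test functions.  They converge in \<open>L\<^sup>p\<close> because \<open>soft\<close> is
  Lipschitz.  The gradients converge because the mollified gradients do, except for the term in which
  \<open>soft'\<close> varies; that term is treated by an almost everywhere convergent subsequence and dominated
  convergence.\<close>

lemma H10_soft:
  fixes u :: "'a::euclidean_space \<Rightarrow> real"
  assumes w: "is_weak_gradient \<Omega> u g" and m [measurable]: "u \<in> borel_measurable borel" "g \<in> borel_measurable borel"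
    and Lp: "L_pow_loc p \<Omega> u" "L_pow_loc p \<Omega> g" and p: "1 \<le> p" and h: "0 < h"
    and R: "cball z R \<subseteq> \<Omega>" and \<psi>: "smooth_cs \<psi> (cball z \<rho>)" and \<rho>: "\<rho> < R"
  shows "H10 p (ball z R) (\<lambda>x. soft h (u x - k) * \<psi> x)
    (\<lambda>x. (soft' h (u x - k) * \<psi> x) *\<^sub>R g x + soft h (u x - k) *\<^sub>R grad \<psi> x)"
proof -
  define B where "B = cball z R"
  have B: "compact B" "B \<subseteq> \<Omega>" using R by (auto simp: B_def)
  have [measurable]: "B \<in> sets borel" using B by (simp add: borel_compact)
  define U where "U = zero_off B u"
  define \<Gamma> where "\<Gamma> = zero_off B g"
  have [measurable]: "U \<in> borel_measurable borel" "\<Gamma> \<in> borel_measurable borel"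
    unfolding U_def \<Gamma>_def by (auto intro: zero_off_measurable)
  have ui: "integrable lborel U" and gi: "integrable lborel \<Gamma>"
    using w B unfolding U_def \<Gamma>_def by (auto intro!: L_pow_loc_integrable simp: is_weak_gradient_def)
  have fin: "pint p U < \<infinity>" "pint p \<Gamma> < \<infinity>" "pint 1 U < \<infinity>"
    unfolding U_def \<Gamma>_def using L_pow_loc_pint[OF Lp(1) B] L_pow_loc_pint[OF Lp(2) B]
      L_pow_loc_pint[of 1 \<Omega> u B] B w by (auto simp: is_weak_gradient_def)
  define t0 where "t0 n = (R - \<rho>) * inverse (real (Suc n))" for n
  have t0: "0 < t0 n" "t0 n \<le> R - \<rho>" for n
    using \<rho> by (auto simp: t0_def field_simps intro: mult_right_mono)
  have "\<forall>n. \<exists>\<eta>::'a\<Rightarrow>real. mollifier (t0 n) \<eta>" using mollifier_exists t0 by blast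
  then obtain \<eta>0 :: "nat \<Rightarrow> 'a \<Rightarrow> real" where \<eta>0: "\<And>n. mollifier (t0 n) (\<eta>0 n)" by metis
  have t00: "t0 \<longlonglongrightarrow> 0"
    unfolding t0_def using tendsto_mult[OF tendsto_const LIMSEQ_inverse_real_of_nat, of "R - \<rho>"] by simp
  have cm: "conv (\<eta>0 n) U \<in> borel_measurable borel" for n by (rule conv_measurable[OF \<eta>0]) measurable
  have c1: "(\<lambda>n. pint 1 (\<lambda>x. conv (\<eta>0 n) U x - U x)) \<longlonglongrightarrow> 0"
    by (rule conv_tendsto[OF \<eta>0 t00 ui fin(3)]) simp
  \<comment> \<open>dropping the first \<open>n0\<close> terms makes all differences integrable\<close>
  obtain r where r: "strict_mono r" "AE x in lborel. (\<lambda>n. conv (\<eta>0 (r n)) U x - U x) \<longlonglongrightarrow> 0"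
  proof -
    have "eventually (\<lambda>n. pint 1 (\<lambda>x. conv (\<eta>0 n) U x - U x) < 1) sequentially"
      by (rule order_tendstoD(2)[OF c1]) simp
    then obtain n0 where n0: "\<And>n. n \<ge> n0 \<Longrightarrow> pint 1 (\<lambda>x. conv (\<eta>0 n) U x - U x) < 1"
      by (auto simp: eventually_sequentially)
    have i: "integrable lborel (\<lambda>x. conv (\<eta>0 (n + n0)) U x - U x)" for n
      using n0[of "n + n0"] cm[of "n + n0"] by (subst integrable_iff_pint_1) (auto intro: order.strict_trans)
    have "(LINT x|lborel. norm (conv (\<eta>0 (n + n0)) U x - U x)) = enn2real (pint 1 (\<lambda>x. conv (\<eta>0 (n + n0)) U x - U x))" for n
      unfolding pint_def using i[of n] by (subst integral_eq_nn_integral) auto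
    then have "(\<lambda>n. LINT x|lborel. norm (conv (\<eta>0 (n + n0)) U x - U x)) \<longlonglongrightarrow> 0"
      using tendsto_enn2real_0[OF LIMSEQ_ignore_initial_segment[OF c1, of n0]] by simp
    then obtain r' where "strict_mono r'" "AE x in lborel. (\<lambda>n. conv (\<eta>0 (r' n + n0)) U x - U x) \<longlonglongrightarrow> 0"
      using tendsto_L1_AE_subseq[of lborel "\<lambda>n x. conv (\<eta>0 (n + n0)) U x - U x", OF i] by blast
    then show thesis by (intro that[of "\<lambda>n. r' n + n0"]) (auto simp: strict_mono_def)
  qed
  define \<eta> where "\<eta> n = \<eta>0 (r n)" for n
  define t where "t n = t0 (r n)" for n
  have \<eta>: "mollifier (t n) (\<eta> n)" for n unfolding \<eta>_def t_def by (rule \<eta>0)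
  have t: "t \<longlonglongrightarrow> 0" unfolding t_def using LIMSEQ_subseq_LIMSEQ[OF t00 r(1)] by (simp add: o_def)
  have tR: "t n \<le> R - \<rho>" for n using t0 by (simp add: t_def)
  define Uc where "Uc n = conv (\<eta> n) U" for n
  define Gc where "Gc n = conv (\<eta> n) \<Gamma>" for n
  have [measurable]: "Uc n \<in> borel_measurable borel" "Gc n \<in> borel_measurable borel" for n
    unfolding Uc_def Gc_def by (rule conv_measurable[OF \<eta>], measurable)+
  have Ulim: "(\<lambda>n. pint p (\<lambda>x. Uc n x - U x)) \<longlonglongrightarrow> 0"
    unfolding Uc_def by (rule conv_tendsto[OF \<eta> t ui fin(1) p])
  have Glim: "(\<lambda>n. pint p (\<lambda>x. Gc n x - \<Gamma> x)) \<longlonglongrightarrow> 0"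
    unfolding Gc_def by (rule conv_tendsto[OF \<eta> t gi fin(2) p])
  have ae: "AE x in lborel. (\<lambda>n. Uc n x - U x) \<longlonglongrightarrow> 0" using r(2) by (simp add: Uc_def \<eta>_def)
  have Uk: "C_k j (Uc n)" for j n
  proof -
    have "C_k j (\<lambda>x. LINT y|lborel. \<eta> n (x - y) * U y)"
      using \<eta>[of n] by (intro C_k_conv[OF ui]) (auto simp: mollifier_def)
    then show ?thesis by (simp add: Uc_def conv_def[abs_def])
  qed
  have Ugrad: "grad (Uc n) x = Gc n x" if "x \<in> cball z \<rho>" for n x
  proof -
    have "cball x (t n) \<subseteq> B"
    proof
      fix y assume "y \<in> cball x (t n)"
      then have "dist z y \<le> dist z x + t n" using dist_triangle[of z y x] by simp
      then show "y \<in> B" using that tR[of n] by (simp add: B_def)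
    qed
    then show ?thesis unfolding Uc_def Gc_def U_def \<Gamma>_def by (intro grad_conv[OF w m B \<eta>])
  qed
  have onB: "U x = u x" "\<Gamma> x = g x" if "x \<in> cball z \<rho>" for x
    using that \<rho> by (auto simp: U_def \<Gamma>_def zero_off_def B_def)
  have \<psi>1: "C_k (Suc 0) \<psi>" using smooth_cs_C_k[OF \<psi>] .
  have [measurable]: "\<psi> \<in> borel_measurable borel" "grad \<psi> \<in> borel_measurable borel"
    using smooth_cs_measurable[OF \<psi>] grad_measurable[OF \<psi>1] by auto
  have [measurable]: "soft h \<in> borel_measurable borel" "soft' h \<in> borel_measurable borel"
    using C_k_soft[OF h, of 0] continuous_soft'[OF h] by (auto intro: borel_measurable_continuous_onI)
  obtain C where C: "C > 0" "\<And>x. \<bar>\<psi> x\<bar> \<le> C" "\<And>x. norm (grad \<psi> x) \<le> C"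
    using smooth_cs_bounded_deriv[OF \<psi>] by auto
  have out: "\<psi> x = 0" "grad \<psi> x = 0" if "x \<notin> cball z \<rho>" for x
    using smooth_cs_0[OF \<psi> that] grad_outside[OF \<psi> that] by auto
  define f where "f n x = soft h (Uc n x + - k) * \<psi> x" for n x
  have fk: "smooth_cs (f n) (cball z \<rho>)" for n
    unfolding f_def by (intro smooth_cs_mult[OF \<psi>] C_k_compose[OF C_k_soft[OF h]] C_k_add Uk C_k_const)
  have test: "test_function (ball z R) (f n)" for n
    using fk[of n] \<rho> unfolding test_function_iff by (intro exI[of _ "cball z \<rho>"]) auto
  have fgrad: "grad (f n) x = (soft' h (Uc n x - k) * \<psi> x) *\<^sub>R grad (Uc n) x + soft h (Uc n x - k) *\<^sub>R grad \<psi> x" for n x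
  proof (rule grad_unique)
    have "((\<lambda>x. Uc n x + - k) has_derivative (\<lambda>s. grad (Uc n) x \<bullet> s)) (at x)"
      by (auto intro!: derivative_eq_intros grad_has_derivative Uk)
    then have "((\<lambda>x. soft h (Uc n x + - k)) has_derivative (\<lambda>s. soft' h (Uc n x + - k) * (grad (Uc n) x \<bullet> s))) (at x)"
      using has_derivative_compose[OF _ has_field_derivative_imp_has_derivative[OF soft_deriv[OF h]]] by blast
    from has_derivative_mult[OF this grad_has_derivative[OF \<psi>1]]
    show "(f n has_derivative (\<bullet>) ((soft' h (Uc n x - k) * \<psi> x) *\<^sub>R grad (Uc n) x + soft h (Uc n x - k) *\<^sub>R grad \<psi> x)) (at x)"
      unfolding f_def[abs_def] by (rule has_derivative_eq_rhs) (simp add: fun_eq_iff inner_add_left algebra_simps)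
  qed
  let ?v = "\<lambda>x. soft h (u x - k) * \<psi> x"
  let ?D = "\<lambda>x. (soft' h (u x - k) * \<psi> x) *\<^sub>R g x + soft h (u x - k) *\<^sub>R grad \<psi> x"
  have lim1: "(\<lambda>n. pint p (\<lambda>x. f n x - ?v x)) \<longlonglongrightarrow> 0"
  proof (rule pint_scaled_tendsto[OF _ _ _ _ Ulim, where C=C])
    fix n x
    show "norm (f n x - ?v x) \<le> C * norm (Uc n x - U x)"
    proof (cases "x \<in> cball z \<rho>")
      case True
      have "norm (f n x - ?v x) = \<bar>soft h (Uc n x - k) - soft h (U x - k)\<bar> * \<bar>\<psi> x\<bar>"
        using onB[OF True] by (simp add: f_def flip: abs_mult left_diff_distrib)
      also have "\<dots> \<le> \<bar>Uc n x - U x\<bar> * C"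
        using soft_lipschitz[OF h, of "Uc n x - k" "U x - k"] C(2)[of x] by (intro mult_mono) auto
      finally show ?thesis by (simp add: mult.commute)
    qed (use out C in \<open>simp add: f_def\<close>)
  qed (use C p in auto)
  \<comment> \<open>the errors from the mollified gradient, from the slope of the truncation and from its value\<close>
  define E1 where "E1 n x = (soft' h (Uc n x - k) * \<psi> x) *\<^sub>R (Gc n x - \<Gamma> x)" for n x
  define E2 where "E2 n x = ((soft' h (Uc n x - k) - soft' h (U x - k)) * \<psi> x) *\<^sub>R \<Gamma> x" for n x
  define E3 where "E3 n x = (soft h (Uc n x - k) - soft h (U x - k)) *\<^sub>R grad \<psi> x" for n x
  have [measurable]: "E1 n \<in> borel_measurable borel" "E2 n \<in> borel_measurable borel" "E3 n \<in> borel_measurable borel" for n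
    unfolding E1_def[abs_def] E2_def[abs_def] E3_def[abs_def] by measurable
  have E: "grad (f n) x - ?D x = E1 n x + E2 n x + E3 n x" for n x
  proof (cases "x \<in> cball z \<rho>")
    case True
    show ?thesis unfolding fgrad Ugrad[OF True] E1_def E2_def E3_def onB[OF True]
      by (simp add: algebra_simps)
  qed (use out in \<open>simp add: fgrad E1_def E2_def E3_def\<close>)
  have s': "\<bar>soft' h a\<bar> \<le> 1" "\<bar>soft' h a - soft' h b\<bar> \<le> 1" for a b
    using soft'_nonneg[OF h, of a] soft'_le_1[OF h, of a] soft'_nonneg[OF h, of b] soft'_le_1[OF h, of b] by auto
  have L1: "(\<lambda>n. pint p (E1 n)) \<longlonglongrightarrow> 0"
  proof (rule pint_scaled_tendsto[OF _ _ _ _ Glim, where C=C])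
    fix n x
    have "\<bar>soft' h (Uc n x - k)\<bar> * \<bar>\<psi> x\<bar> \<le> 1 * C" using s' C by (intro mult_mono) auto
    then show "norm (E1 n x) \<le> C * norm (Gc n x - \<Gamma> x)"
      by (simp add: E1_def abs_mult mult_right_mono)
  qed (use C p in auto)
  have L3: "(\<lambda>n. pint p (E3 n)) \<longlonglongrightarrow> 0"
  proof (rule pint_scaled_tendsto[OF _ _ _ _ Ulim, where C=C])
    fix n x
    have "\<bar>soft h (Uc n x - k) - soft h (U x - k)\<bar> * norm (grad \<psi> x) \<le> \<bar>Uc n x - U x\<bar> * C"
      using soft_lipschitz[OF h, of "Uc n x - k" "U x - k"] C(3)[of x] by (intro mult_mono) auto
    then show "norm (E3 n x) \<le> C * norm (Uc n x - U x)" by (simp add: E3_def mult.commute)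
  qed (use C p in auto)
  have L2: "(\<lambda>n. pint p (E2 n)) \<longlonglongrightarrow> 0"
  proof -
    have "(\<lambda>n. \<integral>\<^sup>+x. ennreal (norm (E2 n x) powr p) \<partial>lborel) \<longlonglongrightarrow> (\<integral>\<^sup>+(x::'a). 0 \<partial>lborel)"
    proof (rule nn_integral_dominated_convergence[where w="\<lambda>x. ennreal (C powr p) * ennreal (norm (\<Gamma> x) powr p)"])
      show "(\<integral>\<^sup>+x. ennreal (C powr p) * ennreal (norm (\<Gamma> x) powr p) \<partial>lborel) < \<infinity>"
        using fin(2) by (simp add: nn_integral_cmult ennreal_mult_less_top flip: pint_def)
      show "AE x in lborel. ennreal (norm (E2 n x) powr p) \<le> ennreal (C powr p) * ennreal (norm (\<Gamma> x) powr p)" for n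
      proof (intro AE_I2)
        fix x
        have "\<bar>soft' h (Uc n x - k) - soft' h (U x - k)\<bar> * \<bar>\<psi> x\<bar> \<le> 1 * C" using s' C by (intro mult_mono) auto
        then have "norm (E2 n x) \<le> C * norm (\<Gamma> x)" by (simp add: E2_def abs_mult mult_right_mono)
        then have "norm (E2 n x) powr p \<le> (C * norm (\<Gamma> x)) powr p" using p by (intro powr_mono2) auto
        also have "\<dots> = C powr p * norm (\<Gamma> x) powr p" using C by (simp add: powr_mult)
        finally show "ennreal (norm (E2 n x) powr p) \<le> ennreal (C powr p) * ennreal (norm (\<Gamma> x) powr p)"
          by (simp add: ennreal_leI flip: ennreal_mult)
      qed
      show "AE x in lborel. (\<lambda>n. ennreal (norm (E2 n x) powr p)) \<longlonglongrightarrow> 0"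
        using ae
      proof eventually_elim
        case (elim x)
        have "(\<lambda>n. Uc n x - k) \<longlonglongrightarrow> U x - k" using LIM_zero_cancel[OF elim] by (intro tendsto_intros)
        then have "(\<lambda>n. soft' h (Uc n x - k)) \<longlonglongrightarrow> soft' h (U x - k)"
          using continuous_soft'[OF h] by (intro isCont_tendsto_compose[of _ "soft' h"]) (auto simp: continuous_on_eq_continuous_at)
        then have "(\<lambda>n. norm (((soft' h (Uc n x - k) - soft' h (U x - k)) * \<psi> x) *\<^sub>R \<Gamma> x)) \<longlonglongrightarrow> norm (((soft' h (U x - k) - soft' h (U x - k)) * \<psi> x) *\<^sub>R \<Gamma> x)"
          by (intro tendsto_intros)
        then have "(\<lambda>n. norm (E2 n x)) \<longlonglongrightarrow> 0" by (simp add: E2_def)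
        then have "(\<lambda>n. norm (E2 n x) powr p) \<longlonglongrightarrow> 0 powr p"
          by (intro tendsto_powr') (use p in auto)
        then have "(\<lambda>n. ennreal (norm (E2 n x) powr p)) \<longlonglongrightarrow> ennreal (0 powr p)" by (rule tendsto_ennrealI)
        then show ?case using p by simp
      qed
    qed measurable
    then show ?thesis by (simp add: pint_def)
  qed
  have lim2: "(\<lambda>n. pint p (\<lambda>x. grad (f n) x - ?D x)) \<longlonglongrightarrow> 0"
  proof (rule tendsto_sandwich[OF _ _ tendsto_const])
    show "\<forall>\<^sub>F n in sequentially. pint p (\<lambda>x. grad (f n) x - ?D x) \<le> ennreal (3 powr p) * (pint p (E1 n) + pint p (E2 n) + pint p (E3 n))"
      unfolding E using p by (intro always_eventually allI pint_add3) auto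
    have "(\<lambda>n. ennreal (3 powr p) * (pint p (E1 n) + pint p (E2 n) + pint p (E3 n))) \<longlonglongrightarrow> ennreal (3 powr p) * (0 + 0 + 0)"
      by (intro ennreal_tendsto_cmult tendsto_add L1 L2 L3) auto
    then show "(\<lambda>n. ennreal (3 powr p) * (pint p (E1 n) + pint p (E2 n) + pint p (E3 n))) \<longlonglongrightarrow> 0" by simp
  qed simp
  have o: "?v x = 0 \<and> ?D x = 0" if "x \<notin> ball z R" for x
  proof -
    have "x \<notin> cball z \<rho>" using that \<rho> by auto
    then show ?thesis using out by simp
  qed
  have "?v \<in> borel_measurable borel" "?D \<in> borel_measurable borel" by measurable
  then show ?thesis unfolding H10_def using o test lim1 lim2 by blast
qed

section \<open>Pointwise inequalities\<close>

lemma power_diff_le: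
  fixes X Y :: real
  assumes "0 \<le> X" "X \<le> Y" shows "Y ^ m - X ^ m \<le> real m * Y ^ (m - 1) * (Y - X)"
proof (induction m)
  case (Suc m)
  have "Y ^ Suc m - X ^ Suc m = Y * (Y ^ m - X ^ m) + X ^ m * (Y - X)" by (simp add: algebra_simps)
  also have "\<dots> \<le> Y * (real m * Y ^ (m - 1) * (Y - X)) + Y ^ m * (Y - X)"
    using assms by (intro add_mono mult_left_mono mult_right_mono Suc power_mono) auto
  also have "\<dots> = real (Suc m) * Y ^ (Suc m - 1) * (Y - X)"
    by (cases m) (auto simp: algebra_simps)
  finally show ?case .
qed simp

lemma power_le_powr:
  fixes Y p :: real
  assumes "0 \<le> Y" "Y \<le> 1" "p \<le> real m" "1 < p" shows "Y ^ (m - 1) \<le> Y powr (p - 1)"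
proof (cases "Y = 0")
  case True
  have "0 < m - 1" using assms by simp
  then show ?thesis using True by (simp add: zero_power)
next
  case False
  then have "Y ^ (m - 1) = Y powr (real m - 1)" using assms by (simp flip: powr_realpow add: of_nat_diff)
  also have "\<dots> \<le> Y powr (p - 1)" using assms False by (intro powr_mono') auto
  finally show ?thesis .
qed

text \<open>Let \<open>\<tau> = (a - b)/(a - k)\<close>.  By convexity \<open>soft\<close> drops from \<open>a\<close> to \<open>b\<close> at least by the fraction \<open>\<tau>\<close>, while
  the weight grows from \<open>X\<^sup>m\<close> to \<open>Y\<^sup>m\<close> by at most \<open>m Y\<^sup>m\<^sup>-\<^sup>1 (Y - X)\<close>.  So the product can be negative only if
  \<open>\<tau> Y < m (Y - X)\<close>, and then the factor \<open>\<tau>\<^sup>p\<^sup>-\<^sup>1\<close> pays for everything.  The power \<open>m \<ge> p\<close> of the cut-off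
  is there to turn \<open>\<tau>\<^sup>p\<^sup>-\<^sup>1 Y\<^sup>m\<^sup>-\<^sup>1\<close> into \<open>(\<tau> Y)\<^sup>p\<^sup>-\<^sup>1\<close>.\<close>

lemma nonlocal_kernel_ordered:
  fixes a b k h X Y p :: real
  assumes h: "0 < h" and ab: "b \<le> a" and XY: "0 \<le> X" "X \<le> 1" "0 \<le> Y" "Y \<le> 1" and p: "1 < p" "p \<le> real m"
  shows "- (real m powr p * max (a - k) 0 powr p * \<bar>X - Y\<bar> powr p)
     \<le> (a - b) powr (p - 1) * (soft h (a - k) * X ^ m - soft h (b - k) * Y ^ m)"
proof -
  define A where "A = a - k"
  define B where "B = b - k"
  have AB: "B \<le> A" "a - b = A - B" using ab by (auto simp: A_def B_def)
  have neg: "- (real m powr p * max A 0 powr p * \<bar>X - Y\<bar> powr p) \<le> 0" by simp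
  have mono: "soft h B \<le> soft h A" by (rule soft_mono[OF h AB(1)])
  show ?thesis
  proof (cases "Y \<le> X \<or> B \<le> 0")
    case True
    have "soft h B * Y ^ m \<le> soft h A * X ^ m"
    proof (cases "Y \<le> X")
      case True
      then show ?thesis using XY mono soft_nonneg by (intro mult_mono power_mono) auto
    next
      case False
      then have "B \<le> 0" using True by simp
      then show ?thesis using XY soft_nonneg[of h A] by (simp add: soft_def[of h B])
    qed
    then have "0 \<le> (A - B) powr (p - 1) * (soft h A * X ^ m - soft h B * Y ^ m)" by simp
    then show ?thesis using neg unfolding A_def[symmetric] B_def[symmetric] AB(2) by linarith
  next
    case False
    then have Bp: "0 < B" "X < Y" by auto
    then have Ap: "0 < A" using AB by simp
    \<comment> \<open>\<open>soft_chord\<close> becomes \<open>soft h B \<le> (1 - \<tau>) soft h A\<close>\<close>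
    define \<tau> where "\<tau> = (A - B) / A"
    have \<tau>: "0 \<le> \<tau>" "A - B = A * \<tau>" "B / A = 1 - \<tau>" using Ap AB by (auto simp: \<tau>_def field_simps)
    define d where "d = Y - X"
    have d: "0 < d" using Bp by (simp add: d_def)
    have m: "0 < real m" using p by simp
    have SB: "soft h B * Y ^ m \<le> soft h A * (1 - \<tau>) * Y ^ m"
      using soft_chord[OF h Bp(1) AB(1)] XY by (intro mult_right_mono) (auto simp: \<tau>)
    have Ym: "Y ^ m = Y ^ (m - 1) * Y" using m by (cases m) auto
    have "soft h A * (Y ^ (m - 1) * (\<tau> * Y - real m * d)) \<le> soft h A * (X ^ m - (1 - \<tau>) * Y ^ m)"
    proof (rule mult_left_mono)
      have "Y ^ m - X ^ m \<le> real m * Y ^ (m - 1) * d" using power_diff_le[of X Y m] XY Bp by (simp add: d_def)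
      moreover have "X ^ m - (1 - \<tau>) * Y ^ m = \<tau> * Y ^ m - (Y ^ m - X ^ m)" by (simp add: algebra_simps)
      ultimately show "Y ^ (m - 1) * (\<tau> * Y - real m * d) \<le> X ^ m - (1 - \<tau>) * Y ^ m"
        using Ym by (simp add: algebra_simps)
    qed (rule soft_nonneg)
    also have "\<dots> \<le> soft h A * X ^ m - soft h B * Y ^ m" using SB by (simp add: algebra_simps)
    finally have low: "soft h A * (Y ^ (m - 1) * (\<tau> * Y - real m * d)) \<le> soft h A * X ^ m - soft h B * Y ^ m" .
    have "- (A powr p * (real m * d) powr p) \<le> (A * \<tau>) powr (p - 1) * (soft h A * (Y ^ (m - 1) * (\<tau> * Y - real m * d)))"
    proof (cases "\<tau> * Y \<ge> real m * d")
      case True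
      then have "0 \<le> (A * \<tau>) powr (p - 1) * (soft h A * (Y ^ (m - 1) * (\<tau> * Y - real m * d)))"
        using XY soft_nonneg by auto
      moreover have "- (A powr p * (real m * d) powr p) \<le> 0" by simp
      ultimately show ?thesis by linarith
    next
      case False
      have "\<tau> powr (p - 1) * Y ^ (m - 1) \<le> \<tau> powr (p - 1) * Y powr (p - 1)"
        using power_le_powr[of Y p m] XY p by (intro mult_left_mono) auto
      also have "\<dots> = (\<tau> * Y) powr (p - 1)" using \<tau> XY by (simp add: powr_mult)
      also have "\<dots> \<le> (real m * d) powr (p - 1)" using False \<tau> XY p by (intro powr_mono2) auto
      finally have 1: "\<tau> powr (p - 1) * Y ^ (m - 1) \<le> (real m * d) powr (p - 1)" .
      have "(A * \<tau>) powr (p - 1) * (soft h A * (Y ^ (m - 1) * (real m * d - \<tau> * Y)))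
         \<le> (A * \<tau>) powr (p - 1) * (A * (Y ^ (m - 1) * (real m * d)))"
        using False soft_le[OF h, of A] soft_nonneg[of h A] XY \<tau> Ap m d
        by (intro mult_left_mono mult_mono) auto
      also have "\<dots> = (A powr (p - 1) * A) * ((\<tau> powr (p - 1) * Y ^ (m - 1)) * (real m * d))"
        using \<tau> Ap by (simp add: powr_mult)
      also have "\<dots> \<le> (A powr (p - 1) * A) * ((real m * d) powr (p - 1) * (real m * d))"
        using 1 m d Ap by (intro mult_left_mono mult_right_mono) auto
      also have "\<dots> = A powr p * (real m * d) powr p"
        using powr_mult_base[of A "p - 1"] powr_mult_base[of "real m * d" "p - 1"] Ap m d by (simp add: mult.commute)
      finally show ?thesis by (simp add: algebra_simps)
    qed
    also have "\<dots> \<le> (A * \<tau>) powr (p - 1) * (soft h A * X ^ m - soft h B * Y ^ m)"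
      using low by (intro mult_left_mono) auto
    finally show ?thesis
      unfolding A_def[symmetric] B_def[symmetric] AB(2) \<tau>(2) using Ap d m
      by (simp add: powr_mult d_def mult_ac)
  qed
qed

lemma signed_power: "1 < p \<Longrightarrow> b \<le> a \<Longrightarrow> \<bar>a - b\<bar> powr (p - 2) * (a - b) = (a - b) powr (p - 1)" for a b p :: real
proof -
  assume "1 < p" "b \<le> a"
  then show ?thesis using powr_mult_base[of "a - b" "p - 2"] by (simp add: mult.commute)
qed

lemma nonlocal_kernel_lower:
  fixes a b k h X Y p :: real
  assumes h: "0 < h" and XY: "0 \<le> X" "X \<le> 1" "0 \<le> Y" "Y \<le> 1" and p: "1 < p" "p \<le> real m"
  shows "- (real m powr p * (max (a - k) 0 powr p + max (b - k) 0 powr p) * \<bar>X - Y\<bar> powr p)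
     \<le> \<bar>a - b\<bar> powr (p - 2) * (a - b) * (soft h (a - k) * X ^ m - soft h (b - k) * Y ^ m)"
proof (cases "b \<le> a")
  case True
  have "real m powr p * max (a - k) 0 powr p * \<bar>X - Y\<bar> powr p \<le> real m powr p * (max (a - k) 0 powr p + max (b - k) 0 powr p) * \<bar>X - Y\<bar> powr p"
    by (intro mult_right_mono mult_left_mono) auto
  then show ?thesis
    unfolding signed_power[OF p(1) True] using nonlocal_kernel_ordered[OF h True XY p, of k] by linarith
next
  case False
  then have ba: "a \<le> b" by simp
  have "real m powr p * max (b - k) 0 powr p * \<bar>Y - X\<bar> powr p \<le> real m powr p * (max (a - k) 0 powr p + max (b - k) 0 powr p) * \<bar>X - Y\<bar> powr p"
    by (simp only: abs_minus_commute[of Y X]) (intro mult_right_mono mult_left_mono, auto)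
  moreover have "\<bar>a - b\<bar> powr (p - 2) * (a - b) * (soft h (a - k) * X ^ m - soft h (b - k) * Y ^ m) =
     \<bar>b - a\<bar> powr (p - 2) * (b - a) * (soft h (b - k) * Y ^ m - soft h (a - k) * X ^ m)"
    by (simp add: abs_minus_commute algebra_simps)
  ultimately show ?thesis
    unfolding signed_power[OF p(1) ba] using nonlocal_kernel_ordered[OF h ba XY(3,4,1,2) p, of k] by (simp only: signed_power[OF p(1) ba])
qed

text \<open>When the cut-off vanishes at the second point, the kernel is negative only for \<open>k < a < b\<close>, and then
  \<open>b - a < b - k\<close>.\<close>

lemma nonlocal_kernel_far:
  fixes a b k h X p :: real
  assumes h: "0 < h" and X: "0 \<le> X" "X \<le> 1" and p: "1 < p"
  shows "- (max (b - k) 0 powr (p - 1) * max (a - k) 0) \<le> \<bar>a - b\<bar> powr (p - 2) * (a - b) * (soft h (a - k) * X ^ m)"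
proof -
  have S: "0 \<le> soft h (a - k) * X ^ m" "soft h (a - k) * X ^ m \<le> max (a - k) 0"
  proof -
    show "0 \<le> soft h (a - k) * X ^ m" using X soft_nonneg by auto
    have "soft h (a - k) * X ^ m \<le> max (a - k) 0 * 1"
      using X soft_le[OF h, of "a - k"] by (intro mult_mono power_le_one) auto
    then show "soft h (a - k) * X ^ m \<le> max (a - k) 0" by simp
  qed
  show ?thesis
  proof (cases "b \<le> a")
    case True
    have "0 \<le> (a - b) powr (p - 1) * (soft h (a - k) * X ^ m)" using S by simp
    moreover have "- (max (b - k) 0 powr (p - 1) * max (a - k) 0) \<le> 0" by simp
    ultimately show ?thesis unfolding signed_power[OF p True] by linarith
  next
    case False
    then have ba: "a \<le> b" by simp
    have eq: "\<bar>a - b\<bar> powr (p - 2) * (a - b) * (soft h (a - k) * X ^ m) = - ((b - a) powr (p - 1) * (soft h (a - k) * X ^ m))"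
      unfolding signed_power[OF p ba, symmetric] by (simp add: abs_minus_commute algebra_simps)
    show ?thesis
    proof (cases "a \<le> k")
      case True
      then show ?thesis by (simp add: soft_def)
    next
      case False
      have "(b - a) powr (p - 1) * (soft h (a - k) * X ^ m) \<le> max (b - k) 0 powr (p - 1) * max (a - k) 0"
        using S False ba p by (intro mult_mono powr_mono2) auto
      then show ?thesis unfolding eq by simp
    qed
  qed
qed

text \<open>The mixed term is at most half of the coercive term, unless \<open>|g| X < 2 m (a - k)\<^sub>+ |e|\<close>, in which case it is
  bounded by the \<open>p\<close>-th power of the right-hand side.  The coercive term in turn controls the full gradient
  \<open>D\<close> of the test function.\<close>

lemma local_integrand_lower:
  fixes g e :: "'a::euclidean_space" and a k h X p :: real
  assumes h: "0 < h" and X: "0 \<le> X" "X \<le> 1" and p: "1 < p" "p \<le> real m"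
  defines "D \<equiv> (soft' h (a - k) * X ^ m) *\<^sub>R g + soft h (a - k) *\<^sub>R ((real m * X ^ (m - 1)) *\<^sub>R e)"
  shows "norm D powr p / (2 * 2 powr p) - 2 * (2 * real m) powr p * (max (a - k) 0 powr p * norm e powr p) \<le> norm g powr (p - 2) * (g \<bullet> D)"
proof -
  define A where "A = norm g"
  define G where "G = soft h (a - k)"
  define G' where "G' = soft' h (a - k)"
  define w where "w = max (a - k) 0"
  define E where "E = norm e"
  have nn: "0 \<le> A" "0 \<le> G" "0 \<le> G'" "0 \<le> w" "0 \<le> E" "G' \<le> 1" "G \<le> w" "G \<le> w * G'"
    using soft_nonneg soft'_nonneg[OF h] soft'_le_1[OF h] soft_le[OF h] soft_le_deriv[OF h]
    by (auto simp: A_def G_def G'_def w_def E_def)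
  have m: "1 < real m" using p by simp
  have Xm: "X ^ m = X ^ (m - 1) * X" using m by (cases m) auto
  define N where "N = A powr (p - 1) * (G * (real m * X ^ (m - 1) * E))"
  define s where "s = 2 * real m * w * E"
  have s: "0 \<le> s" using nn by (simp add: s_def)
  have sp: "s powr p = (2 * real m) powr p * (w powr p * E powr p)"
    using nn by (simp add: s_def powr_mult mult.assoc)
  have AX: "A powr (p - 1) * X ^ (m - 1) \<le> (A * X) powr (p - 1)"
    using power_le_powr[OF X p(2,1)] nn X by (simp add: powr_mult mult_left_mono)
  have Ap: "A powr (p - 1) * A = A powr p" using nn powr_mult_base[of A "p - 1"] by (simp add: mult.commute)
  have N: "N \<le> G' * X ^ m * A powr p / 2 + s powr p"
  proof (cases "A * X \<ge> s")
    case True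
    have "G * (real m * E) \<le> w * G' * (real m * E)" using nn by (intro mult_right_mono) auto
    also have "\<dots> = G' * s / 2" by (simp add: s_def)
    also have "\<dots> \<le> G' * (A * X) / 2" using True nn by (simp add: mult_left_mono)
    finally have "A powr (p - 1) * X ^ (m - 1) * (G * (real m * E)) \<le> A powr (p - 1) * X ^ (m - 1) * (G' * (A * X) / 2)"
      using X by (intro mult_left_mono) auto
    also have "\<dots> = G' * X ^ m * A powr p / 2" unfolding Xm Ap[symmetric] by (simp add: mult_ac)
    finally have "N \<le> G' * X ^ m * A powr p / 2" by (simp add: N_def mult_ac)
    then show ?thesis by (simp add: add_increasing2)
  next
    case False
    have "G * (real m * E) \<le> w * (real m * E)" using nn by (intro mult_right_mono) auto
    also have "\<dots> \<le> s" using nn by (simp add: s_def mult_ac)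
    finally have 1: "G * (real m * E) \<le> s" .
    have "A powr (p - 1) * X ^ (m - 1) \<le> s powr (p - 1)"
      using AX powr_mono2[of "p - 1" "A * X" s] False nn X p by auto
    then have "(A powr (p - 1) * X ^ (m - 1)) * (G * (real m * E)) \<le> s powr (p - 1) * s"
      using 1 nn X s by (intro mult_mono) auto
    also have "\<dots> = s powr p" using s powr_mult_base[of s "p - 1"] by (simp add: mult.commute)
    finally have "N \<le> s powr p" by (simp add: N_def mult_ac)
    moreover have "0 \<le> G' * X ^ m * A powr p / 2" using nn X by simp
    ultimately show ?thesis by linarith
  qed
  have gg: "A powr (p - 2) * (A * A) = A powr p"
    using nn powr_mult_base[of A "p - 2"] powr_mult_base[of A "p - 1"] by (simp add: mult_ac)
  have ge: "\<bar>norm g powr (p - 2) * (g \<bullet> e)\<bar> \<le> A powr (p - 1) * E"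
  proof -
    have "\<bar>norm g powr (p - 2) * (g \<bullet> e)\<bar> = A powr (p - 2) * \<bar>g \<bullet> e\<bar>" by (simp add: abs_mult A_def)
    also have "\<dots> \<le> A powr (p - 2) * (A * E)"
      using Cauchy_Schwarz_ineq2[of g e] by (intro mult_left_mono) (auto simp: A_def E_def)
    also have "\<dots> = A powr (p - 1) * E" using nn powr_mult_base[of A "p - 2"] by (simp add: mult_ac)
    finally show ?thesis .
  qed
  have "norm g powr (p - 2) * (g \<bullet> D) = G' * X ^ m * A powr p + G * (real m * X ^ (m - 1)) * (norm g powr (p - 2) * (g \<bullet> e))"
    unfolding gg[symmetric] by (simp add: D_def G_def G'_def A_def inner_add_right power2_norm_eq_inner[symmetric] power2_eq_square algebra_simps)
  moreover have "G * (real m * X ^ (m - 1)) * - (norm g powr (p - 2) * (g \<bullet> e)) \<le> G * (real m * X ^ (m - 1)) * (A powr (p - 1) * E)"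
    using ge nn X by (intro mult_left_mono) auto
  ultimately have 1: "norm g powr (p - 2) * (g \<bullet> D) \<ge> G' * X ^ m * A powr p - N"
    by (simp add: N_def mult_ac)
  have "norm D \<le> G' * X ^ m * A + G * (real m * X ^ (m - 1) * E)"
    using norm_triangle_ineq[of "(soft' h (a - k) * X ^ m) *\<^sub>R g" "soft h (a - k) *\<^sub>R ((real m * X ^ (m - 1)) *\<^sub>R e)"] nn X
    by (simp add: D_def G_def G'_def A_def E_def abs_mult)
  then have "norm D powr p \<le> (G' * X ^ m * A + G * (real m * X ^ (m - 1) * E)) powr p"
    using p by (intro powr_mono2) auto
  also have "\<dots> \<le> 2 powr p * ((G' * X ^ m * A) powr p + (G * (real m * X ^ (m - 1) * E)) powr p)"
    using nn X p by (intro powr_add_le) auto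
  also have "\<dots> \<le> 2 powr p * (G' * X ^ m * A powr p + s powr p)"
  proof (intro mult_left_mono add_mono)
    have q: "0 \<le> G' * X ^ m" "G' * X ^ m \<le> 1" using nn X by (auto intro!: mult_le_one power_le_one)
    have "(G' * X ^ m) powr p \<le> (G' * X ^ m) powr 1"
      using powr_mono'[of 1 p "G' * X ^ m"] q p by simp
    then have "(G' * X ^ m) powr p \<le> G' * X ^ m" using q by simp
    then show "(G' * X ^ m * A) powr p \<le> G' * X ^ m * A powr p"
      using q nn by (simp add: powr_mult mult_right_mono)
    have "G * (real m * X ^ (m - 1) * E) \<le> w * (real m * 1 * E)"
      using nn X m by (intro mult_mono power_le_one) auto
    also have "\<dots> \<le> s" using nn by (simp add: s_def mult_ac)
    finally show "(G * (real m * X ^ (m - 1) * E)) powr p \<le> s powr p"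
      using nn X p by (intro powr_mono2) auto
  qed simp
  finally have "norm D powr p / (2 * 2 powr p) \<le> (G' * X ^ m * A powr p + s powr p) / 2" by (simp add: field_simps)
  with 1 N have "norm D powr p / (2 * 2 powr p) - 2 * s powr p \<le> norm g powr (p - 2) * (g \<bullet> D)"
    using powr_ge_zero[of s p] by argo
  then show ?thesis by (simp add: sp w_def E_def)
qed

section \<open>Kernels and constants\<close>

lemma emeasure_ball_scaled:
  "0 \<le> r \<Longrightarrow> emeasure lborel (ball (c::'a::euclidean_space) r) = ennreal (r ^ DIM('a) * measure lborel (ball (0::'a) 1))"
  using emeasure_lborel_ball_finite[of c r] content_ball_conv_unit_ball[of r c]
  by (simp add: emeasure_eq_ennreal_measure less_top)

text \<open>Uniform in \<open>b\<close> up to the factor \<open>1/b\<close>, which the factor \<open>1 - s\<close> of the normalizing constant will cancel.\<close>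

lemma one_minus_two_powr:
  fixes b p :: real
  assumes "0 < b" "b \<le> p" shows "1 / (1 - 2 powr (- b)) \<le> (1 + p) / (b * ln 2)"
proof -
  define x where "x = b * ln (2::real)"
  have x: "0 < x" using assms by (simp add: x_def)
  have l2: "ln (2::real) \<le> 1" using ln_le_minus_one[of 2] by simp
  have "x \<le> p" using assms l2 mult_mono[of b p "ln 2" 1] by (simp add: x_def)
  have e: "2 powr (- b) = inverse (exp x)" by (simp add: powr_def x_def exp_minus mult.commute)
  have "1 + x \<le> exp x" by (rule exp_ge_add_one_self)
  then have "inverse (exp x) \<le> inverse (1 + x)" using x by (intro le_imp_inverse_le) auto
  then have "1 - 2 powr (- b) \<ge> x / (1 + x)" using x unfolding e by (simp add: field_simps)
  then have "inverse (1 - 2 powr (- b)) \<le> inverse (x / (1 + x))"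
    by (rule le_imp_inverse_le) (use x in simp)
  then have "1 / (1 - 2 powr (- b)) \<le> (1 + x) / x" by (simp add: inverse_eq_divide)
  also have "\<dots> \<le> (1 + p) / x" using \<open>x \<le> p\<close> x by (intro divide_right_mono) auto
  finally show ?thesis by (simp add: x_def)
qed

lemma ennreal_le_suminf: "f (j::nat) \<le> (\<Sum>j. f j :: ennreal)"
  using sum_le_suminf[OF summableI, of "{j}" f] by simp

lemma power_powr_swap: "0 \<le> x \<Longrightarrow> (x ^ j) powr a = (x powr a) ^ j" for x a :: real
  by (induction j) (simp_all add: powr_mult)

text \<open>Sum over the dyadic shells \<open>R/2\<^sup>j\<^sup>+\<^sup>1 \<le> |z| < R/2\<^sup>j\<close>.\<close>

lemma kernel_near:
  assumes b: "0 < b" "b \<le> p" and R: "0 < R"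
  shows "(\<integral>\<^sup>+z. indicator (ball (0::'a::euclidean_space) R) z * ennreal (norm z powr (b - real DIM('a))) \<partial>lborel)
    \<le> ennreal (measure lborel (ball (0::'a) 1) * 2 ^ DIM('a) * ((1 + p) / ln 2) * (R powr b / b))"
proof -
  define N where "N = DIM('a)"
  define \<omega> where "\<omega> = measure lborel (ball (0::'a) 1)"
  have \<omega>: "0 \<le> \<omega>" by (simp add: \<omega>_def)
  define r where "r j = R / 2 ^ j" for j :: nat
  have r: "0 < r j" "r (Suc j) = r j / 2" for j using R by (auto simp: r_def)
  \<comment> \<open>the largest value on the shell, with the two factors of \<open>|z|\<^sup>b |z|\<^sup>-\<^sup>N\<close> estimated separately\<close>
  define c where "c j = r j powr b / r (Suc j) ^ N" for j
  have c: "0 \<le> c j" for j using r by (simp add: c_def less_imp_le)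
  have pt: "indicator (ball (0::'a) R) z * ennreal (norm z powr (b - real N)) \<le> (\<Sum>j. ennreal (c j) * indicator (ball (0::'a) (r j)) z)" for z
  proof (cases "z \<in> ball 0 R \<and> z \<noteq> 0")
    case True
    then have z: "0 < norm z" "norm z < R" by auto
    have "\<exists>n. r n \<le> norm z"
    proof -
      obtain n where "(1 / 2) ^ n < norm z / R" using real_arch_pow_inv[of "norm z / R" "1/2"] z R by auto
      then show ?thesis using R by (intro exI[of _ n]) (simp add: r_def field_simps power_divide)
    qed
    then obtain n where n: "r n \<le> norm z" by blast
    have "\<not> r 0 \<le> norm z" using z by (simp add: r_def)
    then obtain j where j: "\<not> r j \<le> norm z" "r (Suc j) \<le> norm z"
      using ex_least_nat_less[of "\<lambda>n. r n \<le> norm z" n] n by auto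
    have "norm z powr (b - real N) = norm z powr b / norm z ^ N"
      using z by (simp add: powr_diff powr_realpow)
    also have "\<dots> \<le> c j"
      unfolding c_def using j z r(1) b by (intro frac_le powr_mono2 power_mono) (auto simp: less_imp_le)
    finally have "ennreal (norm z powr (b - real N)) \<le> ennreal (c j) * indicator (ball 0 (r j)) z"
      using j by (simp add: ennreal_leI)
    also have "\<dots> \<le> (\<Sum>j. ennreal (c j) * indicator (ball (0::'a) (r j)) z)"
      by (rule ennreal_le_suminf)
    finally show ?thesis using True by simp
  next
    case False
    then have "indicator (ball (0::'a) R) z * ennreal (norm z powr (b - real N)) = 0" by auto
    then show ?thesis by (simp only: zero_le)
  qed
  have [measurable]: "ball (0::'a) x \<in> sets borel" for x by simp
  have q: "0 < (2::real) powr (- b)" "(2::real) powr (- b) < 1" using b powr_less_mono[of "-b" 0 "2::real"] by auto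
  have shell: "c j * (r j ^ N * \<omega>) = \<omega> * 2 ^ N * R powr b * (2 powr (- b)) ^ j" for j
  proof -
    have "r (Suc j) ^ N = r j ^ N / 2 ^ N" by (simp add: r power_divide)
    then have "c j * (r j ^ N * \<omega>) = r j powr b * 2 ^ N * \<omega>" using r(1)[of j] by (simp add: c_def)
    moreover have "r j powr b = R powr b * (2 powr (- b)) ^ j"
    proof -
      have "(2 powr (- b)) ^ j = ((2::real) ^ j) powr (- b)"
        by (simp add: power_powr_swap)
      then show ?thesis using R by (simp add: r_def powr_divide powr_minus_divide)
    qed
    ultimately have "c j * (r j ^ N * \<omega>) = (R powr b * (2 powr (- b)) ^ j) * 2 ^ N * \<omega>" by simp
    then show ?thesis by (simp only: mult_ac)
  qed
  have "(\<integral>\<^sup>+z. indicator (ball (0::'a) R) z * ennreal (norm z powr (b - real N)) \<partial>lborel)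
     \<le> (\<integral>\<^sup>+z. (\<Sum>j. ennreal (c j) * indicator (ball (0::'a) (r j)) z) \<partial>lborel)"
    by (intro nn_integral_mono pt)
  also have "\<dots> = (\<Sum>j. \<integral>\<^sup>+z. ennreal (c j) * indicator (ball (0::'a) (r j)) z \<partial>lborel)"
    by (rule nn_integral_suminf) measurable
  also have "\<dots> = (\<Sum>j. ennreal (\<omega> * 2 ^ N * R powr b * (2 powr (- b)) ^ j))"
  proof (intro suminf_cong)
    fix j
    have "(\<integral>\<^sup>+z. ennreal (c j) * indicator (ball (0::'a) (r j)) z \<partial>lborel) = ennreal (c j) * ennreal (r j ^ N * \<omega>)"
      using r(1)[of j] by (simp add: nn_integral_cmult_indicator emeasure_ball_scaled N_def \<omega>_def less_imp_le)
    also have "\<dots> = ennreal (c j * (r j ^ N * \<omega>))" using c by (simp add: ennreal_mult')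
    finally show "(\<integral>\<^sup>+z. ennreal (c j) * indicator (ball (0::'a) (r j)) z \<partial>lborel) = ennreal (\<omega> * 2 ^ N * R powr b * (2 powr (- b)) ^ j)"
      by (simp only: shell)
  qed
  also have "\<dots> = ennreal (\<omega> * 2 ^ N * R powr b * (1 / (1 - 2 powr (- b))))"
    using \<omega> q by (intro suminf_ennreal_eq sums_mult geometric_sums) auto
  also have "\<dots> \<le> ennreal (\<omega> * 2 ^ N * R powr b * ((1 + p) / (b * ln 2)))"
    using \<omega> one_minus_two_powr[OF b] by (intro ennreal_leI mult_left_mono) auto
  finally show ?thesis by (simp add: N_def \<omega>_def mult_ac)
qed

text \<open>Sum over the dyadic shells \<open>2\<^sup>j R \<le> |z| < 2\<^sup>j\<^sup>+\<^sup>1 R\<close>.\<close>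

lemma kernel_far:
  assumes M: "real DIM('a) < M" and R: "0 < R"
  shows "(\<integral>\<^sup>+z. indicator (- ball (0::'a::euclidean_space) R) z * ennreal ((R / norm z) powr M) \<partial>lborel)
    \<le> ennreal (measure lborel (ball (0::'a) 1) * 2 ^ DIM('a) * (1 / (1 - 2 powr (real DIM('a) - M))) * R ^ DIM('a))"
proof -
  define N where "N = DIM('a)"
  define \<omega> where "\<omega> = measure lborel (ball (0::'a) 1)"
  have \<omega>: "0 \<le> \<omega>" by (simp add: \<omega>_def)
  define r where "r j = R * 2 ^ j" for j :: nat
  have r: "0 < r j" "r (Suc j) = r j * 2" for j using R by (auto simp: r_def)
  define c where "c j = (2 powr (- M)) ^ j" for j :: nat
  have c: "0 \<le> c j" for j by (simp add: c_def)
  have pt: "indicator (- ball (0::'a) R) z * ennreal ((R / norm z) powr M) \<le> (\<Sum>j. ennreal (c j) * indicator (ball (0::'a) (r (Suc j))) z)" for z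
  proof (cases "z \<in> ball 0 R")
    case False
    then have z: "R \<le> norm z" by auto
    obtain n where "norm z / R < 2 ^ n" using real_arch_pow[of 2 "norm z / R"] by auto
    then have n: "norm z < r n" using R by (simp add: r_def field_simps)
    have "\<not> norm z < r 0" using z by (simp add: r_def)
    then obtain j where j: "\<not> norm z < r j" "norm z < r (Suc j)"
      using ex_least_nat_less[of "\<lambda>n. norm z < r n" n] n by auto
    have "(R / norm z) powr M \<le> (R / r j) powr M"
      using j(1) r(1)[of j] R M z by (intro powr_mono2 frac_le) auto
    also have "R / r j = (1 / 2) ^ j" using R by (simp add: r_def power_divide)
    also have "((1 / 2) ^ j) powr M = c j"
      by (simp add: c_def power_powr_swap powr_divide powr_minus_divide)
    finally have "ennreal ((R / norm z) powr M) \<le> ennreal (c j) * indicator (ball 0 (r (Suc j))) z"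
      using j by (simp add: ennreal_leI)
    also have "\<dots> \<le> (\<Sum>j. ennreal (c j) * indicator (ball (0::'a) (r (Suc j))) z)"
      by (rule ennreal_le_suminf)
    finally show ?thesis using False by simp
  qed simp
  have [measurable]: "ball (0::'a) x \<in> sets borel" for x by simp
  have q: "0 < (2::real) powr (real N - M)" "(2::real) powr (real N - M) < 1"
    using M powr_less_mono[of "real N - M" 0 "2::real"] by (auto simp: N_def)
  have shell: "c j * (r (Suc j) ^ N * \<omega>) = \<omega> * 2 ^ N * R ^ N * (2 powr (real N - M)) ^ j" for j
  proof -
    have "(2 powr (real N - M)) ^ j = (2 powr real N) ^ j * (2 powr (- M)) ^ j"
      by (simp add: power_mult_distrib[symmetric] powr_add[symmetric])
    moreover have "(2 powr real N) ^ j = ((2::real) ^ j) ^ N" by (simp add: powr_realpow mult.commute flip: power_mult)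
    ultimately show ?thesis by (simp add: c_def r_def power_mult_distrib mult_ac)
  qed
  have "(\<integral>\<^sup>+z. indicator (- ball (0::'a) R) z * ennreal ((R / norm z) powr M) \<partial>lborel)
     \<le> (\<integral>\<^sup>+z. (\<Sum>j. ennreal (c j) * indicator (ball (0::'a) (r (Suc j))) z) \<partial>lborel)"
    by (intro nn_integral_mono pt)
  also have "\<dots> = (\<Sum>j. \<integral>\<^sup>+z. ennreal (c j) * indicator (ball (0::'a) (r (Suc j))) z \<partial>lborel)"
    by (rule nn_integral_suminf) measurable
  also have "\<dots> = (\<Sum>j. ennreal (\<omega> * 2 ^ N * R ^ N * (2 powr (real N - M)) ^ j))"
  proof (intro suminf_cong)
    fix j
    have "(\<integral>\<^sup>+z. ennreal (c j) * indicator (ball (0::'a) (r (Suc j))) z \<partial>lborel) = ennreal (c j) * ennreal (r (Suc j) ^ N * \<omega>)"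
      using r(1)[of "Suc j"] by (simp add: nn_integral_cmult_indicator emeasure_ball_scaled N_def \<omega>_def less_imp_le)
    also have "\<dots> = ennreal (c j * (r (Suc j) ^ N * \<omega>))" using c by (simp add: ennreal_mult')
    finally show "(\<integral>\<^sup>+z. ennreal (c j) * indicator (ball (0::'a) (r (Suc j))) z \<partial>lborel) = ennreal (\<omega> * 2 ^ N * R ^ N * (2 powr (real N - M)) ^ j)"
      by (simp only: shell)
  qed
  also have "\<dots> = ennreal (\<omega> * 2 ^ N * R ^ N * (1 / (1 - 2 powr (real N - M))))"
    using \<omega> q R by (intro suminf_ennreal_eq sums_mult geometric_sums) auto
  finally show ?thesis by (simp add: N_def \<omega>_def mult_ac)
qed

lemma C_norm_bound:
  assumes N: "1 \<le> N" and p: "1 < p"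
  shows "\<exists>K>0. \<forall>s. 0 < s \<and> s < 1 \<longrightarrow> 0 \<le> C_norm N s p \<and> C_norm N s p \<le> K * (1 - s)"
proof -
  define F where "F s = Gamma ((real N + p * s) / 2) / Gamma (2 - s)" for s
  have pos: "0 < (real N + p * s) / 2" if "0 \<le> s" for s
    using that N p by (simp add: add_pos_nonneg)
  have "continuous_on {0..1} F"
    unfolding F_def
  proof (intro continuous_on_divide)
    have G: "continuous_on {0<..} (Gamma :: real \<Rightarrow> real)"
      by (rule continuous_on_Gamma) (auto dest: nonpos_Ints_nonpos)
    show "continuous_on {0..1} (\<lambda>s. Gamma ((real N + p * s) / 2))"
      by (rule continuous_on_compose2[OF G]) (use pos in \<open>auto intro!: continuous_intros\<close>)
    show "continuous_on {0..1} (\<lambda>s::real. Gamma (2 - s))"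
      by (rule continuous_on_compose2[OF G]) (auto intro!: continuous_intros)
    show "\<forall>s\<in>{0..1}. Gamma (2 - s) \<noteq> (0::real)"
      using Gamma_real_pos[of "2 - s" for s] by (auto simp: less_le)
  qed
  then have "compact (F ` {0..1})" by (intro compact_continuous_image) auto
  then have "bounded (F ` {0..1})" by (rule compact_imp_bounded)
  then obtain K0 where "\<forall>y\<in>F ` {0..1}. norm y \<le> K0" by (auto simp: bounded_iff)
  then have K0: "\<bar>F s\<bar> \<le> K0" if "s \<in> {0..1}" for s using that by auto
  have Fn: "0 \<le> F s" if "0 \<le> s" "s \<le> 1" for s
    unfolding F_def using pos[OF that(1)] that by (intro divide_nonneg_nonneg less_imp_le[OF Gamma_real_pos]) auto
  define c where "c = 1 / (pi powr ((real N - 1) / 2) * Gamma ((p + 1) / 2))"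
  have c: "0 \<le> c" unfolding c_def using p by (intro divide_nonneg_nonneg mult_nonneg_nonneg less_imp_le[OF Gamma_real_pos]) auto
  have eq: "C_norm N s p = (s * p / 2 * 2 powr (2 * s - 1)) * c * F s * (1 - s)" for s
    by (simp add: C_norm_def c_def F_def mult_ac)
  have "0 \<le> C_norm N s p \<and> C_norm N s p \<le> (p * c * K0 + 1) * (1 - s)" if s: "0 < s" "s < 1" for s
  proof
    have 2: "2 powr (2 * s - 1) \<le> 2 powr (1::real)" using s by (intro powr_mono) auto
    have "s * p / 2 * 2 powr (2 * s - 1) \<le> 1 * p / 2 * 2"
      using s p 2 by (intro mult_mono divide_right_mono) auto
    then have "(s * p / 2 * 2 powr (2 * s - 1)) * c * F s * (1 - s) \<le> p * c * K0 * (1 - s)"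
      using s p c Fn[of s] K0[of s] by (intro mult_right_mono mult_mono) auto
    then show "C_norm N s p \<le> (p * c * K0 + 1) * (1 - s)" unfolding eq using s by (simp add: algebra_simps)
    show "0 \<le> C_norm N s p" unfolding eq using s p c Fn[of s] by (intro mult_nonneg_nonneg) auto
  qed
  moreover have "p * c * K0 + 1 > 0" using p c K0[of 0] by (intro add_nonneg_pos mult_nonneg_nonneg) auto
  ultimately show ?thesis by blast
qed

lemma C_norm_measurable [measurable]: "(\<lambda>s. C_norm N s p) \<in> borel_measurable borel"
proof -
  have [measurable]: "(Gamma :: real \<Rightarrow> real) \<in> borel_measurable borel"
  proof -
    have "(\<lambda>x::real. rGamma x) \<in> borel_measurable borel"
      by (intro borel_measurable_continuous_onI continuous_intros)
    then have "(\<lambda>x::real. inverse (rGamma x)) \<in> borel_measurable borel" by measurable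
    then show ?thesis by (simp add: rGamma_inverse_Gamma)
  qed
  show ?thesis unfolding C_norm_def by measurable
qed

section \<open>The energy estimate\<close>

definition upper :: "('a::euclidean_space \<Rightarrow> real) \<Rightarrow> real \<Rightarrow> 'a \<Rightarrow> real" where
  "upper u k x = max (u x - k) 0"

definition mass :: "real \<Rightarrow> ('a::euclidean_space \<Rightarrow> real) \<Rightarrow> real \<Rightarrow> 'a \<Rightarrow> real \<Rightarrow> ennreal" where
  "mass q u k z r = (\<integral>\<^sup>+x. indicator (ball z r) x * ennreal (upper u k x powr q) \<partial>lborel)"

text \<open>The integral inside the tail of \<open>u\<^sub>+\<close> for a single order \<open>s\<close>, without the factor \<open>r\<^sup>s\<^sup>p\<close>.\<close>

definition far_mass :: "real \<Rightarrow> ('a::euclidean_space \<Rightarrow> real) \<Rightarrow> 'a \<Rightarrow> real \<Rightarrow> real \<Rightarrow> ennreal" where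
  "far_mass p u z r s = (\<integral>\<^sup>+y. indicator (- ball z r) y *
     ennreal (upper u 0 y powr (p - 1) / norm (y - z) powr (real DIM('a) + s * p)) \<partial>lborel)"

definition kernel_const :: "'a::euclidean_space itself \<Rightarrow> real \<Rightarrow> real" where
  "kernel_const T p = measure lborel (ball (0::'a) 1) * 2 ^ DIM('a) * ((1 + p) / ln 2)"

lemma kernel_const_nonneg: "0 \<le> p \<Longrightarrow> 0 \<le> kernel_const T p"
  by (simp add: kernel_const_def)

lemma upper_measurable [measurable]:
  assumes [measurable]: "u \<in> borel_measurable borel"
  shows "upper u k \<in> borel_measurable borel"
  unfolding upper_def[abs_def] by measurable

lemma ball_measurable [measurable]: "ball (x::'a::euclidean_space) r \<in> sets borel"
  by simp

lemma upper_nonneg: "0 \<le> upper u k x" by (simp add: upper_def)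

lemma nn_integral_lborel_product:
  fixes F :: "'a::euclidean_space \<Rightarrow> 'a \<Rightarrow> ennreal"
  assumes [measurable]: "(\<lambda>(x, y). F x y) \<in> borel_measurable (borel \<Otimes>\<^sub>M borel)"
  shows "(\<integral>\<^sup>+z. (case z of (x, y) \<Rightarrow> F x y) \<partial>lborel) = (\<integral>\<^sup>+x. \<integral>\<^sup>+y. F x y \<partial>lborel \<partial>lborel)"
proof -
  have "(\<lambda>(x, y). F x y) \<in> borel_measurable (lborel \<Otimes>\<^sub>M lborel)" by measurable
  from lborel.nn_integral_fst[OF this] show ?thesis by (simp add: lborel_prod)
qed

lemma neg_integral_le: "ennreal (- (LINT x|M. f x)) \<le> (\<integral>\<^sup>+x. ennreal (- f x) \<partial>M)"
  using integral_le_nn_integral[of M "\<lambda>x. - f x"] by simp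

text \<open>In the application \<open>b = p (1 - s)\<close>: the Lipschitz bound of the cut-off has improved the singularity of the
  kernel to an integrable one.\<close>

lemma near_integral:
  fixes u :: "'a::euclidean_space \<Rightarrow> real"
  assumes [measurable]: "u \<in> borel_measurable borel" and b: "0 < b" "b \<le> p" and \<rho>: "0 < \<rho>" "\<rho> \<le> 1"
  shows "(\<integral>\<^sup>+x. \<integral>\<^sup>+y. indicator (ball z \<rho>) x * indicator (ball z \<rho>) y * ennreal (upper u k x powr p * norm (x - y) powr (b - real DIM('a))) \<partial>lborel \<partial>lborel)
    \<le> ennreal (kernel_const TYPE('a) p * (2 powr p / b)) * mass p u k z \<rho>"
proof -
  have in1: "(\<integral>\<^sup>+y. indicator (ball z \<rho>) y * ennreal (norm (x - y) powr (b - real DIM('a))) \<partial>lborel) \<le> ennreal (kernel_const TYPE('a) p * (2 powr p / b))"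
    if x: "x \<in> ball z \<rho>" for x
  proof -
    have "(\<integral>\<^sup>+y. indicator (ball z \<rho>) y * ennreal (norm (x - y) powr (b - real DIM('a))) \<partial>lborel) \<le>
      (\<integral>\<^sup>+y. indicator (ball 0 (2 * \<rho>)) (x - y) * ennreal (norm (x - y) powr (b - real DIM('a))) \<partial>lborel)"
    proof (intro nn_integral_mono mult_right_mono)
      fix y
      have "y \<in> ball z \<rho> \<Longrightarrow> x - y \<in> ball 0 (2 * \<rho>)"
        using x dist_triangle_less_add[of x z \<rho> y \<rho>] by (simp add: dist_commute dist_norm[of x y])
      then show "indicator (ball z \<rho>) y \<le> (indicator (ball 0 (2 * \<rho>)) (x - y) :: ennreal)"
        by (auto simp: indicator_def)
    qed simp
    also have "\<dots> = (\<integral>\<^sup>+y. indicator (ball 0 (2 * \<rho>)) y * ennreal (norm (y::'a) powr (b - real DIM('a))) \<partial>lborel)"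
      by (rule nn_integral_lborel_reflect) measurable
    also have "\<dots> \<le> ennreal (kernel_const TYPE('a) p * ((2 * \<rho>) powr b / b))"
      unfolding kernel_const_def by (rule kernel_near[OF b]) (use \<rho> in simp)
    also have "\<dots> \<le> ennreal (kernel_const TYPE('a) p * (2 powr p / b))"
    proof (intro ennreal_leI mult_left_mono divide_right_mono)
      have "(2 * \<rho>) powr b \<le> 2 powr b" using \<rho> b by (intro powr_mono2) auto
      also have "\<dots> \<le> 2 powr p" using b by (intro powr_mono) auto
      finally show "(2 * \<rho>) powr b \<le> 2 powr p" .
    qed (use b kernel_const_nonneg[of p "TYPE('a)"] in auto)
    finally show ?thesis .
  qed
  have "(\<integral>\<^sup>+x. \<integral>\<^sup>+y. indicator (ball z \<rho>) x * indicator (ball z \<rho>) y * ennreal (upper u k x powr p * norm (x - y) powr (b - real DIM('a))) \<partial>lborel \<partial>lborel)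
    \<le> (\<integral>\<^sup>+x. ennreal (kernel_const TYPE('a) p * (2 powr p / b)) * (indicator (ball z \<rho>) x * ennreal (upper u k x powr p)) \<partial>lborel)"
  proof (intro nn_integral_mono)
    fix x
    have "(\<integral>\<^sup>+y. indicator (ball z \<rho>) x * indicator (ball z \<rho>) y * ennreal (upper u k x powr p * norm (x - y) powr (b - real DIM('a))) \<partial>lborel)
      = (\<integral>\<^sup>+y. (indicator (ball z \<rho>) x * ennreal (upper u k x powr p)) * (indicator (ball z \<rho>) y * ennreal (norm (x - y) powr (b - real DIM('a)))) \<partial>lborel)"
      by (intro nn_integral_cong) (simp add: ennreal_mult' mult_ac)
    also have "\<dots> = (indicator (ball z \<rho>) x * ennreal (upper u k x powr p)) * (\<integral>\<^sup>+y. indicator (ball z \<rho>) y * ennreal (norm (x - y) powr (b - real DIM('a))) \<partial>lborel)"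
      by (rule nn_integral_cmult) measurable
    also have "\<dots> \<le> (indicator (ball z \<rho>) x * ennreal (upper u k x powr p)) * ennreal (kernel_const TYPE('a) p * (2 powr p / b))"
      using in1[of x] by (cases "x \<in> ball z \<rho>") (auto intro: mult_left_mono)
    finally show "(\<integral>\<^sup>+y. indicator (ball z \<rho>) x * indicator (ball z \<rho>) y * ennreal (upper u k x powr p * norm (x - y) powr (b - real DIM('a))) \<partial>lborel)
      \<le> ennreal (kernel_const TYPE('a) p * (2 powr p / b)) * (indicator (ball z \<rho>) x * ennreal (upper u k x powr p))"
      by (simp add: mult.commute)
  qed
  also have "\<dots> = ennreal (kernel_const TYPE('a) p * (2 powr p / b)) * mass p u k z \<rho>"
    unfolding mass_def by (rule nn_integral_cmult) measurable
  finally show ?thesis .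
qed

text \<open>Seen from a point of the smaller ball, distances to far points shrink at most by a fixed factor.\<close>

lemma far_kernel_compare:
  fixes x y z :: "'a::euclidean_space"
  assumes x: "x \<in> ball z \<sigma>" and y: "y \<notin> ball z \<rho>" and r: "0 < \<sigma>" "\<sigma> < \<rho>" "\<rho> \<le> R"
    and q: "0 \<le> q" "q \<le> Q" and t: "0 \<le> t"
  shows "t / norm (x - y) powr q \<le> (R / (\<rho> - \<sigma>)) powr Q * (t / norm (y - z) powr q)"
proof -
  define c where "c = R / (\<rho> - \<sigma>)"
  have c: "1 \<le> c" using r by (simp add: c_def field_simps)
  have yz: "\<rho> \<le> norm (y - z)" using y by (simp add: dist_norm norm_minus_commute)
  have "norm (y - z) \<le> norm (x - y) + \<sigma>"
    using x dist_triangle[of y z x] by (simp add: dist_norm norm_minus_commute)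
  then have "norm (y - z) - \<sigma> \<le> norm (x - y)" by simp
  moreover have "norm (y - z) * ((\<rho> - \<sigma>) / \<rho>) \<le> norm (y - z) - \<sigma>"
    using yz r mult_right_mono[of \<rho> "norm (y - z)" \<sigma>] by (simp add: field_simps)
  moreover have "norm (y - z) / c \<le> norm (y - z) * ((\<rho> - \<sigma>) / \<rho>)"
  proof -
    have "(\<rho> - \<sigma>) / R \<le> (\<rho> - \<sigma>) / \<rho>" using r by (intro divide_left_mono) auto
    then have "norm (y - z) * ((\<rho> - \<sigma>) / R) \<le> norm (y - z) * ((\<rho> - \<sigma>) / \<rho>)" by (intro mult_left_mono) auto
    then show ?thesis by (simp add: c_def)
  qed
  ultimately have le: "norm (y - z) / c \<le> norm (x - y)" by linarith
  have pos: "0 < norm (y - z)" using yz r by linarith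
  have "(norm (y - z) / c) powr q \<le> norm (x - y) powr q" using le q c by (intro powr_mono2) auto
  then have "t / norm (x - y) powr q \<le> t / (norm (y - z) / c) powr q"
    using t pos c by (intro divide_left_mono) (auto intro!: mult_pos_pos order.strict_trans2[OF _ \<open>(norm (y - z) / c) powr q \<le> norm (x - y) powr q\<close>])
  also have "\<dots> = c powr q * (t / norm (y - z) powr q)" using c pos by (simp add: powr_divide)
  also have "\<dots> \<le> c powr Q * (t / norm (y - z) powr q)"
    using c q t by (intro mult_right_mono powr_mono) auto
  finally show ?thesis by (simp add: c_def)
qed

lemma far_integral:
  fixes u :: "'a::euclidean_space \<Rightarrow> real"
  assumes [measurable]: "u \<in> borel_measurable borel" and r: "0 < \<sigma>" "\<sigma> < \<rho>" "\<rho> \<le> R" "R / 2 \<le> \<rho>" and p: "1 < p" and s: "0 < s" "s < 1" and k: "0 \<le> k"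
  shows "(\<integral>\<^sup>+x. \<integral>\<^sup>+y. indicator (ball z \<sigma>) x * indicator (- ball z \<rho>) y *
      ennreal (upper u k y powr (p - 1) * upper u k x / norm (x - y) powr (real DIM('a) + s * p)) \<partial>lborel \<partial>lborel)
    \<le> ennreal ((R / (\<rho> - \<sigma>)) powr (real DIM('a) + p)) * (far_mass p u z (R / 2) s * mass 1 u k z \<rho>)"
proof -
  let ?c = "(R / (\<rho> - \<sigma>)) powr (real DIM('a) + p)"
  have "(\<integral>\<^sup>+x. \<integral>\<^sup>+y. indicator (ball z \<sigma>) x * indicator (- ball z \<rho>) y *
      ennreal (upper u k y powr (p - 1) * upper u k x / norm (x - y) powr (real DIM('a) + s * p)) \<partial>lborel \<partial>lborel)
    \<le> (\<integral>\<^sup>+x. ennreal ?c * far_mass p u z (R / 2) s * (indicator (ball z \<rho>) x * ennreal (upper u k x powr 1)) \<partial>lborel)"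
  proof (intro nn_integral_mono)
    fix x
    have "(\<integral>\<^sup>+y. indicator (ball z \<sigma>) x * indicator (- ball z \<rho>) y *
      ennreal (upper u k y powr (p - 1) * upper u k x / norm (x - y) powr (real DIM('a) + s * p)) \<partial>lborel) \<le>
      (\<integral>\<^sup>+y. (ennreal ?c * (indicator (ball z \<rho>) x * ennreal (upper u k x))) * (indicator (- ball z (R / 2)) y *
         ennreal (upper u 0 y powr (p - 1) / norm (y - z) powr (real DIM('a) + s * p))) \<partial>lborel)"
    proof (intro nn_integral_mono)
      fix y
      show "indicator (ball z \<sigma>) x * indicator (- ball z \<rho>) y *
        ennreal (upper u k y powr (p - 1) * upper u k x / norm (x - y) powr (real DIM('a) + s * p))
        \<le> (ennreal ?c * (indicator (ball z \<rho>) x * ennreal (upper u k x))) * (indicator (- ball z (R / 2)) y *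
         ennreal (upper u 0 y powr (p - 1) / norm (y - z) powr (real DIM('a) + s * p)))"
      proof (cases "x \<in> ball z \<sigma> \<and> y \<notin> ball z \<rho>")
        case True
        then have x: "x \<in> ball z \<sigma>" "x \<in> ball z \<rho>" and y: "y \<notin> ball z \<rho>" "y \<notin> ball z (R / 2)" using r by auto
        have "upper u k y powr (p - 1) * upper u k x / norm (x - y) powr (real DIM('a) + s * p)
          \<le> ?c * (upper u k y powr (p - 1) * upper u k x / norm (y - z) powr (real DIM('a) + s * p))"
          using s p by (intro far_kernel_compare[OF x(1) y(1) r(1,2,3)]) (auto simp: upper_nonneg)
        also have "\<dots> \<le> ?c * (upper u 0 y powr (p - 1) * upper u k x / norm (y - z) powr (real DIM('a) + s * p))"
          using p k by (intro mult_left_mono divide_right_mono mult_right_mono powr_mono2) (auto simp: upper_def)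
        finally show ?thesis
          using x y by (simp add: ennreal_leI upper_nonneg mult_ac flip: ennreal_mult')
      next
        case False
        then have "indicator (ball z \<sigma>) x * indicator (- ball z \<rho>) y *
          ennreal (upper u k y powr (p - 1) * upper u k x / norm (x - y) powr (real DIM('a) + s * p)) = 0" by auto
        then show ?thesis by (simp only: zero_le)
      qed
    qed
    also have "\<dots> = (ennreal ?c * (indicator (ball z \<rho>) x * ennreal (upper u k x))) * far_mass p u z (R / 2) s"
      unfolding far_mass_def by (rule nn_integral_cmult) measurable
    finally show "(\<integral>\<^sup>+y. indicator (ball z \<sigma>) x * indicator (- ball z \<rho>) y *
      ennreal (upper u k y powr (p - 1) * upper u k x / norm (x - y) powr (real DIM('a) + s * p)) \<partial>lborel) \<le>
      ennreal ?c * far_mass p u z (R / 2) s * (indicator (ball z \<rho>) x * ennreal (upper u k x powr 1))"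
      by (simp add: upper_nonneg mult_ac)
  qed
  also have "\<dots> = ennreal ?c * far_mass p u z (R / 2) s * mass 1 u k z \<rho>"
    unfolding mass_def by (rule nn_integral_cmult) measurable
  finally show ?thesis by (simp add: mult.assoc)
qed

lemma ennreal_double:
  assumes "0 \<le> c" shows "ennreal c * (X + X) + (Y + Y) = ennreal (2 * c) * X + 2 * Y"
proof -
  have "ennreal (2 * c) = ennreal 2 * ennreal c" using assms by (intro ennreal_mult) auto
  then have "ennreal (2 * c) = 2 * ennreal c" by simp
  then show ?thesis by (simp only: mult_2[symmetric] mult_ac)
qed

lemma ennreal_collect:
  assumes "0 \<le> c" "0 \<le> A" "0 \<le> B"
  shows "ennreal (2 * c) * (ennreal A * X) + 2 * (ennreal B * Y) = ennreal (2 * c * A) * X + ennreal (2 * B) * Y"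
proof -
  have "ennreal (2 * c * A) = ennreal (2 * c) * ennreal A" using assms by (intro ennreal_mult) auto
  moreover have "ennreal (2 * B) = ennreal 2 * ennreal B" using assms by (intro ennreal_mult) auto
  then have "ennreal (2 * B) = 2 * ennreal B" by simp
  ultimately show ?thesis by (simp only: mult.assoc)
qed

text \<open>The estimate is one of the negative part of the integrand, since coercivity comes from the local term.
  The integrand is bounded below by the near kernel if both points lie in
  the larger ball and by the far kernel if one does not; it vanishes if neither does.\<close>

lemma nonlocal_form_lower:
  fixes u :: "'a::euclidean_space \<Rightarrow> real"
  assumes u [measurable]: "u \<in> borel_measurable borel" and p: "1 < p" "p \<le> real m" and h: "0 < h" and k: "0 \<le> k"
    and r: "0 < \<sigma>" "\<sigma> < \<rho>" "\<rho> \<le> R" "R / 2 \<le> \<rho>" "R \<le> 1"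
    and \<phi>: "\<And>x. 0 \<le> \<phi> x" "\<And>x. \<phi> x \<le> 1" "\<And>x. x \<notin> ball z \<sigma> \<Longrightarrow> \<phi> x = 0" "\<And>x y. \<bar>\<phi> x - \<phi> y\<bar> \<le> L * norm (x - y)" and L: "0 \<le> L"
    and s: "0 < s" "s < 1"
  shows "ennreal (- nonlocal_form p s u (\<lambda>x. soft h (u x - k) * \<phi> x ^ m)) \<le>
    ennreal (2 * (real m powr p * L powr p) * (kernel_const TYPE('a) p * (2 powr p / (p * (1 - s))))) * mass p u k z \<rho> +
    ennreal (2 * (R / (\<rho> - \<sigma>)) powr (real DIM('a) + p)) * (far_mass p u z (R / 2) s * mass 1 u k z \<rho>)"
proof -
  define b where "b = p * (1 - s)"
  have b: "0 < b" "b \<le> p" using p s by (auto simp: b_def algebra_simps)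
  have \<rho>: "0 < \<rho>" "\<rho> \<le> 1" using r by auto
  let ?I = "\<lambda>x y. \<bar>u x - u y\<bar> powr (p - 2) * (u x - u y) * (soft h (u x - k) * \<phi> x ^ m - soft h (u y - k) * \<phi> y ^ m) /
    norm (x - y) powr (real DIM('a) + s * p)"
  define n where "n x y = indicator (ball z \<rho>) x * indicator (ball z \<rho>) y * ennreal (upper u k x powr p * norm (x - y) powr (b - real DIM('a)))" for x y
  define f where "f x y = indicator (ball z \<sigma>) x * indicator (- ball z \<rho>) y *
      ennreal (upper u k y powr (p - 1) * upper u k x / norm (x - y) powr (real DIM('a) + s * p))" for x y
  define c where "c = real m powr p * L powr p"
  have c: "0 \<le> c" by (simp add: c_def)
  have [measurable]: "(\<lambda>(x, y). n x y) \<in> borel_measurable (borel \<Otimes>\<^sub>M borel)" "(\<lambda>(x, y). f x y) \<in> borel_measurable (borel \<Otimes>\<^sub>M borel)"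
    unfolding n_def f_def by measurable
  have [measurable]: "(\<lambda>y. n x y) \<in> borel_measurable borel" "(\<lambda>y. n y x) \<in> borel_measurable borel" 
     "(\<lambda>y. f x y) \<in> borel_measurable borel" "(\<lambda>y. f y x) \<in> borel_measurable borel" for x
    unfolding n_def f_def by measurable
  have far: "ennreal (- ?I x y) \<le> f x y" if "y \<notin> ball z \<rho>" for x y
  proof -
    have y: "\<phi> y = 0" using \<phi>(3)[of y] that r by auto
    have m0: "0 < m" using p by (cases m) auto
    have ym: "\<phi> y ^ m = 0" using y m0 by (simp add: zero_power)
    show ?thesis
    proof (cases "x \<in> ball z \<sigma>")
      case True
      have "- (upper u k y powr (p - 1) * upper u k x) \<le> \<bar>u x - u y\<bar> powr (p - 2) * (u x - u y) * (soft h (u x - k) * \<phi> x ^ m)"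
        unfolding upper_def by (rule nonlocal_kernel_far[OF h \<phi>(1,2) p(1)])
      then have "- ?I x y \<le> upper u k y powr (p - 1) * upper u k x / norm (x - y) powr (real DIM('a) + s * p)"
        unfolding ym minus_divide_left by (intro divide_right_mono) auto
      then show ?thesis using True that by (simp add: f_def ennreal_leI)
    next
      case False
      then show ?thesis using ym \<phi>(3)[of x] m0 by (simp add: zero_power)
    qed
  qed
  have sym: "?I x y = ?I y x" for x y by (simp add: abs_minus_commute norm_minus_commute algebra_simps)
  have near: "ennreal (- ?I x y) \<le> ennreal c * (n x y + n y x)" if x: "x \<in> ball z \<rho>" and y: "y \<in> ball z \<rho>" for x y
  proof -
    let ?w = "upper u k x powr p + upper u k y powr p"
    have "- ?I x y \<le> real m powr p * ?w * \<bar>\<phi> x - \<phi> y\<bar> powr p / norm (x - y) powr (real DIM('a) + s * p)"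
      using nonlocal_kernel_lower[OF h \<phi>(1)[of x] \<phi>(2)[of x] \<phi>(1)[of y] \<phi>(2)[of y] p, where a="u x" and b="u y" and k=k]
      unfolding minus_divide_left upper_def by (intro divide_right_mono) auto
    also have "\<dots> \<le> real m powr p * ?w * (L powr p * norm (x - y) powr p) / norm (x - y) powr (real DIM('a) + s * p)"
    proof (intro divide_right_mono mult_left_mono)
      have "\<bar>\<phi> x - \<phi> y\<bar> powr p \<le> (L * norm (x - y)) powr p" using \<phi>(4) p by (intro powr_mono2) auto
      then show "\<bar>\<phi> x - \<phi> y\<bar> powr p \<le> L powr p * norm (x - y) powr p" using L by (simp add: powr_mult)
    qed auto
    also have "\<dots> = c * (?w * (norm (x - y) powr p / norm (x - y) powr (real DIM('a) + s * p)))" by (simp add: c_def)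
    also have "norm (x - y) powr p / norm (x - y) powr (real DIM('a) + s * p) = norm (x - y) powr (b - real DIM('a))"
      by (simp add: b_def algebra_simps flip: powr_diff)
    also have "c * (?w * norm (x - y) powr (b - real DIM('a))) = c * (upper u k x powr p * norm (x - y) powr (b - real DIM('a)) + upper u k y powr p * norm (y - x) powr (b - real DIM('a)))"
      by (simp add: norm_minus_commute algebra_simps)
    finally have "ennreal (- ?I x y) \<le> ennreal (c * (upper u k x powr p * norm (x - y) powr (b - real DIM('a)) + upper u k y powr p * norm (y - x) powr (b - real DIM('a))))"
      by (rule ennreal_leI)
    also have "\<dots> = ennreal c * (n x y + n y x)"
      using x y c by (simp add: n_def ennreal_mult'' ennreal_plus)
    finally show ?thesis .
  qed
  have pt: "ennreal (- ?I x y) \<le> ennreal c * (n x y + n y x) + (f x y + f y x)" for x y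
  proof (cases "x \<in> ball z \<rho>")
    case True
    show ?thesis
    proof (cases "y \<in> ball z \<rho>")
      case y: True
      show ?thesis by (rule order_trans[OF near[OF True y] add_increasing2[OF zero_le order_refl]])
    next
      case False
      show ?thesis
        by (rule order_trans[OF far[OF False] add_increasing[OF zero_le add_increasing2[OF zero_le order_refl]]])
    qed
  next
    case False
    show ?thesis unfolding sym[of x y]
      by (rule order_trans[OF far[OF False] add_increasing[OF zero_le add_increasing[OF zero_le order_refl]]])
  qed
  have swap: "(\<integral>\<^sup>+x. \<integral>\<^sup>+y. n y x \<partial>lborel \<partial>lborel) = (\<integral>\<^sup>+x. \<integral>\<^sup>+y. n x y \<partial>lborel \<partial>lborel)"
    "(\<integral>\<^sup>+x. \<integral>\<^sup>+y. f y x \<partial>lborel \<partial>lborel) = (\<integral>\<^sup>+x. \<integral>\<^sup>+y. f x y \<partial>lborel \<partial>lborel)"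
  proof -
    show "(\<integral>\<^sup>+x. \<integral>\<^sup>+y. n y x \<partial>lborel \<partial>lborel) = (\<integral>\<^sup>+x. \<integral>\<^sup>+y. n x y \<partial>lborel \<partial>lborel)"
      by (rule lborel_pair.Fubini') (unfold n_def, measurable)
    show "(\<integral>\<^sup>+x. \<integral>\<^sup>+y. f y x \<partial>lborel \<partial>lborel) = (\<integral>\<^sup>+x. \<integral>\<^sup>+y. f x y \<partial>lborel \<partial>lborel)"
      by (rule lborel_pair.Fubini') (unfold f_def, measurable)
  qed
  have "ennreal (- nonlocal_form p s u (\<lambda>x. soft h (u x - k) * \<phi> x ^ m)) \<le>
    (\<integral>\<^sup>+z. ennreal (- (case z of (x, y) \<Rightarrow> ?I x y)) \<partial>(lebesgue :: ('a \<times> 'a) measure))"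
    unfolding nonlocal_form_def by (rule neg_integral_le)
  also have "\<dots> = (\<integral>\<^sup>+z. ennreal (- (case z of (x, y) \<Rightarrow> ?I x y)) \<partial>lborel)"
    by (rule nn_integral_completion)
  also have "\<dots> \<le> (\<integral>\<^sup>+z. (case z of (x, y) \<Rightarrow> ennreal c * (n x y + n y x) + (f x y + f y x)) \<partial>lborel)"
    using pt by (intro nn_integral_mono) auto
  also have "\<dots> = (\<integral>\<^sup>+x. \<integral>\<^sup>+y. ennreal c * (n x y + n y x) + (f x y + f y x) \<partial>lborel \<partial>lborel)"
    by (rule nn_integral_lborel_product) (unfold n_def f_def, measurable)
  also have "\<dots> = ennreal c * ((\<integral>\<^sup>+x. \<integral>\<^sup>+y. n x y \<partial>lborel \<partial>lborel) + (\<integral>\<^sup>+x. \<integral>\<^sup>+y. n y x \<partial>lborel \<partial>lborel)) +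
     ((\<integral>\<^sup>+x. \<integral>\<^sup>+y. f x y \<partial>lborel \<partial>lborel) + (\<integral>\<^sup>+x. \<integral>\<^sup>+y. f y x \<partial>lborel \<partial>lborel))"
  proof -
    have [measurable]: "(\<lambda>x. \<integral>\<^sup>+y. n x y \<partial>lborel) \<in> borel_measurable borel" "(\<lambda>x. \<integral>\<^sup>+y. n y x \<partial>lborel) \<in> borel_measurable borel"
      "(\<lambda>x. \<integral>\<^sup>+y. f x y \<partial>lborel) \<in> borel_measurable borel" "(\<lambda>x. \<integral>\<^sup>+y. f y x \<partial>lborel) \<in> borel_measurable borel"
      unfolding n_def f_def by measurable
    have "(\<integral>\<^sup>+y. ennreal c * (n x y + n y x) + (f x y + f y x) \<partial>lborel) =
      ennreal c * ((\<integral>\<^sup>+y. n x y \<partial>lborel) + (\<integral>\<^sup>+y. n y x \<partial>lborel)) + ((\<integral>\<^sup>+y. f x y \<partial>lborel) + (\<integral>\<^sup>+y. f y x \<partial>lborel))" for x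
      by (simp add: nn_integral_add nn_integral_cmult)
    then show ?thesis by (simp add: nn_integral_add nn_integral_cmult)
  qed
  also have "\<dots> = ennreal (2 * c) * (\<integral>\<^sup>+x. \<integral>\<^sup>+y. n x y \<partial>lborel \<partial>lborel) + 2 * (\<integral>\<^sup>+x. \<integral>\<^sup>+y. f x y \<partial>lborel \<partial>lborel)"
    unfolding swap by (rule ennreal_double[OF c])
  also have "\<dots> \<le> ennreal (2 * c) * (ennreal (kernel_const TYPE('a) p * (2 powr p / b)) * mass p u k z \<rho>) +
     2 * (ennreal ((R / (\<rho> - \<sigma>)) powr (real DIM('a) + p)) * (far_mass p u z (R / 2) s * mass 1 u k z \<rho>))"
    unfolding n_def f_def
    by (intro add_mono mult_left_mono near_integral[OF u b \<rho>] far_integral[OF u r(1-4) p(1) s k]) auto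
  also have "\<dots> = ennreal (2 * c * (kernel_const TYPE('a) p * (2 powr p / b))) * mass p u k z \<rho> +
    ennreal (2 * (R / (\<rho> - \<sigma>)) powr (real DIM('a) + p)) * (far_mass p u z (R / 2) s * mass 1 u k z \<rho>)"
    by (rule ennreal_collect) (use c b p kernel_const_nonneg[of p "TYPE('a)"] in auto)
  finally show ?thesis by (simp only: c_def b_def)
qed

lemma far_mass_measurable [measurable]:
  fixes u :: "'a::euclidean_space \<Rightarrow> real"
  assumes [measurable]: "u \<in> borel_measurable borel"
  shows "far_mass p u z r \<in> borel_measurable borel"
proof -
  have "(\<lambda>s. \<integral>\<^sup>+y. indicator (- ball z r) y *
     ennreal (upper u 0 y powr (p - 1) / norm (y - z) powr (real DIM('a) + s * p)) \<partial>lborel) \<in> borel_measurable borel"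
    by measurable
  then show ?thesis by (simp add: far_mass_def[abs_def])
qed

text \<open>The \<open>(p - 1)\<close>-st power of the tail of \<open>u\<^sub>+\<close>, without the factor \<open>r\<^sup>s\<^sup>p\<close>.  The energy estimate bounds
  the contribution of far points by this quantity, so that after scaling by the local term it carries the
  factor \<open>r\<^sup>p\<close> for every order \<open>s\<close>.\<close>

definition total_tail :: "real \<Rightarrow> real measure \<Rightarrow> ('a::euclidean_space \<Rightarrow> real) \<Rightarrow> 'a \<Rightarrow> real \<Rightarrow> ennreal" where
  "total_tail p \<mu> u z r = (\<integral>\<^sup>+s. indicator {0<..<1} s * ennreal (C_norm DIM('a) s p) * far_mass p u z r s \<partial>\<mu>)"

lemma borel_imp_measurable_mu:
  assumes "sets \<mu> = sets (restrict_space borel {0..1::real})" and f: "f \<in> borel_measurable borel"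
  shows "f \<in> borel_measurable \<mu>"
  using measurable_restrict_space1[OF f, of "{0..1}"] measurable_cong_sets[OF assms(1) refl] by blast

lemma open_interval_in_mu:
  assumes "sets \<mu> = sets (restrict_space borel {0..1::real})" shows "{0<..<1} \<in> sets \<mu>"
  unfolding assms sets_restrict_space by (rule image_eqI[of _ _ "{0<..<1}"]) auto

text \<open>The factor \<open>1 - s\<close> of the normalizing constant cancels the singularity of the near integral at \<open>s = 1\<close>, so
  the bound is uniform in \<open>s\<close> and can be integrated against the finite measure.\<close>

lemma nonlocal_total_lower:
  fixes u :: "'a::euclidean_space \<Rightarrow> real"
  assumes u [measurable]: "u \<in> borel_measurable borel" and p: "1 < p" "p \<le> real m" and h: "0 < h" and k: "0 \<le> k"
    and r: "0 < \<sigma>" "\<sigma> < \<rho>" "\<rho> \<le> R" "R / 2 \<le> \<rho>" "R \<le> 1"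
    and \<phi>: "\<And>x. 0 \<le> \<phi> x" "\<And>x. \<phi> x \<le> 1" "\<And>x. x \<notin> ball z \<sigma> \<Longrightarrow> \<phi> x = 0" "\<And>x y. \<bar>\<phi> x - \<phi> y\<bar> \<le> L * norm (x - y)" and L: "0 \<le> L"
    and \<mu>: "finite_measure \<mu>" "sets \<mu> = sets (restrict_space borel {0..1})"
    and K: "0 \<le> K" "\<And>s. 0 < s \<Longrightarrow> s < 1 \<Longrightarrow> 0 \<le> C_norm DIM('a) s p \<and> C_norm DIM('a) s p \<le> K * (1 - s)"
  shows "ennreal (- (LINT s:{0<..<1}|\<mu>. C_norm DIM('a) s p * nonlocal_form p s u (\<lambda>x. soft h (u x - k) * \<phi> x ^ m))) \<le>
    ennreal (2 * real m powr p * kernel_const TYPE('a) p * 2 powr p / p * K * measure \<mu> (space \<mu>) * L powr p) * mass p u k z \<rho> +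
    ennreal (2 * (R / (\<rho> - \<sigma>)) powr (real DIM('a) + p)) * (total_tail p \<mu> u z (R / 2) * mass 1 u k z \<rho>)"
proof -
  interpret \<mu>: finite_measure \<mu> by (rule \<mu>)
  note mb = borel_imp_measurable_mu[OF \<mu>(2)]
  have I [measurable]: "{0<..<1} \<in> sets \<mu>" by (rule open_interval_in_mu[OF \<mu>(2)])
  define v where "v x = soft h (u x - k) * \<phi> x ^ m" for x
  define a where "a = 2 * real m powr p * kernel_const TYPE('a) p * 2 powr p / p * K * L powr p"
  define b where "b = 2 * (R / (\<rho> - \<sigma>)) powr (real DIM('a) + p)"
  have kc: "0 \<le> kernel_const TYPE('a) p" using p by (intro kernel_const_nonneg) auto
  have ab: "0 \<le> a" "0 \<le> b" using p K kc by (auto simp: a_def b_def)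
  let ?M = "mass p u k z \<rho>" and ?M1 = "mass 1 u k z \<rho>" and ?f = "far_mass p u z (R / 2)"
  have pt: "ennreal (- (indicator {0<..<1} s *\<^sub>R (C_norm DIM('a) s p * nonlocal_form p s u v))) \<le>
     (ennreal a * ?M) * indicator {0<..<1} s + (ennreal b * ?M1) * (indicator {0<..<1} s * ennreal (C_norm DIM('a) s p) * ?f s)" for s
  proof (cases "s \<in> {0<..<1}")
    case True
    then have s: "0 < s" "s < 1" by auto
    have C: "0 \<le> C_norm DIM('a) s p" "C_norm DIM('a) s p \<le> K * (1 - s)" using K(2)[OF s] by auto
    define e where "e = 2 * (real m powr p * L powr p) * (kernel_const TYPE('a) p * (2 powr p / (p * (1 - s))))"
    have e: "0 \<le> e" using p s kc by (simp add: e_def)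
    have Ce: "C_norm DIM('a) s p * e \<le> a"
    proof -
      have "C_norm DIM('a) s p * e \<le> K * (1 - s) * e" using C e by (intro mult_right_mono) auto
      also have "\<dots> = a" using s p by (simp add: e_def a_def)
      finally show ?thesis .
    qed
    have "ennreal (- (indicator {0<..<1} s *\<^sub>R (C_norm DIM('a) s p * nonlocal_form p s u v))) = ennreal (C_norm DIM('a) s p) * ennreal (- nonlocal_form p s u v)"
      using True C by (simp flip: ennreal_mult')
    also have "\<dots> \<le> ennreal (C_norm DIM('a) s p) * (ennreal e * ?M + ennreal b * (?f s * ?M1))"
      unfolding v_def e_def b_def by (intro mult_left_mono nonlocal_form_lower[OF u p h k r \<phi> L s]) auto
    also have "\<dots> = ennreal (C_norm DIM('a) s p * e) * ?M + (ennreal b * ?M1) * (ennreal (C_norm DIM('a) s p) * ?f s)"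
      using C e by (simp add: ennreal_mult distrib_left mult_ac)
    also have "\<dots> \<le> ennreal a * ?M + (ennreal b * ?M1) * (ennreal (C_norm DIM('a) s p) * ?f s)"
      using Ce by (intro add_right_mono mult_right_mono ennreal_leI) auto
    finally show ?thesis using True by simp
  qed simp
  have "ennreal (- (LINT s:{0<..<1}|\<mu>. C_norm DIM('a) s p * nonlocal_form p s u v)) \<le>
     (\<integral>\<^sup>+s. ennreal (- (indicator {0<..<1} s *\<^sub>R (C_norm DIM('a) s p * nonlocal_form p s u v))) \<partial>\<mu>)"
    unfolding set_lebesgue_integral_def by (rule neg_integral_le)
  also have "\<dots> \<le> (\<integral>\<^sup>+s. (ennreal a * ?M) * indicator {0<..<1} s + (ennreal b * ?M1) * (indicator {0<..<1} s * ennreal (C_norm DIM('a) s p) * ?f s) \<partial>\<mu>)"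
    by (intro nn_integral_mono pt)
  also have "\<dots> = (ennreal a * ?M) * emeasure \<mu> {0<..<1} + (ennreal b * ?M1) * total_tail p \<mu> u z (R / 2)"
  proof -
    have [measurable]: "(\<lambda>s. ennreal (C_norm DIM('a) s p)) \<in> borel_measurable \<mu>" "?f \<in> borel_measurable \<mu>"
      by (auto intro!: mb)
    show ?thesis unfolding total_tail_def
      by (subst nn_integral_add) (auto simp: nn_integral_cmult nn_integral_cmult_indicator)
  qed
  also have "\<dots> \<le> (ennreal a * ?M) * ennreal (measure \<mu> (space \<mu>)) + (ennreal b * ?M1) * total_tail p \<mu> u z (R / 2)"
    using emeasure_mono[of "{0<..<1}" "space \<mu>" \<mu>] sets.sets_into_space[OF I]
    by (intro add_right_mono mult_left_mono) (auto simp: \<mu>.emeasure_eq_measure)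
  also have "\<dots> = ennreal (a * measure \<mu> (space \<mu>)) * ?M + ennreal b * (total_tail p \<mu> u z (R / 2) * ?M1)"
    using ab by (simp add: ennreal_mult mult_ac)
  finally show ?thesis unfolding v_def a_def b_def by (simp add: mult_ac)
qed

subsection \<open>Cut-off functions\<close>

lemma flat_1_bounds: "0 \<le> flat 1 t" "flat 1 t \<le> 1"
  by (auto simp: flat_def)

lemma flat_1_lipschitz: "\<bar>flat 1 s - flat 1 t\<bar> \<le> 4 * \<bar>s - t\<bar>"
proof -
  have "norm (flat (monom 1 2 * (1 - pderiv 1)) t) \<le> 4" for t
  proof (cases "t > 0")
    case True
    define y where "y = 1 / t"
    have y: "y > 0" using True by (simp add: y_def)
    have "1 + y / 2 \<le> exp (y / 2)" by (rule exp_ge_add_one_self)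
    then have "(1 + y / 2)\<^sup>2 \<le> (exp (y / 2))\<^sup>2" using y by (intro power_mono) auto
    also have "\<dots> = exp y" by (simp flip: exp_double)
    finally have "y\<^sup>2 \<le> 4 * exp y" using y by (simp add: power2_eq_square algebra_simps)
    then have "y\<^sup>2 * exp (- y) \<le> 4" by (simp add: exp_minus field_simps)
    then show ?thesis using True by (simp add: flat_def poly_monom y_def)
  qed (simp add: flat_def)
  then show ?thesis
    using field_differentiable_bound[of UNIV "flat 1" "flat (monom 1 2 * (1 - pderiv 1))" 4 t s] flat_deriv[of 1]
    by (auto simp: abs_minus_commute)
qed

lemma lipschitz_grad_bound:
  assumes f: "C_k (Suc 0) f" and L: "\<And>x y. \<bar>f x - f y\<bar> \<le> L * norm (x - y)" "0 \<le> L"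
  shows "norm (grad f x) \<le> L"
proof -
  define e where "e = grad f x"
  have "((\<lambda>t. f (x + t *\<^sub>R e)) has_derivative (\<lambda>s. grad f (x + 0 *\<^sub>R e) \<bullet> (s *\<^sub>R e))) (at 0)"
    by (rule has_derivative_compose[OF _ grad_has_derivative[OF f]]) (auto intro!: derivative_eq_intros)
  then have "((\<lambda>t. f (x + t *\<^sub>R e)) has_real_derivative (norm e)\<^sup>2) (at 0)"
    by (simp add: has_field_derivative_def e_def power2_norm_eq_inner mult.commute[of _ "_ \<bullet> _"])
  then have "((\<lambda>t. (f (x + t *\<^sub>R e) - f x) / t) \<longlongrightarrow> (norm e)\<^sup>2) (at 0)"
    by (simp add: has_field_derivative_iff)
  moreover have "\<forall>\<^sub>F t in at 0. (f (x + t *\<^sub>R e) - f x) / t \<le> L * norm e"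
  proof (rule eventually_at_filter[THEN iffD2], intro always_eventually allI impI)
    fix t :: real assume t: "t \<noteq> 0"
    have "\<bar>f (x + t *\<^sub>R e) - f x\<bar> \<le> L * norm (t *\<^sub>R e)"
      using L(1)[of "x + t *\<^sub>R e" x] by simp
    then have "\<bar>f (x + t *\<^sub>R e) - f x\<bar> / \<bar>t\<bar> \<le> L * norm (t *\<^sub>R e) / \<bar>t\<bar>"
      by (rule divide_right_mono) simp
    then have "\<bar>(f (x + t *\<^sub>R e) - f x) / t\<bar> \<le> L * norm (t *\<^sub>R e) / \<bar>t\<bar>" by simp
    also have "\<dots> = L * norm e" using t by simp
    finally show "(f (x + t *\<^sub>R e) - f x) / t \<le> L * norm e" by linarith
  qed
  ultimately have "(norm e)\<^sup>2 \<le> L * norm e" by (rule tendsto_upperbound) simp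
  then show ?thesis unfolding e_def[symmetric] using L(2) by (cases "norm e = 0") (auto simp: power2_eq_square)
qed

text \<open>The flat function of \<open>(\<sigma>\<^sup>2 - |x - z|\<^sup>2)/(\<sigma>\<^sup>2 - r\<^sup>2)\<close>: the argument is at least \<open>1\<close> in the inner ball.  The
  value \<open>exp(-1)\<close> instead of \<open>1\<close> there costs only a constant.\<close>

lemma cutoff_exists:
  fixes z :: "'a::euclidean_space"
  assumes r: "0 < r" "r < \<sigma>"
  shows "\<exists>\<phi>. (\<forall>j. C_k j \<phi>) \<and> (\<forall>x. 0 \<le> \<phi> x \<and> \<phi> x \<le> 1) \<and> (\<forall>x. x \<notin> ball z \<sigma> \<longrightarrow> \<phi> x = 0) \<and>
    (\<forall>x\<in>ball z r. exp (- 1) \<le> \<phi> x) \<and> (\<forall>x y. \<bar>\<phi> x - \<phi> y\<bar> \<le> 8 / (\<sigma> - r) * norm (x - y))"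
proof -
  define c where "c = 1 / (\<sigma>\<^sup>2 - r\<^sup>2)"
  have c: "0 < c" using r power_strict_mono[of r \<sigma> 2] by (simp add: c_def)
  define \<phi> where "\<phi> x = flat 1 (\<sigma>\<^sup>2 * c + (- c) * (norm (x - z))\<^sup>2)" for x :: 'a
  \<comment> \<open>stopping the distance at \<open>\<sigma>\<close> does not change the cut-off, and makes its argument globally Lipschitz\<close>
  define q where "q x = min (norm (x - z)) \<sigma>" for x :: 'a
  have \<phi>q: "\<phi> x = flat 1 (c * (\<sigma>\<^sup>2 - (q x)\<^sup>2))" for x
  proof (cases "norm (x - z) \<le> \<sigma>")
    case True then show ?thesis by (simp add: \<phi>_def q_def algebra_simps)
  next
    case False
    then have "\<sigma>\<^sup>2 \<le> (norm (x - z))\<^sup>2" using r by (intro power_mono) auto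
    then have "c * \<sigma>\<^sup>2 \<le> c * (norm (x - z))\<^sup>2" using c by simp
    then show ?thesis using False by (simp add: \<phi>_def q_def flat_def algebra_simps)
  qed
  have C: "C_k j \<phi>" for j unfolding \<phi>_def[abs_def] by (rule C_k_flat_ball)
  have b: "0 \<le> \<phi> x \<and> \<phi> x \<le> 1" for x unfolding \<phi>_def using flat_1_bounds by auto
  have o: "\<phi> x = 0" if "x \<notin> ball z \<sigma>" for x
  proof -
    have "q x = \<sigma>" using that by (simp add: q_def dist_norm norm_minus_commute)
    then show ?thesis unfolding \<phi>q by (simp add: flat_def)
  qed
  have i: "exp (- 1) \<le> \<phi> x" if "x \<in> ball z r" for x
  proof -
    have "norm (x - z) < r" using that by (simp add: dist_norm norm_minus_commute)
    then have "(norm (x - z))\<^sup>2 \<le> r\<^sup>2" by (intro power_mono) auto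
    then have "1 \<le> \<sigma>\<^sup>2 * c + (- c) * (norm (x - z))\<^sup>2"
      using c mult_left_mono[of "\<sigma>\<^sup>2 - r\<^sup>2" "\<sigma>\<^sup>2 - (norm (x - z))\<^sup>2" c] by (simp add: c_def algebra_simps)
    then show ?thesis unfolding \<phi>_def by (simp add: flat_def)
  qed
  have l: "\<bar>\<phi> x - \<phi> y\<bar> \<le> 8 / (\<sigma> - r) * norm (x - y)" for x y
  proof -
    have q: "0 \<le> q x" "q x \<le> \<sigma>" "0 \<le> q y" "q y \<le> \<sigma>" using r by (auto simp: q_def)
    have "\<bar>q x - q y\<bar> \<le> \<bar>norm (x - z) - norm (y - z)\<bar>" by (auto simp: q_def)
    also have "\<dots> \<le> norm (x - y)" using norm_triangle_ineq3[of "x - z" "y - z"] by simp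
    finally have qd: "\<bar>q x - q y\<bar> \<le> norm (x - y)" .
    have "\<bar>\<phi> x - \<phi> y\<bar> \<le> 4 * \<bar>c * (\<sigma>\<^sup>2 - (q x)\<^sup>2) - c * (\<sigma>\<^sup>2 - (q y)\<^sup>2)\<bar>"
      unfolding \<phi>q by (rule flat_1_lipschitz)
    also have "\<dots> = 4 * (c * (\<bar>q x - q y\<bar> * (q x + q y)))"
    proof -
      have "c * (\<sigma>\<^sup>2 - (q x)\<^sup>2) - c * (\<sigma>\<^sup>2 - (q y)\<^sup>2) = - (c * ((q x - q y) * (q x + q y)))"
        by (simp add: power2_eq_square algebra_simps)
      then show ?thesis using q c by (simp add: abs_mult)
    qed
    also have "\<dots> \<le> 4 * (c * (norm (x - y) * (2 * \<sigma>)))"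
      using q c qd by (intro mult_left_mono mult_mono) auto
    also have "\<dots> = 8 * (\<sigma> * c) * norm (x - y)" by simp
    also have "\<dots> \<le> 8 * (1 / (\<sigma> - r)) * norm (x - y)"
    proof (intro mult_right_mono mult_left_mono)
      have "\<sigma>\<^sup>2 - r\<^sup>2 = (\<sigma> - r) * (\<sigma> + r)" by (simp add: power2_eq_square algebra_simps)
      then have "\<sigma> * c = (\<sigma> / (\<sigma> + r)) * (1 / (\<sigma> - r))" by (simp add: c_def)
      also have "\<dots> \<le> 1 * (1 / (\<sigma> - r))" using r by (intro mult_right_mono) auto
      finally show "\<sigma> * c \<le> 1 / (\<sigma> - r)" by simp
    qed auto
    finally show ?thesis by simp
  qed
  show ?thesis using C b o i l by blast
qed

lemma pint_integrable:
  assumes "f \<in> borel_measurable borel" "pint p f < \<infinity>"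
  shows "integrable lborel (\<lambda>x. norm (f x) powr p)"
  using assms by (auto simp: integrable_iff_bounded pint_def)

lemma pint_eq_integral:
  assumes "f \<in> borel_measurable borel" "pint p f < \<infinity>"
  shows "pint p f = ennreal (LINT x|lborel. norm (f x) powr p)"
  unfolding pint_def by (rule nn_integral_eq_integral[OF pint_integrable[OF assms]]) auto

lemma grad_power:
  assumes f: "C_k (Suc 0) f" shows "grad (\<lambda>x. f x ^ m) x = (real m * f x ^ (m - 1)) *\<^sub>R grad f x"
  by (rule grad_unique, rule has_derivative_eq_rhs[OF has_derivative_power[OF grad_has_derivative[OF f]]])
     (auto simp: fun_eq_iff)

text \<open>Test the inequality of the subsolution with \<open>v = soft h (u - k) \<phi>\<^sup>m\<close>.  The local term bounds the energy of
  \<open>v\<close> from below up to the integral of \<open>(u - k)\<^sub>+\<^sup>p |grad \<phi>|\<^sup>p\<close>, and the nonlocal term is at least minus the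
  near and far contributions.  Dividing by the mass of the measure at \<open>1\<close> gives the bound for \<open>D\<close>.\<close>

lemma energy_estimate:
  fixes p :: real and \<mu> :: "real measure"
  assumes p: "1 < p" and \<mu>: "finite_measure \<mu>" "sets \<mu> = sets (restrict_space borel {0..1})" "measure \<mu> {1} > 0"
  shows "\<exists>C>0. \<exists>c>0. \<forall>(\<Omega> :: 'a::euclidean_space set) u z R \<rho> r k h.
    open \<Omega> \<and> weak_subsolution p \<mu> \<Omega> u \<and> u \<in> borel_measurable borel \<and> cball z \<rho> \<subseteq> \<Omega> \<and>
    0 < r \<and> r < \<rho> \<and> R / 2 \<le> \<rho> \<and> \<rho> \<le> R \<and> R \<le> 1 \<and> 0 \<le> k \<and> 0 < h \<longrightarrow>
    (\<exists>v D. H10 p (ball z \<rho>) v D \<and> (\<forall>x. u x \<le> k \<longrightarrow> v x = 0) \<and> (\<forall>x\<in>ball z r. c * soft h (u x - k) \<le> v x) \<and>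
      pint p D \<le> ennreal C * (ennreal ((\<rho> - r) powr (- p)) * mass p u k z \<rho> +
        ennreal ((R / (\<rho> - r)) powr (real DIM('a) + p)) * (total_tail p \<mu> u z (R / 2) * mass 1 u k z \<rho>)))"
proof -
  interpret \<mu>: finite_measure \<mu> by (rule \<mu>)
  define N where "N = DIM('a)"
  define \<alpha> where "\<alpha> = measure \<mu> {1}"
  have \<alpha>: "0 < \<alpha>" using \<mu> by (simp add: \<alpha>_def)
  obtain K where K: "0 < K" "\<And>s. 0 < s \<Longrightarrow> s < 1 \<Longrightarrow> 0 \<le> C_norm N s p \<and> C_norm N s p \<le> K * (1 - s)"
    using C_norm_bound[OF _ p, of N] by (auto simp: N_def)
  define m where "m = nat \<lceil>p\<rceil>"
  have m: "p \<le> real m" by (simp add: m_def) linarith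
  have m0: "0 < m" using p m by (cases m) auto
  define c1 where "c1 = 1 / (2 * 2 powr p)"
  define c2 where "c2 = 2 * (2 * real m) powr p"
  define c3 where "c3 = 2 * real m powr p * kernel_const TYPE('a) p * 2 powr p / p * K * measure \<mu> (space \<mu>)"
  have c1: "0 < c1" by (simp add: c1_def)
  have c2: "0 \<le> c2" by (simp add: c2_def)
  have c3: "0 \<le> c3" using p K kernel_const_nonneg[of p "TYPE('a)"] by (simp add: c3_def)
  define C where "C = (16 powr p * (\<alpha> * c2 + c3) + 2 * 2 powr (real N + p)) / (\<alpha> * c1)"
  have C: "0 < C" unfolding C_def using \<alpha> c1 c2 c3 by (intro divide_pos_pos add_nonneg_pos) auto
  define c :: real where "c = exp (- 1) ^ m"
  have c: "(0::real) < c" by (simp add: c_def)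
  show ?thesis
  proof (rule exI[of _ C], rule conjI[OF C], rule exI[of _ c], rule conjI[OF c], intro allI impI)
    fix \<Omega> :: "'a set" and u :: "'a \<Rightarrow> real" and z :: 'a and R \<rho> r k h :: real
    assume "open \<Omega> \<and> weak_subsolution p \<mu> \<Omega> u \<and> u \<in> borel_measurable borel \<and> cball z \<rho> \<subseteq> \<Omega> \<and>
      0 < r \<and> r < \<rho> \<and> R / 2 \<le> \<rho> \<and> \<rho> \<le> R \<and> R \<le> 1 \<and> 0 \<le> k \<and> 0 < h"
    then have \<Omega>: "open \<Omega>" and sub: "weak_subsolution p \<mu> \<Omega> u" and u [measurable]: "u \<in> borel_measurable borel"
      and B\<Omega>: "cball z \<rho> \<subseteq> \<Omega>" and r: "0 < r" "r < \<rho>" "R / 2 \<le> \<rho>" "\<rho> \<le> R" "R \<le> 1" and k: "0 \<le> k" and h: "0 < h" by auto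
    \<comment> \<open>the cut-off lives halfway, so that its support keeps a distance from the complement of the large ball\<close>
    define \<sigma> where "\<sigma> = (\<rho> + r) / 2"
    have \<sigma>: "0 < \<sigma>" "\<sigma> < \<rho>" "r < \<sigma>" "\<sigma> - r = (\<rho> - r) / 2" "\<rho> - \<sigma> = (\<rho> - r) / 2" using r by (auto simp: \<sigma>_def field_simps)
    obtain \<phi> where \<phi>: "\<And>j. C_k j \<phi>" "\<And>x. 0 \<le> \<phi> x" "\<And>x. \<phi> x \<le> 1" "\<And>x. x \<notin> ball z \<sigma> \<Longrightarrow> \<phi> x = 0"
      "\<And>x. x \<in> ball z r \<Longrightarrow> exp (- 1) \<le> \<phi> x" "\<And>x y. \<bar>\<phi> x - \<phi> y\<bar> \<le> 8 / (\<sigma> - r) * norm (x - y)"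
      using cutoff_exists[OF r(1) \<sigma>(3), of z] by blast
    define L where "L = 8 / (\<sigma> - r)"
    have L: "0 \<le> L" "L = 16 / (\<rho> - r)" using \<sigma> by (auto simp: L_def field_simps)
    have gradL: "norm (grad \<phi> x) \<le> L" for x
      by (rule lipschitz_grad_bound[OF \<phi>(1) _ L(1)]) (unfold L_def, rule \<phi>(6))
    define \<psi> where "\<psi> x = \<phi> x ^ m" for x
    have \<psi>: "smooth_cs \<psi> (cball z \<sigma>)"
      using \<phi>(1,4) m0 by (auto simp: smooth_cs_def \<psi>_def[abs_def] intro!: C_k_power)
    obtain g where g [measurable]: "g \<in> borel_measurable borel" and wg: "is_weak_gradient \<Omega> u g"
      and gae: "AE x in lborel. x \<in> \<Omega> \<longrightarrow> weak_gradient \<Omega> u x = g x" and gp: "L_pow_loc p \<Omega> g" and up: "L_pow_loc p \<Omega> u"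
    proof -
      have W: "\<exists>g. is_weak_gradient \<Omega> u g" "L_pow_loc p \<Omega> u" "L_pow_loc p \<Omega> (weak_gradient \<Omega> u)"
        using sub by (auto simp: weak_subsolution_def W1p_loc_def)
      have w: "is_weak_gradient \<Omega> u (weak_gradient \<Omega> u)" unfolding weak_gradient_def by (rule someI_ex[OF W(1)])
      obtain g where g: "g \<in> borel_measurable borel" "AE x in lborel. x \<in> \<Omega> \<longrightarrow> weak_gradient \<Omega> u x = g x"
        using set_borel_measurable_representative[of \<Omega> "weak_gradient \<Omega> u"] W(3) by (auto simp: L_pow_loc_def)
      show thesis
        by (rule that[OF g(1) is_weak_gradient_cong_AE[OF w _ g(2)] g(2) L_pow_loc_cong_AE[OF W(3) g(2)] W(2)]) simp
    qed
    define v where "v x = soft h (u x - k) * \<psi> x" for x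
    define D where "D x = (soft' h (u x - k) * \<psi> x) *\<^sub>R g x + soft h (u x - k) *\<^sub>R grad \<psi> x" for x
    have H: "H10 p (ball z \<rho>) v D"
      unfolding v_def[abs_def] D_def[abs_def]
      by (rule H10_soft[OF wg u g up gp _ h B\<Omega> \<psi> \<sigma>(2)]) (use p in simp)
    have p1: "1 \<le> p" "0 < p" using p by auto
    note [measurable] = H10_measurable[OF H]
    define B where "B = cball z \<rho>"
    have B: "compact B" "B \<subseteq> \<Omega>" using B\<Omega> by (auto simp: B_def)
    have [measurable]: "B \<in> sets borel" by (simp add: B_def)
    have fin: "pint p (zero_off B u) < \<infinity>" "pint p (zero_off B g) < \<infinity>" "pint p D < \<infinity>"
      using L_pow_loc_pint[OF up B] L_pow_loc_pint[OF gp B] H10_pint_finite[OF H p1(2)] by auto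
    have Dform: "D x = (soft' h (u x - k) * \<phi> x ^ m) *\<^sub>R g x + soft h (u x - k) *\<^sub>R ((real m * \<phi> x ^ (m - 1)) *\<^sub>R grad \<phi> x)" for x
      unfolding D_def \<psi>_def[abs_def] by (subst grad_power[OF \<phi>(1)]) simp
    define F where "F x = norm (g x) powr (p - 2) * (g x \<bullet> D x)" for x
    have [measurable]: "F \<in> borel_measurable borel" unfolding F_def[abs_def] by measurable
    have Dout: "D x = 0" if "x \<notin> ball z \<rho>" for x using H10_outside(2)[OF H that] .
    have Fi: "integrable lborel F"
    proof (rule Bochner_Integration.integrable_bound)
      show "integrable lborel (\<lambda>x. norm (zero_off B g x) powr p + norm (D x) powr p)"
        using fin by (intro Bochner_Integration.integrable_add pint_integrable) (auto intro: zero_off_measurable)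
      show "AE x in lborel. norm (F x) \<le> norm (norm (zero_off B g x) powr p + norm (D x) powr p)"
      proof (intro AE_I2)
        fix x
        show "norm (F x) \<le> norm (norm (zero_off B g x) powr p + norm (D x) powr p)"
        proof (cases "x \<in> ball z \<rho>")
          case True
          then have on: "zero_off B g x = g x" by (auto simp: zero_off_def B_def)
          define G E where "G = norm (g x)" and "E = norm (D x)"
          have GE: "0 \<le> G" "0 \<le> E" by (auto simp: G_def E_def)
          have "norm (F x) = G powr (p - 2) * \<bar>g x \<bullet> D x\<bar>" by (simp add: F_def G_def abs_mult)
          also have "\<dots> \<le> G powr (p - 2) * (G * E)"
            using Cauchy_Schwarz_ineq2[of "g x" "D x"] by (intro mult_left_mono) (auto simp: G_def E_def)
          also have "\<dots> = G powr (p - 1) * E" using GE powr_mult_base[of G "p - 2"] by (simp add: mult_ac)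
          also have "\<dots> \<le> max G E powr (p - 1) * max G E" using GE p by (intro mult_mono powr_mono2) auto
          also have "\<dots> = max G E powr p" using GE powr_mult_base[of "max G E" "p - 1"] by (simp add: mult_ac max_def)
          also have "\<dots> \<le> G powr p + E powr p" by (auto simp: max_def)
          finally show ?thesis by (simp add: on G_def E_def)
        qed (use Dout in \<open>simp add: F_def\<close>)
      qed
    qed measurable
    define W where "W = (LINT x|lborel. indicator (ball z \<rho>) x * upper u k x powr p)"
    have iW: "integrable lborel (\<lambda>x. indicator (ball z \<rho>) x * upper u k x powr p)"
    proof (rule Bochner_Integration.integrable_bound[OF pint_integrable[OF _ fin(1)]])
      show "AE x in lborel. norm (indicator (ball z \<rho>) x * upper u k x powr p) \<le> norm (norm (zero_off B u x) powr p)"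
        using k p by (intro AE_I2) (auto simp: indicator_def zero_off_def B_def upper_def intro!: powr_mono2)
    qed (auto intro: zero_off_measurable)
    have mW: "mass p u k z \<rho> = ennreal W"
    proof -
      have "mass p u k z \<rho> = (\<integral>\<^sup>+x. ennreal (indicator (ball z \<rho>) x * upper u k x powr p) \<partial>lborel)"
        unfolding mass_def by (intro nn_integral_cong) (auto simp: indicator_def)
      also have "\<dots> = ennreal W" unfolding W_def by (rule nn_integral_eq_integral[OF iW]) auto
      finally show ?thesis .
    qed
    define P where "P = (LINT x|lborel. norm (D x) powr p)"
    have iP: "integrable lborel (\<lambda>x. norm (D x) powr p)" by (rule pint_integrable[OF _ fin(3)]) measurable
    have mP: "pint p D = ennreal P" unfolding P_def by (rule pint_eq_integral[OF _ fin(3)]) measurable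
    have PW: "0 \<le> P" "0 \<le> W" by (auto simp: P_def W_def)
    have low: "c1 * P - c2 * L powr p * W \<le> (LINT x|lborel. F x)"
    proof -
      have "c1 * P - c2 * L powr p * W = (LINT x|lborel. c1 * norm (D x) powr p - c2 * L powr p * (indicator (ball z \<rho>) x * upper u k x powr p))"
        using iP iW by (simp add: P_def W_def)
      also have "\<dots> \<le> (LINT x|lborel. F x)"
      proof (rule integral_mono)
        show "integrable lborel (\<lambda>x. c1 * norm (D x) powr p - c2 * L powr p * (indicator (ball z \<rho>) x * upper u k x powr p))"
          using iP iW by simp
        show "integrable lborel F" by (rule Fi)
        fix x
        show "c1 * norm (D x) powr p - c2 * L powr p * (indicator (ball z \<rho>) x * upper u k x powr p) \<le> F x"
        proof (cases "x \<in> ball z \<rho>")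
          case True
          have "c1 * norm (D x) powr p - c2 * (upper u k x powr p * norm (grad \<phi> x) powr p) \<le> F x"
            using local_integrand_lower[OF h \<phi>(2) \<phi>(3) p m, of "u x" k x "g x" "grad \<phi> x"]
            by (simp add: F_def Dform c1_def c2_def upper_def)
          moreover have "c2 * (upper u k x powr p * norm (grad \<phi> x) powr p) \<le> c2 * (upper u k x powr p * L powr p)"
            using gradL[of x] p c2 by (intro mult_left_mono powr_mono2) auto
          ultimately show ?thesis using True by (simp add: mult_ac)
        next
          case False
          then show ?thesis using Dout[OF False] p1 by (simp add: F_def)
        qed
      qed
      finally show ?thesis .
    qed
    define NL where "NL = (LINT s:{0<..<1}|\<mu>. C_norm DIM('a) s p * nonlocal_form p s u v)"
    have ineq: "NL + \<alpha> * (LINT x|lborel. F x) \<le> 0"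
    proof -
      have W0: "W1p_0 p (ball z \<rho>) v" by (rule H10_imp_W1p_0[OF H p1(1)]) auto
      have v0: "0 \<le> v x" for x using soft_nonneg \<phi>(2) by (simp add: v_def \<psi>_def)
      have cl: "compact (closure (ball z \<rho>))" "closure (ball z \<rho>) \<subseteq> \<Omega>" using r B\<Omega> by auto
      have S: "NL + \<alpha> * (LINT x:\<Omega>|lebesgue. norm (weak_gradient \<Omega> u x) powr (p - 2) * (weak_gradient \<Omega> u x \<bullet> weak_gradient \<Omega> v x)) \<le> 0"
        using sub W0 v0 cl unfolding weak_subsolution_def NL_def \<alpha>_def by blast
      have wv: "is_weak_gradient \<Omega> v D"
        by (rule H10_weak_gradient[OF H p1(1) bounded_ball]) (use B\<Omega> ball_subset_cball in blast)
      have "is_weak_gradient \<Omega> v (weak_gradient \<Omega> v)"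
        unfolding weak_gradient_def by (rule someI[of "is_weak_gradient \<Omega> v", OF wv])
      then have vae: "AE x in lborel. x \<in> \<Omega> \<longrightarrow> weak_gradient \<Omega> v x = D x"
        by (rule weak_gradient_unique[OF _ wv \<Omega>])
      have F0: "F x = 0" if "x \<notin> \<Omega>" for x
      proof -
        have "x \<notin> ball z \<rho>" using that B\<Omega> ball_subset_cball by blast
        then show ?thesis using Dout by (simp add: F_def)
      qed
      have "(LINT x:\<Omega>|lebesgue. F x) = (LINT x:\<Omega>|lebesgue. norm (weak_gradient \<Omega> u x) powr (p - 2) * (weak_gradient \<Omega> u x \<bullet> weak_gradient \<Omega> v x))"
      proof (rule lebesgue_set_integral_cong_AE)
        have "(\<lambda>x. indicator \<Omega> x *\<^sub>R F x) = F" using F0 by (intro ext) (auto simp: indicator_def)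
        then show "(\<lambda>x. indicator \<Omega> x *\<^sub>R F x) \<in> borel_measurable lebesgue" by (simp add: borel_imp_lebesgue)
        show "AE x in lborel. x \<in> \<Omega> \<longrightarrow> F x = norm (weak_gradient \<Omega> u x) powr (p - 2) * (weak_gradient \<Omega> u x \<bullet> weak_gradient \<Omega> v x)"
          using gae vae by eventually_elim (simp add: F_def)
      qed
      moreover have "(LINT x:\<Omega>|lebesgue. F x) = (LINT x|lborel. F x)" by (rule lebesgue_set_integral_eq) (use F0 in auto)
      ultimately show ?thesis using S by simp
    qed
    define T where "T = total_tail p \<mu> u z (R / 2)"
    let ?e = "real DIM('a) + p"
    have NLb: "ennreal (- NL) \<le> ennreal (c3 * L powr p) * ennreal W + ennreal (2 * (R / (\<rho> - \<sigma>)) powr ?e) * (T * mass 1 u k z \<rho>)"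
      unfolding NL_def v_def[abs_def] \<psi>_def T_def mW[symmetric] c3_def
      by (rule nonlocal_total_lower[OF u p m h k \<sigma>(1,2) r(4,3,5) \<phi>(2,3,4) _ L(1) \<mu>(1,2)])
        (use \<phi>(6) K in \<open>auto simp: L_def N_def\<close>)
    have "\<alpha> * c1 * P \<le> \<alpha> * c2 * L powr p * W + max (- NL) 0"
    proof -
      have "\<alpha> * (c1 * P - c2 * L powr p * W) \<le> \<alpha> * (LINT x|lborel. F x)" using low \<alpha> by (intro mult_left_mono) auto
      also have "\<dots> \<le> max (- NL) 0" using ineq by linarith
      finally show ?thesis by (simp add: algebra_simps)
    qed
    then have "ennreal (\<alpha> * c1 * P) \<le> ennreal (\<alpha> * c2 * L powr p * W + max (- NL) 0)" by (rule ennreal_leI)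
    also have "\<dots> = ennreal (\<alpha> * c2 * L powr p * W) + ennreal (- NL)"
      using \<alpha> c2 PW by (subst ennreal_plus) (auto simp: max_def ennreal_neg)
    also have "\<dots> \<le> ennreal (\<alpha> * c2 * L powr p * W) + (ennreal (c3 * L powr p) * ennreal W + ennreal (2 * (R / (\<rho> - \<sigma>)) powr ?e) * (T * mass 1 u k z \<rho>))"
      by (intro add_left_mono NLb)
    also have "\<dots> = ennreal ((\<alpha> * c2 + c3) * L powr p) * ennreal W + ennreal (2 * (R / (\<rho> - \<sigma>)) powr ?e) * (T * mass 1 u k z \<rho>)"
    proof -
      have "ennreal (\<alpha> * c2 * L powr p * W) + ennreal (c3 * L powr p) * ennreal W = ennreal ((\<alpha> * c2 + c3) * L powr p) * ennreal W"
        using \<alpha> c2 c3 PW by (simp add: algebra_simps flip: ennreal_mult ennreal_plus)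
      then show ?thesis by (simp add: add.assoc[symmetric])
    qed
    also have "\<dots> \<le> ennreal (\<alpha> * c1 * C) * (ennreal ((\<rho> - r) powr (- p)) * ennreal W) + ennreal (\<alpha> * c1 * C) * (ennreal ((R / (\<rho> - r)) powr ?e) * (T * mass 1 u k z \<rho>))"
    proof (intro add_mono)
      have "L powr p = 16 powr p * (\<rho> - r) powr (- p)" using r L by (simp add: powr_divide powr_minus_divide)
      then have "(\<alpha> * c2 + c3) * L powr p = (16 powr p * (\<alpha> * c2 + c3)) * (\<rho> - r) powr (- p)" by simp
      also have "\<dots> \<le> \<alpha> * c1 * C * (\<rho> - r) powr (- p)"
        using \<alpha> c1 by (intro mult_right_mono) (auto simp: C_def)
      finally have "ennreal ((\<alpha> * c2 + c3) * L powr p) * ennreal W \<le> ennreal (\<alpha> * c1 * C * (\<rho> - r) powr (- p)) * ennreal W"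
        by (intro mult_right_mono ennreal_leI) auto
      then show "ennreal ((\<alpha> * c2 + c3) * L powr p) * ennreal W \<le> ennreal (\<alpha> * c1 * C) * (ennreal ((\<rho> - r) powr (- p)) * ennreal W)"
        using \<alpha> c1 C by (simp add: ennreal_mult mult.assoc)
      have "(R / (\<rho> - \<sigma>)) powr ?e = 2 powr ?e * (R / (\<rho> - r)) powr ?e"
      proof -
        have "R / (\<rho> - \<sigma>) = 2 * (R / (\<rho> - r))" unfolding \<sigma>(5) by simp
        then show ?thesis using r by (simp only: powr_mult)
      qed
      then have "2 * (R / (\<rho> - \<sigma>)) powr ?e = (2 * 2 powr ?e) * (R / (\<rho> - r)) powr ?e" by simp
      also have "\<dots> \<le> \<alpha> * c1 * C * (R / (\<rho> - r)) powr ?e"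
        using \<alpha> c1 c2 c3 by (intro mult_right_mono) (auto simp: C_def N_def)
      finally have "ennreal (2 * (R / (\<rho> - \<sigma>)) powr ?e) * (T * mass 1 u k z \<rho>) \<le> ennreal (\<alpha> * c1 * C * (R / (\<rho> - r)) powr ?e) * (T * mass 1 u k z \<rho>)"
        by (intro mult_right_mono ennreal_leI) auto
      then show "ennreal (2 * (R / (\<rho> - \<sigma>)) powr ?e) * (T * mass 1 u k z \<rho>) \<le> ennreal (\<alpha> * c1 * C) * (ennreal ((R / (\<rho> - r)) powr ?e) * (T * mass 1 u k z \<rho>))"
        using \<alpha> c1 C by (simp add: ennreal_mult mult.assoc)
    qed
    finally have "ennreal (\<alpha> * c1) * pint p D \<le> ennreal (\<alpha> * c1) * (ennreal C * (ennreal ((\<rho> - r) powr (- p)) * mass p u k z \<rho> + ennreal ((R / (\<rho> - r)) powr ?e) * (T * mass 1 u k z \<rho>)))"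
      using \<alpha> c1 C PW unfolding mP mW by (simp add: ennreal_mult distrib_left mult.assoc)
    then have PD: "pint p D \<le> ennreal C * (ennreal ((\<rho> - r) powr (- p)) * mass p u k z \<rho> + ennreal ((R / (\<rho> - r)) powr ?e) * (T * mass 1 u k z \<rho>))"
      using \<alpha> c1 by (subst (asm) ennreal_mult_le_mult_iff) auto
    have v1: "v x = 0" if "u x \<le> k" for x using that by (simp add: v_def soft_def)
    have v2: "c * soft h (u x - k) \<le> v x" if "x \<in> ball z r" for x
    proof -
      have "exp (- 1) ^ m \<le> \<phi> x ^ m" using \<phi>(5)[OF that] by (intro power_mono) auto
      then show ?thesis unfolding v_def \<psi>_def c_def using soft_nonneg[of h "u x - k"] by (simp add: mult.commute mult_right_mono)
    qed
    show "\<exists>v D. H10 p (ball z \<rho>) v D \<and> (\<forall>x. u x \<le> k \<longrightarrow> v x = 0) \<and> (\<forall>x\<in>ball z r. c * soft h (u x - k) \<le> v x) \<and>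
      pint p D \<le> ennreal C * (ennreal ((\<rho> - r) powr (- p)) * mass p u k z \<rho> +
        ennreal ((R / (\<rho> - r)) powr (real DIM('a) + p)) * (total_tail p \<mu> u z (R / 2) * mass 1 u k z \<rho>))"
      using H v1 v2 PD unfolding T_def by blast
  qed
qed

section \<open>De Giorgi iteration\<close>

text \<open>The threshold is the value of \<open>a 0\<close> for which the geometric sequence with ratio \<open>B\<^sup>-\<^sup>1\<^sup>/\<^sup>\<beta>\<close> solves the recursion
  with equality.\<close>

lemma fast_geometric_convergence:
  fixes a :: "nat \<Rightarrow> real"
  assumes a: "\<And>j. 0 \<le> a j" "\<And>j. a (Suc j) \<le> C * B ^ j * a j powr (1 + \<beta>)"
    and C: "0 < C" and B: "1 < B" and \<beta>: "0 < \<beta>" and a0: "a 0 \<le> C powr (- 1 / \<beta>) * B powr (- 1 / \<beta>\<^sup>2)"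
  shows "a \<longlonglongrightarrow> 0"
proof -
  define \<theta> where "\<theta> = C powr (- 1 / \<beta>) * B powr (- 1 / \<beta>\<^sup>2)"
  define q where "q = B powr (- 1 / \<beta>)"
  have \<theta>: "0 < \<theta>" using C B by (simp add: \<theta>_def)
  have q: "0 < q" "q < 1" using B \<beta> powr_less_mono[of "- 1 / \<beta>" 0 B] by (auto simp: q_def)
  have C\<theta>: "C * \<theta> powr \<beta> = q"
  proof -
    have e: "- 1 / \<beta> * \<beta> = - 1" "- 1 / \<beta>\<^sup>2 * \<beta> = - 1 / \<beta>"
      using \<beta> by (simp_all add: power2_eq_square)
    have "\<theta> powr \<beta> = C powr (- 1) * q"
      unfolding \<theta>_def q_def using C B by (simp only: powr_mult powr_powr e powr_ge_zero)
    then show ?thesis using C by (simp add: powr_neg_one)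
  qed
  have Bq: "B * q powr \<beta> = 1"
  proof -
    have e: "- 1 / \<beta> * \<beta> = - 1" using \<beta> by simp
    have "q powr \<beta> = B powr (- 1)" unfolding q_def by (simp only: powr_powr e)
    then show ?thesis using B by (simp add: powr_neg_one)
  qed
  have le: "a j \<le> \<theta> * q ^ j" for j
  proof (induction j)
    case 0 then show ?case using a0 by (simp add: \<theta>_def)
  next
    case (Suc j)
    have "a (Suc j) \<le> C * B ^ j * a j powr (1 + \<beta>)" by (rule a)
    also have "\<dots> \<le> C * B ^ j * (\<theta> * q ^ j) powr (1 + \<beta>)"
      using C B \<beta> a(1) Suc by (intro mult_left_mono powr_mono2) auto
    also have "\<dots> = C * B ^ j * ((\<theta> * q ^ j) * (\<theta> powr \<beta> * (q powr \<beta>) ^ j))"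
    proof -
      have "(\<theta> * q ^ j) powr (1 + \<beta>) = (\<theta> * q ^ j) * (\<theta> * q ^ j) powr \<beta>"
        using \<theta> q by (simp add: powr_add)
      also have "(\<theta> * q ^ j) powr \<beta> = \<theta> powr \<beta> * (q powr \<beta>) ^ j"
        using \<theta> q by (simp add: powr_mult power_powr_swap)
      finally show ?thesis by simp
    qed
    also have "\<dots> = (C * \<theta> powr \<beta>) * (B * q powr \<beta>) ^ j * (\<theta> * q ^ j)"
      by (simp add: power_mult_distrib mult_ac)
    also have "\<dots> = \<theta> * q ^ Suc j" by (simp add: C\<theta> Bq)
    finally show ?case .
  qed
  have "(\<lambda>j. \<theta> * q ^ j) \<longlonglongrightarrow> \<theta> * 0" using q by (intro tendsto_intros LIMSEQ_realpow_zero) auto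
  then show ?thesis
    using le a(1) by (intro tendsto_sandwich[of "\<lambda>_. 0" a sequentially "\<lambda>j. \<theta> * q ^ j" 0]) auto
qed

lemma mass_mono:
  fixes z :: "'a::euclidean_space"
  assumes "k0 \<le> k" "r \<le> \<rho>" "0 \<le> p" shows "mass p u k z r \<le> mass p u k0 z \<rho>"
  unfolding mass_def
proof (intro nn_integral_mono)
  fix x :: 'a
  have "ennreal (upper u k x powr p) \<le> ennreal (upper u k0 x powr p)"
    using assms by (intro ennreal_leI powr_mono2) (auto simp: upper_def)
  then show "indicator (ball z r) x * ennreal (upper u k x powr p) \<le> indicator (ball z \<rho>) x * ennreal (upper u k0 x powr p)"
    using assms(2) by (auto simp: indicator_def)
qed

lemma mass_1_le:
  fixes z :: "'a::euclidean_space"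
  assumes [measurable]: "u \<in> borel_measurable borel" and \<delta>: "0 < \<delta>" "k = k0 + \<delta>" and p: "1 < p"
  shows "mass 1 u k z \<rho> \<le> ennreal ((1 / \<delta>) powr (p - 1)) * mass p u k0 z \<rho>"
proof -
  have "mass 1 u k z \<rho> \<le> (\<integral>\<^sup>+x. ennreal ((1 / \<delta>) powr (p - 1)) * (indicator (ball z \<rho>) x * ennreal (upper u k0 x powr p)) \<partial>lborel)"
    unfolding mass_def
  proof (intro nn_integral_mono)
    fix x :: 'a
    have "upper u k x \<le> (1 / \<delta>) powr (p - 1) * upper u k0 x powr p"
    proof (cases "u x \<le> k")
      case False
      then have u: "\<delta> \<le> upper u k0 x" "upper u k x \<le> upper u k0 x" using \<delta> by (auto simp: upper_def)
      have "1 \<le> (1 / \<delta> * upper u k0 x) powr (p - 1)" using u \<delta> p by (intro ge_one_powr_ge_zero) auto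
      then have "1 * upper u k0 x \<le> (1 / \<delta> * upper u k0 x) powr (p - 1) * upper u k0 x"
        by (intro mult_right_mono) (auto simp: upper_def)
      also have "\<dots> = (1 / \<delta>) powr (p - 1) * (upper u k0 x * upper u k0 x powr (p - 1))"
        using \<delta> by (simp only: powr_mult upper_nonneg zero_le_divide_1_iff less_imp_le mult_ac)
      also have "upper u k0 x * upper u k0 x powr (p - 1) = upper u k0 x powr p"
        using powr_mult_base[OF upper_nonneg, of u k0 x "p - 1"] by simp
      finally show ?thesis using u by simp
    qed (simp add: upper_def)
    then have "ennreal (upper u k x powr 1) \<le> ennreal ((1 / \<delta>) powr (p - 1)) * ennreal (upper u k0 x powr p)"
      by (simp add: upper_nonneg ennreal_leI flip: ennreal_mult)
    then show "indicator (ball z \<rho>) x * ennreal (upper u k x powr 1) \<le> ennreal ((1 / \<delta>) powr (p - 1)) * (indicator (ball z \<rho>) x * ennreal (upper u k0 x powr p))"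
      by (auto simp: indicator_def)
  qed
  also have "\<dots> = ennreal ((1 / \<delta>) powr (p - 1)) * mass p u k0 z \<rho>"
    unfolding mass_def by (rule nn_integral_cmult) measurable
  finally show ?thesis .
qed

lemma superlevel_measure_le:
  fixes z :: "'a::euclidean_space"
  assumes [measurable]: "u \<in> borel_measurable borel" and \<delta>: "0 < \<delta>" "k = k0 + \<delta>" and p: "0 < p"
  shows "emeasure lborel {x \<in> ball z \<rho>. k < u x} \<le> ennreal ((1 / \<delta>) powr p) * mass p u k0 z \<rho>"
proof -
  define A where "A = {x \<in> ball z \<rho>. k < u x}"
  have [measurable]: "A \<in> sets borel" unfolding A_def by measurable
  have "emeasure lborel A = (\<integral>\<^sup>+x. indicator A x \<partial>lborel)" by simp
  also have "\<dots> \<le> (\<integral>\<^sup>+x. ennreal ((1 / \<delta>) powr p) * (indicator (ball z \<rho>) x * ennreal (upper u k0 x powr p)) \<partial>lborel)"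
  proof (intro nn_integral_mono)
    fix x :: 'a
    show "indicator A x \<le> ennreal ((1 / \<delta>) powr p) * (indicator (ball z \<rho>) x * ennreal (upper u k0 x powr p))"
    proof (cases "x \<in> A")
      case True
      then have u: "\<delta> \<le> upper u k0 x" and x: "x \<in> ball z \<rho>" using \<delta> by (auto simp: upper_def A_def)
      have "1 \<le> (1 / \<delta> * upper u k0 x) powr p" using u \<delta> p by (intro ge_one_powr_ge_zero) auto
      also have "\<dots> = (1 / \<delta>) powr p * upper u k0 x powr p" using \<delta> by (simp only: powr_mult upper_nonneg zero_le_divide_1_iff less_imp_le)
      finally have "ennreal 1 \<le> ennreal ((1 / \<delta>) powr p * upper u k0 x powr p)" by (rule ennreal_leI)
      then show ?thesis using True x by (simp add: ennreal_mult)
    qed simp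
  qed
  also have "\<dots> = ennreal ((1 / \<delta>) powr p) * mass p u k0 z \<rho>"
    unfolding mass_def by (rule nn_integral_cmult) measurable
  finally show ?thesis by (simp add: A_def)
qed

text \<open>Half of the gap between the levels \<open>k0 < k1\<close> bounds the measure of the superlevel set and the integral of the
  first power (Chebyshev); the other half is the parameter of \<open>soft\<close>, because \<open>(u - k1)\<^sub>+ \<le> soft h (u - k1 + h)\<close>.
  The Faber-Krahn inequality turns the small superlevel set into the gain \<open>m\<^sup>p\<^sup>/\<^sup>N\<close>.\<close>

lemma De_Giorgi_step:
  fixes p :: real and \<mu> :: "real measure"
  assumes p: "1 < p" and \<mu>: "finite_measure \<mu>" "sets \<mu> = sets (restrict_space borel {0..1})" "measure \<mu> {1} > 0"
  shows "\<exists>C>0. \<forall>(\<Omega> :: 'a::euclidean_space set) u z R \<rho> r k0 k1 m t.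
    open \<Omega> \<and> weak_subsolution p \<mu> \<Omega> u \<and> u \<in> borel_measurable borel \<and> cball z \<rho> \<subseteq> \<Omega> \<and>
    0 < r \<and> r < \<rho> \<and> R / 2 \<le> \<rho> \<and> \<rho> \<le> R \<and> R \<le> 1 \<and> 0 \<le> k0 \<and> k0 < k1 \<and> 0 < m \<and> 0 \<le> t \<and>
    mass p u k0 z \<rho> \<le> ennreal m \<and> total_tail p \<mu> u z (R / 2) \<le> ennreal t \<longrightarrow>
    mass p u k1 z r \<le> ennreal (C * ((2 / (k1 - k0)) powr p * m) powr (p / DIM('a)) *
       ((\<rho> - r) powr (- p) + (R / (\<rho> - r)) powr (real DIM('a) + p) * (t * (2 / (k1 - k0)) powr (p - 1))) * m)"
proof -
  define N where "N = DIM('a)"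
  have N: "0 < N" by (simp add: N_def)
  define \<omega> where "\<omega> = measure lborel (ball (0::'a) 1)"
  have \<omega>: "0 < \<omega>" unfolding \<omega>_def by (rule content_ball_pos) simp
  obtain C c where C: "0 < C" and c: "0 < c" and energy: "\<forall>(\<Omega> :: 'a set) u z R \<rho> r k h.
    open \<Omega> \<and> weak_subsolution p \<mu> \<Omega> u \<and> u \<in> borel_measurable borel \<and> cball z \<rho> \<subseteq> \<Omega> \<and>
    0 < r \<and> r < \<rho> \<and> R / 2 \<le> \<rho> \<and> \<rho> \<le> R \<and> R \<le> 1 \<and> 0 \<le> k \<and> 0 < h \<longrightarrow>
    (\<exists>v D. H10 p (ball z \<rho>) v D \<and> (\<forall>x. u x \<le> k \<longrightarrow> v x = 0) \<and> (\<forall>x\<in>ball z r. c * soft h (u x - k) \<le> v x) \<and>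
      pint p D \<le> ennreal C * (ennreal ((\<rho> - r) powr (- p)) * mass p u k z \<rho> +
        ennreal ((R / (\<rho> - r)) powr (real DIM('a) + p)) * (total_tail p \<mu> u z (R / 2) * mass 1 u k z \<rho>)))"
    using energy_estimate[OF p \<mu>, where 'a='a] by (elim exE conjE)
  define C' where "C' = (1 / c) powr p * (2 * 6 powr p * (2 / \<omega>) powr (p / N)) * C"
  have C': "0 < C'" using c \<omega> C by (simp add: C'_def)
  show ?thesis
  proof (intro exI[of _ C'] conjI C' allI impI)
    fix \<Omega> :: "'a set" and u :: "'a \<Rightarrow> real" and z :: 'a and R \<rho> r k0 k1 m t :: real
    assume as: "open \<Omega> \<and> weak_subsolution p \<mu> \<Omega> u \<and> u \<in> borel_measurable borel \<and> cball z \<rho> \<subseteq> \<Omega> \<and>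
      0 < r \<and> r < \<rho> \<and> R / 2 \<le> \<rho> \<and> \<rho> \<le> R \<and> R \<le> 1 \<and> 0 \<le> k0 \<and> k0 < k1 \<and> 0 < m \<and> 0 \<le> t \<and>
      mass p u k0 z \<rho> \<le> ennreal m \<and> total_tail p \<mu> u z (R / 2) \<le> ennreal t"
    define h where "h = (k1 - k0) / 2"
    define k where "k = k0 + h"
    have h: "0 < h" "0 \<le> k" "k + h = k1" "2 / (k1 - k0) = 1 / h" using as by (auto simp: h_def k_def field_simps)
    have u [measurable]: "u \<in> borel_measurable borel" using as by simp
    obtain v D where H: "H10 p (ball z \<rho>) v D" and v0: "\<And>x. u x \<le> k \<Longrightarrow> v x = 0" and v1: "\<And>x. x \<in> ball z r \<Longrightarrow> c * soft h (u x - k) \<le> v x"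
      and PD: "pint p D \<le> ennreal C * (ennreal ((\<rho> - r) powr (- p)) * mass p u k z \<rho> +
        ennreal ((R / (\<rho> - r)) powr (real DIM('a) + p)) * (total_tail p \<mu> u z (R / 2) * mass 1 u k z \<rho>))"
    proof -
      have "\<exists>v D. H10 p (ball z \<rho>) v D \<and> (\<forall>x. u x \<le> k \<longrightarrow> v x = 0) \<and> (\<forall>x\<in>ball z r. c * soft h (u x - k) \<le> v x) \<and>
        pint p D \<le> ennreal C * (ennreal ((\<rho> - r) powr (- p)) * mass p u k z \<rho> +
          ennreal ((R / (\<rho> - r)) powr (real DIM('a) + p)) * (total_tail p \<mu> u z (R / 2) * mass 1 u k z \<rho>))"
        by (rule energy[rule_format, of \<Omega>]) (use as h in simp)
      then show thesis using that by blast
    qed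
    note [measurable] = H10_measurable[OF H]
    have "mass p u k z \<rho> \<le> mass p u k0 z \<rho>"
      by (rule mass_mono) (use h p in \<open>auto simp: k_def\<close>)
    then have M: "mass p u k z \<rho> \<le> ennreal m"
      by (rule order_trans) (use as in simp)
    have M1: "mass 1 u k z \<rho> \<le> ennreal ((1 / h) powr (p - 1) * m)"
    proof -
      have "mass 1 u k z \<rho> \<le> ennreal ((1 / h) powr (p - 1)) * mass p u k0 z \<rho>"
        by (rule mass_1_le[OF u h(1) k_def p])
      also have "\<dots> \<le> ennreal ((1 / h) powr (p - 1)) * ennreal m" using as by (intro mult_left_mono) auto
      finally show ?thesis using as by (simp add: ennreal_mult)
    qed
    define e where "e = (\<rho> - r) powr (- p) + (R / (\<rho> - r)) powr (real N + p) * (t * (1 / h) powr (p - 1))"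
    have e: "0 \<le> e" using as by (simp add: e_def)
    have PD': "pint p D \<le> ennreal (C * (e * m))"
    proof -
      have "pint p D \<le> ennreal C * (ennreal ((\<rho> - r) powr (- p)) * mass p u k z \<rho> +
        ennreal ((R / (\<rho> - r)) powr (real N + p)) * (total_tail p \<mu> u z (R / 2) * mass 1 u k z \<rho>))" using PD by (simp add: N_def)
      also have "\<dots> \<le> ennreal C * (ennreal ((\<rho> - r) powr (- p)) * ennreal m +
        ennreal ((R / (\<rho> - r)) powr (real N + p)) * (ennreal t * ennreal ((1 / h) powr (p - 1) * m)))"
        using as by (intro mult_left_mono add_mono mult_mono M M1) auto
      also have "\<dots> = ennreal (C * ((\<rho> - r) powr (- p) * m + (R / (\<rho> - r)) powr (real N + p) * (t * ((1 / h) powr (p - 1) * m))))"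
        using as C by (simp flip: ennreal_mult ennreal_plus)
      also have "C * ((\<rho> - r) powr (- p) * m + (R / (\<rho> - r)) powr (real N + p) * (t * ((1 / h) powr (p - 1) * m))) = C * (e * m)"
        by (simp add: e_def algebra_simps)
      finally show ?thesis .
    qed
    define A where "A = {x \<in> ball z \<rho>. k < u x}"
    define a where "a = (1 / h) powr p * m"
    have a: "0 < a" using h as by (simp add: a_def)
    have A: "emeasure lborel A \<le> ennreal a"
    proof -
      have "emeasure lborel A \<le> ennreal ((1 / h) powr p) * mass p u k0 z \<rho>"
        unfolding A_def by (rule superlevel_measure_le[OF u h(1) k_def]) (use p in simp)
      also have "\<dots> \<le> ennreal ((1 / h) powr p) * ennreal m" using as by (intro mult_left_mono) auto
      finally show ?thesis using as by (simp add: a_def ennreal_mult)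
    qed
    have [measurable]: "A \<in> sets borel" unfolding A_def by measurable
    \<comment> \<open>the radius for which the ball has measure \<open>2 a\<close>\<close>
    define \<tau> where "\<tau> = (2 / \<omega> * a) powr (1 / N)"
    have \<tau>: "0 < \<tau>" using a \<omega> by (simp add: \<tau>_def)
    have "\<tau> ^ N = 2 / \<omega> * a"
      using \<tau> N a \<omega> by (simp add: \<tau>_def powr_powr flip: powr_realpow)
    then have vol: "measure lborel (ball (0::'a) \<tau>) / 2 = a"
      using content_ball_conv_unit_ball[of \<tau> "0::'a"] \<tau> \<omega> by (simp add: N_def \<omega>_def)
    have "pint p v \<le> ennreal (2 * 6 powr p * \<tau> powr p) * pint p D"
    proof (rule Faber_Krahn[OF H _ \<tau>])
      show "v x = 0" if "x \<notin> A" for x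
        using that v0[of x] H10_outside(1)[OF H, of x] by (cases "x \<in> ball z \<rho>") (auto simp: A_def)
      show "emeasure lborel A \<le> ennreal (measure lborel (ball (0::'a) \<tau>) / 2)" using A vol by simp
    qed (use p in auto)
    also have "\<tau> powr p = (2 / \<omega>) powr (p / N) * a powr (p / N)"
      using a \<omega> by (simp add: \<tau>_def powr_powr flip: powr_mult)
    also have "ennreal (2 * 6 powr p * ((2 / \<omega>) powr (p / N) * a powr (p / N))) * pint p D \<le>
       ennreal (2 * 6 powr p * ((2 / \<omega>) powr (p / N) * a powr (p / N))) * ennreal (C * (e * m))"
      by (intro mult_left_mono PD') auto
    also have "\<dots> = ennreal (2 * 6 powr p * ((2 / \<omega>) powr (p / N) * a powr (p / N)) * (C * (e * m)))"
      using C e as by (intro ennreal_mult[symmetric]) auto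
    finally have PV: "pint p v \<le> ennreal (2 * 6 powr p * ((2 / \<omega>) powr (p / N) * a powr (p / N)) * (C * (e * m)))" .
    have "mass p u k1 z r \<le> (\<integral>\<^sup>+x. ennreal ((1 / c) powr p) * ennreal (norm (v x) powr p) \<partial>lborel)"
      unfolding mass_def
    proof (intro nn_integral_mono)
      fix x
      show "indicator (ball z r) x * ennreal (upper u k1 x powr p) \<le> ennreal ((1 / c) powr p) * ennreal (norm (v x) powr p)"
      proof (cases "x \<in> ball z r")
        case True
        have "upper u k1 x \<le> soft h (u x - k)"
          using soft_ge[OF h(1), of "u x - k"] soft_nonneg[of h "u x - k"] h(3) by (simp add: upper_def)
        also have "\<dots> \<le> 1 / c * norm (v x)"
          using v1[OF True] c by (simp add: field_simps)
        finally have "upper u k1 x powr p \<le> (1 / c * norm (v x)) powr p"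
          using p by (intro powr_mono2) (auto simp: upper_nonneg)
        also have "\<dots> = (1 / c) powr p * norm (v x) powr p" by (rule powr_mult)
        finally have "ennreal (upper u k1 x powr p) \<le> ennreal ((1 / c) powr p * norm (v x) powr p)" by (rule ennreal_leI)
        then show ?thesis using True by (simp add: ennreal_mult)
      qed simp
    qed
    also have "\<dots> = ennreal ((1 / c) powr p) * pint p v" unfolding pint_def by (rule nn_integral_cmult) measurable
    also have "\<dots> \<le> ennreal ((1 / c) powr p) * ennreal (2 * 6 powr p * ((2 / \<omega>) powr (p / N) * a powr (p / N)) * (C * (e * m)))"
      by (intro mult_left_mono PV) auto
    also have "\<dots> = ennreal ((1 / c) powr p * (2 * 6 powr p * ((2 / \<omega>) powr (p / N) * a powr (p / N)) * (C * (e * m))))"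
      using C e as by (intro ennreal_mult[symmetric]) auto
    also have "(1 / c) powr p * (2 * 6 powr p * ((2 / \<omega>) powr (p / N) * a powr (p / N)) * (C * (e * m))) = C' * a powr (p / N) * e * m"
      by (simp add: C'_def mult_ac)
    finally show "mass p u k1 z r \<le> ennreal (C' * ((2 / (k1 - k0)) powr p * m) powr (p / DIM('a)) *
       ((\<rho> - r) powr (- p) + (R / (\<rho> - r)) powr (real DIM('a) + p) * (t * (2 / (k1 - k0)) powr (p - 1))) * m)"
      unfolding h(4) a_def e_def N_def .
  qed
qed

text \<open>Iterate over the radii \<open>R/2 + R/2\<^sup>j\<^sup>+\<^sup>1\<close> and the levels \<open>K (1 - 2\<^sup>-\<^sup>j)\<close>.  Divided by \<open>R\<^sup>N K\<^sup>p\<close>, the masses satisfy the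
  recursion of fast geometric convergence with \<open>\<beta> = p/N\<close>, in which neither \<open>R\<close> nor \<open>K\<close> occurs; the bound on the
  tail is just what makes its contribution scale like the local one.\<close>

lemma De_Giorgi_bound:
  fixes p :: real and \<mu> :: "real measure"
  assumes p: "1 < p" and \<mu>: "finite_measure \<mu>" "sets \<mu> = sets (restrict_space borel {0..1})" "measure \<mu> {1} > 0"
  shows "\<exists>c>0. \<forall>(\<Omega> :: 'a::euclidean_space set) u z R K.
    open \<Omega> \<and> weak_subsolution p \<mu> \<Omega> u \<and> u \<in> borel_measurable borel \<and> cball z R \<subseteq> \<Omega> \<and> 0 < R \<and> R \<le> 1 \<and> 0 < K \<and>
    mass p u 0 z R \<le> ennreal (c * R ^ DIM('a) * K powr p) \<and> total_tail p \<mu> u z (R / 2) \<le> ennreal (K powr (p - 1) / R powr p) \<longrightarrow>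
    (AE x in lborel. x \<in> ball z (R / 2) \<longrightarrow> u x \<le> K)"
proof -
  define N where "N = DIM('a)"
  have N: "0 < N" by (simp add: N_def)
  obtain C where C: "0 < C" and step: "\<forall>(\<Omega> :: 'a set) u z R \<rho> r k0 k1 m t.
    open \<Omega> \<and> weak_subsolution p \<mu> \<Omega> u \<and> u \<in> borel_measurable borel \<and> cball z \<rho> \<subseteq> \<Omega> \<and>
    0 < r \<and> r < \<rho> \<and> R / 2 \<le> \<rho> \<and> \<rho> \<le> R \<and> R \<le> 1 \<and> 0 \<le> k0 \<and> k0 < k1 \<and> 0 < m \<and> 0 \<le> t \<and>
    mass p u k0 z \<rho> \<le> ennreal m \<and> total_tail p \<mu> u z (R / 2) \<le> ennreal t \<longrightarrow>
    mass p u k1 z r \<le> ennreal (C * ((2 / (k1 - k0)) powr p * m) powr (p / N) *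
       ((\<rho> - r) powr (- p) + (R / (\<rho> - r)) powr (real N + p) * (t * (2 / (k1 - k0)) powr (p - 1))) * m)"
    using De_Giorgi_step[OF p \<mu>, where 'a='a] unfolding N_def by (elim exE conjE)
  define \<beta> where "\<beta> = p / N"
  have \<beta>: "0 < \<beta>" using p N by (simp add: \<beta>_def)
  define s where "s = p * \<beta> + (real N + p) + p"
  \<comment> \<open>each factor of the recursion is a power of \<open>2\<^sup>j\<^sup>+\<^sup>2\<close>, and \<open>s\<close> collects the exponents\<close>
  define B where "B = 2 powr s"
  have s: "0 < s" using p \<beta> unfolding s_def by (intro add_nonneg_pos add_nonneg_nonneg mult_nonneg_nonneg) auto
  have B: "1 < B" using s powr_less_mono[of 0 s "2::real"] by (simp add: B_def)
  define C' where "C' = 2 * C * B ^ 2"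
  have C': "0 < C'" using C B by (simp add: C'_def)
  define c where "c = C' powr (- 1 / \<beta>) * B powr (- 1 / \<beta>\<^sup>2)"
  have c: "0 < c" using C' B by (simp add: c_def)
  show ?thesis
  proof (intro exI[of _ c] conjI c allI impI)
    fix \<Omega> :: "'a set" and u :: "'a \<Rightarrow> real" and z :: 'a and R K :: real
    assume as: "open \<Omega> \<and> weak_subsolution p \<mu> \<Omega> u \<and> u \<in> borel_measurable borel \<and> cball z R \<subseteq> \<Omega> \<and> 0 < R \<and> R \<le> 1 \<and> 0 < K \<and>
      mass p u 0 z R \<le> ennreal (c * R ^ DIM('a) * K powr p) \<and> total_tail p \<mu> u z (R / 2) \<le> ennreal (K powr (p - 1) / R powr p)"
    then have R: "0 < R" "R \<le> 1" and K: "0 < K" and u [measurable]: "u \<in> borel_measurable borel" by auto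
    define \<rho> where "\<rho> j = R / 2 + R / 2 ^ (j + 1)" for j :: nat
    define k where "k j = K * (1 - 1 / 2 ^ j)" for j :: nat
    define X where "X j = (2::real) ^ (j + 2)" for j :: nat
    have X: "0 < X j" "1 \<le> X j" for j using one_le_power[of "2::real" "j + 2"] by (auto simp: X_def)
    have \<rho>: "\<rho> j - \<rho> (Suc j) = R / X j" "R / 2 < \<rho> j" "\<rho> j \<le> R" for j
      using R by (auto simp: \<rho>_def X_def field_simps)
    have k: "2 / (k (Suc j) - k j) = X j / K" "0 \<le> k j" "k j < k (Suc j)" "k j \<le> K" for j
      using K by (auto simp: k_def X_def field_simps)
    \<comment> \<open>the unit in which the masses are measured\<close>
    define S where "S = R ^ N * K powr p"
    have S: "0 < S" using R K by (simp add: S_def)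
    define G where "G m j = C' * B ^ j * m powr (1 + \<beta>)" for m :: real and j :: nat
    have main: "mass p u (k (Suc j)) z (\<rho> (Suc j)) \<le> ennreal (S * G m j)"
      if m: "0 < m" and le: "mass p u (k j) z (\<rho> j) \<le> ennreal (S * m)" for m j
    proof -
      have "mass p u (k (Suc j)) z (\<rho> (Suc j)) \<le> ennreal (C * ((2 / (k (Suc j) - k j)) powr p * (S * m)) powr (p / N) *
         ((\<rho> j - \<rho> (Suc j)) powr (- p) + (R / (\<rho> j - \<rho> (Suc j))) powr (real N + p) * ((K powr (p - 1) / R powr p) * (2 / (k (Suc j) - k j)) powr (p - 1))) * (S * m))"
      proof (rule step[rule_format, of \<Omega>], intro conjI)
        show "cball z (\<rho> j) \<subseteq> \<Omega>" using as \<rho>(3)[of j] subset_cball[of "\<rho> j" R z] by blast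
        show "0 < \<rho> (Suc j)" "\<rho> (Suc j) < \<rho> j" "R / 2 \<le> \<rho> j" using \<rho>(2)[of j] \<rho>(2)[of "Suc j"] \<rho>(1)[of j] R X(1)[of j] by (auto simp: less_imp_le intro: order.strict_trans2) (smt (verit) divide_pos_pos)
        show "\<rho> j \<le> R" "R \<le> 1" "0 \<le> k j" "k j < k (Suc j)" using \<rho> R k by auto
        show "0 < S * m" using S m by simp
        show "0 \<le> K powr (p - 1) / R powr p" by simp
      qed (use as le in auto)
      also have "C * ((2 / (k (Suc j) - k j)) powr p * (S * m)) powr (p / N) *
         ((\<rho> j - \<rho> (Suc j)) powr (- p) + (R / (\<rho> j - \<rho> (Suc j))) powr (real N + p) * ((K powr (p - 1) / R powr p) * (2 / (k (Suc j) - k j)) powr (p - 1))) * (S * m)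
        \<le> S * G m j"
      proof -
        have t1: "((2 / (k (Suc j) - k j)) powr p * (S * m)) powr (p / N) = X j powr (p * \<beta>) * R powr p * m powr \<beta>"
        proof -
          have eq: "(2 / (k (Suc j) - k j)) powr p * (S * m) = X j powr p * R ^ N * m"
            using K X[of j] R unfolding k(1) S_def by (simp add: powr_divide)
          have RN: "(R ^ N) powr \<beta> = R powr p"
            using R N by (simp add: \<beta>_def powr_powr flip: powr_realpow)
          have "((2 / (k (Suc j) - k j)) powr p * (S * m)) powr (p / N) = (X j powr p) powr \<beta> * (R ^ N) powr \<beta> * m powr \<beta>"
            unfolding eq by (simp only: powr_mult \<beta>_def)
          then show ?thesis by (simp only: powr_powr RN)
        qed
        have t2: "(\<rho> j - \<rho> (Suc j)) powr (- p) = X j powr p / R powr p"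
          unfolding \<rho>(1) using R X[of j] by (simp add: powr_divide powr_minus field_simps)
        have t3: "(R / (\<rho> j - \<rho> (Suc j))) powr (real N + p) = X j powr (real N + p)"
          unfolding \<rho>(1) using R by simp
        have t4: "(K powr (p - 1) / R powr p) * (2 / (k (Suc j) - k j)) powr (p - 1) = X j powr (p - 1) / R powr p"
          unfolding k(1) using K X[of j] by (simp add: powr_divide)
        have "X j powr p \<le> X j powr (real N + p) * X j powr p"
          using X[of j] p by (intro mult_le_cancel_right1[THEN iffD2] conjI impI) (auto intro!: ge_one_powr_ge_zero)
        moreover have "X j powr (real N + p) * X j powr (p - 1) \<le> X j powr (real N + p) * X j powr p"
          using X[of j] by (intro mult_left_mono powr_mono) auto
        ultimately have t5: "X j powr p + X j powr (real N + p) * X j powr (p - 1) \<le> 2 * (X j powr (real N + p) * X j powr p)" by linarith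
        have XB: "X j powr (p * \<beta>) * (X j powr (real N + p) * X j powr p) = B ^ (j + 2)"
        proof -
          have "X j powr (p * \<beta>) * (X j powr (real N + p) * X j powr p) = X j powr s"
            by (simp add: s_def add_ac flip: powr_add)
          also have "\<dots> = B ^ (j + 2)" unfolding X_def B_def by (rule power_powr_swap) simp
          finally show ?thesis .
        qed
        have "C * (X j powr (p * \<beta>) * R powr p * m powr \<beta>) * (X j powr p / R powr p + X j powr (real N + p) * (X j powr (p - 1) / R powr p)) * (S * m)
          = C * m powr \<beta> * m * S * X j powr (p * \<beta>) * (X j powr p + X j powr (real N + p) * X j powr (p - 1))"
          using R by (simp add: field_simps)
        also have "\<dots> \<le> C * m powr \<beta> * m * S * X j powr (p * \<beta>) * (2 * (X j powr (real N + p) * X j powr p))"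
          using C m S by (intro mult_left_mono t5) auto
        also have "\<dots> = 2 * C * (m * m powr \<beta>) * S * (X j powr (p * \<beta>) * (X j powr (real N + p) * X j powr p))"
          by (simp only: mult_ac)
        also have "\<dots> = S * G m j"
          unfolding XB G_def C'_def using m by (simp add: powr_add power_add power2_eq_square mult_ac)
        finally show ?thesis unfolding t1 t2 t3 t4 .
      qed
      finally show ?thesis by (simp add: ennreal_leI)
    qed
    define a where "a = rec_nat c (\<lambda>j m. G m j)"
    have a: "a 0 = c" "a (Suc j) = C' * B ^ j * a j powr (1 + \<beta>)" for j by (auto simp: a_def G_def)
    have apos: "0 < a j" for j by (induction j) (use c C' B in \<open>auto simp: a\<close>)
    have mass: "mass p u (k j) z (\<rho> j) \<le> ennreal (S * a j)" for j
    proof (induction j)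
      case 0
      have "\<rho> 0 = R" "k 0 = 0" by (auto simp: \<rho>_def k_def)
      then show ?case using as by (simp add: a S_def N_def mult_ac)
    next
      case (Suc j)
      then show ?case using main[OF apos Suc] by (simp add: a G_def)
    qed
    have "a \<longlonglongrightarrow> 0"
      by (rule fast_geometric_convergence[OF _ _ C' B \<beta>]) (use a apos less_imp_le in \<open>auto simp: c_def\<close>)
    then have lim: "(\<lambda>j. ennreal (S * a j)) \<longlonglongrightarrow> ennreal (S * 0)" by (intro tendsto_ennrealI tendsto_mult tendsto_const)
    have "mass p u K z (R / 2) \<le> ennreal (S * a j)" for j
    proof -
      have "mass p u K z (R / 2) \<le> mass p u (k j) z (\<rho> j)"
        by (rule mass_mono) (use k \<rho>(2)[of j] p in auto)
      then show ?thesis using mass by (rule order_trans)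
    qed
    then have "mass p u K z (R / 2) \<le> ennreal (S * 0)" by (intro LIMSEQ_le_const[OF lim]) auto
    then have "(\<integral>\<^sup>+x. indicator (ball z (R / 2)) x * ennreal (upper u K x powr p) \<partial>lborel) = 0" by (simp add: mass_def)
    then have "AE x in lborel. indicator (ball z (R / 2)) x * ennreal (upper u K x powr p) = 0"
      by (subst (asm) nn_integral_0_iff_AE) auto
    then show "AE x in lborel. x \<in> ball z (R / 2) \<longrightarrow> u x \<le> K"
    proof (rule eventually_mono, intro impI)
      fix x assume "indicator (ball z (R / 2)) x * ennreal (upper u K x powr p) = 0" "x \<in> ball z (R / 2)"
      then have "upper u K x powr p \<le> 0" by (simp add: ennreal_eq_0_iff)
      then have "upper u K x powr p = 0" using powr_ge_zero[of "upper u K x" p] by linarith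
      then have "upper u K x = 0" by simp
      then show "u x \<le> K" by (simp add: upper_def)
    qed
  qed
qed

section \<open>Comparison of tails\<close>

lemma Young_crude:
  fixes a b p :: real
  assumes "0 \<le> a" "0 \<le> b" "1 < p" shows "a powr (p - 1) * b \<le> a powr p + b powr p"
proof -
  have "a powr (p - 1) * b \<le> max a b powr (p - 1) * max a b"
    using assms by (intro mult_mono powr_mono2) auto
  also have "\<dots> = max a b powr p" using assms powr_mult_base[of "max a b" "p - 1"] by (simp add: mult.commute max_def)
  also have "\<dots> \<le> a powr p + b powr p" by (auto simp: max_def)
  finally show ?thesis .
qed

text \<open>For \<open>y\<close> outside the ball around \<open>x0\<close> the distances to \<open>z\<close> and to \<open>x0\<close> are comparable.  For \<open>y\<close> inside it,
  Young's inequality separates \<open>u\<^sub>+\<^sup>p\<^sup>-\<^sup>1\<close> from the kernel; the scale \<open>l\<close> is left free to balance the two terms.\<close>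

lemma far_mass_split:
  fixes u :: "'a::euclidean_space \<Rightarrow> real"
  assumes [measurable]: "u \<in> borel_measurable borel" and p: "1 < p" and s: "0 < s" "s < 1"
    and z: "z \<in> ball x0 (r / 2)" and r: "0 < r" and S: "0 < S" "S \<le> 1" and l: "0 < l"
  shows "far_mass p u z S s \<le> ennreal (2 powr (real DIM('a) + p)) * far_mass p u x0 (r / 2) s +
    ennreal (S powr (- (real DIM('a) + p)) * l powr (p - 1)) * (ennreal (l powr (- p)) * mass p u 0 x0 r +
      ennreal (measure lborel (ball (0::'a) 1) * 2 ^ DIM('a) * (1 / (1 - 2 powr (real DIM('a) - real DIM('a) * p))) * S ^ DIM('a)))"
proof -
  define N where "N = real DIM('a)"
  have N: "1 \<le> N" by (simp add: N_def)
  define q where "q = N + s * p"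
  have q: "0 \<le> q" "N \<le> q" "q \<le> N + p" using N p s mult_right_mono[of s 1 p] by (auto simp: q_def add_nonneg_nonneg)
  define U where "U = upper u 0"
  have [measurable]: "U \<in> borel_measurable borel" unfolding U_def by measurable
  have U: "0 \<le> U y" for y by (simp add: U_def upper_nonneg)
  define c1 where "c1 = 2 powr (N + p)"
  define c2 where "c2 = S powr (- (N + p)) * l powr (p - 1)"
  define c3 where "c3 = l powr (- p)"
  have c: "0 \<le> c1" "0 \<le> c2" "0 \<le> c3" by (auto simp: c1_def c2_def c3_def)
  let ?f = "\<lambda>y. indicator (- ball x0 (r / 2)) y * ennreal (U y powr (p - 1) / norm (y - x0) powr q)"
  let ?g = "\<lambda>y. indicator (ball x0 r) y * ennreal (U y powr p)"
  let ?h = "\<lambda>y. indicator (- ball 0 S) (y + - z) * ennreal ((S / norm (y + - z)) powr (N * p))"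
  have pt: "indicator (- ball z S) y * ennreal (U y powr (p - 1) / norm (y - z) powr q)
     \<le> ennreal c1 * ?f y + ennreal c2 * (ennreal c3 * ?g y + ?h y)" for y
  proof (cases "y \<in> ball z S")
    case False
    then have yz: "S \<le> norm (y - z)" by (simp add: dist_norm norm_minus_commute)
    then have yz0: "0 < norm (y - z)" using S by linarith
    show ?thesis
    proof (cases "y \<in> ball x0 r")
      case True
      define b where "b = (S / norm (y - z)) powr N"
      have Sy: "0 \<le> S / norm (y - z)" "S / norm (y - z) \<le> 1" using S yz yz0 by auto
      have "U y powr (p - 1) / norm (y - z) powr q = S powr (- q) * (U y powr (p - 1) * (S / norm (y - z)) powr q)"
        using S by (simp add: powr_divide powr_minus field_simps)
      also have "\<dots> \<le> S powr (- (N + p)) * (U y powr (p - 1) * b)"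
        unfolding b_def using S q Sy by (intro mult_mono powr_mono' mult_left_mono) auto
      also have "U y powr (p - 1) * b = l powr (p - 1) * ((U y / l) powr (p - 1) * b)"
        using l by (simp add: powr_divide)
      also have "S powr (- (N + p)) * (l powr (p - 1) * ((U y / l) powr (p - 1) * b)) \<le> S powr (- (N + p)) * (l powr (p - 1) * ((U y / l) powr p + b powr p))"
        using U l p by (intro mult_left_mono Young_crude) (auto simp: b_def)
      also have "(U y / l) powr p = c3 * U y powr p" using l by (simp add: c3_def powr_divide powr_minus field_simps)
      also have "b powr p = (S / norm (y - z)) powr (N * p)" by (simp add: b_def powr_powr)
      also have "S powr (- (N + p)) * (l powr (p - 1) * (c3 * U y powr p + (S / norm (y - z)) powr (N * p))) = c2 * (c3 * U y powr p + (S / norm (y - z)) powr (N * p))"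
        by (simp add: c2_def)
      finally have "ennreal (U y powr (p - 1) / norm (y - z) powr q) \<le> ennreal (c2 * (c3 * U y powr p + (S / norm (y - z)) powr (N * p)))"
        by (rule ennreal_leI)
      also have "\<dots> = ennreal c2 * (ennreal c3 * ennreal (U y powr p) + ennreal ((S / norm (y - z)) powr (N * p)))"
        using c by (simp add: ennreal_mult ennreal_plus)
      also have "\<dots> = ennreal c2 * (ennreal c3 * ?g y + ?h y)"
        using True yz by simp
      also have "\<dots> \<le> ennreal c1 * ?f y + ennreal c2 * (ennreal c3 * ?g y + ?h y)" by (rule add_increasing) auto
      finally show ?thesis using False by simp
    next
      case y: False
      then have yx: "r \<le> norm (y - x0)" by (simp add: dist_norm norm_minus_commute)
      have "norm (x0 - z) \<le> r / 2" using z by (simp add: dist_norm)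
      moreover have "norm (y - x0) \<le> norm (y - z) + norm (x0 - z)"
        using norm_triangle_ineq[of "y - z" "z - x0"] by (simp add: norm_minus_commute)
      ultimately have half: "norm (y - x0) / 2 \<le> norm (y - z)" using yx by linarith
      have yx0: "0 < norm (y - x0)" using yx r by linarith
      have "(norm (y - x0) / 2) powr q \<le> norm (y - z) powr q" using half q by (intro powr_mono2) auto
      then have "U y powr (p - 1) / norm (y - z) powr q \<le> U y powr (p - 1) / (norm (y - x0) / 2) powr q"
        using yx0 yz0 by (intro divide_left_mono mult_pos_pos) auto
      also have "\<dots> = 2 powr q * (U y powr (p - 1) / norm (y - x0) powr q)" by (simp add: powr_divide)
      also have "\<dots> \<le> c1 * (U y powr (p - 1) / norm (y - x0) powr q)"
        unfolding c1_def using q by (intro mult_right_mono powr_mono) auto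
      finally have "ennreal (U y powr (p - 1) / norm (y - z) powr q) \<le> ennreal (c1 * (U y powr (p - 1) / norm (y - x0) powr q))"
        by (rule ennreal_leI)
      also have "\<dots> = ennreal c1 * ennreal (U y powr (p - 1) / norm (y - x0) powr q)"
        using c by (intro ennreal_mult) auto
      also have "\<dots> = ennreal c1 * ?f y" using y r by simp
      also have "\<dots> \<le> ennreal c1 * ?f y + ennreal c2 * (ennreal c3 * ?g y + ?h y)" by (rule add_increasing2) auto
      finally show ?thesis using False by simp
    qed
  qed simp
  have "far_mass p u z S s = (\<integral>\<^sup>+y. indicator (- ball z S) y * ennreal (U y powr (p - 1) / norm (y - z) powr q) \<partial>lborel)"
    by (simp add: far_mass_def U_def q_def N_def)
  also have "\<dots> \<le> (\<integral>\<^sup>+y. ennreal c1 * ?f y + ennreal c2 * (ennreal c3 * ?g y + ?h y) \<partial>lborel)"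
    by (intro nn_integral_mono pt)
  also have "\<dots> = ennreal c1 * (\<integral>\<^sup>+y. ?f y \<partial>lborel) + ennreal c2 * (ennreal c3 * (\<integral>\<^sup>+y. ?g y \<partial>lborel) + (\<integral>\<^sup>+y. ?h y \<partial>lborel))"
    by (simp add: nn_integral_add nn_integral_cmult)
  also have "(\<integral>\<^sup>+y. ?f y \<partial>lborel) = far_mass p u x0 (r / 2) s" by (simp add: far_mass_def U_def q_def N_def)
  also have "(\<integral>\<^sup>+y. ?g y \<partial>lborel) = mass p u 0 x0 r" by (simp add: mass_def U_def)
  also have "(\<integral>\<^sup>+y. ?h y \<partial>lborel) = (\<integral>\<^sup>+y. indicator (- ball 0 S) y * ennreal ((S / norm (y::'a)) powr (N * p)) \<partial>lborel)"
    by (rule nn_integral_lborel_shift) measurable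
  also have "\<dots> \<le> ennreal (measure lborel (ball (0::'a) 1) * 2 ^ DIM('a) * (1 / (1 - 2 powr (real DIM('a) - N * p))) * S ^ DIM('a))"
    by (rule kernel_far[OF _ S(1)]) (use N p in \<open>auto simp: N_def\<close>)
  finally show ?thesis
    unfolding c1_def c2_def c3_def N_def by (simp add: add_left_mono mult_left_mono)
qed

lemma total_tail_split:
  fixes u :: "'a::euclidean_space \<Rightarrow> real"
  assumes u [measurable]: "u \<in> borel_measurable borel" and p: "1 < p"
    and \<mu>: "finite_measure \<mu>" "sets \<mu> = sets (restrict_space borel {0..1})"
    and K: "0 \<le> K" "\<And>s. 0 < s \<Longrightarrow> s < 1 \<Longrightarrow> 0 \<le> C_norm DIM('a) s p \<and> C_norm DIM('a) s p \<le> K * (1 - s)"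
    and z: "z \<in> ball x0 (r / 2)" and r: "0 < r" and S: "0 < S" "S \<le> 1" and l: "0 < l"
  shows "total_tail p \<mu> u z S \<le> ennreal (2 powr (real DIM('a) + p)) * total_tail p \<mu> u x0 (r / 2) +
    ennreal (K * measure \<mu> (space \<mu>)) *
    (ennreal (S powr (- (real DIM('a) + p)) * l powr (p - 1)) * (ennreal (l powr (- p)) * mass p u 0 x0 r +
      ennreal (measure lborel (ball (0::'a) 1) * 2 ^ DIM('a) * (1 / (1 - 2 powr (real DIM('a) - real DIM('a) * p))) * S ^ DIM('a))))"
    (is "_ \<le> ennreal ?c * _ + _ * ?E")
proof -
  interpret \<mu>: finite_measure \<mu> by (rule \<mu>)
  have I [measurable]: "{0<..<1} \<in> sets \<mu>" by (rule open_interval_in_mu[OF \<mu>(2)])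
  have [measurable]: "(\<lambda>s. ennreal (C_norm DIM('a) s p)) \<in> borel_measurable \<mu>" "far_mass p u x0 (r / 2) \<in> borel_measurable \<mu>"
    by (auto intro!: borel_imp_measurable_mu[OF \<mu>(2)])
  have pt: "indicator {0<..<1} s * ennreal (C_norm DIM('a) s p) * far_mass p u z S s \<le>
     ennreal ?c * (indicator {0<..<1} s * ennreal (C_norm DIM('a) s p) * far_mass p u x0 (r / 2) s) + (ennreal K * ?E) * indicator {0<..<1} s" for s
  proof (cases "s \<in> {0<..<1}")
    case True
    then have s: "0 < s" "s < 1" by auto
    have "C_norm DIM('a) s p \<le> K * (1 - s)" using K(2)[OF s] by simp
    also have "\<dots> \<le> K * 1" using K(1) s by (intro mult_left_mono) auto
    finally have C: "C_norm DIM('a) s p \<le> K" by simp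
    have "ennreal (C_norm DIM('a) s p) * far_mass p u z S s \<le> ennreal (C_norm DIM('a) s p) * (ennreal ?c * far_mass p u x0 (r / 2) s + ?E)"
      by (intro mult_left_mono far_mass_split[OF u p s z r S l]) auto
    also have "\<dots> = ennreal ?c * (ennreal (C_norm DIM('a) s p) * far_mass p u x0 (r / 2) s) + ennreal (C_norm DIM('a) s p) * ?E"
      by (simp only: distrib_left mult_ac)
    also have "\<dots> \<le> ennreal ?c * (ennreal (C_norm DIM('a) s p) * far_mass p u x0 (r / 2) s) + ennreal K * ?E"
      using C by (intro add_left_mono mult_right_mono ennreal_leI) auto
    finally show ?thesis using True by simp
  qed simp
  have "total_tail p \<mu> u z S \<le> (\<integral>\<^sup>+s. ennreal ?c * (indicator {0<..<1} s * ennreal (C_norm DIM('a) s p) * far_mass p u x0 (r / 2) s) + (ennreal K * ?E) * indicator {0<..<1} s \<partial>\<mu>)"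
    unfolding total_tail_def by (intro nn_integral_mono pt)
  also have "\<dots> = ennreal ?c * total_tail p \<mu> u x0 (r / 2) + (ennreal K * ?E) * emeasure \<mu> {0<..<1}"
    unfolding total_tail_def by (subst nn_integral_add) (auto simp: nn_integral_cmult nn_integral_cmult_indicator)
  also have "\<dots> \<le> ennreal ?c * total_tail p \<mu> u x0 (r / 2) + (ennreal K * ?E) * ennreal (measure \<mu> (space \<mu>))"
    using emeasure_mono[of "{0<..<1}" "space \<mu>" \<mu>] sets.sets_into_space[OF I]
    by (intro add_left_mono mult_left_mono) (auto simp: \<mu>.emeasure_eq_measure)
  also have "(ennreal K * ?E) * ennreal (measure \<mu> (space \<mu>)) = ennreal (K * measure \<mu> (space \<mu>)) * ?E"
  proof -
    have "ennreal (K * measure \<mu> (space \<mu>)) = ennreal K * ennreal (measure \<mu> (space \<mu>))"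
      using K(1) by (intro ennreal_mult) auto
    then show ?thesis by (simp only: mult_ac)
  qed
  finally show ?thesis .
qed

lemma Tail_positive_part:
  fixes u :: "'a::euclidean_space \<Rightarrow> real"
  shows "Tail p \<mu> (\<lambda>x. max (u x) 0) x0 r = ennreal_powr
     (\<integral>\<^sup>+s. indicator {0<..<1} s * (ennreal (C_norm DIM('a) s p * r powr (s * p)) * far_mass p u x0 r s) \<partial>\<mu>) (1 / (p - 1))"
  unfolding Tail_def far_mass_def nn_integral_completion upper_def
  by (simp add: mult.commute[of _ "indicator _ _"])

text \<open>As \<open>r \<le> 1\<close>, the factor \<open>r\<^sup>s\<^sup>p\<close> inside the tail is at least \<open>r\<^sup>p\<close>.\<close>

lemma total_tail_le_Tail:
  fixes u :: "'a::euclidean_space \<Rightarrow> real"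
  assumes u [measurable]: "u \<in> borel_measurable borel" and p: "1 < p" and \<mu>: "sets \<mu> = sets (restrict_space borel {0..1})"
    and C: "\<And>s. 0 < s \<Longrightarrow> s < 1 \<Longrightarrow> 0 \<le> C_norm DIM('a) s p"
    and T: "Tail p \<mu> (\<lambda>x. max (u x) 0) x0 r = ennreal t" "0 \<le> t" and r: "0 < r" "r \<le> 1"
  shows "total_tail p \<mu> u x0 r \<le> ennreal (r powr (- p) * t powr (p - 1))"
proof -
  define I where "I = (\<integral>\<^sup>+s. indicator {0<..<1} s * (ennreal (C_norm DIM('a) s p * r powr (s * p)) * far_mass p u x0 r s) \<partial>\<mu>)"
  have I: "I = ennreal (t powr (p - 1))"
  proof -
    have eq: "ennreal_powr I (1 / (p - 1)) = ennreal t" using T by (simp add: Tail_positive_part I_def)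
    then obtain i where i: "I = ennreal i" "0 \<le> i" by (cases I) (auto simp: ennreal_powr_def)
    then have "i powr (1 / (p - 1)) = t" using eq T(2) by (simp add: ennreal_powr_def)
    then have "t powr (p - 1) = i" using i p by (auto simp: powr_powr)
    then show ?thesis using i by simp
  qed
  have [measurable]: "{0<..<1} \<in> sets \<mu>" by (rule open_interval_in_mu[OF \<mu>])
  have [measurable]: "(\<lambda>s. ennreal (C_norm DIM('a) s p * r powr (s * p))) \<in> borel_measurable \<mu>" "far_mass p u x0 r \<in> borel_measurable \<mu>"
    by (rule borel_imp_measurable_mu[OF \<mu>], measurable)+
  have "total_tail p \<mu> u x0 r \<le> (\<integral>\<^sup>+s. ennreal (r powr (- p)) * (indicator {0<..<1} s * (ennreal (C_norm DIM('a) s p * r powr (s * p)) * far_mass p u x0 r s)) \<partial>\<mu>)"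
    unfolding total_tail_def
  proof (intro nn_integral_mono)
    fix s
    show "indicator {0<..<1} s * ennreal (C_norm DIM('a) s p) * far_mass p u x0 r s \<le>
      ennreal (r powr (- p)) * (indicator {0<..<1} s * (ennreal (C_norm DIM('a) s p * r powr (s * p)) * far_mass p u x0 r s))"
    proof (cases "s \<in> {0<..<1}")
      case True
      then have s: "0 < s" "s < 1" by auto
      have "s * p \<le> p" using s p by simp
      then have "r powr p \<le> r powr (s * p)" using r by (intro powr_mono') auto
      then have "1 \<le> r powr (- p) * r powr (s * p)" using r by (simp add: powr_minus field_simps)
      then have "C_norm DIM('a) s p * 1 \<le> C_norm DIM('a) s p * (r powr (- p) * r powr (s * p))"
        using C[OF s] by (intro mult_left_mono) auto
      then have "ennreal (C_norm DIM('a) s p) \<le> ennreal (r powr (- p) * (C_norm DIM('a) s p * r powr (s * p)))"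
        by (intro ennreal_leI) (simp add: mult_ac)
      also have "\<dots> = ennreal (r powr (- p)) * ennreal (C_norm DIM('a) s p * r powr (s * p))"
        using C[OF s] by (intro ennreal_mult) auto
      finally have "ennreal (C_norm DIM('a) s p) * far_mass p u x0 r s \<le> ennreal (r powr (- p)) * ennreal (C_norm DIM('a) s p * r powr (s * p)) * far_mass p u x0 r s"
        by (rule mult_right_mono) simp
      then show ?thesis using True by (simp add: mult.assoc)
    qed simp
  qed
  also have "\<dots> = ennreal (r powr (- p)) * I" unfolding I_def by (rule nn_integral_cmult) measurable
  also have "\<dots> = ennreal (r powr (- p) * t powr (p - 1))" unfolding I by (intro ennreal_mult[symmetric]) auto
  finally show ?thesis .
qed

section \<open>Change of representative\<close>

lemma lebesgue_integral_cong_AE: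
  fixes f g :: "'a::euclidean_space \<Rightarrow> real"
  assumes ae: "AE x in lborel. f x = g x" shows "(LINT x|lebesgue. f x) = (LINT x|lebesgue. g x)"
proof (cases "f \<in> borel_measurable lebesgue")
  case True
  then show ?thesis
    by (intro integral_cong_AE lebesgue_measurable_cong_AE[OF True ae] AE_completion ae)
next
  case False
  have "AE x in lborel. g x = f x" using ae by eventually_elim simp
  then have "g \<notin> borel_measurable lebesgue" using False lebesgue_measurable_cong_AE by blast
  then show ?thesis using False borel_measurable_integrable by (metis not_integrable_integral_eq)
qed

text \<open>A Borel null set is needed because \<open>P\<close> itself may fail to be measurable.\<close>

lemma AE_lborel_fst_snd:
  assumes "AE x in lborel. P (x::'a::euclidean_space)"
  shows "AE z in lborel. P (fst z) \<and> P (snd (z :: 'a \<times> 'a))"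
proof -
  obtain N where N: "{x. \<not> P x} \<subseteq> N" "emeasure lborel N = 0" "N \<in> sets borel"
    using AE_E[OF assms] by auto
  then have ae: "AE x in lborel. x \<notin> N" by (subst AE_iff_null_sets[symmetric]) (auto simp: null_sets_def)
  have "AE z in (lborel \<Otimes>\<^sub>M lborel). fst z \<notin> N \<and> snd z \<notin> (N :: 'a set)"
  proof (rule lborel_pair.AE_pair_measure)
    have [measurable]: "N \<in> sets borel" by (rule N(3))
    show "{z \<in> space (lborel \<Otimes>\<^sub>M lborel). fst z \<notin> N \<and> snd z \<notin> N} \<in> sets (lborel \<Otimes>\<^sub>M lborel)" by measurable
    show "AE x in lborel. AE y in lborel. fst (x, y) \<notin> N \<and> snd (x, y) \<notin> N"
      using ae by eventually_elim (use ae in simp)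
  qed
  then have "AE z in lborel. fst z \<notin> N \<and> snd z \<notin> N" by (simp only: lborel_prod)
  then show ?thesis by (rule eventually_mono) (use N(1) in auto)
qed

lemma Tail_cong_AE:
  fixes u u' :: "'a::euclidean_space \<Rightarrow> real"
  assumes "AE x in lborel. u x = u' x" shows "Tail p \<mu> u x0 r = Tail p \<mu> u' x0 r"
proof -
  have "(\<integral>\<^sup>+y\<in>- ball x0 r. ennreal (\<bar>u y\<bar> powr (p - 1) / norm (y - x0) powr (real DIM('a) + s * p)) \<partial>lebesgue) =
    (\<integral>\<^sup>+y\<in>- ball x0 r. ennreal (\<bar>u' y\<bar> powr (p - 1) / norm (y - x0) powr (real DIM('a) + s * p)) \<partial>lebesgue)" for s
    unfolding nn_integral_completion using assms by (intro nn_integral_cong_AE) (auto elim!: eventually_mono)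
  then show ?thesis by (simp add: Tail_def)
qed

text \<open>Every ingredient of the definition is an integral or is defined through integrals, including the chosen
  weak gradient, since the predicate it is chosen from does not change.\<close>

lemma weak_subsolution_cong_AE:
  fixes u u' :: "'a::euclidean_space \<Rightarrow> real"
  assumes ae: "AE x in lborel. u x = u' x" and sub: "weak_subsolution p \<mu> \<Omega> u"
  shows "weak_subsolution p \<mu> \<Omega> u'"
proof -
  have ae': "AE x in lborel. x \<in> S \<longrightarrow> u x = u' x" "AE x in lborel. x \<in> S \<longrightarrow> u' x = u x" for S
    using ae by (auto elim!: eventually_mono)
  have "is_weak_gradient \<Omega> u g = is_weak_gradient \<Omega> u' g" for g
    using is_weak_gradient_cong_AE[of \<Omega> u g u' g] is_weak_gradient_cong_AE[of \<Omega> u' g u g] ae' by auto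
  then have "is_weak_gradient \<Omega> u = is_weak_gradient \<Omega> u'" by blast
  then have wg: "weak_gradient \<Omega> u' = weak_gradient \<Omega> u" and ex: "(\<exists>g. is_weak_gradient \<Omega> u' g) = (\<exists>g. is_weak_gradient \<Omega> u g)"
    by (simp_all add: weak_gradient_def)
  have "W1p_loc p \<Omega> u'" using sub L_pow_loc_cong_AE[OF _ ae'(1)] by (auto simp: weak_subsolution_def W1p_loc_def wg ex)
  moreover have "tail_space p \<mu> u'"
    using sub L_pow_loc_cong_AE[OF _ ae'(1)] Tail_cong_AE[OF ae] by (auto simp: weak_subsolution_def tail_space_def)
  moreover have nf: "nonlocal_form p s u' v = nonlocal_form p s u v" for s v
    unfolding nonlocal_form_def
    by (rule lebesgue_integral_cong_AE, rule eventually_mono[OF AE_lborel_fst_snd[OF ae]]) auto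
  ultimately show ?thesis using sub unfolding weak_subsolution_def wg nf by blast
qed

section \<open>The boundedness theorem\<close>

lemma weak_subsolution_lebesgue_measurable:
  "weak_subsolution p \<mu> \<Omega> u \<Longrightarrow> u \<in> borel_measurable lebesgue"
  by (auto simp: weak_subsolution_def tail_space_def L_pow_loc_def set_borel_measurable_def)

text \<open>Cover the ball of radius \<open>r/2\<close> by balls with radius \<open>R/2\<close>, where \<open>R = \<epsilon> r \<delta>\<^sup>(\<^sup>p\<^sup>-\<^sup>1\<^sup>)\<^sup>/\<^sup>p\<close>.  The tail from outside the
  large ball enters multiplied by \<open>(R/r)\<^sup>p = \<epsilon>\<^sup>p \<delta>\<^sup>p\<^sup>-\<^sup>1\<close>, which is how the factor \<open>\<delta>\<close> in front of the tail
  arises.  The integral of \<open>u\<^sub>+\<^sup>p\<close> has to be small compared with \<open>R\<^sup>N K\<^sup>p\<close>, which is the source of the power of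
  \<open>\<delta>\<close> in the last hypothesis.\<close>

lemma bound_by_level:
  fixes p :: real and \<mu> :: "real measure"
  assumes p: "1 < p" and \<mu>: "finite_measure \<mu>" "sets \<mu> = sets (restrict_space borel {0..1})" "measure \<mu> {1} > 0"
  shows "\<exists>b>0. \<forall>(\<Omega> :: 'a::euclidean_space set) u x0 r \<delta> K t F.
    open \<Omega> \<and> weak_subsolution p \<mu> \<Omega> u \<and> u \<in> borel_measurable borel \<and> ball x0 r \<subseteq> \<Omega> \<and> 0 < r \<and> r \<le> 1 \<and>
    0 < \<delta> \<and> \<delta> \<le> 1 \<and> 0 < K \<and> 0 \<le> t \<and> 0 \<le> F \<and> Tail p \<mu> (\<lambda>x. max (u x) 0) x0 (r / 2) = ennreal t \<and> mass p u 0 x0 r = ennreal F \<and>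
    \<delta> * t \<le> K \<and> F \<le> b * r ^ DIM('a) * \<delta> powr ((p - 1) * DIM('a) / p) * K powr p \<longrightarrow>
    (AE x in lborel. x \<in> ball x0 (r / 2) \<longrightarrow> u x \<le> K)"
proof -
  interpret \<mu>: finite_measure \<mu> by (rule \<mu>)
  define N where "N = DIM('a)"
  have N: "1 \<le> real N" by (simp add: N_def)
  define \<omega> where "\<omega> = measure lborel (ball (0::'a) 1)"
  obtain KC where KC: "0 < KC" "\<And>s. 0 < s \<Longrightarrow> s < 1 \<Longrightarrow> 0 \<le> C_norm N s p \<and> C_norm N s p \<le> KC * (1 - s)"
    using C_norm_bound[OF _ p, of N] by (auto simp: N_def)
  obtain c where c: "0 < c" and local: "\<forall>(\<Omega> :: 'a set) u z R K.
    open \<Omega> \<and> weak_subsolution p \<mu> \<Omega> u \<and> u \<in> borel_measurable borel \<and> cball z R \<subseteq> \<Omega> \<and> 0 < R \<and> R \<le> 1 \<and> 0 < K \<and>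
    mass p u 0 z R \<le> ennreal (c * R ^ DIM('a) * K powr p) \<and> total_tail p \<mu> u z (R / 2) \<le> ennreal (K powr (p - 1) / R powr p) \<longrightarrow>
    (AE x in lborel. x \<in> ball z (R / 2) \<longrightarrow> u x \<le> K)"
    using De_Giorgi_bound[OF p \<mu>, where 'a='a] by (elim exE conjE)
  \<comment> \<open>chosen such that \<open>2\<^sup>N\<^sup>+\<^sup>2\<^sup>p \<epsilon>\<^sup>p = 1/2\<close>: the outer tail uses up half of the admissible tail\<close>
  define \<epsilon> where "\<epsilon> = 2 powr (- (real N + 2 * p + 1) / p)"
  have \<epsilon>: "0 < \<epsilon>" "\<epsilon> \<le> 1 / 4" "\<epsilon> powr p = 2 powr (- (real N + 2 * p + 1))"
  proof -
    show "0 < \<epsilon>" by (simp add: \<epsilon>_def)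
    have "- (real N + 2 * p + 1) / p \<le> - 2" using p N by (simp add: field_simps)
    then have "\<epsilon> \<le> 2 powr (- 2)" unfolding \<epsilon>_def by (intro powr_mono) auto
    then show "\<epsilon> \<le> 1 / 4" by (simp add: powr_minus powr_numeral)
    show "\<epsilon> powr p = 2 powr (- (real N + 2 * p + 1))" using p by (simp add: \<epsilon>_def powr_powr)
  qed
  define CF where "CF = \<omega> * 2 ^ N * (1 / (1 - 2 powr (real N - real N * p)))"
  have CF: "0 \<le> CF"
  proof -
    have "real N \<le> real N * p" using N p mult_left_mono[of 1 p "real N"] by simp
    then have "2 powr (real N - real N * p) \<le> (2::real) powr 0" by (intro powr_mono) auto
    then show ?thesis by (auto simp: CF_def \<omega>_def)
  qed
  define E0 where "E0 = KC * measure \<mu> (space \<mu>) * 2 powr (real N + p) * (c + CF / 2 ^ N)"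
  have E0: "0 \<le> E0" using KC c CF by (simp add: E0_def)
  \<comment> \<open>the scale \<open>\<kappa> K\<close> in Young's inequality is so small that the inner tail uses up the other half\<close>
  define \<kappa> where "\<kappa> = (1 / (2 * (E0 + 1))) powr (1 / (p - 1))"
  have \<kappa>: "0 < \<kappa>" "\<kappa> powr (p - 1) * E0 \<le> 1 / 2"
  proof -
    show "0 < \<kappa>" using E0 by (simp add: \<kappa>_def)
    have "\<kappa> powr (p - 1) = 1 / (2 * (E0 + 1))" using E0 p by (simp add: \<kappa>_def powr_powr)
    then have "\<kappa> powr (p - 1) * E0 = E0 / (2 * (E0 + 1))" by simp
    also have "\<dots> \<le> 1 / 2" using E0 by (simp add: field_simps)
    finally show "\<kappa> powr (p - 1) * E0 \<le> 1 / 2" .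
  qed
  define b where "b = c * min 1 (\<kappa> powr p) * \<epsilon> ^ N"
  have b: "0 < b" using c \<kappa> \<epsilon> by (simp add: b_def)
  show ?thesis
  proof (intro exI[of _ b] conjI b allI impI)
    fix \<Omega> :: "'a set" and u :: "'a \<Rightarrow> real" and x0 :: 'a and r \<delta> K t F :: real
    assume as: "open \<Omega> \<and> weak_subsolution p \<mu> \<Omega> u \<and> u \<in> borel_measurable borel \<and> ball x0 r \<subseteq> \<Omega> \<and> 0 < r \<and> r \<le> 1 \<and>
      0 < \<delta> \<and> \<delta> \<le> 1 \<and> 0 < K \<and> 0 \<le> t \<and> 0 \<le> F \<and> Tail p \<mu> (\<lambda>x. max (u x) 0) x0 (r / 2) = ennreal t \<and> mass p u 0 x0 r = ennreal F \<and>
      \<delta> * t \<le> K \<and> F \<le> b * r ^ DIM('a) * \<delta> powr ((p - 1) * DIM('a) / p) * K powr p"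
    then have u [measurable]: "u \<in> borel_measurable borel" and r: "0 < r" "r \<le> 1" and \<delta>: "0 < \<delta>" "\<delta> \<le> 1" and K: "0 < K" and t: "0 \<le> t"
      and F0: "0 \<le> F" and T: "Tail p \<mu> (\<lambda>x. max (u x) 0) x0 (r / 2) = ennreal t" and MF: "mass p u 0 x0 r = ennreal F" and Kt: "\<delta> * t \<le> K" by auto
    define R where "R = \<epsilon> * r * \<delta> powr ((p - 1) / p)"
    have d1: "0 < \<delta> powr ((p - 1) / p)" "\<delta> powr ((p - 1) / p) \<le> 1"
      using \<delta> p powr_mono2[of "(p - 1) / p" \<delta> 1] by auto
    have R: "0 < R" "R \<le> r / 4" "R \<le> 1" "R / 2 \<le> 1"
    proof -
      show R0: "0 < R" using \<epsilon> r d1 by (simp add: R_def)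
      have "R \<le> 1 / 4 * r * 1" unfolding R_def using \<epsilon> r d1 by (intro mult_mono) auto
      then show "R \<le> r / 4" by simp
      then show "R \<le> 1" using r by simp
      then show "R / 2 \<le> 1" using R0 by simp
    qed
    have Rp: "R powr p = \<epsilon> powr p * r powr p * \<delta> powr (p - 1)"
      using p by (simp add: R_def powr_mult powr_powr)
    have RN: "R ^ N = \<epsilon> ^ N * r ^ N * \<delta> powr ((p - 1) * real N / p)"
    proof -
      have "(\<delta> powr ((p - 1) / p)) ^ N = \<delta> powr ((p - 1) * real N / p)"
        using d1 by (simp add: powr_powr flip: powr_realpow)
      then show ?thesis by (simp add: R_def power_mult_distrib)
    qed
    have Fb: "F \<le> c * min 1 (\<kappa> powr p) * R ^ N * K powr p"
    proof -
      have "F \<le> b * r ^ N * \<delta> powr ((p - 1) * real N / p) * K powr p" using as by (simp add: N_def)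
      also have "b * r ^ N * \<delta> powr ((p - 1) * real N / p) = c * min 1 (\<kappa> powr p) * R ^ N"
        by (simp add: RN b_def mult_ac)
      finally show ?thesis .
    qed
    have F1: "F \<le> c * R ^ N * K powr p"
    proof -
      have "c * min 1 (\<kappa> powr p) * R ^ N * K powr p \<le> c * 1 * R ^ N * K powr p"
        using c R by (intro mult_right_mono mult_left_mono) auto
      then show ?thesis using Fb by simp
    qed
    have F2: "F \<le> c * \<kappa> powr p * R ^ N * K powr p"
    proof -
      have "c * min 1 (\<kappa> powr p) * R ^ N * K powr p \<le> c * \<kappa> powr p * R ^ N * K powr p"
        using c R by (intro mult_right_mono mult_left_mono) auto
      then show ?thesis using Fb by simp
    qed
    show "AE x in lborel. x \<in> ball x0 (r / 2) \<longrightarrow> u x \<le> K"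
    proof (rule AE_open_local)
      fix z assume z: "z \<in> ball x0 (r / 2)"
      have sub: "cball z R \<subseteq> ball x0 r"
      proof
        fix y assume "y \<in> cball z R"
        then show "y \<in> ball x0 r" using z R r dist_triangle[of x0 y z] by simp
      qed
      have "mass p u 0 z R \<le> mass p u 0 x0 r"
        unfolding mass_def
      proof (intro nn_integral_mono mult_right_mono)
        fix x show "indicator (ball z R) x \<le> (indicator (ball x0 r) x :: ennreal)"
          using subset_trans[OF ball_subset_cball sub] by (auto simp: indicator_def simp del: mem_ball)
      qed simp
      also have "\<dots> \<le> ennreal (c * R ^ DIM('a) * K powr p)" unfolding MF using F1 by (intro ennreal_leI) (simp add: N_def)
      finally have m: "mass p u 0 z R \<le> ennreal (c * R ^ DIM('a) * K powr p)" .
      define S where "S = R / 2"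
      have S: "0 < S" "S \<le> 1" using R by (auto simp: S_def)
      define l where "l = \<kappa> * K"
      have l: "0 < l" using \<kappa> K by (simp add: l_def)
      have C: "\<And>s. 0 < s \<Longrightarrow> s < 1 \<Longrightarrow> 0 \<le> C_norm DIM('a) s p \<and> C_norm DIM('a) s p \<le> KC * (1 - s)" using KC by (simp add: N_def)
      have TT: "total_tail p \<mu> u x0 (r / 2) \<le> ennreal ((r / 2) powr (- p) * t powr (p - 1))"
        by (rule total_tail_le_Tail[OF u p \<mu>(2) _ T t]) (use C r in auto)
      have "total_tail p \<mu> u z S \<le> ennreal (2 powr (real N + p)) * total_tail p \<mu> u x0 (r / 2) +
        ennreal (KC * measure \<mu> (space \<mu>)) * (ennreal (S powr (- (real N + p)) * l powr (p - 1)) * (ennreal (l powr (- p)) * ennreal F + ennreal (CF * S ^ N)))"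
        using total_tail_split[OF u p \<mu>(1,2) _ C z r(1) S l] KC(1) unfolding MF CF_def \<omega>_def N_def by simp
      also have "\<dots> \<le> ennreal (2 powr (real N + p)) * ennreal ((r / 2) powr (- p) * t powr (p - 1)) +
        ennreal (KC * measure \<mu> (space \<mu>)) * (ennreal (S powr (- (real N + p)) * l powr (p - 1)) * (ennreal (l powr (- p)) * ennreal F + ennreal (CF * S ^ N)))"
        by (intro add_right_mono mult_left_mono TT) auto
      also have "\<dots> = ennreal (2 powr (real N + p) * ((r / 2) powr (- p) * t powr (p - 1)) +
        KC * measure \<mu> (space \<mu>) * (S powr (- (real N + p)) * l powr (p - 1) * (l powr (- p) * F + CF * S ^ N)))"
        using KC CF S F0 by (simp flip: ennreal_mult ennreal_plus)
      also have "\<dots> \<le> ennreal (K powr (p - 1) / R powr p)"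
      proof (rule ennreal_leI)
        have far: "2 powr (real N + p) * ((r / 2) powr (- p) * t powr (p - 1)) \<le> (K powr (p - 1) / R powr p) / 2"
        proof -
          have e: "2 powr (real N + p) * 2 powr p * \<epsilon> powr p = 1 / 2"
          proof -
            have "2 powr (real N + p) * 2 powr p * \<epsilon> powr p = (2::real) powr (- 1)"
              unfolding \<epsilon>(3) by (simp add: powr_add[symmetric])
            then show ?thesis by (simp add: powr_neg_one)
          qed
          have "2 powr (real N + p) * ((r / 2) powr (- p) * t powr (p - 1)) * R powr p =
            (2 powr (real N + p) * 2 powr p * \<epsilon> powr p) * (\<delta> powr (p - 1) * t powr (p - 1)) * (r powr (- p) * r powr p)"
            unfolding Rp by (simp add: powr_divide powr_minus field_simps)
          also have "\<dots> = 1 / 2 * (\<delta> * t) powr (p - 1)"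
            unfolding e using r by (simp add: powr_mult powr_minus)
          also have "\<dots> \<le> 1 / 2 * K powr (p - 1)"
            using Kt \<delta> t p by (intro mult_left_mono powr_mono2) auto
          finally show ?thesis using R by (simp add: field_simps)
        qed
        have near: "KC * measure \<mu> (space \<mu>) * (S powr (- (real N + p)) * l powr (p - 1) * (l powr (- p) * F + CF * S ^ N)) \<le> (K powr (p - 1) / R powr p) / 2"
        proof -
          have "l powr (- p) * F \<le> l powr (- p) * (c * \<kappa> powr p * R ^ N * K powr p)" using F2 by (intro mult_left_mono) auto
          also have "\<dots> = c * R ^ N" using \<kappa>(1) K by (simp add: l_def powr_mult powr_minus field_simps)
          finally have lF: "l powr (- p) * F \<le> c * R ^ N" .
          have SN: "CF * S ^ N = CF / 2 ^ N * R ^ N" by (simp add: S_def power_divide)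
          have Sp: "S powr (- (real N + p)) = 2 powr (real N + p) * (1 / (R ^ N * R powr p))"
          proof -
            have "S powr (- (real N + p)) = 2 powr (real N + p) / R powr (real N + p)"
              unfolding S_def powr_minus_divide powr_divide by simp
            also have "R powr (real N + p) = R ^ N * R powr p" using R by (simp add: powr_add powr_realpow)
            finally show ?thesis by simp
          qed
          have "KC * measure \<mu> (space \<mu>) * (S powr (- (real N + p)) * l powr (p - 1) * (l powr (- p) * F + CF * S ^ N))
            \<le> KC * measure \<mu> (space \<mu>) * (S powr (- (real N + p)) * l powr (p - 1) * (c * R ^ N + CF / 2 ^ N * R ^ N))"
            unfolding SN using KC lF by (intro mult_left_mono add_right_mono) auto
          also have "\<dots> = (\<kappa> powr (p - 1) * E0) * (K powr (p - 1) / R powr p)"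
            unfolding Sp E0_def l_def using R by (simp add: powr_mult field_simps)
          also have "\<dots> \<le> 1 / 2 * (K powr (p - 1) / R powr p)"
            by (intro mult_right_mono \<kappa>(2)) auto
          finally show ?thesis by simp
        qed
        show "2 powr (real N + p) * ((r / 2) powr (- p) * t powr (p - 1)) +
          KC * measure \<mu> (space \<mu>) * (S powr (- (real N + p)) * l powr (p - 1) * (l powr (- p) * F + CF * S ^ N)) \<le> K powr (p - 1) / R powr p"
          using far near by linarith
      qed
      finally have tt: "total_tail p \<mu> u z (R / 2) \<le> ennreal (K powr (p - 1) / R powr p)" by (simp add: S_def)
      have "AE x in lborel. x \<in> ball z (R / 2) \<longrightarrow> u x \<le> K"
        by (rule local[rule_format, of \<Omega> u z R K]) (use as R K m tt sub in auto)
      then show "\<exists>r>0. AE x in lborel. x \<in> ball z r \<longrightarrow> u x \<le> K" using R by (intro exI[of _ "R / 2"]) simp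
    qed
  qed
qed

theorem theorem1p3:
  fixes p :: real and \<mu> :: "real measure"
  assumes "1 < p"
    and "finite_measure \<mu>"
    and "sets \<mu> = sets (restrict_space borel {0..1})"
    and "measure \<mu> {0<..<1} > 0"
    and "measure \<mu> {0} = 0"
    and "measure \<mu> {1} > 0"
  shows "\<exists>C>0. \<forall>(\<Omega> :: 'a::euclidean_space set) u x0 r \<delta>.
    open \<Omega> \<and> connected \<Omega> \<and> \<Omega> \<noteq> {} \<and> bounded \<Omega> \<and> weak_subsolution p \<mu> \<Omega> u \<and>
    0 < r \<and> r \<le> 1 \<and> ball x0 r \<subseteq> \<Omega> \<and> 0 < \<delta> \<and> \<delta> \<le> 1 \<longrightarrow>
    esssup (restrict_space lebesgue (ball x0 (r / 2))) (\<lambda>x. ereal (u x)) \<le>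
      enn2ereal
        (ennreal \<delta> * Tail p \<mu> (\<lambda>x. max (u x) 0) x0 (r / 2) +
         ennreal (C * \<delta> powr (- ((p - 1) * eta DIM('a) p / ((eta DIM('a) p - 1) * p)))) *
         ennreal_powr
           ((\<integral>\<^sup>+x\<in>ball x0 r. ennreal (max (u x) 0 powr p) \<partial>lebesgue) / emeasure lebesgue (ball x0 r))
           (1 / p))"
proof -
  note p = assms(1)
  define N where "N = DIM('a)"
  have N: "1 \<le> real N" by (simp add: N_def)
  define \<omega> where "\<omega> = measure lborel (ball (0::'a) 1)"
  have \<omega>: "0 < \<omega>" unfolding \<omega>_def by (rule content_ball_pos) simp
  define \<gamma> where "\<gamma> = (p - 1) * eta DIM('a) p / ((eta DIM('a) p - 1) * p)"
  have \<gamma>: "(p - 1) * real N / p \<le> \<gamma> * p"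
  proof (cases "p < real N")
    case True
    have "eta N p - 1 = p / (real N - p)" using True by (simp add: eta_def field_simps)
    then have "eta N p / (eta N p - 1) = real N / p" using True p by (simp add: eta_def)
    moreover have "\<gamma> * p = (p - 1) * (eta N p / (eta N p - 1))" using p by (simp add: \<gamma>_def N_def)
    ultimately have "\<gamma> * p = (p - 1) * (real N / p)" by simp
    then show ?thesis by simp
  next
    case False
    then have "\<gamma> * p = (p - 1) * 2" using p by (simp add: \<gamma>_def eta_def N_def)
    moreover have "real N / p \<le> 2" using False p by (simp add: field_simps)
    then have "(p - 1) * (real N / p) \<le> (p - 1) * 2" using p by (intro mult_left_mono) auto
    ultimately show ?thesis by simp
  qed
  obtain b where b: "0 < b" and main: "\<forall>(\<Omega> :: 'a set) u x0 r \<delta> K t F.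
    open \<Omega> \<and> weak_subsolution p \<mu> \<Omega> u \<and> u \<in> borel_measurable borel \<and> ball x0 r \<subseteq> \<Omega> \<and> 0 < r \<and> r \<le> 1 \<and>
    0 < \<delta> \<and> \<delta> \<le> 1 \<and> 0 < K \<and> 0 \<le> t \<and> 0 \<le> F \<and> Tail p \<mu> (\<lambda>x. max (u x) 0) x0 (r / 2) = ennreal t \<and> mass p u 0 x0 r = ennreal F \<and>
    \<delta> * t \<le> K \<and> F \<le> b * r ^ DIM('a) * \<delta> powr ((p - 1) * DIM('a) / p) * K powr p \<longrightarrow>
    (AE x in lborel. x \<in> ball x0 (r / 2) \<longrightarrow> u x \<le> K)"
    using bound_by_level[OF p assms(2,3,6), where 'a='a] by (elim exE conjE)
  define C where "C = (\<omega> / b) powr (1 / p)"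
  have C: "0 < C" using \<omega> b by (simp add: C_def)
  have Cp: "C powr p = \<omega> / b" using \<omega> b p by (simp add: C_def powr_powr)
  show ?thesis
  proof (intro exI[of _ C] conjI C allI impI)
    fix \<Omega> :: "'a set" and u :: "'a \<Rightarrow> real" and x0 :: 'a and r \<delta> :: real
    assume as: "open \<Omega> \<and> connected \<Omega> \<and> \<Omega> \<noteq> {} \<and> bounded \<Omega> \<and> weak_subsolution p \<mu> \<Omega> u \<and>
      0 < r \<and> r \<le> 1 \<and> ball x0 r \<subseteq> \<Omega> \<and> 0 < \<delta> \<and> \<delta> \<le> 1"
    then have r: "0 < r" "r \<le> 1" and \<delta>: "0 < \<delta>" "\<delta> \<le> 1" and sub: "weak_subsolution p \<mu> \<Omega> u" by auto
    have um: "u \<in> borel_measurable lebesgue" by (rule weak_subsolution_lebesgue_measurable[OF sub])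
    obtain w where w: "w \<in> borel_measurable borel" and ae: "AE x in lborel. u x = w x"
      using borel_representative[OF um] by blast
    have subw: "weak_subsolution p \<mu> \<Omega> w" by (rule weak_subsolution_cong_AE[OF ae sub])
    have "AE x in lborel. max (u x) 0 = max (w x) 0" using ae by eventually_elim simp
    then have Tw: "Tail p \<mu> (\<lambda>x. max (u x) 0) x0 (r / 2) = Tail p \<mu> (\<lambda>x. max (w x) 0) x0 (r / 2)"
      by (rule Tail_cong_AE)
    have Mw: "(\<integral>\<^sup>+x\<in>ball x0 r. ennreal (max (u x) 0 powr p) \<partial>lebesgue) = mass p w 0 x0 r"
      unfolding nn_integral_completion mass_def upper_def
      by (rule nn_integral_cong_AE) (use ae in \<open>auto elim!: eventually_mono simp: mult.commute\<close>)
    have Bw: "emeasure lebesgue (ball x0 r) = ennreal (r ^ N * \<omega>)"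
      using emeasure_ball_scaled[of r x0] r by (simp add: N_def \<omega>_def)
    define A where "A = ennreal (C * \<delta> powr (- \<gamma>))"
    define V where "V = ennreal_powr (mass p w 0 x0 r / ennreal (r ^ N * \<omega>)) (1 / p)"
    define T where "T = Tail p \<mu> (\<lambda>x. max (w x) 0) x0 (r / 2)"
    have rw: "0 < r ^ N * \<omega>" using r \<omega> by simp
    have Apos: "0 < C * \<delta> powr (- \<gamma>)" using C \<delta> by simp
    have "esssup (restrict_space lebesgue (ball x0 (r / 2))) (\<lambda>x. ereal (u x)) \<le> enn2ereal (ennreal \<delta> * T + A * V)"
    proof (cases "ennreal \<delta> * T + A * V = \<infinity>")
      case False
      then have T: "T \<noteq> \<infinity>" and V: "V \<noteq> \<infinity>"
        using \<delta> Apos by (auto simp: A_def ennreal_mult_eq_top_iff)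
      obtain t where t: "T = ennreal t" "0 \<le> t" using T by (cases T) auto
      have "mass p w 0 x0 r \<noteq> \<infinity>"
      proof
        assume "mass p w 0 x0 r = \<infinity>"
        then have "mass p w 0 x0 r / ennreal (r ^ N * \<omega>) = \<infinity>" using rw by (simp add: ennreal_top_divide)
        then show False using V by (simp add: V_def ennreal_powr_def)
      qed
      then obtain F where F: "mass p w 0 x0 r = ennreal F" "0 \<le> F" by (cases "mass p w 0 x0 r") auto
      define q where "q = (F / (r ^ N * \<omega>)) powr (1 / p)"
      have Vq: "V = ennreal q" using F rw by (simp add: V_def q_def ennreal_powr_def divide_ennreal)
      define K where "K = \<delta> * t + C * \<delta> powr (- \<gamma>) * q"
      have K0: "0 \<le> K" "\<delta> * t \<le> K" "C * \<delta> powr (- \<gamma>) * q \<le> K" using \<delta> t C by (auto simp: K_def q_def)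
      have eqK: "ennreal \<delta> * T + A * V = ennreal K"
        unfolding t A_def Vq K_def using \<delta> t Apos by (simp add: q_def ennreal_plus ennreal_mult)
      have Fle: "F \<le> b * r ^ N * \<delta> powr ((p - 1) * real N / p) * K powr p"
      proof -
        have "(C * \<delta> powr (- \<gamma>) * q) powr p = C powr p * (\<delta> powr (- \<gamma>)) powr p * q powr p" by (simp only: powr_mult)
        also have "\<dots> = \<omega> / b * \<delta> powr (- (\<gamma> * p)) * (F / (r ^ N * \<omega>))"
          unfolding Cp q_def using F rw p by (simp add: powr_powr)
        finally have eq: "b * r ^ N * ((C * \<delta> powr (- \<gamma>) * q) powr p) = F * \<delta> powr (- (\<gamma> * p))"
          using b r \<omega> by (simp add: field_simps)
        have "1 \<le> \<delta> powr ((p - 1) * real N / p) * \<delta> powr (- (\<gamma> * p))"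
        proof -
          have "\<delta> powr 0 \<le> \<delta> powr ((p - 1) * real N / p - \<gamma> * p)" using \<gamma> \<delta> by (intro powr_mono') auto
          also have "(p - 1) * real N / p - \<gamma> * p = (p - 1) * real N / p + - (\<gamma> * p)" by simp
          finally show ?thesis using \<delta> by (simp only: powr_add) simp
        qed
        then have "F * 1 \<le> F * (\<delta> powr ((p - 1) * real N / p) * \<delta> powr (- (\<gamma> * p)))" using F by (intro mult_left_mono) auto
        then have "F \<le> \<delta> powr ((p - 1) * real N / p) * (b * r ^ N * ((C * \<delta> powr (- \<gamma>) * q) powr p))"
          unfolding eq by (simp add: mult_ac)
        also have "\<dots> = b * r ^ N * \<delta> powr ((p - 1) * real N / p) * (C * \<delta> powr (- \<gamma>) * q) powr p"
          by (simp only: mult_ac)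
        also have "\<dots> \<le> b * r ^ N * \<delta> powr ((p - 1) * real N / p) * K powr p"
          using b r p K0 Apos by (intro mult_left_mono powr_mono2) (auto simp: q_def)
        finally show ?thesis .
      qed
      \<comment> \<open>levels have to be positive, but \<open>K\<close> may be \<open>0\<close>\<close>
      have step: "AE x in lborel. x \<in> ball x0 (r / 2) \<longrightarrow> w x \<le> K + 1 / real (Suc n)" for n
      proof (rule main[rule_format, of \<Omega> w x0 r \<delta> _ t F], intro conjI)
        show "Tail p \<mu> (\<lambda>x. max (w x) 0) x0 (r / 2) = ennreal t" using t by (simp add: T_def)
        show "0 < K + 1 / real (Suc n)" using K0 by (intro add_nonneg_pos) auto
        have n: "K \<le> K + 1 / real (Suc n)" by simp
        then show "\<delta> * t \<le> K + 1 / real (Suc n)" using K0 by linarith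
        have "b * r ^ N * \<delta> powr ((p - 1) * real N / p) * K powr p \<le> b * r ^ N * \<delta> powr ((p - 1) * real N / p) * (K + 1 / real (Suc n)) powr p"
          using b r p K0 n by (intro mult_left_mono powr_mono2) auto
        then show "F \<le> b * r ^ DIM('a) * \<delta> powr ((p - 1) * real DIM('a) / p) * (K + 1 / real (Suc n)) powr p"
          using Fle by (simp add: N_def)
      qed (use as subw w F t in auto)
      have "AE x in lborel. \<forall>n. x \<in> ball x0 (r / 2) \<longrightarrow> w x \<le> K + 1 / real (Suc n)"
        using step by (subst AE_all_countable) auto
      with ae have "AE x in lborel. x \<in> ball x0 (r / 2) \<longrightarrow> u x \<le> K"
      proof eventually_elim
        case (elim x)
        show ?case
        proof
          assume x: "x \<in> ball x0 (r / 2)"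
          have "(\<lambda>n. K + 1 / real (Suc n)) \<longlonglongrightarrow> K + 0"
            using LIMSEQ_inverse_real_of_nat by (intro tendsto_intros) (simp add: inverse_eq_divide)
          then have "w x \<le> K + 0" by (rule LIMSEQ_le_const) (use elim x in auto)
          then show "u x \<le> K" using elim by simp
        qed
      qed
      then have "AE x in restrict_space lebesgue (ball x0 (r / 2)). ereal (u x) \<le> ereal K"
        by (subst AE_restrict_space_iff) (auto intro!: AE_completion elim!: eventually_mono)
      moreover have "(\<lambda>x. ereal (u x)) \<in> borel_measurable (restrict_space lebesgue (ball x0 (r / 2)))"
        by (intro measurable_restrict_space1 borel_measurable_ereal um)
      ultimately have "esssup (restrict_space lebesgue (ball x0 (r / 2))) (\<lambda>x. ereal (u x)) \<le> ereal K"
        by (intro esssup_I)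
      then show ?thesis using K0 by (simp add: eqK enn2ereal_ennreal)
    next
      case True
      show ?thesis unfolding True by simp
    qed
    then show "esssup (restrict_space lebesgue (ball x0 (r / 2))) (\<lambda>x. ereal (u x)) \<le>
      enn2ereal
        (ennreal \<delta> * Tail p \<mu> (\<lambda>x. max (u x) 0) x0 (r / 2) +
         ennreal (C * \<delta> powr (- ((p - 1) * eta DIM('a) p / ((eta DIM('a) p - 1) * p)))) *
         ennreal_powr
           ((\<integral>\<^sup>+x\<in>ball x0 r. ennreal (max (u x) 0 powr p) \<partial>lebesgue) / emeasure lebesgue (ball x0 r))
           (1 / p))"
      unfolding Tw Mw Bw T_def A_def V_def \<gamma>_def .
  qed
qed

end
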